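(* Let $0<\alpha\le 1$ and $t>2$, and let $A,B$ be real constants. Assume that for all $\tau\in[t-e^{2/3}\alpha,\,t+e^{2/3}\alpha]$ and all $\sigma$ with $0\le 1-\sigma<e^{2/3}\alpha$ we have a bound $$\log|\zeta(\sigma+i\tau)|<B(1-\sigma)^{3/2}\log|\tau|+\frac23\log\log|\tau|+A$$ (it being part of the assumption that the right-hand side is defined). Then $$N(1+it,\alpha)\le\frac{\tilde C_{1,\alpha}}{\pi}\log|t|+2\log\log|t|+\tilde C_{3,\alpha},$$ where $$\tilde C_{1,\alpha}=\frac{3E_{1/2}\,e\,B\,\alpha^{3/2}}{2},$$ $$\tilde C_{3,\alpha}=\frac{3A}{4}+\frac{3c_{4,e^{2/3}\alpha}}{2}+\frac{3\log(29.388)}{2}<\frac{3A}{4}+\frac34\log(\zeta(1+e^{2/3}\alpha))+\frac{3\log 2}{4}+\frac{3\log(29.388)}{2}.$$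
   Context: $N(s,\alpha)$ denotes the number of zeros $\rho$ of the Riemann zeta function $\zeta$ with $|\rho-s|\le\alpha$, counted with multiplicity, zeros on the boundary counting with $1/2$ of their multiplicity. $E_{1/2}=\int_0^{\pi/2}\cos(\theta)^{3/2}\,d\theta\approx 0.874019$. For $r>0$, $c_{4,r}=\frac12\log(\zeta(1+r))-\frac r\pi\int_0^1\frac{\zeta'(1+ru)}{\zeta(1+ru)}\arcsin(u)\,du$. *)

theory Defs
  imports "HOL-Complex_Analysis.Complex_Analysis"
begin

text \<open>
  The Riemann zeta function: the analytic continuation of the Dirichlet series to the
  punctured plane. The description is unique by the identity theorem. The value at the
  pole is fixed to be 0 by convention, so the point 1 has to be excluded explicitly
  when zeros are counted.
\<close>

definition zeta :: "complex \<Rightarrow> complex" where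
  "zeta = (THE f. f holomorphic_on (- {1}) \<and> f 1 = 0 \<and>
             (\<forall>s. Re s > 1 \<longrightarrow> f s = (\<Sum>n. 1 / of_nat (Suc n) powr s)))"

text \<open>For finitely many zeros in the disc (always the case), this is \<open>N(s,\<alpha>)\<close>.\<close>

definition zeta_zero_count :: "complex \<Rightarrow> real \<Rightarrow> real" where
  "zeta_zero_count s \<alpha> =
     (\<Sum>\<rho> | \<rho> \<noteq> 1 \<and> zeta \<rho> = 0 \<and> cmod (\<rho> - s) \<le> \<alpha>.
        (if cmod (\<rho> - s) = \<alpha> then 1 / 2 else 1) * real_of_int (zorder zeta \<rho>))"

definition E_half :: real where
  "E_half = integral {0..pi / 2} (\<lambda>\<theta>. cos \<theta> powr (3 / 2))"

text \<open>
  For \<open>x > 1\<close> both \<open>\<zeta>(x)\<close> and \<open>\<zeta>'(x)\<close> are real, so taking real parts only adjusts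
  the type. The integrand is undefined only at the end point \<open>u = 0\<close>, which has measure 0.
\<close>

definition c4 :: "real \<Rightarrow> real" where
  "c4 r = 1 / 2 * ln (Re (zeta (of_real (1 + r)))) -
     r / pi * integral {0..1} (\<lambda>u.
       Re (deriv zeta (of_real (1 + r * u)) / zeta (of_real (1 + r * u))) * arcsin u)"

definition C1_tilde :: "real \<Rightarrow> real \<Rightarrow> real" where
  "C1_tilde B \<alpha> = 3 * E_half * exp 1 * B * \<alpha> powr (3 / 2) / 2"

definition C3_tilde :: "real \<Rightarrow> real \<Rightarrow> real" where
  "C3_tilde A \<alpha> = 3 * A / 4 + 3 * c4 (exp (2 / 3) * \<alpha>) / 2 + 3 * ln 29.388 / 2"

end

theory Submission
  imports Defs
begin

text \<open>
  On a zero-free circle of radius \<open>r\<close> around \<open>1 + it\<close>, Jensen's formula expresses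
  \<open>ln \<bar>\<zeta>(1 + it)\<bar>\<close> plus the sum of \<open>ln (r / \<bar>\<rho> - 1 - it\<bar>)\<close> over the enclosed zeros as the mean of
  \<open>ln \<bar>\<zeta>\<bar>\<close> over the circle. The right half of the circle contributes at most \<open>c4 r\<close>, by
  \<open>\<bar>\<zeta>(\<sigma> + i\<tau>)\<bar> \<le> \<zeta>(\<sigma>)\<close>. The left half is bounded by the hypothesis, where pairing \<open>t + y\<close> with
  \<open>t - y\<close> and concavity replace \<open>ln \<bar>\<tau>\<bar>\<close> by \<open>ln t\<close>. Each zero within \<open>\<alpha>\<close> of the centre contributes at
  least \<open>ln (r / \<alpha>)\<close>, which tends to \<open>2 / 3\<close> as \<open>r\<close> tends to \<open>e\<^sup>2\<^sup>/\<^sup>3 \<alpha>\<close>.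

  The remaining input is a lower bound \<open>- ln (29.388 ln t)\<close> for \<open>ln \<bar>\<zeta>(1 + it)\<bar>\<close>. It is only needed
  together with the surplus \<open>ln (\<alpha> / \<bar>\<rho> - 1 - it\<bar>)\<close> of the zeros near the centre. Let
  \<open>\<delta> = 0.28 / ln t\<close> and compare the Poisson--Jensen formulas at \<open>1 + it\<close>, \<open>1 + \<delta> + it\<close> and
  \<open>1 + 4\<delta> + it\<close> on a circle of radius almost 2. The combination \<open>2 P\<^sub>\<delta> - P\<^sub>4\<^sub>\<delta> - P\<^sub>0\<close> of Poisson
  kernels is small and nonnegative on the left half circle, and the same combination of Green
  functions is nonnegative at all zeros that are not very close to the centre. At most one zero, a
  simple one, can be very close; it is treated separately. For \<open>t \<le> 8\<close> the value at \<open>1 + it\<close> is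
  bounded directly by Euler--Maclaurin summation.
\<close>

section \<open>Periodic sums and the continuation of the zeta function\<close>

text \<open>At r = e^(2/3) \<alpha> every counted zero contributes at least 2/3 to Jensen's formula;
  dividing by it gives the factor 3/2 in the constants. The term 2 ln ln t is 3/2 times 1/3 + 1,
  with 1/3 from the left half circle and 1 from the value at the centre. On the left half circle
  only upper bounds for ln |zeta| are at hand, so a kernel must be nonnegative there. The weights 2,
  -1, -1 sum to zero and leave the first order term -4 e c with e = \<delta> / R and c = cos
  \<theta>, which has the right sign for c < 0. Since 4 / \<delta> = (100/7) ln t, the difference ln
  29.388 - ln (100/7) > 0.72 has to pay for the kernel error 0.562. It leaves a reserve of 0.15,
  which is spent when B is negative: then replacing ln |\<tau>| by ln t goes the wrong way and has
  to be compensated. The exceptional zero is a real obstacle for bounds at the centre, where its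
  Green function is arbitrarily large; it is overcome by averaging over the circle instead.\<close>

text \<open>For \<open>N \<ge> 1\<close> this is the integral of b(x - floor x) x^(-s) over x \<ge>
  N, cut at the integers so that the periodic continuation of \<open>b\<close> may jump
  there.\<close>

definition psum :: "(real \<Rightarrow> real) \<Rightarrow> nat \<Rightarrow> complex \<Rightarrow> complex" where
  "psum b N s =
     (\<Sum>n. integral {0..1} (\<lambda>x. of_real (b x) * of_real (real (N + n) + x) powr (- s)))"

lemma powr_has_integral_unit:
  fixes m \<sigma> :: real
  assumes "m \<ge> 1" "\<sigma> \<noteq> 1"
  shows "((\<lambda>x. (m + x) powr (- \<sigma>)) has_integral
           ((m powr (1 - \<sigma>) - (m + 1) powr (1 - \<sigma>)) / (\<sigma> - 1))) {0..1}"
proof -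
  have "((\<lambda>x. (m + x) powr (- \<sigma>)) has_integral
         ((m + 1) powr (1 - \<sigma>) / (1 - \<sigma>) - (m + 0) powr (1 - \<sigma>) / (1 - \<sigma>))) {0..1}"
  proof (rule fundamental_theorem_of_calculus)
    fix x :: real assume "x \<in> {0..1}"
    hence "m + x > 0" using assms by auto
    hence "((\<lambda>x. (m + x) powr (1 - \<sigma>)) has_real_derivative
            (1 - \<sigma>) * (m + x) powr (1 - \<sigma> - of_nat 1) * 1) (at x)"
      by (intro DERIV_fun_powr) (auto intro!: derivative_eq_intros)
    from DERIV_cdivide[OF this, of "1 - \<sigma>"]
    have "((\<lambda>x. (m + x) powr (1 - \<sigma>) / (1 - \<sigma>)) has_real_derivative (m + x) powr (- \<sigma>)) (at x)"
      using assms(2) by simp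
    thus "((\<lambda>x. (m + x) powr (1 - \<sigma>) / (1 - \<sigma>)) has_vector_derivative (m + x) powr (- \<sigma>))
            (at x within {0..1})"
      unfolding has_real_derivative_iff_has_vector_derivative[symmetric]
      by (rule has_field_derivative_at_within)
  qed auto
  moreover have "(m + 1) powr (1 - \<sigma>) / (1 - \<sigma>) - (m + 0) powr (1 - \<sigma>) / (1 - \<sigma>)
      = (m powr (1 - \<sigma>) - (m + 1) powr (1 - \<sigma>)) / (\<sigma> - 1)"
    using assms(2) by (simp add: divide_simps) argo
  ultimately show ?thesis by simp
qed

lemma continuous_on_powr_unit:
  fixes m :: real and s :: complex
  assumes "m \<ge> 1" "continuous_on {0..1} b"
  shows "continuous_on {0..1} (\<lambda>x. of_real (b x) * of_real (m + x) powr s)"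
  by (intro continuous_intros continuous_on_of_real assms(2))
     (use assms in \<open>auto simp: complex_nonpos_Reals_iff simp flip: of_real_add\<close>)

text \<open>Only a lower bound \<open>\<sigma>\<close> for \<open>Re s\<close> enters, so that one
  telescoping majorant serves a whole disc in \<open>psum_holomorphic\<close>.\<close>

lemma psum_term_bound:
  fixes m \<sigma> M :: real and s :: complex
  assumes "m \<ge> 1" "1 < \<sigma>" "\<sigma> \<le> Re s" "continuous_on {0..1} b"
    and M: "\<And>x. x \<in> {0..1} \<Longrightarrow> \<bar>b x\<bar> \<le> M"
  shows "norm (integral {0..1} (\<lambda>x. of_real (b x) * of_real (m + x) powr (- s)))
           \<le> M * ((m powr (1 - \<sigma>) - (m + 1) powr (1 - \<sigma>)) / (\<sigma> - 1))"
proof -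
  have "norm (integral {0..1} (\<lambda>x. of_real (b x) * of_real (m + x) powr (- s)))
          \<le> integral {0..1} (\<lambda>x. M * (m + x) powr (- \<sigma>))"
  proof (rule integral_norm_bound_integral)
    show "(\<lambda>x. of_real (b x) * of_real (m + x) powr (- s)) integrable_on {0..1}"
      by (intro integrable_continuous_interval continuous_on_powr_unit assms)
    show "(\<lambda>x. M * (m + x) powr (- \<sigma>)) integrable_on {0..1}"
      using powr_has_integral_unit[of m \<sigma>] assms by (auto intro!: integrable_on_mult_right)
    fix x :: real assume x: "x \<in> {0..1}"
    have "norm (of_real (m + x) powr (- s)) = (m + x) powr (- Re s)"
      using assms x by (subst norm_powr_real_powr) auto
    also have "\<dots> \<le> (m + x) powr (- \<sigma>)"
      using assms x by (intro powr_mono) auto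
    finally show "norm (of_real (b x) * of_real (m + x) powr (- s)) \<le> M * (m + x) powr (- \<sigma>)"
      unfolding norm_mult using M[OF x] by (intro mult_mono) auto
  qed
  also have "\<dots> = M * ((m powr (1 - \<sigma>) - (m + 1) powr (1 - \<sigma>)) / (\<sigma> - 1))"
    using powr_has_integral_unit[of m \<sigma>] assms by (simp add: integral_unique)
  finally show ?thesis .
qed

lemma filterlim_add_const_nat_at_top': "filterlim (\<lambda>n. N + n) at_top (sequentially :: nat filter)" for N :: nat
  using filterlim_add_const_nat_at_top[of N] by (simp add: add.commute)

lemma telescoping_powr_sums:
  fixes N :: nat and \<sigma> :: real
  assumes "N \<ge> 1" "\<sigma> > 1"
  shows "(\<lambda>n. M * ((real (N + n) powr (1 - \<sigma>) - (real (N + n) + 1) powr (1 - \<sigma>)) / (\<sigma> - 1)))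
           sums (M * (real N powr (1 - \<sigma>) / (\<sigma> - 1)))"
proof -
  have "(\<lambda>n. real (N + n) powr (1 - \<sigma>)) \<longlonglongrightarrow> 0"
    using assms by (intro tendsto_neg_powr filterlim_compose[OF filterlim_real_sequentially] filterlim_add_const_nat_at_top') auto
  from telescope_sums'[OF this]
  have "(\<lambda>n. real (N + n) powr (1 - \<sigma>) - (real (N + n) + 1) powr (1 - \<sigma>))
          sums (real N powr (1 - \<sigma>))"
    by (simp add: add_ac)
  from sums_mult[OF sums_divide[OF this], of M "\<sigma> - 1"] show ?thesis by simp
qed

lemma bounded_on_unit:
  fixes b :: "real \<Rightarrow> real"
  assumes "continuous_on {0..1} b"
  obtains M where "\<And>x. x \<in> {0..1} \<Longrightarrow> \<bar>b x\<bar> \<le> M"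
proof -
  have "bounded (b ` {0..1})"
    by (intro compact_imp_bounded compact_continuous_image assms) auto
  then obtain M where "\<forall>y\<in>b ` {0..1}. norm y \<le> M" unfolding bounded_iff by blast
  thus ?thesis using that[of M] by auto
qed

lemma psum_sums:
  assumes "N \<ge> 1" "Re s > 1" "continuous_on {0..1} b"
  shows "(\<lambda>n. integral {0..1} (\<lambda>x. of_real (b x) * of_real (real (N + n) + x) powr (- s)))
           sums psum b N s"
proof -
  obtain M where M: "\<And>x. x \<in> {0..1} \<Longrightarrow> \<bar>b x\<bar> \<le> M"
    using bounded_on_unit[OF assms(3)] by blast
  have "summable (\<lambda>n. integral {0..1} (\<lambda>x. of_real (b x) * of_real (real (N + n) + x) powr (- s)))"
  proof (rule summable_comparison_test'[OF sums_summable[OF telescoping_powr_sums[of N "Re s" M]], of 0])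
    fix n
    show "norm (integral {0..1} (\<lambda>x. of_real (b x) * of_real (real (N + n) + x) powr (- s)))
       \<le> M * ((real (N + n) powr (1 - Re s) - (real (N + n) + 1) powr (1 - Re s)) / (Re s - 1))"
      by (rule psum_term_bound[OF _ _ _ assms(3) M]) (use assms in auto)
  qed (use assms in auto)
  thus ?thesis unfolding psum_def by (rule summable_sums)
qed

lemma norm_psum_le:
  assumes "N \<ge> 1" "Re s > 1" "continuous_on {0..1} b"
    and M: "\<And>x. x \<in> {0..1} \<Longrightarrow> \<bar>b x\<bar> \<le> M"
  shows "norm (psum b N s) \<le> M * (real N powr (1 - Re s) / (Re s - 1))"
proof -
  have S: "summable (\<lambda>n. norm (integral {0..1} (\<lambda>x. of_real (b x) * of_real (real (N + n) + x) powr (- s))))"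
  proof (rule summable_comparison_test'[OF sums_summable[OF telescoping_powr_sums[of N "Re s" M]], of 0])
    fix n
    show "norm (norm (integral {0..1} (\<lambda>x. of_real (b x) * of_real (real (N + n) + x) powr (- s))))
       \<le> M * ((real (N + n) powr (1 - Re s) - (real (N + n) + 1) powr (1 - Re s)) / (Re s - 1))"
      unfolding real_norm_def abs_norm_cancel by (rule psum_term_bound[OF _ _ _ assms(3) M]) (use assms in auto)
  qed (use assms in auto)
  have "norm (psum b N s) \<le>
     (\<Sum>n. norm (integral {0..1} (\<lambda>x. of_real (b x) * of_real (real (N + n) + x) powr (- s))))"
    unfolding psum_def by (rule summable_norm[OF S])
  also have "\<dots> \<le> (\<Sum>n. M * ((real (N + n) powr (1 - Re s) - (real (N + n) + 1) powr (1 - Re s)) / (Re s - 1)))"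
  proof (rule suminf_le[OF _ S sums_summable[OF telescoping_powr_sums]])
    fix n
    show "norm (integral {0..1} (\<lambda>x. of_real (b x) * of_real (real (N + n) + x) powr (- s)))
       \<le> M * ((real (N + n) powr (1 - Re s) - (real (N + n) + 1) powr (1 - Re s)) / (Re s - 1))"
      by (rule psum_term_bound[OF _ _ _ assms(3) M]) (use assms in auto)
  qed (use assms in auto)
  also have "\<dots> = M * (real N powr (1 - Re s) / (Re s - 1))"
    using telescoping_powr_sums[of N "Re s" M] assms by (simp add: sums_iff)
  finally show ?thesis .
qed

lemma psum_term_holomorphic:
  fixes m :: real
  assumes "m \<ge> 1" "continuous_on {0..1} b" "convex U"
  shows "(\<lambda>s. integral {0..1} (\<lambda>x. of_real (b x) * of_real (m + x) powr (- s))) holomorphic_on U"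
proof -
  have "(\<lambda>s. integral (cbox 0 1) (\<lambda>x. of_real (b x) * of_real (m + x) powr (- s))) holomorphic_on U"
  proof (rule leibniz_rule_holomorphic[where
          fx = "\<lambda>s x. - of_real (b x) * of_real (m + x) powr (- s) * of_real (ln (m + x))"])
    fix s :: complex and x :: real assume "x \<in> cbox 0 1"
    hence "m + x > 0" using assms by auto
    hence nz: "of_real (m + x) \<noteq> (0 :: complex)" and L: "Ln (of_real (m + x)) = of_real (ln (m + x))"
      by (auto simp: Ln_of_real simp del: of_real_add)
    have "((\<lambda>s. c * (a powr (- s))) has_field_derivative - c * a powr (- s) * Ln a) (at s within U)"
      if "a \<noteq> 0" for a c :: complex
      using that by (auto intro!: derivative_eq_intros simp: powr_def)
    from this[OF nz, of "of_real (b x)"] L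
    show "((\<lambda>s. of_real (b x) * of_real (m + x) powr (- s)) has_field_derivative
            - of_real (b x) * of_real (m + x) powr (- s) * of_real (ln (m + x))) (at s within U)"
      by simp
  next
    fix s :: complex
    show "(\<lambda>x. of_real (b x) * of_real (m + x) powr (- s)) integrable_on cbox 0 1"
      using integrable_continuous_interval[OF continuous_on_powr_unit[OF assms(1,2)]] by simp
  next
    have b: "continuous_on (U \<times> {0..1}) (\<lambda>p. b (snd p))"
      by (rule continuous_on_compose2[OF assms(2)]) (auto intro!: continuous_intros)
    have "continuous_on (U \<times> {0..1}) (\<lambda>p. - of_real (b (snd p)) * of_real (m + snd p) powr (- fst p) * of_real (ln (m + snd p)))"
      by (intro continuous_intros b) (use assms in \<open>auto simp: complex_nonpos_Reals_iff simp flip: of_real_add\<close>)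
    thus "continuous_on (U \<times> cbox 0 1)
      (\<lambda>(s, x). - of_real (b x) * of_real (m + x) powr (- s) * of_real (ln (m + x)))"
      by (simp add: case_prod_unfold)
  qed fact
  thus ?thesis by simp
qed

lemma psum_holomorphic:
  assumes "N \<ge> 1" "continuous_on {0..1} b"
  shows "psum b N holomorphic_on {s. Re s > 1}"
proof -
  define f :: "nat \<Rightarrow> complex \<Rightarrow> complex" where "f = (\<lambda>n s. integral {0..1} (\<lambda>x. of_real (b x) * of_real (real (N + n) + x) powr (- s)))"
  obtain M where M: "\<And>x. x \<in> {0..1} \<Longrightarrow> \<bar>b x\<bar> \<le> M"
    using bounded_on_unit[OF assms(2)] by blast
  have "open {s. Re s > 1}" by (simp add: open_halfspace_Re_gt)
  thus ?thesis
  proof (rule holomorphic_uniform_sequence[where f = "\<lambda>n s. \<Sum>k<n. f k s"])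
    fix n
    have "f k holomorphic_on {s. Re s > 1}" for k
      unfolding f_def using assms by (intro psum_term_holomorphic convex_halfspace_Re_gt) auto
    thus "(\<lambda>s. \<Sum>k<n. f k s) holomorphic_on {s. Re s > 1}"
      by (intro holomorphic_intros)
  next
    fix s :: complex assume s: "s \<in> {s. Re s > 1}"
    define d where "d = (Re s - 1) / 2"
    have d: "d > 0" "Re w \<ge> 1 + d" if "w \<in> cball s d" for w
    proof -
      show "d > 0" using s by (simp add: d_def)
      have "\<bar>Re (s - w)\<bar> \<le> d" using that abs_Re_le_cmod[of "s - w"] by (auto simp: dist_norm)
      hence "Re s - Re w \<le> d" by simp
      thus "Re w \<ge> 1 + d" unfolding d_def by argo
    qed
    have d0: "d > 0" using s by (simp add: d_def)
    have "uniform_limit (cball s d) (\<lambda>n w. \<Sum>k<n. f k w) (\<lambda>w. \<Sum>k. f k w) sequentially"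
    proof (rule Weierstrass_m_test)
      show "summable (\<lambda>n. M * ((real (N + n) powr (1 - (1 + d)) - (real (N + n) + 1) powr (1 - (1 + d))) / ((1 + d) - 1)))"
        using telescoping_powr_sums[of N "1 + d" M] assms d0 by (auto simp: sums_iff)
      fix n w assume "w \<in> cball s d"
      thus "norm (f n w) \<le> M * ((real (N + n) powr (1 - (1 + d)) - (real (N + n) + 1) powr (1 - (1 + d))) / ((1 + d) - 1))"
        unfolding f_def using assms d(2)[of w] d0 by (intro psum_term_bound M) auto
    qed
    hence "uniform_limit (cball s d) (\<lambda>n w. \<Sum>k<n. f k w) (psum b N) sequentially"
      by (simp add: psum_def[abs_def] f_def)
    moreover have "cball s d \<subseteq> {s. Re s > 1}" using d d0 by force
    ultimately show "\<exists>d>0. cball s d \<subseteq> {s. Re s > 1} \<and>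
        uniform_limit (cball s d) (\<lambda>n s. \<Sum>k<n. f k s) (psum b N) sequentially"
      using d0 by blast
  qed
qed

lemma integration_by_parts_unit:
  fixes m :: real and s :: complex
  assumes m: "m \<ge> 1" and b: "continuous_on {0..1} b"
    and B: "\<And>x. x \<in> {0..1} \<Longrightarrow> (B has_real_derivative b x) (at x within {0..1})"
  shows "integral {0..1} (\<lambda>x. of_real (b x) * of_real (m + x) powr (- s)) =
     of_real (B 1) * of_real (m + 1) powr (- s) - of_real (B 0) * of_real m powr (- s)
     + s * integral {0..1} (\<lambda>x. of_real (B x) * of_real (m + x) powr (- (s + 1)))"
proof -
  have Bc: "continuous_on {0..1} B"
    using B by (rule DERIV_continuous_on)
  have "((\<lambda>x. of_real (b x) * of_real (m + x) powr (- s)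
             + of_real (B x) * (- s * of_real (m + x) powr (- s - 1))) has_integral
         (of_real (B 1) * of_real (m + 1) powr (- s) - of_real (B 0) * of_real (m + 0) powr (- s))) {0..1}"
  proof (rule fundamental_theorem_of_calculus)
    fix x :: real assume x: "x \<in> {0..1}"
    hence "m + x > 0" using m by auto
    hence nz: "complex_of_real (m + x) \<notin> \<real>\<^sub>\<le>\<^sub>0" by (simp add: complex_nonpos_Reals_iff)
    have "((\<lambda>z. z powr (- s)) has_field_derivative (- s * of_real (m + x) powr (- s - 1))) (at (of_real (m + x)))"
      using has_field_derivative_powr[OF nz, of "- s"] by simp
    moreover have "((\<lambda>x. m + x) has_real_derivative 1) (at x within {0..1})"
      by (auto intro!: derivative_eq_intros)
    hence "((\<lambda>x. of_real (m + x) :: complex) has_vector_derivative of_real 1) (at x within {0..1})"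
      by (intro has_vector_derivative_of_real) (simp add: has_real_derivative_iff_has_vector_derivative)
    ultimately have 1: "((\<lambda>x. of_real (m + x) powr (- s)) has_vector_derivative
        (- s * of_real (m + x) powr (- s - 1))) (at x within {0..1})"
      using field_vector_diff_chain_within[of "\<lambda>x. of_real (m + x)" "of_real 1" x "{0..1}"
              "\<lambda>z. z powr (- s)" "- s * of_real (m + x) powr (- s - 1)"]
      by (auto simp: o_def has_field_derivative_at_within)
    have 2: "((\<lambda>x. of_real (B x) :: complex) has_vector_derivative of_real (b x)) (at x within {0..1})"
      using B[OF x] by (intro has_vector_derivative_of_real) (simp add: has_real_derivative_iff_has_vector_derivative)
    show "((\<lambda>x. of_real (B x) * of_real (m + x) powr (- s)) has_vector_derivative
       (of_real (b x) * of_real (m + x) powr (- s)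
             + of_real (B x) * (- s * of_real (m + x) powr (- s - 1)))) (at x within {0..1})"
      using has_vector_derivative_mult[OF 2 1] by (simp add: add_ac)
  qed auto
  hence I1: "((\<lambda>x. of_real (b x) * of_real (m + x) powr (- s)
             - s * (of_real (B x) * of_real (m + x) powr (- (s + 1)))) has_integral
         (of_real (B 1) * of_real (m + 1) powr (- s) - of_real (B 0) * of_real m powr (- s))) {0..1}"
    by (simp add: mult_ac)
  have I2: "((\<lambda>x. of_real (b x) * of_real (m + x) powr (- s)) has_integral
      integral {0..1} (\<lambda>x. of_real (b x) * of_real (m + x) powr (- s))) {0..1}"
    by (intro integrable_integral integrable_continuous_interval continuous_on_powr_unit m b)
  have I3: "((\<lambda>x. s * (of_real (B x) * of_real (m + x) powr (- (s + 1)))) has_integral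
      s * integral {0..1} (\<lambda>x. of_real (B x) * of_real (m + x) powr (- (s + 1)))) {0..1}"
    by (intro has_integral_mult_right integrable_integral integrable_continuous_interval
          continuous_on_powr_unit m Bc)
  have "of_real (B 1) * of_real (m + 1) powr (- s) - of_real (B 0) * of_real m powr (- s) =
     integral {0..1} (\<lambda>x. of_real (b x) * of_real (m + x) powr (- s))
     - s * integral {0..1} (\<lambda>x. of_real (B x) * of_real (m + x) powr (- (s + 1)))"
    by (rule has_integral_unique[OF I1 has_integral_diff[OF I2 I3]])
  thus ?thesis by simp
qed

lemma powr_tendsto_0:
  fixes s :: complex
  assumes "Re s > 0" "N \<ge> 1"
  shows "(\<lambda>n. of_real (real (N + n)) powr (- s)) \<longlonglongrightarrow> 0"
proof (rule tendsto_norm_zero_cancel)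
  have "(\<lambda>n. real (N + n) powr (- Re s)) \<longlonglongrightarrow> 0"
    using assms by (intro tendsto_neg_powr filterlim_compose[OF filterlim_real_sequentially] filterlim_add_const_nat_at_top') auto
  moreover have "norm (of_real (real (N + n)) powr (- s)) = real (N + n) powr (- Re s)" for n
    by (subst norm_powr_real_powr) auto
  ultimately show "(\<lambda>n. norm (of_real (real (N + n)) powr (- s))) \<longlonglongrightarrow> 0" by simp
qed

text \<open>Boundary terms of neighbouring unit intervals cancel because \<open>B 1 = B 0\<close>,
  and only the one at N survives. The gain is one more power of decay, s + 1 in place of s.\<close>

lemma psum_by_parts:
  assumes N: "N \<ge> 1" and s: "Re s > 1" and b: "continuous_on {0..1} b"
    and B: "\<And>x. x \<in> {0..1} \<Longrightarrow> (B has_real_derivative b x) (at x within {0..1})" and B01: "B 1 = B 0"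
  shows "psum b N s = - of_real (B 0) * of_nat N powr (- s) + s * psum B N (s + 1)"
proof -
  have Bc: "continuous_on {0..1} B"
    using B by (rule DERIV_continuous_on)
  have "(\<lambda>n. of_real (real (N + n)) powr (- s)) \<longlonglongrightarrow> 0"
    using N s by (intro powr_tendsto_0) auto
  from telescope_sums[OF this] have "(\<lambda>n. of_real (real (N + Suc n)) powr (- s) - of_real (real (N + n)) powr (- s))
      sums (- (of_nat N powr (- s)))" by simp
  from sums_mult[OF this, of "of_real (B 0)"]
  have "(\<lambda>n. of_real (B 1) * of_real (real (N + n) + 1) powr (- s) - of_real (B 0) * of_real (real (N + n)) powr (- s))
      sums (- of_real (B 0) * of_nat N powr (- s))" by (simp add: B01 algebra_simps)
  moreover have "(\<lambda>n. s * integral {0..1} (\<lambda>x. of_real (B x) * of_real (real (N + n) + x) powr (- (s + 1))))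
      sums (s * psum B N (s + 1))"
    by (intro sums_mult psum_sums) (use N s Bc in auto)
  ultimately have "(\<lambda>n. integral {0..1} (\<lambda>x. of_real (b x) * of_real (real (N + n) + x) powr (- s)))
    sums (- of_real (B 0) * of_nat N powr (- s) + s * psum B N (s + 1))"
  proof -
    assume *: "(\<lambda>n. of_real (B 1) * of_real (real (N + n) + 1) powr (- s) - of_real (B 0) * of_real (real (N + n)) powr (- s))
      sums (- of_real (B 0) * of_nat N powr (- s))"
      "(\<lambda>n. s * integral {0..1} (\<lambda>x. of_real (B x) * of_real (real (N + n) + x) powr (- (s + 1))))
      sums (s * psum B N (s + 1))"
    have "real (N + n) \<ge> 1" for n using N by simp
    from integration_by_parts_unit[OF this b B] sums_add[OF *] show ?thesis
      by presburger
  qed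
  thus ?thesis using psum_sums[OF N s b] sums_unique2 by blast
qed

text \<open>Each integration by parts moves the half-plane of holomorphy one unit to the left. Mean
  zero of \<open>b\<close> is what gives its primitive equal values at 0 and 1.\<close>

lemma psum_continuation:
  assumes N: "N \<ge> 1"
  shows "continuous_on {0..1} b \<Longrightarrow> integral {0..1} b = 0 \<Longrightarrow>
    \<exists>G. G holomorphic_on {s. Re s > 1 - real m} \<and> (\<forall>s. Re s > 1 \<longrightarrow> G s = psum b N s)"
proof (induction m arbitrary: b)
  case 0
  thus ?case using psum_holomorphic[OF N] by (intro exI[of _ "psum b N"]) auto
next
  case (Suc m)
  define B0 where "B0 = (\<lambda>x. integral {0..x} b)"
  \<comment> \<open>Subtracting the mean makes the primitive eligible for the next integration by
    parts.\<close>
  define B where "B = (\<lambda>x. B0 x - integral {0..1} B0)"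
  have B0: "(B0 has_real_derivative b x) (at x within {0..1})" if "x \<in> {0..1}" for x
    unfolding B0_def using integral_has_real_derivative[OF Suc.prems(1) that] .
  hence B0c: "continuous_on {0..1} B0"
    by (rule DERIV_continuous_on)
  have B: "(B has_real_derivative b x) (at x within {0..1})" if "x \<in> {0..1}" for x
    unfolding B_def using B0[OF that] by (auto intro!: derivative_eq_intros)
  have Bc: "continuous_on {0..1} B" unfolding B_def by (intro continuous_intros B0c)
  have Bi: "integral {0..1} B = 0"
    unfolding B_def using B0c by (subst integral_diff) (auto intro!: integrable_continuous_interval)
  have B01: "B 1 = B 0" using Suc.prems(2) by (simp add: B_def B0_def)
  obtain G where G: "G holomorphic_on {s. Re s > 1 - real m}" "\<And>s. Re s > 1 \<Longrightarrow> G s = psum B N s"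
    using Suc.IH[OF Bc Bi] by blast
  define H where "H = (\<lambda>s. - of_real (B 0) * of_nat N powr (- s) + s * G (s + 1))"
  have "(G \<circ> (\<lambda>s. s + 1)) holomorphic_on {s. Re s > 1 - real (Suc m)}"
    by (rule holomorphic_on_compose_gen[OF _ G(1)]) (auto intro!: holomorphic_intros)
  hence "(\<lambda>s. G (s + 1)) holomorphic_on {s. Re s > 1 - real (Suc m)}" by (simp add: o_def)
  hence "H holomorphic_on {s. Re s > 1 - real (Suc m)}"
    unfolding H_def using N by (intro holomorphic_intros) auto
  moreover have "H s = psum b N s" if "Re s > 1" for s
    using psum_by_parts[OF N that Suc.prems(1) B B01] G(2)[of "s + 1"] that by (simp add: H_def)
  ultimately show ?case by blast
qed

text \<open>By the identity theorem two continuations agree on the smaller half-plane, so the value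
  at s may be read off from any continuation that reaches s.\<close>

lemma entire_glue:
  fixes F :: "complex \<Rightarrow> complex"
  assumes "\<And>m::nat. \<exists>G. G holomorphic_on {s. Re s > 1 - real m} \<and> (\<forall>s. Re s > 1 \<longrightarrow> G s = F s)"
  shows "\<exists>G. G holomorphic_on UNIV \<and> (\<forall>s. Re s > 1 \<longrightarrow> G s = F s)"
proof -
  obtain g where g: "\<And>m::nat. g m holomorphic_on {s. Re s > 1 - real m}" "\<And>m s. Re s > 1 \<Longrightarrow> g m s = F s"
    using assms by metis
  have agree: "g m s = g n s" if "m \<le> n" and s: "Re s > 1 - real m" for m n s
  proof (rule analytic_continuation_open[where f = "g m" and g = "g n" and s = "{s. Re s > 1}" and s' = "{s. Re s > 1 - real m}"])
    have "(2 :: complex) \<in> {s. Re s > 1}" by simp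
    thus "{s. 1 < Re s} \<noteq> {}" by blast
    show "g m z = g n z" if "z \<in> {s. 1 < Re s}" for z
      using g(2)[of z m] g(2)[of z n] that by simp
    show "connected {s. 1 - real m < Re s}" by (intro convex_connected convex_halfspace_Re_gt)
    show "g n holomorphic_on {s. 1 - real m < Re s}"
      using that(1) by (intro holomorphic_on_subset[OF g(1)[of n]]) auto
    show "g m holomorphic_on {s. 1 - real m < Re s}" by (rule g(1))
  qed (use s in \<open>auto simp: open_halfspace_Re_gt\<close>)
  \<comment> \<open>The index is large enough for 1 - m < Re s.\<close>
  define G where "G = (\<lambda>s. g (nat \<lceil>2 - Re s\<rceil>) s)"
  have G: "G s = g m s" if "Re s > 1 - real m" for s m
  proof -
    have "Re s > 1 - real (nat \<lceil>2 - Re s\<rceil>)" by linarith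
    thus ?thesis unfolding G_def
      using agree[of m "nat \<lceil>2 - Re s\<rceil>" s] agree[of "nat \<lceil>2 - Re s\<rceil>" m s] that
      by (metis linorder_le_cases)
  qed
  have "G field_differentiable at s" for s
  proof -
    define m where "m = nat \<lceil>2 - Re s\<rceil>"
    have m: "Re s > 1 - real m" unfolding m_def by linarith
    have "g m field_differentiable at s"
      by (rule holomorphic_on_imp_differentiable_at[OF g(1)[of m]]) (use m in \<open>auto simp: open_halfspace_Re_gt\<close>)
    moreover have "eventually (\<lambda>w. w \<in> {s. Re s > 1 - real m}) (nhds s)"
      using m by (intro eventually_nhds_in_open) (auto simp: open_halfspace_Re_gt)
    hence "eventually (\<lambda>w. g m w = G w) (nhds s)" by eventually_elim (simp add: G[of m])
    ultimately show ?thesis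
      unfolding field_differentiable_def using DERIV_cong_ev[of s s "g m" G] by blast
  qed
  hence "G holomorphic_on UNIV" by (simp add: holomorphic_on_def field_differentiable_at_within)
  moreover have "G s = F s" if "Re s > 1" for s using G[of 0 s] g(2)[of s 0] that by simp
  ultimately show ?thesis by blast
qed

text \<open>Euler-Maclaurin summation to first order on each unit interval; the non-integral terms
  telescope.\<close>

lemma zeta_tail_sums:
  assumes N: "N \<ge> 1" and s: "Re s > 1"
  shows "(\<lambda>n. of_nat (N + n) powr (- s)) sums
           (of_nat N powr (1 - s) / (s - 1) + of_nat N powr (- s) / 2 - s * psum (\<lambda>x. x - 1 / 2) N (s + 1))"
proof -
  define I where "I = (\<lambda>n. integral {0..1} (\<lambda>x. of_real (x - 1 / 2) * of_real (real (N + n) + x) powr (- (s + 1))))"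
  define P where "P = (\<lambda>n w. of_real (real (N + n)) powr w :: complex)"
  have m: "real (N + n) \<ge> 1" for n using N by simp
  have ne: "s \<noteq> 1" using s by auto
  have step: "P n (- s) = (P n (1 - s) - P (Suc n) (1 - s)) / (s - 1)
      + (P n (- s) - P (Suc n) (- s)) / 2 - s * I n" for n
  proof -
    have suc: "of_real (real (N + n) + 1) powr w = P (Suc n) w" for w
      by (simp add: P_def add_ac)
    have Pn: "P n w = of_real (real (N + n)) powr w" for w by (simp add: P_def)
    define J where "J = integral {0..1} (\<lambda>x. of_real 1 * (of_real (real (N + n) + x) powr (- s) :: complex))"
    have "J = of_real (1 - 1 / 2) * P (Suc n) (- s) - of_real (0 - 1 / 2) * P n (- s) + s * I n"
      unfolding J_def I_def suc[symmetric] Pn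
      by (rule integration_by_parts_unit[OF m, of "\<lambda>_. 1" "\<lambda>x. x - 1 / 2" n s])
         (auto intro!: derivative_eq_intros)
    \<comment> \<open>This instance has \<open>b = 0\<close>, \<open>B = 1\<close> and exponent s -
      1: it merely evaluates the integral of x^(-s) over the interval.\<close>
    moreover have "integral {0..1} (\<lambda>x. of_real 0 * of_real (real (N + n) + x) powr (- (s - 1))) =
        of_real 1 * P (Suc n) (- (s - 1)) - of_real 1 * P n (- (s - 1)) +
        (s - 1) * integral {0..1} (\<lambda>x. of_real 1 * of_real (real (N + n) + x) powr (- (s - 1 + 1)))"
      unfolding suc[symmetric] Pn
      by (rule integration_by_parts_unit[OF m, of "\<lambda>_. 0" "\<lambda>x. 1" n "s - 1"])
         (auto intro!: derivative_eq_intros)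
    hence "0 = P (Suc n) (1 - s) - P n (1 - s) + (s - 1) * J" by (simp add: J_def)
    hence "J = (P n (1 - s) - P (Suc n) (1 - s)) / (s - 1)" using ne by (simp add: field_simps)
    ultimately show ?thesis by (simp add: field_simps)
  qed
  have lim: "(\<lambda>n. P n (- w)) \<longlonglongrightarrow> 0" if "Re w > 0" for w
    unfolding P_def by (rule powr_tendsto_0[OF that N])
  have T: "(\<lambda>n. P n (- w) - P (Suc n) (- w)) sums P 0 (- w)" if "Re w > 0" for w
    using telescope_sums'[OF lim[OF that]] by simp
  have "(\<lambda>n. (P n (- (s - 1)) - P (Suc n) (- (s - 1))) / (s - 1)
      + (P n (- s) - P (Suc n) (- s)) / 2 - s * I n) sums
      (P 0 (- (s - 1)) / (s - 1) + P 0 (- s) / 2 - s * psum (\<lambda>x. x - 1 / 2) N (s + 1))"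
    unfolding I_def
    by (intro sums_diff sums_add sums_divide T sums_mult psum_sums continuous_intros) (use s N in auto)
  hence "(\<lambda>n. P n (- s)) sums
      (P 0 (- (s - 1)) / (s - 1) + P 0 (- s) / 2 - s * psum (\<lambda>x. x - 1 / 2) N (s + 1))"
    using step by simp
  thus ?thesis by (simp add: P_def)
qed

lemma zeta_exists:
  "\<exists>f. f holomorphic_on (- {1}) \<and> f 1 = 0 \<and>
       (\<forall>s. Re s > 1 \<longrightarrow> f s = (\<Sum>n. 1 / of_nat (Suc n) powr s))"
proof -
  have "integral {0..1} (\<lambda>x::real. x - 1 / 2) = 0"
  proof (rule integral_unique)
    have "((\<lambda>x::real. x - 1 / 2) has_integral ((1^2 - 1) / 2 - (0^2 - 0) / 2)) {0..1}"
      by (rule fundamental_theorem_of_calculus)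
         (auto intro!: derivative_eq_intros simp flip: has_real_derivative_iff_has_vector_derivative)
    thus "((\<lambda>x::real. x - 1 / 2) has_integral 0) {0..1}" by simp
  qed
  \<comment> \<open>As x - 1/2 has mean zero, its periodic integral continues to an entire function,
    and the pole at 1 comes from 1 / (s - 1) alone.\<close>
  hence "\<exists>G. G holomorphic_on UNIV \<and> (\<forall>s. Re s > 1 \<longrightarrow> G s = psum (\<lambda>x. x - 1 / 2) 1 s)"
    by (intro entire_glue psum_continuation continuous_intros) auto
  then obtain G where G: "G holomorphic_on UNIV" "\<And>s. Re s > 1 \<Longrightarrow> G s = psum (\<lambda>x. x - 1 / 2) 1 s"
    by blast
  define f where "f = (\<lambda>s. if s = 1 then 0 else 1 / (s - 1) + 1 / 2 - s * G (s + 1))"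
  have "(G \<circ> (\<lambda>s. s + 1)) holomorphic_on (- {1})"
    by (rule holomorphic_on_compose_gen[OF _ G(1)]) (auto intro!: holomorphic_intros)
  hence "(\<lambda>s. 1 / (s - 1) + 1 / 2 - s * G (s + 1)) holomorphic_on (- {1})"
    by (intro holomorphic_intros) (auto simp: o_def)
  hence "f holomorphic_on (- {1})"
    by (rule holomorphic_transform) (auto simp: f_def)
  moreover have "f s = (\<Sum>n. 1 / of_nat (Suc n) powr s)" if s: "Re s > 1" for s
  proof -
    have "(\<lambda>n. of_nat (1 + n) powr (- s)) sums (1 / (s - 1) + 1 / 2 - s * psum (\<lambda>x. x - 1 / 2) 1 (s + 1))"
      using zeta_tail_sums[of 1 s] s by simp
    moreover have "f s = 1 / (s - 1) + 1 / 2 - s * psum (\<lambda>x. x - 1 / 2) 1 (s + 1)"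
      using G(2)[of "s + 1"] s by (auto simp: f_def)
    ultimately show ?thesis by (simp add: sums_iff powr_minus_divide)
  qed
  ultimately show ?thesis by (intro exI[of _ f]) (auto simp: f_def)
qed

lemma zeta_unique:
  assumes "f holomorphic_on (- {1})" "g holomorphic_on (- {1})" "f 1 = g 1"
    and "\<And>s. Re s > 1 \<Longrightarrow> f s = g s"
  shows "f = g"
proof
  fix z :: complex
  show "f z = g z"
  proof (cases "z = 1")
    case False
    show ?thesis
    proof (rule analytic_continuation_open[of "{s. Re s > 1}" "- {1}" f g z])
      show "open {s. Re s > 1}" by (rule open_halfspace_Re_gt)
      have "(2 :: complex) \<in> {s. Re s > 1}" by simp
      thus "{s :: complex. Re s > 1} \<noteq> {}" by blast
      show "connected (- {1 :: complex})" by (rule connected_punctured_universe) simp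
      show "f s = g s" if "s \<in> {s. Re s > 1}" for s using that assms(4) by blast
    qed (use assms(1,2) False in auto)
  qed (simp add: assms(3))
qed

lemma
  shows zeta_holomorphic: "zeta holomorphic_on (- {1})"
    and zeta_1: "zeta 1 = 0"
    and zeta_suminf: "Re s > 1 \<Longrightarrow> zeta s = (\<Sum>n. 1 / of_nat (Suc n) powr s)"
proof -
  define Q where "Q = (\<lambda>f. f holomorphic_on (- {1 :: complex}) \<and> f 1 = (0 :: complex) \<and>
       (\<forall>s. Re s > 1 \<longrightarrow> f s = (\<Sum>n. 1 / of_nat (Suc n) powr s)))"
  have "\<exists>!f. Q f"
  proof (rule ex_ex1I)
    show "\<exists>f. Q f" using zeta_exists unfolding Q_def .
    fix f g assume fg: "Q f" "Q g"
    show "f = g"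
    proof (rule zeta_unique)
      show "f holomorphic_on (- {1})" "g holomorphic_on (- {1})" "f 1 = g 1"
        using fg unfolding Q_def by metis+
      show "f s = g s" if "Re s > 1" for s
        using fg that unfolding Q_def by metis
    qed
  qed
  hence "Q (THE f. Q f)" by (rule theI')
  hence Q: "Q zeta" unfolding zeta_def Q_def .
  show "zeta holomorphic_on (- {1})" "zeta 1 = 0" using Q by (auto simp: Q_def)
  show "Re s > 1 \<Longrightarrow> zeta s = (\<Sum>n. 1 / of_nat (Suc n) powr s)" using Q by (auto simp: Q_def)
qed

lemma zeta_sums:
  assumes "Re s > 1"
  shows "(\<lambda>n. of_nat (Suc n) powr (- s)) sums zeta s"
proof -
  have "summable (\<lambda>n. of_nat (Suc n) powr (- s))"
    using zeta_tail_sums[of 1 s] assms by (simp add: sums_iff)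
  thus ?thesis using zeta_suminf[OF assms] by (simp add: sums_iff powr_minus_divide)
qed

section \<open>Euler-Maclaurin summation to third order\<close>

text \<open>This is B_3(x) / 6 with the third Bernoulli polynomial, the primitive of B_2(x) / 2 that
  vanishes at 0 and 1.\<close>

definition bern3 :: "real \<Rightarrow> real" where
  "bern3 x = x ^ 3 / 6 - x ^ 2 / 4 + x / 12"

lemma continuous_bern3 [continuous_intros]: "continuous_on A bern3"
  unfolding bern3_def by (intro continuous_intros) auto

lemma bern3_bound:
  assumes "x \<in> {0..1}"
  shows "\<bar>bern3 x\<bar> \<le> 81 / 10000"
proof -
  have *: "y ^ 3 / 6 - y / 24 \<le> 81 / 10000" if "\<bar>y\<bar> \<le> 1 / 2" for y :: real
  proof -
    \<comment> \<open>The maximum of y^3 / 6 - y / 24 is near y = -0.2887, about -1 / (2 sqrt 3).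
      The product is y^3 minus its tangent at that point, and it is nonpositive because y \<le> 1/2
      < 2 * 0.2887.\<close>
    have "(y + 0.2887) ^ 2 * (y - 2 * 0.2887) \<le> 0"
      using that by (intro mult_nonneg_nonpos) auto
    moreover have "(y + c) ^ 2 * (y - 2 * c) = y ^ 3 - 3 * c ^ 2 * y - 2 * c ^ 3" for c :: real
      by (simp add: power2_eq_square power3_eq_cube algebra_simps)
    ultimately have "y ^ 3 - 3 * 0.2887 ^ 2 * y - 2 * 0.2887 ^ 3 \<le> 0" by metis
    hence "y ^ 3 \<le> 25004307 / 100000000 * y + 481249563 / 10000000000"
      by (simp add: power2_eq_square power3_eq_cube)
    moreover have "y \<le> 1 / 2" using that by simp
    ultimately show ?thesis by linarith
  qed
  have eq: "bern3 x = (x - 1 / 2) ^ 3 / 6 - (x - 1 / 2) / 24"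
    by (simp add: bern3_def power2_eq_square power3_eq_cube field_simps)
  have "- bern3 x = (1 / 2 - x) ^ 3 / 6 - (1 / 2 - x) / 24"
    by (simp add: bern3_def power2_eq_square power3_eq_cube field_simps)
  moreover have "\<bar>x - 1 / 2\<bar> \<le> 1 / 2" "\<bar>1 / 2 - x\<bar> \<le> 1 / 2" using assms by (simp_all add: abs_le_iff field_simps)
  ultimately show ?thesis using *[of "x - 1 / 2"] *[of "1 / 2 - x"] eq by linarith
qed

text \<open>Pushing the remainder to the third Bernoulli polynomial makes it converge for Re s > -2,
  which is enough for circles of radius below 2 around points of the 1-line. There is no term with
  N^(-s-2) because \<open>bern3 0 = 0\<close>. The identity is proved for Re s > 1 and then
  continued.\<close>

theorem zeta_euler_maclaurin:
  assumes N: "N \<ge> 1" and s: "Re s > -2" "s \<noteq> 1"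
  shows "zeta s = (\<Sum>k\<in>{1..<N}. of_nat k powr (- s)) + of_nat N powr (1 - s) / (s - 1) +
     of_nat N powr (- s) / 2 + s * of_nat N powr (- s - 1) / 12
     - s * (s + 1) * (s + 2) * psum bern3 N (s + 3)"
proof -
  define F where "F = (\<lambda>s. (\<Sum>k\<in>{1..<N}. of_nat k powr (- s)) + of_nat N powr (1 - s) / (s - 1) +
     of_nat N powr (- s) / 2 + s * of_nat N powr (- s - 1) / 12
     - s * (s + 1) * (s + 2) * psum bern3 N (s + 3))"
  have eq: "zeta s = F s" if s: "Re s > 1" for s
  proof -
    have A: "(\<lambda>n. of_nat (Suc (n + (N - 1))) powr (- s)) sums
        (zeta s - (\<Sum>n<N - 1. of_nat (Suc n) powr (- s)))"
      by (rule sums_split_initial_segment[OF zeta_sums[OF s]])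
    have B: "(\<lambda>n. of_nat (Suc (n + (N - 1))) powr (- s)) = (\<lambda>n. of_nat (N + n) powr (- s))"
    proof
      fix n
      have "Suc (n + (N - 1)) = N + n" using N by simp
      thus "of_nat (Suc (n + (N - 1))) powr (- s) = of_nat (N + n) powr (- s)" by (rule arg_cong)
    qed
    have C: "(\<Sum>n<N - 1. of_nat (Suc n) powr (- s)) = (\<Sum>k\<in>{1..<N}. of_nat k powr (- s))"
      by (rule sum.reindex_bij_witness[of _ "\<lambda>k. k - 1" Suc]) (use N in auto)
    have 1: "zeta s - (\<Sum>k\<in>{1..<N}. of_nat k powr (- s)) =
       of_nat N powr (1 - s) / (s - 1) + of_nat N powr (- s) / 2 - s * psum (\<lambda>x. x - 1 / 2) N (s + 1)"
      using sums_unique2[OF A[unfolded B C] zeta_tail_sums[OF N s]] .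
    have "psum (\<lambda>x. x - 1 / 2) N (s + 1) =
        - of_real (0 ^ 2 / 2 - 0 / 2 + 1 / 12) * of_nat N powr (- (s + 1)) + (s + 1) * psum (\<lambda>x. x ^ 2 / 2 - x / 2 + 1 / 12) N (s + 1 + 1)"
      using s by (intro psum_by_parts[OF N]) (auto intro!: derivative_eq_intros continuous_intros)
    hence 2: "psum (\<lambda>x. x - 1 / 2) N (s + 1) = - (of_nat N powr (- s - 1)) / 12
        + (s + 1) * psum (\<lambda>x. x ^ 2 / 2 - x / 2 + 1 / 12) N (s + 2)" by (simp add: add.assoc)
    have "psum (\<lambda>x. x ^ 2 / 2 - x / 2 + 1 / 12) N (s + 2) =
        - of_real (bern3 0) * of_nat N powr (- (s + 2)) + (s + 2) * psum bern3 N (s + 2 + 1)"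
    proof (rule psum_by_parts[OF N])
      show "(bern3 has_real_derivative x\<^sup>2 / 2 - x / 2 + 1 / 12) (at x within {0..1})" for x
        unfolding bern3_def[abs_def] by (auto intro!: derivative_eq_intros simp: field_simps)
    qed (use s in \<open>auto intro!: continuous_intros simp: bern3_def\<close>)
    hence 3: "psum (\<lambda>x. x ^ 2 / 2 - x / 2 + 1 / 12) N (s + 2) = (s + 2) * psum bern3 N (s + 3)"
      by (simp add: bern3_def add.assoc)
    from 1 show ?thesis unfolding F_def 2 3 by (simp add: algebra_simps)
  qed
  have hol: "F holomorphic_on ({s. Re s > -2} - {1})"
  proof -
    have "(psum bern3 N \<circ> (\<lambda>s. s + 3)) holomorphic_on ({s. Re s > -2} - {1})"
      by (rule holomorphic_on_compose_gen[OF _ psum_holomorphic[OF N]])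
         (auto intro!: holomorphic_intros continuous_intros)
    thus ?thesis unfolding F_def o_def by (intro holomorphic_intros) (use N in auto)
  qed
  have "open {s :: complex. Re s > -2}" by (simp add: open_halfspace_Re_gt)
  moreover have "connected ({s :: complex. Re s > -2} - {1})"
    by (intro connected_open_delete convex_connected convex_halfspace_Re_gt) (auto simp: open_halfspace_Re_gt)
  moreover have "(2 :: complex) \<in> {s. Re s > 1}" by simp
  hence "{s :: complex. Re s > 1} \<noteq> {}" by blast
  moreover have "zeta holomorphic_on ({s. Re s > -2} - {1})"
    by (rule holomorphic_on_subset[OF zeta_holomorphic]) auto
  moreover have "{s :: complex. Re s > 1} \<subseteq> {s. Re s > -2} - {1}" by auto
  moreover have "s \<in> {s. Re s > -2} - {1}" using s by simp
  ultimately have "zeta s = F s"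
    by (intro analytic_continuation_open[of "{s. Re s > 1}" "{s. Re s > -2} - {1}" zeta F s])
       (simp_all add: hol eq open_halfspace_Re_gt open_Diff)
  thus ?thesis by (simp add: F_def)
qed

lemma zeta_error_bound:
  assumes N: "N \<ge> 1" and s: "Re s > -2"
  shows "norm (psum bern3 N (s + 3)) \<le> 81 / 10000 * (real N powr (- 2 - Re s) / (Re s + 2))"
proof -
  have e: "1 - Re (s + 3) = - 2 - Re s" "Re (s + 3) - 1 = Re s + 2" by auto
  have "norm (psum bern3 N (s + 3)) \<le> 81 / 10000 * (real N powr (1 - Re (s + 3)) / (Re (s + 3) - 1))"
    by (rule norm_psum_le[OF N _ continuous_bern3 bern3_bound]) (use s in auto)
  thus ?thesis unfolding e .
qed

section \<open>A Poisson--Jensen formula\<close>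

text \<open>Base points on the real axis suffice. The kernel is then a function of the cosine alone,
  and reflecting \<theta> at \<pi>/2 becomes a change of sign of \<open>c\<close>.\<close>

definition poisson :: "real \<Rightarrow> real \<Rightarrow> real" where
  "poisson w c = (1 - w\<^sup>2) / (1 - 2 * w * c + w\<^sup>2)"

lemma poisson_denom_pos:
  fixes w c :: real
  assumes "\<bar>w\<bar> < 1" "\<bar>c\<bar> \<le> 1"
  shows "1 - 2 * w * c + w\<^sup>2 > 0"
proof -
  have "\<bar>w * c\<bar> \<le> \<bar>w\<bar> * 1" unfolding abs_mult using assms(2) by (intro mult_left_mono) auto
  moreover have "(1 - \<bar>w\<bar>)\<^sup>2 > 0" using assms by simp
  ultimately show ?thesis by (simp add: power2_eq_square algebra_simps)
qed

theorem poisson_integral_formula: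
  fixes h :: "complex \<Rightarrow> complex" and w :: real
  assumes w: "\<bar>w\<bar> < 1" and cont: "continuous_on (cball 0 1) h" and hol: "h holomorphic_on ball 0 1"
  shows "((\<lambda>\<theta>. of_real (poisson w (cos \<theta>)) * h (cis \<theta>)) has_integral (2 * pi * h (of_real w))) {0..2 * pi}"
proof -
  have nz: "1 - of_real w * z \<noteq> 0" if "norm z \<le> 1" for z :: complex
  proof
    assume "1 - of_real w * z = 0"
    hence "norm (of_real w * z) = 1" by simp
    moreover have "norm (of_real w * z) \<le> \<bar>w\<bar> * 1"
      unfolding norm_mult norm_of_real using that by (intro mult_left_mono) auto
    ultimately show False using w by simp
  qed
  have "((\<lambda>u. h u / (u - of_real w)) has_contour_integral (2 * of_real pi * \<i> * h (of_real w))) (circlepath 0 1)"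
    by (rule Cauchy_integral_circlepath[OF cont hol]) (use w in auto)
  \<comment> \<open>The factor u makes Cauchy's formula at 0 return the value 0. Adding this
    integral turns the Cauchy kernel into the Poisson kernel on the circle.\<close>
  moreover have "((\<lambda>u. (u * (of_real w * h u / (1 - of_real w * u))) / (u - 0)) has_contour_integral
       (2 * of_real pi * \<i> * (0 * (of_real w * h 0 / (1 - of_real w * 0))))) (circlepath 0 1)"
    by (rule Cauchy_integral_circlepath) (use nz in \<open>auto intro!: continuous_intros holomorphic_intros cont hol\<close>)
  ultimately have "((\<lambda>u. h u / (u - of_real w) + (u * (of_real w * h u / (1 - of_real w * u))) / (u - 0))
       has_contour_integral (2 * of_real pi * \<i> * h (of_real w) + 2 * of_real pi * \<i> * (0 * (of_real w * h 0 / (1 - of_real w * 0))))) (circlepath 0 1)"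
    by (rule has_contour_integral_add)
  hence "((\<lambda>t. (h (cis t) / (cis t - of_real w) + (cis t * (of_real w * h (cis t) / (1 - of_real w * cis t))) / cis t) * \<i> * cis t)
       has_integral (2 * of_real pi * \<i> * h (of_real w))) {0..2 * pi}"
    unfolding circlepath_def by (subst (asm) has_contour_integral_part_circlepath_iff) auto
  hence "((\<lambda>t. \<i> * (of_real (poisson w (cos t)) * h (cis t))) has_integral (2 * of_real pi * \<i> * h (of_real w))) {0..2 * pi}"
  proof (rule has_integral_eq[rotated])
    fix t :: real
    define z where "z = cis t"
    have z0: "z \<noteq> 0" and nz1: "1 - of_real w * z \<noteq> 0" using nz[of z] by (auto simp: z_def)
    have nzw: "z - of_real w \<noteq> 0"
    proof
      assume "z - of_real w = 0"
      hence "norm z = norm (of_real w :: complex)" by simp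
      thus False using w by (simp add: z_def)
    qed
    have c: "2 * of_real (cos t) * z = z ^ 2 + 1"
    proof -
      have "2 * of_real (cos t) = z + inverse z"
        by (simp add: z_def cis_inverse complex_eq_iff)
      thus ?thesis using z0 by (simp add: field_simps power2_eq_square)
    qed
    have den: "(z - of_real w) * (1 - of_real w * z) = z * of_real (1 - 2 * w * cos t + w\<^sup>2)"
    proof -
      have "(z - of_real w) * (1 - of_real w * z) = z * (1 + of_real w ^ 2) - of_real w * (z ^ 2 + 1)"
        by (simp add: algebra_simps power2_eq_square)
      also have "\<dots> = z * of_real (1 - 2 * w * cos t + w\<^sup>2)"
        unfolding c[symmetric] by (simp add: algebra_simps)
      finally show ?thesis .
    qed
    have dz: "of_real (1 - 2 * w * cos t + w\<^sup>2) \<noteq> (0 :: complex)"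
      using poisson_denom_pos[OF w, of "cos t"] by (simp only: of_real_eq_0_iff) simp
    have "(h z / (z - of_real w) + (z * (of_real w * h z / (1 - of_real w * z))) / z) * \<i> * z
       = \<i> * h z * (z * ((1 - of_real w * z) + of_real w * (z - of_real w)) / ((z - of_real w) * (1 - of_real w * z)))"
      using z0 nz1 nzw by (simp add: divide_simps) (simp add: algebra_simps)
    also have "\<dots> = \<i> * h z * (z * (1 - of_real w ^ 2) / (z * of_real (1 - 2 * w * cos t + w\<^sup>2)))"
      by (subst den) (simp add: algebra_simps power2_eq_square)
    also have "\<dots> = \<i> * (of_real (poisson w (cos t)) * h z)"
      using z0 dz by (simp add: poisson_def)
    finally show "(h (cis t) / (cis t - of_real w) + (cis t * (of_real w * h (cis t) / (1 - of_real w * cis t))) / cis t) * \<i> * cis t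
        = \<i> * (of_real (poisson w (cos t)) * h (cis t))"
      by (simp add: z_def)
  qed
  from has_integral_mult_right[OF this, of "- \<i>"]
  have "((\<lambda>t. - \<i> * (\<i> * (of_real (poisson w (cos t)) * h (cis t)))) has_integral
      - \<i> * (2 * of_real pi * \<i> * h (of_real w))) {0..2 * pi}" .
  moreover have "- \<i> * (2 * of_real pi * \<i> * h (of_real w)) = 2 * pi * h (of_real w)"
    by (simp add: complex_eq_iff)
  ultimately have "((\<lambda>t. - \<i> * (\<i> * (of_real (poisson w (cos t)) * h (cis t)))) has_integral
      2 * pi * h (of_real w)) {0..2 * pi}" by metis
  thus ?thesis by simp
qed

corollary poisson_integral_formula_Re:
  fixes h :: "complex \<Rightarrow> complex" and w :: real
  assumes w: "\<bar>w\<bar> < 1" and hol: "h holomorphic_on cball 0 1"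
  shows "((\<lambda>\<theta>. poisson w (cos \<theta>) * Re (h (cis \<theta>))) has_integral (2 * pi * Re (h (of_real w)))) {0..2 * pi}"
proof -
  have "continuous_on (cball 0 1) h" "h holomorphic_on ball 0 1"
    using hol holomorphic_on_imp_continuous_on holomorphic_on_subset ball_subset_cball by blast+
  from has_integral_linear[OF poisson_integral_formula[OF w this] bounded_linear_Re]
  show ?thesis by (simp add: o_def)
qed

text \<open>The Green function of the unit disc with pole \<xi>, evaluated at a real point, for
  which no conjugate appears.\<close>

definition green :: "complex \<Rightarrow> real \<Rightarrow> real" where
  "green \<xi> w = ln (norm (1 - of_real w * \<xi>) / norm (of_real w - \<xi>))"

lemma norm_cis_diff:
  "norm (cis \<theta> - \<xi>) = norm (1 - cnj \<xi> * cis \<theta>)"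
proof -
  have "norm (cis \<theta> - \<xi>) = norm (cnj (cis \<theta> - \<xi>))" by (rule complex_mod_cnj[symmetric])
  also have "\<dots> = norm (cis \<theta> * cnj (cis \<theta> - \<xi>))" by (simp add: norm_mult)
  also have "cis \<theta> * cnj (cis \<theta> - \<xi>) = 1 - cnj \<xi> * cis \<theta>"
    by (simp add: algebra_simps cis_cnj cis_mult)
  finally show ?thesis .
qed

lemma finite_zeros_cball:
  assumes f: "f holomorphic_on ball c R'" and R: "R < R'" and nz: "\<exists>z\<in>ball c R'. f z \<noteq> 0"
  shows "finite {z \<in> cball c R. f z = 0}"
proof (rule ccontr)
  assume inf: "infinite {z \<in> cball c R. f z = 0}"
  then obtain x where x: "x \<in> cball c R" "x islimpt {z \<in> cball c R. f z = 0}"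
    using compact_eq_Bolzano_Weierstrass[of "cball c R"] by (metis (no_types, lifting) compact_cball mem_Collect_eq subsetI)
  from nz obtain z where z: "z \<in> ball c R'" "f z \<noteq> 0" by blast
  have "f z = 0"
  proof (rule analytic_continuation[OF f])
    show "{z \<in> cball c R. f z = 0} \<subseteq> ball c R'" using R by auto
  qed (use x R z in auto)
  with z show False by simp
qed

text \<open>Dividing out the zeros leaves a zero-free function with a holomorphic logarithm, whose
  real part obeys the Poisson formula. The zeros re-enter through factors that have the right
  modulus on the circle but do not vanish inside.\<close>

theorem poisson_jensen:
  fixes f :: "complex \<Rightarrow> complex"
  assumes f: "f holomorphic_on ball c R'" and R: "0 < R" "R < R'"
    and sphere: "\<And>z. z \<in> sphere c R \<Longrightarrow> f z \<noteq> 0" and w: "\<bar>w\<bar> < 1" and fw: "f (c + of_real (R * w)) \<noteq> 0"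
  defines "Z \<equiv> {z \<in> ball c R. f z = 0}"
  shows "finite Z"
    and "((\<lambda>\<theta>. poisson w (cos \<theta>) * ln (norm (f (c + of_real R * cis \<theta>)))) has_integral
           2 * pi * (ln (norm (f (c + of_real (R * w)))) +
             (\<Sum>\<rho>\<in>Z. of_int (zorder f \<rho>) * green ((\<rho> - c) / of_real R) w))) {0..2 * pi}"
proof -
  have cw: "c + of_real (R * w) \<in> ball c R"
    using R w by (auto simp: dist_norm norm_mult abs_mult)
  define R1 where "R1 = (R + R') / 2"
  have R1: "R < R1" "R1 < R'" using R by (auto simp: R1_def)
  have nz: "\<exists>z\<in>ball c R'. f z \<noteq> 0" using cw R fw by (intro bexI[of _ "c + of_real (R * w)"]) auto
  have fin1: "finite {z \<in> cball c R1. f z = 0}" by (rule finite_zeros_cball[OF f R1(2) nz])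
  show finZ: "finite Z" unfolding Z_def by (rule finite_subset[OF _ fin1]) (use R1 in auto)
  \<comment> \<open>\<open>D\<close> holds the distances of the zeros beyond the circle, up to
    \<open>R1\<close>. Its minimum is a radius larger than R whose open disc contains only the zeros
    in \<open>Z\<close>.\<close>
  define D where "D = insert R1 ((\<lambda>z. dist c z) ` ({z \<in> cball c R1. f z = 0} - Z))"
  define R2 where "R2 = Min D"
  have finD: "finite D" "D \<noteq> {}" using fin1 by (auto simp: D_def)
  have "R < d" if "d \<in> D" for d
  proof -
    have "R < dist c z" if "z \<in> cball c R1" "f z = 0" "z \<notin> Z" for z
    proof -
      have "dist c z \<noteq> R" using sphere[of z] that(2) by auto
      thus ?thesis using that by (auto simp: Z_def)
    qed
    thus ?thesis using that R1 by (auto simp: D_def)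
  qed
  hence R2: "R < R2" using finD by (simp add: R2_def)
  have R21: "R2 \<le> R1" using finD by (auto simp: R2_def D_def)
  define A where "A = ball c R2"
  have A: "open A" "connected A" "A \<subseteq> ball c R'" "ball c R \<subseteq> A"
    using R1 R2 R21 by (auto simp: A_def)
  have ZA: "z \<in> Z" if "z \<in> A" "f z = 0" for z
  proof (rule ccontr)
    assume "z \<notin> Z"
    hence "dist c z \<in> D" using that R21 by (auto simp: D_def A_def)
    hence "R2 \<le> dist c z" unfolding R2_def using finD by simp
    with that show False by (simp add: A_def)
  qed
  have fA: "f holomorphic_on A" using f A(3) by (rule holomorphic_on_subset)
  have Zsub: "Z \<subseteq> A" using A by (auto simp: Z_def)
  have f0: "f z = 0" if "z \<in> Z" for z using that by (simp add: Z_def)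
  have cwA: "c + of_real (R * w) \<in> A" using cw A by blast
  have zpos: "zorder f z > 0" if "z \<in> Z" for z
  proof -
    have "z \<in> A" using that Zsub by blast
    have "\<exists>w\<in>A. f w \<noteq> 0" using cwA fw by blast
    with zorder_exist_zero[of f A z] \<open>z \<in> A\<close> fA A f0[OF that] show ?thesis by metis
  qed
  define p where "p = (\<lambda>z. \<Prod>\<rho>\<in>Z. (z - \<rho>) ^ nat (zorder f \<rho>))"
  have p: "p holomorphic_on A" unfolding p_def by (intro holomorphic_intros)
  have p0: "p z = 0 \<longleftrightarrow> z \<in> Z" for z
    using finZ zpos by (auto simp: p_def)
  have zp: "zorder p z = zorder f z" if z: "z \<in> A" for z
  proof (cases "z \<in> Z")
    case True
    show ?thesis
    proof (rule zorder_eqI[OF A(1) z, of "\<lambda>x. \<Prod>\<rho>\<in>Z - {z}. (x - \<rho>) ^ nat (zorder f \<rho>)"])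
      show "(\<lambda>x. \<Prod>\<rho>\<in>Z - {z}. (x - \<rho>) ^ nat (zorder f \<rho>)) holomorphic_on A" by (intro holomorphic_intros)
      show "(\<Prod>\<rho>\<in>Z - {z}. (z - \<rho>) ^ nat (zorder f \<rho>)) \<noteq> 0" using finZ by auto
      fix x assume "x \<noteq> z"
      have "(x - z) powi zorder f z = (x - z) ^ nat (zorder f z)"
        using zpos[OF True] by (simp add: power_int_def)
      thus "p x = (\<Prod>\<rho>\<in>Z - {z}. (x - \<rho>) ^ nat (zorder f \<rho>)) * (x - z) powi zorder f z"
        unfolding p_def using prod.remove[OF finZ True, of "\<lambda>\<rho>. (x - \<rho>) ^ nat (zorder f \<rho>)"] by (simp add: mult.commute)
    qed
  next
    case False
    have an: "p analytic_on {z}" "f analytic_on {z}" using p fA A(1) z analytic_at by blast+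
    have "p z \<noteq> 0" "f z \<noteq> 0" using False p0 ZA[OF z] by auto
    thus ?thesis using zorder_eq_0I[OF an(1)] zorder_eq_0I[OF an(2)] by simp
  qed
  have zeq: "p z = 0 \<longleftrightarrow> f z = 0" if "z \<in> A" for z using p0 ZA[OF that] f0 by blast
  obtain h where h: "h holomorphic_on A" "\<And>z. z \<in> A \<Longrightarrow> h z \<noteq> 0" "\<And>z. z \<in> A \<Longrightarrow> f z = h z * p z"
  proof (rule holomorphic_zorder_factorization[OF fA A(1,2) p zeq zp])
    fix h assume "h holomorphic_on A" "\<And>z. z \<in> A \<Longrightarrow> h z \<noteq> 0" "\<And>z. z \<in> A \<Longrightarrow> f z = h z * p z"
    thus thesis by (rule that)
  qed
  have "simply_connected A" unfolding A_def by (intro convex_imp_simply_connected convex_ball)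
  then obtain l where l: "l holomorphic_on A" "\<And>z. z \<in> A \<Longrightarrow> h z = exp (l z)"
  proof (rule simply_connected_imp_holomorphic_log[OF h(1) _ _ h(2)])
    show "locally path_connected A" using A(1) by (rule open_imp_locally_path_connected)
    fix l assume "l holomorphic_on A" "\<And>z. z \<in> A \<Longrightarrow> h z = exp (l z)"
    thus thesis by (rule that)
  qed
  define \<xi> where "\<xi> = (\<lambda>\<rho>. (\<rho> - c) / of_real R)"
  have \<xi>: "norm (\<xi> \<rho>) < 1" if "\<rho> \<in> Z" for \<rho>
    using that R by (auto simp: \<xi>_def Z_def norm_divide dist_norm norm_minus_commute)
  \<comment> \<open>Every factor z - \<rho> is replaced by R (1 - cnj \<xi> u). The moduli agree for
    |u| = 1, and the bracket has positive real part on the closed disc, so that its logarithm is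
    holomorphic there.\<close>
  define H where "H = (\<lambda>u. l (c + of_real R * u) +
      (\<Sum>\<rho>\<in>Z. of_int (zorder f \<rho>) * (of_real (ln R) + Ln (1 - cnj (\<xi> \<rho>) * u))))"
  have inA: "c + of_real R * u \<in> A" if "u \<in> cball 0 1" for u
  proof -
    have "R * norm u \<le> R * 1" using that R by (intro mult_left_mono) auto
    hence "R * norm u < R2" using R2 by linarith
    thus ?thesis using R by (simp add: A_def dist_norm norm_mult)
  qed
  have Re_pos: "Re (1 - cnj (\<xi> \<rho>) * u) > 0" if "\<rho> \<in> Z" "u \<in> cball 0 1" for \<rho> u
  proof -
    have "Re (cnj (\<xi> \<rho>) * u) \<le> norm (cnj (\<xi> \<rho>) * u)" by (rule complex_Re_le_cmod)
    also have "\<dots> \<le> norm (\<xi> \<rho>) * 1" unfolding norm_mult complex_mod_cnj using that by (intro mult_left_mono) auto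
    finally show ?thesis using \<xi>[OF that(1)] by simp
  qed
  have "(l \<circ> (\<lambda>u. c + of_real R * u)) holomorphic_on cball 0 1"
    by (rule holomorphic_on_compose_gen[OF _ l(1)]) (use inA in \<open>auto intro!: holomorphic_intros\<close>)
  moreover have "(\<lambda>u. Ln (1 - cnj (\<xi> \<rho>) * u)) holomorphic_on cball 0 1" if "\<rho> \<in> Z" for \<rho>
    by (rule holomorphic_on_Ln') (use Re_pos[OF that] in \<open>force intro!: holomorphic_intros simp: complex_nonpos_Reals_iff\<close>)+
  ultimately have "H holomorphic_on cball 0 1"
    unfolding H_def o_def
    by (intro holomorphic_on_add holomorphic_on_sum holomorphic_on_mult holomorphic_on_const) auto
  note P = poisson_integral_formula_Re[OF w this]
  have ReH: "Re (H u) = ln (norm (h (c + of_real R * u))) +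
      (\<Sum>\<rho>\<in>Z. of_int (zorder f \<rho>) * ln (R * norm (1 - cnj (\<xi> \<rho>) * u)))" if u: "u \<in> cball 0 1" for u
  proof -
    have "Re (of_int (zorder f \<rho>) * (of_real (ln R) + Ln (1 - cnj (\<xi> \<rho>) * u)))
        = of_int (zorder f \<rho>) * ln (R * norm (1 - cnj (\<xi> \<rho>) * u))" if "\<rho> \<in> Z" for \<rho>
    proof -
      have ne: "1 - cnj (\<xi> \<rho>) * u \<noteq> 0" using Re_pos[OF that u] by (metis less_irrefl zero_complex.sel(1))
      have "Re (of_int (zorder f \<rho>) * (of_real (ln R) + Ln (1 - cnj (\<xi> \<rho>) * u)))
          = of_int (zorder f \<rho>) * (ln R + Re (Ln (1 - cnj (\<xi> \<rho>) * u)))" by simp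
      thus ?thesis using ne R by (simp add: ln_mult Re_Ln)
    qed
    moreover have "Re (l (c + of_real R * u)) = ln (norm (h (c + of_real R * u)))"
      using l(2)[OF inA[OF u]] by simp
    moreover have "Re (\<Sum>\<rho>\<in>Z. of_int (zorder f \<rho>) * (of_real (ln R) + Ln (1 - cnj (\<xi> \<rho>) * u)))
        = (\<Sum>\<rho>\<in>Z. of_int (zorder f \<rho>) * ln (R * norm (1 - cnj (\<xi> \<rho>) * u)))"
      unfolding Re_sum by (intro sum.cong refl) (rule calculation)
    ultimately show ?thesis unfolding H_def plus_complex.sel by linarith
  qed
  have lnf: "ln (norm (f z)) = ln (norm (h z)) + (\<Sum>\<rho>\<in>Z. of_int (zorder f \<rho>) * ln (norm (z - \<rho>)))"
    if "z \<in> A" "z \<notin> Z" for z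
  proof -
    have "ln (norm (p z)) = (\<Sum>\<rho>\<in>Z. ln (norm ((z - \<rho>) ^ nat (zorder f \<rho>))))"
      unfolding p_def prod_norm[symmetric] using finZ that by (intro ln_prod) auto
    also have "\<dots> = (\<Sum>\<rho>\<in>Z. of_int (zorder f \<rho>) * ln (norm (z - \<rho>)))"
      by (intro sum.cong refl) (use zpos that in \<open>auto simp: norm_power ln_realpow less_imp_le\<close>)
    finally show ?thesis using h(2,3)[OF that(1)] that p0[of z] by (simp add: norm_mult ln_mult)
  qed
  have "((\<lambda>\<theta>. poisson w (cos \<theta>) * ln (norm (f (c + of_real R * cis \<theta>)))) has_integral (2 * pi * Re (H (of_real w)))) {0..2 * pi}"
  proof (rule has_integral_eq[OF _ P])
    fix \<theta> :: real
    have u: "cis \<theta> \<in> cball 0 1" by simp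
    have sph: "c + of_real R * cis \<theta> \<in> sphere c R" using R by (simp add: dist_norm norm_mult)
    hence "c + of_real R * cis \<theta> \<notin> Z" using sphere f0 by blast
    note L = lnf[OF inA[OF u] this]
    have nrm: "norm (c + of_real R * cis \<theta> - \<rho>) = R * norm (1 - cnj (\<xi> \<rho>) * cis \<theta>)" for \<rho>
    proof -
      have "c + of_real R * cis \<theta> - \<rho> = of_real R * (cis \<theta> - \<xi> \<rho>)" using R by (simp add: \<xi>_def field_simps)
      thus ?thesis using R by (simp add: norm_mult norm_cis_diff)
    qed
    show "poisson w (cos \<theta>) * Re (H (cis \<theta>)) = poisson w (cos \<theta>) * ln (norm (f (c + of_real R * cis \<theta>)))"
      unfolding L nrm ReH[OF u] ..
  qed
  moreover have "Re (H (of_real w)) = ln (norm (f (c + of_real (R * w)))) + (\<Sum>\<rho>\<in>Z. of_int (zorder f \<rho>) * green (\<xi> \<rho>) w)"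
  proof -
    have u: "(of_real w :: complex) \<in> cball 0 1" using w by auto
    have nZ: "c + of_real (R * w) \<notin> Z" using fw f0 by blast
    have "of_int (zorder f \<rho>) * ln (R * norm (1 - cnj (\<xi> \<rho>) * of_real w))
        = of_int (zorder f \<rho>) * ln (norm (c + of_real (R * w) - \<rho>)) + of_int (zorder f \<rho>) * green (\<xi> \<rho>) w"
      if \<rho>: "\<rho> \<in> Z" for \<rho>
    proof -
      have "c + of_real (R * w) - \<rho> = of_real R * (of_real w - \<xi> \<rho>)" using R by (simp add: \<xi>_def field_simps)
      hence 1: "norm (c + of_real (R * w) - \<rho>) = R * norm (of_real w - \<xi> \<rho>)" using R by (simp add: norm_mult)
      have "c + of_real (R * w) - \<rho> \<noteq> 0" using nZ \<rho> by auto
      hence 2: "norm (of_real w - \<xi> \<rho>) > 0" using 1 R by (metis norm_eq_zero mult_eq_0_iff zero_less_norm_iff)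
      have "norm (1 - cnj (\<xi> \<rho>) * of_real w) = norm (cnj (1 - of_real w * \<xi> \<rho>))" by (simp add: mult.commute)
      hence 3: "norm (1 - cnj (\<xi> \<rho>) * of_real w) = norm (1 - of_real w * \<xi> \<rho>)" by (simp only: complex_mod_cnj)
      have "1 - cnj (\<xi> \<rho>) * of_real w \<noteq> 0" using Re_pos[OF \<rho> u] by (metis less_irrefl zero_complex.sel(1))
      hence 4: "norm (1 - of_real w * \<xi> \<rho>) > 0" using 3 by (metis zero_less_norm_iff)
      show ?thesis using 1 2 3 4 R by (simp add: green_def ln_mult ln_div algebra_simps)
    qed
    thus ?thesis using ReH[OF u] lnf[OF cwA nZ] by (simp add: sum.distrib)
  qed
  ultimately show "((\<lambda>\<theta>. poisson w (cos \<theta>) * ln (norm (f (c + of_real R * cis \<theta>)))) has_integral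
           2 * pi * (ln (norm (f (c + of_real (R * w)))) +
             (\<Sum>\<rho>\<in>Z. of_int (zorder f \<rho>) * green ((\<rho> - c) / of_real R) w))) {0..2 * pi}"
    by (simp add: \<xi>_def)
qed

section \<open>Zeta to the right of the critical strip\<close>

lemma zeta_norm_summable:
  assumes "Re s > 1"
  shows "summable (\<lambda>n. norm (of_nat (Suc n) powr (- s)))"
proof -
  have "summable (\<lambda>n. norm (of_nat (Suc n) powr (- of_real (Re s) :: complex)))"
  proof -
    have "(\<lambda>n. of_nat (Suc n) powr (- of_real (Re s) :: complex)) sums zeta (of_real (Re s))"
      using zeta_sums[of "of_real (Re s)"] assms by simp
    from sums_summable[OF sums_Re[OF this]]
    have "summable (\<lambda>n. Re (of_nat (Suc n) powr (- of_real (Re s))))" .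
    moreover have "Re (of_nat (Suc n) powr (- of_real (Re s))) = norm (of_nat (Suc n) powr (- of_real (Re s) :: complex))" for n
    proof -
      have "of_nat (Suc n) powr (- of_real (Re s) :: complex) = of_real (real (Suc n) powr (- Re s))"
        using powr_of_real[of "real (Suc n)" "- Re s"] by (simp del: of_nat_Suc)
      thus ?thesis by simp
    qed
    ultimately show ?thesis by simp
  qed
  moreover have "norm (of_nat (Suc n) powr (- of_real (Re s) :: complex)) = norm (of_nat (Suc n) powr (- s))" for n
    by (simp add: norm_powr_real_powr del: of_nat_Suc)
  ultimately show ?thesis by simp
qed

section \<open>Sieve of Eratosthenes and Euler product\<close>

lemma zeta_has_sum:
  assumes "Re s > 1"
  shows "((\<lambda>n. of_nat n powr (- s)) has_sum zeta s) {1..}"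
proof -
  have "((\<lambda>n. of_nat (Suc n) powr (- s)) has_sum zeta s) UNIV"
    by (rule norm_summable_imp_has_sum[OF zeta_norm_summable[OF assms] zeta_sums[OF assms]])
  moreover have bij: "bij_betw Suc UNIV {1..}"
    by (rule bij_betwI[of _ _ _ "\<lambda>n. n - 1"]) auto
  ultimately show ?thesis
    using has_sum_reindex_bij_betw[OF bij, of "\<lambda>n. of_nat n powr (- s)" "zeta s"] by metis
qed

text \<open>One sieving step per prime: the factor 1 - p^(-s) removes exactly the multiples of p
  among the remaining integers.\<close>

lemma zeta_sieve:
  fixes s :: complex
  assumes "Re s > 1"
  shows "finite P \<Longrightarrow> (\<And>p. p \<in> P \<Longrightarrow> prime p) \<Longrightarrow>
    ((\<lambda>n. of_nat n powr (- s)) has_sum (zeta s * (\<Prod>p\<in>P. 1 - of_nat p powr (- s)))) {n. n \<ge> 1 \<and> (\<forall>p\<in>P. \<not> p dvd n)}"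
proof (induction rule: finite_induct)
  case empty
  thus ?case using zeta_has_sum[OF assms] by (simp add: atLeast_def)
next
  case (insert p P)
  define A where "A = {n::nat. n \<ge> 1 \<and> (\<forall>p\<in>P. \<not> p dvd n)}"
  define T where "T = zeta s * (\<Prod>p\<in>P. 1 - of_nat p powr (- s))"
  have p: "prime p" using insert by auto
  have IH: "((\<lambda>n. of_nat n powr (- s)) has_sum T) A"
    unfolding A_def T_def using insert by auto
  have "((\<lambda>n. of_nat p powr (- s) * of_nat n powr (- s)) has_sum (of_nat p powr (- s) * T)) A"
    by (rule has_sum_cmult_right[OF IH])
  moreover have "of_nat p powr (- s) * of_nat n powr (- s) = of_nat (p * n) powr (- s)" for n
    using powr_times_real[of "of_nat p" "of_nat n" "- s"] by simp
  ultimately have "((\<lambda>n. of_nat (p * n) powr (- s)) has_sum (of_nat p powr (- s) * T)) A" by simp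
  moreover have "inj_on (\<lambda>n. p * n) A" using prime_gt_0_nat[OF p] by (auto simp: inj_on_def)
  ultimately have B: "((\<lambda>n. of_nat n powr (- s)) has_sum (of_nat p powr (- s) * T)) ((\<lambda>n. p * n) ` A)"
    using has_sum_reindex[of "\<lambda>n. p * n" A "\<lambda>n. of_nat n powr (- s)"] by (simp add: o_def)
  have coprime: "q dvd p * n \<longleftrightarrow> q dvd n" if "q \<in> P" for q n
  proof -
    have "prime q" "q \<noteq> p" using that insert by auto
    hence "\<not> q dvd p" using p primes_dvd_imp_eq by blast
    thus ?thesis using \<open>prime q\<close> by (simp add: prime_dvd_mult_iff)
  qed
  have img: "(\<lambda>n. p * n) ` A = {n \<in> A. p dvd n}"
  proof (intro equalityI subsetI)
    fix n assume "n \<in> (\<lambda>n. p * n) ` A"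
    thus "n \<in> {n \<in> A. p dvd n}" using coprime prime_gt_0_nat[OF p] by (auto simp: A_def)
  next
    fix n assume n: "n \<in> {n \<in> A. p dvd n}"
    then obtain m where m: "n = p * m" by auto
    have "\<not> q dvd m" if "q \<in> P" for q using n m coprime[OF that, of m] that by (auto simp: A_def)
    moreover have "m \<ge> 1" using n m by (cases m) (auto simp: A_def)
    ultimately have "m \<in> A" by (auto simp: A_def)
    thus "n \<in> (\<lambda>n. p * n) ` A" using m by auto
  qed
  have "((\<lambda>n. of_nat n powr (- s)) has_sum (T - of_nat p powr (- s) * T)) (A - {n \<in> A. p dvd n})"
    by (rule has_sum_Diff[OF IH B[unfolded img]]) auto
  moreover have "A - {n \<in> A. p dvd n} = {n. n \<ge> 1 \<and> (\<forall>q\<in>insert p P. \<not> q dvd n)}"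
    by (auto simp: A_def)
  moreover have "T - of_nat p powr (- s) * T = zeta s * (\<Prod>p\<in>insert p P. 1 - of_nat p powr (- s))"
    using insert by (simp add: T_def algebra_simps)
  ultimately show ?case by simp
qed

definition zr :: "real \<Rightarrow> real" where
  "zr \<sigma> = Re (zeta (of_real \<sigma>))"

lemma zr_sums:
  assumes "\<sigma> > 1"
  shows "(\<lambda>n. real (Suc n) powr (- \<sigma>)) sums zr \<sigma>" and zeta_of_real: "zeta (of_real \<sigma>) = of_real (zr \<sigma>)"
proof -
  have "(\<lambda>n. of_nat (Suc n) powr (- of_real \<sigma> :: complex)) sums zeta (of_real \<sigma>)"
    using zeta_sums[of "of_real \<sigma>"] assms by simp
  moreover have "of_nat (Suc n) powr (- of_real \<sigma> :: complex) = of_real (real (Suc n) powr (- \<sigma>))" for n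
    using powr_of_real[of "real (Suc n)" "- \<sigma>"] by (simp del: of_nat_Suc)
  ultimately have S: "(\<lambda>n. of_real (real (Suc n) powr (- \<sigma>)) :: complex) sums zeta (of_real \<sigma>)" by simp
  from sums_Re[OF S] show 1: "(\<lambda>n. real (Suc n) powr (- \<sigma>)) sums zr \<sigma>" by (simp add: zr_def)
  from sums_of_real[OF 1, where 'a = complex] show "zeta (of_real \<sigma>) = of_real (zr \<sigma>)"
    using S sums_unique2 by blast
qed

lemma zr_ge_1:
  assumes "\<sigma> > 1"
  shows "zr \<sigma> \<ge> 1"
proof -
  have "(\<Sum>n<1. real (Suc n) powr (- \<sigma>)) \<le> (\<Sum>n. real (Suc n) powr (- \<sigma>))"
    using zr_sums(1)[OF assms] by (intro sum_le_suminf) (auto simp: sums_iff)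
  thus ?thesis using zr_sums(1)[OF assms] by (simp add: sums_iff)
qed

lemma norm_zeta_le_zr:
  assumes "Re s > 1"
  shows "norm (zeta s) \<le> zr (Re s)"
proof -
  have "norm (zeta s) = norm (\<Sum>n. of_nat (Suc n) powr (- s))"
    using zeta_sums[OF assms] by (simp add: sums_iff)
  also have "\<dots> \<le> (\<Sum>n. norm (of_nat (Suc n) powr (- s)))"
    by (rule summable_norm[OF zeta_norm_summable[OF assms]])
  also have "(\<lambda>n. norm (of_nat (Suc n) powr (- s))) = (\<lambda>n. real (Suc n) powr (- Re s))"
    by (simp add: norm_powr_real_powr del: of_nat_Suc)
  also have "(\<Sum>n. real (Suc n) powr (- Re s)) = zr (Re s)"
    using zr_sums(1)[OF assms] by (simp add: sums_iff)
  finally show ?thesis .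
qed

text \<open>After sieving by all primes up to M only 1 and integers beyond M remain, so the distance
  from 1 is at most the tail of the series for zeta(Re s).\<close>

lemma euler_product_limit:
  fixes s :: complex
  assumes s: "Re s > 1"
  shows "(\<lambda>M. zeta s * (\<Prod>p | prime p \<and> p \<le> M. 1 - of_nat p powr (- s))) \<longlonglongrightarrow> 1"
proof -
  define \<sigma> where "\<sigma> = Re s"
  have \<sigma>: "\<sigma> > 1" using s by (simp add: \<sigma>_def)
  define f where "f = (\<lambda>n::nat. of_nat n powr (- s) :: complex)"
  define E where "E = (\<lambda>M. zeta s * (\<Prod>p | prime p \<and> p \<le> M. 1 - of_nat p powr (- s)))"
  have nf: "norm (f n) = real n powr (- \<sigma>)" for n
    by (cases "n = 0") (auto simp: f_def \<sigma>_def norm_powr_real_powr)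
  have all: "((\<lambda>n. real n powr (- \<sigma>)) has_sum zr \<sigma>) {1..}"
    using has_sum_Re[OF zeta_has_sum[of "of_real \<sigma>"]] \<sigma>
    by (simp add: zr_def) (smt (verit) has_sum_cong Re_complex_of_real of_real_of_nat_eq powr_of_real of_nat_0_le_iff of_real_minus)
  have bound: "norm (E M - 1) \<le> zr \<sigma> - (\<Sum>n<M. real (Suc n) powr (- \<sigma>))" if M: "M \<ge> 1" for M
  proof -
    define A where "A = {n::nat. n \<ge> 1 \<and> (\<forall>p\<in>{p. prime p \<and> p \<le> M}. \<not> p dvd n)}"
    have "(f has_sum E M) A"
      unfolding f_def E_def A_def by (rule zeta_sieve[OF s]) auto
    moreover have "(f has_sum f 1) {1}" using has_sum_finite[of "{1::nat}" f] by simp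
    moreover have one: "1 \<in> A" unfolding A_def by (auto dest: prime_gt_1_nat)
    ultimately have S: "(f has_sum (E M - f 1)) (A - {1})"
      by (intro has_sum_Diff) auto
    have sub: "A - {1} \<subseteq> {M<..}"
    proof
      fix n assume n: "n \<in> A - {1}"
      then obtain p where p: "prime p" "p dvd n" using prime_factor_nat[of n] by auto
      have "p \<le> n" using p n by (intro dvd_imp_le) (auto simp: A_def)
      moreover have "p > M" using p n by (auto simp: A_def not_le)
      ultimately show "n \<in> {M<..}" by simp
    qed
    have "((\<lambda>n. real n powr (- \<sigma>)) has_sum (\<Sum>n\<in>{1..M}. real n powr (- \<sigma>))) {1..M}"
      by (rule has_sum_finite) auto
    with all have "((\<lambda>n. real n powr (- \<sigma>)) has_sum (zr \<sigma> - (\<Sum>n\<in>{1..M}. real n powr (- \<sigma>)))) ({1..} - {1..M})"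
      by (rule has_sum_Diff) auto
    moreover have "{1..} - {1..M} = {M<..}" by auto
    moreover have "(\<Sum>n\<in>{1..M}. real n powr (- \<sigma>)) = (\<Sum>n<M. real (Suc n) powr (- \<sigma>))"
      by (rule sum.reindex_bij_witness[of _ Suc "\<lambda>k. k - 1"]) auto
    ultimately have tail: "((\<lambda>n. norm (f n)) has_sum (zr \<sigma> - (\<Sum>n<M. real (Suc n) powr (- \<sigma>)))) {M<..}"
      by (simp add: nf)
    have "norm (E M - f 1) \<le> infsum (\<lambda>n. norm (f n)) (A - {1})"
    proof -
      have "(\<lambda>n. norm (f n)) summable_on (A - {1})"
        using summable_on_subset_banach[OF has_sum_imp_summable[OF tail] sub] .
      from norm_infsum_bound[OF this] show ?thesis using infsumI[OF S] by simp
    qed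
    also have "\<dots> \<le> infsum (\<lambda>n. norm (f n)) {M<..}"
      using summable_on_subset_banach[OF has_sum_imp_summable[OF tail] sub]
      by (intro infsum_mono2 has_sum_imp_summable[OF tail] sub) auto
    also have "\<dots> = zr \<sigma> - (\<Sum>n<M. real (Suc n) powr (- \<sigma>))" by (rule infsumI[OF tail])
    finally show ?thesis by (simp add: f_def)
  qed
  have "(\<lambda>M. zr \<sigma> - (\<Sum>n<M. real (Suc n) powr (- \<sigma>))) \<longlonglongrightarrow> zr \<sigma> - zr \<sigma>"
    by (intro tendsto_intros) (use zr_sums(1)[OF \<sigma>] in \<open>simp add: sums_def\<close>)
  hence "(\<lambda>M. zr \<sigma> - (\<Sum>n<M. real (Suc n) powr (- \<sigma>))) \<longlonglongrightarrow> 0" by simp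
  moreover have "eventually (\<lambda>M. norm (E M - 1) \<le> zr \<sigma> - (\<Sum>n<M. real (Suc n) powr (- \<sigma>))) sequentially"
    using eventually_ge_at_top[of 1] by eventually_elim (rule bound)
  ultimately have "(\<lambda>M. E M - 1) \<longlonglongrightarrow> 0" by (rule Lim_null_comparison[rotated])
  thus ?thesis unfolding E_def by (subst (asm) LIM_zero_iff)
qed

lemma of_nat_powr_Complex:
  assumes "n > 0"
  shows "of_nat n powr (- Complex \<sigma> t) = of_real (real n powr (- \<sigma>)) * cis (- t * ln (real n))"
proof -
  have "Ln (of_nat n) = of_real (ln (real n))" using assms Ln_of_real[of "real n"] by simp
  hence "of_nat n powr (- Complex \<sigma> t) = exp (- Complex \<sigma> t * of_real (ln (real n)))"
    using assms by (simp add: powr_def)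
  also have "- Complex \<sigma> t * of_real (ln (real n)) = of_real (- \<sigma> * ln (real n)) + \<i> * of_real (- t * ln (real n))"
    by (simp add: complex_eq_iff)
  also have "exp \<dots> = of_real (real n powr (- \<sigma>)) * cis (- t * ln (real n))"
    using assms by (simp only: exp_add exp_of_real cis_conv_exp) (simp add: powr_def)
  finally show ?thesis .
qed

lemma norm_one_minus_cis:
  "norm (1 - of_real x * cis \<phi>) ^ 2 = 1 - 2 * x * cos \<phi> + x ^ 2"
proof -
  have "norm (1 - of_real x * cis \<phi>) ^ 2 = (1 - x * cos \<phi>) ^ 2 + (x * sin \<phi>) ^ 2"
    by (subst cmod_power2) simp
  also have "\<dots> = 1 - 2 * x * cos \<phi> + x ^ 2 * (cos \<phi> ^ 2 + sin \<phi> ^ 2)"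
    by algebra
  finally show ?thesis by simp
qed

text \<open>The square of |1 - u e^(i \<phi>)| is affine in cos \<phi>, hence a convex combination
  of its values for cos \<phi> = -1 and cos \<phi> = 1. Times (1 - u)^2 these are (1 - u^2)^2 and (1
  - u)^4, both decreasing in u.\<close>

lemma euler_factor_mono:
  fixes x y :: real
  assumes "0 \<le> x" "x \<le> y" "y < 1"
  shows "norm (1 - of_real y * cis \<phi>) * (1 - y) \<le> norm (1 - of_real x * cis \<phi>) * (1 - x)"
proof (rule power2_le_imp_le)
  have eq: "(norm (1 - of_real u * cis \<phi>) * (1 - u)) ^ 2 =
      (1 - cos \<phi>) / 2 * (1 - u ^ 2) ^ 2 + (1 + cos \<phi>) / 2 * (1 - u) ^ 4" for u
    unfolding power_mult_distrib norm_one_minus_cis by (simp add: power2_eq_square power4_eq_xxxx field_simps)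
  have "y ^ 2 \<le> 1" "x ^ 2 \<le> y ^ 2" using assms by (auto intro!: power_mono simp: power_le_one)
  hence "(1 - y ^ 2) ^ 2 \<le> (1 - x ^ 2) ^ 2" by (intro power_mono) auto
  moreover have "(1 - y) ^ 4 \<le> (1 - x) ^ 4" using assms by (intro power_mono) auto
  ultimately show "(norm (1 - of_real y * cis \<phi>) * (1 - y)) ^ 2 \<le> (norm (1 - of_real x * cis \<phi>) * (1 - x)) ^ 2"
    unfolding eq
    using mult_left_mono[of _ _ "(1 + cos \<phi>) / 2"] mult_left_mono[of _ _ "(1 - cos \<phi>) / 2"]
      cos_ge_minus_one[of \<phi>] cos_le_one[of \<phi>]
    by (intro add_mono) simp_all
  show "0 \<le> norm (1 - of_real x * cis \<phi>) * (1 - x)" using assms by auto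
qed

text \<open>The real part of the logarithmic series. The term n = 0 is 0 because division by 0
  yields 0.\<close>

lemma ln_norm_one_minus_sums:
  assumes "0 \<le> x" "x < 1"
  shows "(\<lambda>n. x ^ n * cos (real n * \<phi>) / real n) sums (- ln (norm (1 - of_real x * cis \<phi>)))"
proof -
  define w where "w = of_real x * cis \<phi>"
  have w: "norm w < 1" using assms by (simp add: w_def norm_mult)
  have "1 - w \<noteq> 0" using w by auto
  have "(\<lambda>n. (-1) ^ Suc n / of_nat n * (- w) ^ n) sums Ln (1 + (- w))"
    using Ln_series[of "- w"] w by simp
  from sums_Re[OF sums_minus[OF this]]
  have "(\<lambda>n. Re (- ((-1) ^ Suc n / of_nat n * (- w) ^ n))) sums (- ln (norm (1 - w)))"
    using Re_Ln[OF \<open>1 - w \<noteq> 0\<close>] by simp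
  moreover have "Re (- ((-1) ^ Suc n / of_nat n * (- w) ^ n)) = x ^ n * cos (real n * \<phi>) / real n" for n
  proof -
    have "(- w) ^ n = (-1) ^ n * w ^ n" by (rule power_minus)
    hence "- ((-1) ^ Suc n / of_nat n * (- w) ^ n) = ((-1) ^ n * (-1) ^ n) * w ^ n / of_nat n"
      by simp
    also have "((-1) ^ n * (-1) ^ n :: complex) = 1" by (simp flip: power_mult_distrib)
    also have "1 * w ^ n / of_nat n = of_real (x ^ n / real n) * cis \<phi> ^ n"
      by (simp add: w_def power_mult_distrib)
    also have "cis \<phi> ^ n = cis (real n * \<phi>)" by (rule Complex.DeMoivre)
    finally have "Re (- ((-1) ^ Suc n / of_nat n * (- w) ^ n)) = Re (of_real (x ^ n / real n) * cis (real n * \<phi>))"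
      by (rule arg_cong)
    also have "\<dots> = x ^ n * cos (real n * \<phi>) / real n" by simp
    finally show ?thesis .
  qed
  ultimately show ?thesis unfolding w_def by (simp only:)
qed

text \<open>Taking logarithms, the n-th coefficient involves 3 + 4 cos (n \<phi>) + cos (2 n \<phi>)
  = 2 (1 + cos (n \<phi>))^2.\<close>

lemma euler_factor_341:
  assumes "0 \<le> x" "x < 1"
  shows "(1 - x) ^ 3 * norm (1 - of_real x * cis \<phi>) ^ 4 * norm (1 - of_real x * cis (2 * \<phi>)) \<le> 1"
proof -
  have pos: "norm (1 - of_real x * cis \<psi>) > 0" for \<psi>
  proof -
    have "1 - of_real x * cis \<psi> \<noteq> 0"
    proof
      assume "1 - of_real x * cis \<psi> = 0"
      hence "norm (of_real x * cis \<psi>) = 1" by simp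
      thus False using assms by (simp add: norm_mult)
    qed
    thus ?thesis by simp
  qed
  have "(\<lambda>n. 3 * (x ^ n * cos (real n * 0) / real n) + 4 * (x ^ n * cos (real n * \<phi>) / real n)
        + x ^ n * cos (real n * (2 * \<phi>)) / real n) sums
      (3 * (- ln (norm (1 - of_real x * cis 0))) + 4 * (- ln (norm (1 - of_real x * cis \<phi>)))
        + - ln (norm (1 - of_real x * cis (2 * \<phi>))))"
    by (intro sums_add sums_mult ln_norm_one_minus_sums assms)
  moreover have "3 * (x ^ n * cos (real n * 0) / real n) + 4 * (x ^ n * cos (real n * \<phi>) / real n)
        + x ^ n * cos (real n * (2 * \<phi>)) / real n \<ge> 0" for n
  proof -
    have cd: "cos (real n * (2 * \<phi>)) = 2 * cos (real n * \<phi>) ^ 2 - 1"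
      using cos_double_cos[of "real n * \<phi>"] by (simp add: mult_ac)
    hence "3 * (x ^ n * cos (real n * 0) / real n) + 4 * (x ^ n * cos (real n * \<phi>) / real n)
        + x ^ n * cos (real n * (2 * \<phi>)) / real n = x ^ n / real n * (2 * (1 + cos (real n * \<phi>)) ^ 2)"
      unfolding cd mult_zero_right cos_zero
      by (cases "n = 0") (simp_all add: power2_eq_square field_simps)
    thus ?thesis using assms by simp
  qed
  ultimately have "0 \<le> 3 * (- ln (norm (1 - of_real x * cis 0))) + 4 * (- ln (norm (1 - of_real x * cis \<phi>)))
        + - ln (norm (1 - of_real x * cis (2 * \<phi>)))" by (rule sums_le[OF _ sums_zero, rotated])
  moreover have "norm (1 - of_real x * cis 0) = 1 - x"
  proof -
    have "norm (1 - of_real x * cis 0) = norm (of_real (1 - x) :: complex)" by simp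
    thus ?thesis unfolding norm_of_real using assms by simp
  qed
  ultimately have "ln ((1 - x) ^ 3 * norm (1 - of_real x * cis \<phi>) ^ 4 * norm (1 - of_real x * cis (2 * \<phi>))) \<le> 0"
    using pos[of \<phi>] pos[of "2 * \<phi>"] assms by (simp add: ln_mult ln_realpow)
  moreover have "(1 - x) ^ 3 * norm (1 - of_real x * cis \<phi>) ^ 4 * norm (1 - of_real x * cis (2 * \<phi>)) > 0"
    using pos assms by simp
  ultimately show ?thesis by (simp add: ln_le_zero_iff)
qed

text \<open>Partial products for 1 / |zeta|. Stating limits as |zeta| times \<open>euler_fac\<close>
  tending to 1 transfers inequalities between Euler factors without dividing by a value of
  zeta.\<close>

definition euler_fac :: "nat \<Rightarrow> real \<Rightarrow> real \<Rightarrow> real" where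
  "euler_fac M \<sigma> t = (\<Prod>p | prime p \<and> p \<le> M. norm (1 - of_nat p powr (- Complex \<sigma> t)))"

lemma euler_fac_limit:
  assumes "\<sigma> > 1"
  shows "(\<lambda>M. norm (zeta (Complex \<sigma> t)) * euler_fac M \<sigma> t) \<longlonglongrightarrow> 1"
proof -
  have "(\<lambda>M. norm (zeta (Complex \<sigma> t) * (\<Prod>p | prime p \<and> p \<le> M. 1 - of_nat p powr (- Complex \<sigma> t)))) \<longlonglongrightarrow> norm (1 :: complex)"
    by (intro tendsto_norm euler_product_limit) (use assms in simp)
  thus ?thesis by (simp add: euler_fac_def norm_mult prod_norm)
qed

lemma zeta_nonzero:
  assumes "Re s > 1"
  shows "zeta s \<noteq> 0"
proof
  assume "zeta s = 0"
  hence "(\<lambda>M::nat. 0) \<longlonglongrightarrow> (1 :: complex)"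
    using euler_product_limit[OF assms] by simp
  thus False by (simp add: LIMSEQ_const_iff)
qed

lemma zr_pos: "\<sigma> > 1 \<Longrightarrow> zr \<sigma> > 0"
  using zr_ge_1[of \<sigma>] by simp

lemma norm_zeta_Complex_0: "\<sigma> > 1 \<Longrightarrow> norm (zeta (Complex \<sigma> 0)) = zr \<sigma>"
  using zeta_of_real[of \<sigma>] zr_pos[of \<sigma>] complex_of_real_def[of \<sigma>] by simp

lemma euler_factor_eq:
  assumes "prime p"
  shows "norm (1 - of_nat p powr (- Complex \<sigma> t)) = norm (1 - of_real (real p powr (- \<sigma>)) * cis (- t * ln (real p)))"
  using of_nat_powr_Complex[of p \<sigma> t] prime_gt_0_nat[OF assms] by simp

lemma euler_factor_real:
  assumes "prime p" "\<sigma> > 1"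
  shows "norm (1 - of_nat p powr (- Complex \<sigma> 0)) = 1 - real p powr (- \<sigma>)"
    and "0 \<le> real p powr (- \<sigma>)" "real p powr (- \<sigma>) < 1"
proof -
  have p: "real p > 1" using prime_gt_1_nat[OF assms(1)] by simp
  have "real p powr (- \<sigma>) < real p powr 0" using p assms by (intro powr_less_mono) auto
  thus l: "real p powr (- \<sigma>) < 1" using p by simp
  have "norm (1 - of_nat p powr (- Complex \<sigma> 0)) = norm (of_real (1 - real p powr (- \<sigma>)) :: complex)"
    unfolding euler_factor_eq[OF assms(1)] by simp
  thus "norm (1 - of_nat p powr (- Complex \<sigma> 0)) = 1 - real p powr (- \<sigma>)"
    using l by (simp only: norm_of_real)
qed auto

text \<open>
  Termwise in the Euler product, this is the statement that \<open>|1 - x e^{i\<phi>}| (1 - x)\<close>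
  decreases in \<open>x\<close>. It replaces bounds on the logarithmic derivative of \<open>\<zeta>\<close>.
\<close>

lemma zeta_times_zr_antimono:
  assumes "1 < \<sigma>" "\<sigma> \<le> \<sigma>'"
  shows "norm (zeta (Complex \<sigma>' t)) * zr \<sigma>' \<le> norm (zeta (Complex \<sigma> t)) * zr \<sigma>"
proof -
  have \<sigma>': "\<sigma>' > 1" using assms by simp
  define F where "F = (\<lambda>M \<sigma>. euler_fac M \<sigma> t * euler_fac M \<sigma> 0)"
  define a where "a = (\<lambda>\<sigma>. norm (zeta (Complex \<sigma> t)) * zr \<sigma>)"
  have lim: "(\<lambda>M. a \<sigma> * F M \<sigma>) \<longlonglongrightarrow> 1" if "\<sigma> > 1" for \<sigma>
    using tendsto_mult[OF euler_fac_limit[OF that, of t] euler_fac_limit[OF that, of 0]]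
    by (simp add: norm_zeta_Complex_0[OF that] a_def F_def mult_ac)
  have mono: "F M \<sigma> \<le> F M \<sigma>'" for M
    unfolding F_def euler_fac_def prod.distrib[symmetric]
  proof (rule prod_mono, safe)
    fix p :: nat assume p: "prime p"
    have "real p powr (- \<sigma>') \<le> real p powr (- \<sigma>)"
      using prime_gt_1_nat[OF p] assms by (intro powr_mono) auto
    thus "norm (1 - of_nat p powr (- Complex \<sigma> t)) * norm (1 - of_nat p powr (- Complex \<sigma> 0))
       \<le> norm (1 - of_nat p powr (- Complex \<sigma>' t)) * norm (1 - of_nat p powr (- Complex \<sigma>' 0))"
      unfolding euler_factor_real(1)[OF p assms(1)] euler_factor_real(1)[OF p \<sigma>']
      unfolding euler_factor_eq[OF p]
      using euler_factor_real[OF p assms(1)] euler_factor_real[OF p \<sigma>'] by (intro euler_factor_mono) auto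
  qed auto
  have nonneg: "a \<sigma> \<ge> 0" "a \<sigma>' \<ge> 0"
    using zr_pos[of \<sigma>] zr_pos[of \<sigma>'] assms by (auto simp: a_def)
  have "a \<sigma>' * (a \<sigma> * F M \<sigma>) \<le> a \<sigma> * (a \<sigma>' * F M \<sigma>')" for M
    using mult_left_mono[OF mono[of M], of "a \<sigma> * a \<sigma>'"] nonneg by (simp add: mult_ac)
  hence "a \<sigma>' * 1 \<le> a \<sigma> * 1"
    by (intro LIMSEQ_le[OF tendsto_mult[OF tendsto_const lim[OF assms(1)]] tendsto_mult[OF tendsto_const lim[OF \<sigma>']]]) auto
  thus ?thesis by (simp add: a_def)
qed

text \<open>Each Euler factor is at most its value 1 at x = 0, by
  \<open>euler_factor_mono\<close>.\<close>

lemma zeta_times_zr_ge_1: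
  assumes "1 < \<sigma>"
  shows "norm (zeta (Complex \<sigma> t)) * zr \<sigma> \<ge> 1"
proof -
  have le: "euler_fac M \<sigma> t * euler_fac M \<sigma> 0 \<le> 1" for M
    unfolding euler_fac_def prod.distrib[symmetric]
  proof (rule prod_le_1, safe)
    fix p :: nat assume p: "prime p"
    define x where "x = real p powr (- \<sigma>)"
    have x: "0 \<le> x" "x < 1" using euler_factor_real[OF p assms] by (auto simp: x_def)
    have "norm (1 - of_real x * cis (- t * ln (real p))) * (1 - x) \<le> norm (1 - of_real 0 * cis (- t * ln (real p))) * (1 - 0)"
      using x by (intro euler_factor_mono) auto
    thus "norm (1 - of_nat p powr (- Complex \<sigma> t)) * norm (1 - of_nat p powr (- Complex \<sigma> 0)) \<le> 1"
      unfolding euler_factor_real(1)[OF p assms] unfolding euler_factor_eq[OF p] x_def by simp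
  qed auto
  have "(\<lambda>M. norm (zeta (Complex \<sigma> t)) * zr \<sigma> * (euler_fac M \<sigma> t * euler_fac M \<sigma> 0)) \<longlonglongrightarrow> 1"
    using tendsto_mult[OF euler_fac_limit[OF assms, of t] euler_fac_limit[OF assms, of 0]]
    by (simp add: norm_zeta_Complex_0[OF assms] mult_ac)
  moreover have "norm (zeta (Complex \<sigma> t)) * zr \<sigma> * (euler_fac M \<sigma> t * euler_fac M \<sigma> 0)
      \<le> norm (zeta (Complex \<sigma> t)) * zr \<sigma>" for M
    using mult_left_mono[OF le[of M], of "norm (zeta (Complex \<sigma> t)) * zr \<sigma>"] zr_pos[OF assms] by simp
  ultimately show ?thesis by (intro LIMSEQ_le_const2) auto
qed

lemma zeta_341:
  assumes "1 < \<sigma>"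
  shows "zr \<sigma> ^ 3 * norm (zeta (Complex \<sigma> t)) ^ 4 * norm (zeta (Complex \<sigma> (2 * t))) \<ge> 1"
proof -
  define F where "F = (\<lambda>M. euler_fac M \<sigma> 0 ^ 3 * euler_fac M \<sigma> t ^ 4 * euler_fac M \<sigma> (2 * t))"
  define c where "c = zr \<sigma> ^ 3 * norm (zeta (Complex \<sigma> t)) ^ 4 * norm (zeta (Complex \<sigma> (2 * t)))"
  have c: "c \<ge> 0" using zr_pos[OF assms] by (simp add: c_def)
  have le: "F M \<le> 1" for M
    unfolding F_def euler_fac_def prod_power_distrib prod.distrib[symmetric]
  proof (rule prod_le_1, safe)
    fix p :: nat assume p: "prime p"
    define x where "x = real p powr (- \<sigma>)"
    have x: "0 \<le> x" "x < 1" using euler_factor_real[OF p assms] by (auto simp: x_def)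
    have "(1 - x) ^ 3 * norm (1 - of_real x * cis (- t * ln (real p))) ^ 4 *
        norm (1 - of_real x * cis (2 * (- t * ln (real p)))) \<le> 1"
      by (rule euler_factor_341[OF x])
    moreover have e: "- (2 * t) * ln (real p) = 2 * (- t * ln (real p))" by simp
    ultimately show "norm (1 - of_nat p powr (- Complex \<sigma> 0)) ^ 3 * norm (1 - of_nat p powr (- Complex \<sigma> t)) ^ 4 *
        norm (1 - of_nat p powr (- Complex \<sigma> (2 * t))) \<le> 1"
      unfolding euler_factor_real(1)[OF p assms(1)] unfolding euler_factor_eq[OF p] x_def[symmetric] e by (simp only:)
  qed auto
  have "(\<lambda>M. c * F M) \<longlonglongrightarrow> 1 ^ 3 * 1 ^ 4 * 1"
    using tendsto_mult[OF tendsto_mult[OF tendsto_power[OF euler_fac_limit[OF assms, of 0], of 3]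
        tendsto_power[OF euler_fac_limit[OF assms, of t], of 4]] euler_fac_limit[OF assms, of "2 * t"]]
    by (simp add: norm_zeta_Complex_0[OF assms] c_def F_def power_mult_distrib mult_ac)
  moreover have "c * F M \<le> c" for M using mult_left_mono[OF le[of M] c] by simp
  ultimately show ?thesis unfolding c_def[symmetric] by (intro LIMSEQ_le_const2) auto
qed

section \<open>Growth of zeta on the real axis to the right of 1\<close>

lemma powr_diff_bounds:
  fixes p x :: real
  assumes "p > 0" "x > 0"
  shows "p * (x + 1) powr (- p - 1) < x powr (- p) - (x + 1) powr (- p)"
    and "x powr (- p) - (x + 1) powr (- p) < p * x powr (- p - 1)"
proof -
  have "\<exists>z. z > x \<and> z < x + 1 \<and> (x + 1) powr (- p) - x powr (- p) = (x + 1 - x) * ((- p) * z powr (- p - 1))"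
    using assms by (intro MVT2) (auto intro!: derivative_eq_intros simp: powr_diff)
  then obtain z where z: "z > x" "z < x + 1" "x powr (- p) - (x + 1) powr (- p) = p * z powr (- p - 1)"
    by auto
  have "(x + 1) powr (- p - 1) < z powr (- p - 1)" "z powr (- p - 1) < x powr (- p - 1)"
    using z assms by (auto intro!: powr_less_mono2_neg)
  thus "p * (x + 1) powr (- p - 1) < x powr (- p) - (x + 1) powr (- p)"
    "x powr (- p) - (x + 1) powr (- p) < p * x powr (- p - 1)"
    using z assms by simp_all
qed

text \<open>The partial sums plus the integral of x^(-\<sigma>) over the rest form a decreasing
  sequence with limit \<open>zr \<sigma>\<close>.\<close>

lemma zr_tail:
  assumes \<sigma>: "\<sigma> > 1" and n: "n \<ge> 1"
  shows "zr \<sigma> - (\<Sum>k\<in>{1..n}. real k powr (- \<sigma>)) \<le> real n powr (1 - \<sigma>) / (\<sigma> - 1)"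
    and "zr \<sigma> - (\<Sum>k\<in>{1..n}. real k powr (- \<sigma>)) > 0"
proof -
  define A where "A = (\<lambda>n. \<Sum>k\<in>{1..n}. real k powr (- \<sigma>))"
  have A: "A \<longlonglongrightarrow> zr \<sigma>"
  proof -
    have "A = (\<lambda>n. \<Sum>k<n. real (Suc k) powr (- \<sigma>))"
      unfolding A_def by (rule ext, rule sum.reindex_bij_witness[of _ Suc "\<lambda>k. k - 1"]) auto
    thus ?thesis using zr_sums(1)[OF \<sigma>] unfolding sums_def by (simp only:)
  qed
  have lim0: "(\<lambda>n. real n powr (1 - \<sigma>)) \<longlonglongrightarrow> 0"
    using \<sigma> by (intro tendsto_neg_powr filterlim_real_sequentially) auto
  have "(\<lambda>k. A (n + k) + real (n + k) powr (1 - \<sigma>) / (\<sigma> - 1)) \<longlonglongrightarrow> zr \<sigma> + 0 / (\<sigma> - 1)"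
    using LIMSEQ_ignore_initial_segment[OF A, of n] LIMSEQ_ignore_initial_segment[OF lim0, of n] \<sigma>
    by (intro tendsto_intros) (simp_all add: add.commute)
  moreover have "decseq (\<lambda>k. A (n + k) + real (n + k) powr (1 - \<sigma>) / (\<sigma> - 1))"
  proof (rule decseq_SucI)
    fix k
    have "(\<sigma> - 1) * (real (n + k) + 1) powr (- (\<sigma> - 1) - 1) < real (n + k) powr (- (\<sigma> - 1)) - (real (n + k) + 1) powr (- (\<sigma> - 1))"
      using \<sigma> n by (intro powr_diff_bounds) auto
    hence "(real (n + k) + 1) powr (- \<sigma>) < (real (n + k) powr (1 - \<sigma>) - (real (n + k) + 1) powr (1 - \<sigma>)) / (\<sigma> - 1)"
      using \<sigma> by (simp add: field_simps)
    thus "A (n + Suc k) + real (n + Suc k) powr (1 - \<sigma>) / (\<sigma> - 1) \<le> A (n + k) + real (n + k) powr (1 - \<sigma>) / (\<sigma> - 1)"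
      by (simp add: A_def diff_divide_distrib add_ac)
  qed
  ultimately have "zr \<sigma> + 0 / (\<sigma> - 1) \<le> A (n + 0) + real (n + 0) powr (1 - \<sigma>) / (\<sigma> - 1)"
    by (intro decseq_ge)
  thus "zr \<sigma> - (\<Sum>k\<in>{1..n}. real k powr (- \<sigma>)) \<le> real n powr (1 - \<sigma>) / (\<sigma> - 1)"
    by (simp add: A_def)
  have "incseq A" by (rule incseq_SucI) (simp add: A_def)
  hence "A (Suc n) \<le> zr \<sigma>" using A by (rule incseq_le)
  moreover have "A n < A (Suc n)" by (simp add: A_def)
  ultimately have "zr \<sigma> - A n > 0" by linarith
  thus "zr \<sigma> - (\<Sum>k\<in>{1..n}. real k powr (- \<sigma>)) > 0" by (simp add: A_def)
qed

text \<open>A sequence \<open>E\<close> interpolates: it starts at zeta(\<sigma>), increases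
  strictly and tends to (\<sigma>' - 1) / (\<sigma> - 1) times zeta(\<sigma>'). Strictness is what
  later makes the upper bound for \<open>c4\<close> strict.\<close>

theorem zr_scaled_strict_mono:
  assumes "1 < \<sigma>" "\<sigma> < \<sigma>'"
  shows "(\<sigma> - 1) * zr \<sigma> < (\<sigma>' - 1) * zr \<sigma>'"
proof -
  define \<eta> where "\<eta> = \<sigma>' - \<sigma>"
  have \<eta>: "\<eta> > 0" "\<sigma>' = \<sigma> + \<eta>" using assms by (auto simp: \<eta>_def)
  define A where "A = (\<lambda>n. \<Sum>k\<in>{1..n}. real k powr (- \<sigma>))"
  define S where "S = (\<lambda>n. \<Sum>k\<in>{1..n}. real k powr (- \<sigma>'))"
  define R where "R = (\<lambda>n. zr \<sigma> - A n)"
  \<comment> \<open>Partial sums at \<sigma>' are combined with the tail at \<sigma>, damped by (n +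
    1)^(-\<eta>). The step is positive because the loss of damping is at most \<eta> m^(-\<eta>-1)
    times a tail of at most m^(1-\<sigma>) / (\<sigma> - 1).\<close>
  define E where "E = (\<lambda>n. S (Suc n) + \<eta> / (\<sigma> - 1) * S n + R (Suc n) * real (Suc n) powr (- \<eta>))"
  have limS: "S \<longlonglongrightarrow> zr \<sigma>'"
  proof -
    have "S = (\<lambda>n. \<Sum>k<n. real (Suc k) powr (- \<sigma>'))"
      unfolding S_def by (rule ext, rule sum.reindex_bij_witness[of _ Suc "\<lambda>k. k - 1"]) auto
    thus ?thesis using zr_sums(1)[of \<sigma>'] assms unfolding sums_def by (simp only:)
  qed
  have limA: "A \<longlonglongrightarrow> zr \<sigma>"
  proof -
    have "A = (\<lambda>n. \<Sum>k<n. real (Suc k) powr (- \<sigma>))"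
      unfolding A_def by (rule ext, rule sum.reindex_bij_witness[of _ Suc "\<lambda>k. k - 1"]) auto
    thus ?thesis using zr_sums(1)[of \<sigma>] assms unfolding sums_def by (simp only:)
  qed
  have lim0: "(\<lambda>n. real n powr (- \<eta>)) \<longlonglongrightarrow> 0"
    using \<eta> by (intro tendsto_neg_powr filterlim_real_sequentially) auto
  have "E \<longlonglongrightarrow> zr \<sigma>' + \<eta> / (\<sigma> - 1) * zr \<sigma>' + (zr \<sigma> - zr \<sigma>) * 0"
    unfolding E_def R_def
    by (intro tendsto_intros LIMSEQ_Suc[OF limS] LIMSEQ_Suc[OF limA] limS LIMSEQ_Suc[OF lim0])
  hence limE: "E \<longlonglongrightarrow> zr \<sigma>' + \<eta> / (\<sigma> - 1) * zr \<sigma>'" by simp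
  have step: "E n < E (Suc n)" for n
  proof -
    define m where "m = Suc n"
    have m: "m \<ge> 1" by (simp add: m_def)
    have R: "R m \<le> real m powr (1 - \<sigma>) / (\<sigma> - 1)" "R m > 0"
      using zr_tail[OF assms(1) m] by (auto simp: R_def A_def)
    have "R m * (real m powr (- \<eta>) - (real m + 1) powr (- \<eta>)) < R m * (\<eta> * real m powr (- \<eta> - 1))"
      using R powr_diff_bounds(2)[of \<eta> "real m"] \<eta> m by (intro mult_strict_left_mono) auto
    also have "\<dots> \<le> real m powr (1 - \<sigma>) / (\<sigma> - 1) * (\<eta> * real m powr (- \<eta> - 1))"
      using R \<eta> by (intro mult_right_mono) auto
    also have "\<dots> = \<eta> / (\<sigma> - 1) * (real m powr (1 - \<sigma>) * real m powr (- \<eta> - 1))" by simp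
    also have "real m powr (1 - \<sigma>) * real m powr (- \<eta> - 1) = real m powr (- \<sigma>')"
      using \<eta> by (simp flip: powr_add)
    finally have 1: "R m * (real m powr (- \<eta>) - (real m + 1) powr (- \<eta>)) < \<eta> / (\<sigma> - 1) * real m powr (- \<sigma>')" .
    have "real (Suc m) powr (- \<sigma>) * real (Suc m) powr (- \<eta>) = real (Suc m) powr (- \<sigma>')"
      using \<eta> by (simp flip: powr_add)
    hence 2: "R (Suc m) * real (Suc m) powr (- \<eta>) = R m * real (Suc m) powr (- \<eta>) - real (Suc m) powr (- \<sigma>')"
      by (simp add: R_def A_def algebra_simps)
    have 3: "S (Suc m) = S m + real (Suc m) powr (- \<sigma>')" "S m = S n + real m powr (- \<sigma>')"
      by (simp_all add: S_def m_def)
    have "real (Suc m) = real m + 1" by simp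
    hence 4: "R m * (real m powr (- \<eta>) - real (Suc m) powr (- \<eta>)) < \<eta> / (\<sigma> - 1) * real m powr (- \<sigma>')"
      using 1 by metis
    have "E (Suc n) - E n = \<eta> / (\<sigma> - 1) * real m powr (- \<sigma>') - R m * (real m powr (- \<eta>) - real (Suc m) powr (- \<eta>))"
      unfolding E_def m_def[symmetric] 2 3(1) using 3(2) by (simp add: algebra_simps)
    thus ?thesis using 4 by linarith
  qed
  have "incseq E" using step by (intro incseq_SucI less_imp_le)
  hence "E 1 \<le> zr \<sigma>' + \<eta> / (\<sigma> - 1) * zr \<sigma>'" using limE by (rule incseq_le)
  moreover have "E 0 = zr \<sigma>" by (simp add: E_def S_def R_def A_def)
  moreover have "E 0 < E 1" using step[of 0] by simp
  ultimately have "zr \<sigma> < zr \<sigma>' + \<eta> / (\<sigma> - 1) * zr \<sigma>'" by linarith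
  hence "(\<sigma> - 1) * zr \<sigma> < (\<sigma> - 1) * (zr \<sigma>' + \<eta> / (\<sigma> - 1) * zr \<sigma>')"
    using assms by (intro mult_strict_left_mono) auto
  also have "\<dots> = (\<sigma>' - 1) * zr \<sigma>'" using assms \<eta> by (simp add: field_simps)
  finally show ?thesis .
qed

lemma zr_bounds:
  assumes "1 < \<sigma>"
  shows "zr \<sigma> \<le> 1 / (\<sigma> - 1) + 1 / 2 + \<sigma> / 12 + 81 / 10000 * \<sigma> * (\<sigma> + 1)"
    and "zr \<sigma> \<ge> 1 / (\<sigma> - 1) + 1 / 2 + \<sigma> / 12 - 81 / 10000 * \<sigma> * (\<sigma> + 1)"
proof -
  define s where "s = complex_of_real \<sigma>"
  have s: "Re s > -2" "s \<noteq> 1" "Re s = \<sigma>" using assms by (auto simp: s_def)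
  define e where "e = s * (s + 1) * (s + 2) * psum bern3 1 (s + 3)"
  have "zeta s = 1 / (s - 1) + 1 / 2 + s / 12 - e"
    using zeta_euler_maclaurin[of 1 s] s by (simp add: e_def)
  hence "of_real (zr \<sigma>) = of_real (1 / (\<sigma> - 1) + 1 / 2 + \<sigma> / 12) - e"
    using zeta_of_real[OF assms] by (simp add: s_def)
  hence "e = of_real (1 / (\<sigma> - 1) + 1 / 2 + \<sigma> / 12 - zr \<sigma>)" by (simp add: algebra_simps)
  hence "norm e = \<bar>1 / (\<sigma> - 1) + 1 / 2 + \<sigma> / 12 - zr \<sigma>\<bar>" by (simp only: norm_of_real)
  moreover have "norm e \<le> \<sigma> * (\<sigma> + 1) * (\<sigma> + 2) * (81 / 10000 * (1 / (\<sigma> + 2)))"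
  proof -
    have "norm (psum bern3 1 (s + 3)) \<le> 81 / 10000 * (1 / (\<sigma> + 2))"
      using zeta_error_bound[of 1 s] s by simp
    moreover have "norm s = \<sigma>" "norm (s + 1) = \<sigma> + 1" "norm (s + 2) = \<sigma> + 2"
    proof -
      have "s + 1 = of_real (\<sigma> + 1)" "s + 2 = of_real (\<sigma> + 2)" by (simp_all add: s_def)
      thus "norm s = \<sigma>" "norm (s + 1) = \<sigma> + 1" "norm (s + 2) = \<sigma> + 2"
        using assms by (simp_all only: s_def norm_of_real)
    qed
    ultimately show ?thesis unfolding e_def norm_mult using assms by (intro mult_mono) auto
  qed
  moreover have "\<sigma> * (\<sigma> + 1) * (\<sigma> + 2) * (81 / 10000 * (1 / (\<sigma> + 2))) = 81 / 10000 * \<sigma> * (\<sigma> + 1)"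
    using assms by (simp add: field_simps)
  ultimately show "zr \<sigma> \<le> 1 / (\<sigma> - 1) + 1 / 2 + \<sigma> / 12 + 81 / 10000 * \<sigma> * (\<sigma> + 1)"
    "zr \<sigma> \<ge> 1 / (\<sigma> - 1) + 1 / 2 + \<sigma> / 12 - 81 / 10000 * \<sigma> * (\<sigma> + 1)"
    by linarith+
qed

text \<open>With x = \<sigma> - 1, a zero at 1 + it would contribute x^4 to the 3-4-1 product
  against x^(-3) from the pole, while the factor at 1 + x + 2it stays bounded.\<close>

theorem zeta_line_1_nonzero:
  assumes t: "t \<noteq> 0"
  shows "zeta (Complex 1 t) \<noteq> 0"
proof
  assume 0: "zeta (Complex 1 t) = 0"
  have der: "(zeta has_field_derivative deriv zeta (Complex 1 u)) (at (Complex 1 u))" if "u \<noteq> 0" for u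
    using that holomorphic_derivI[OF zeta_holomorphic, of "Complex 1 u"] by (auto simp: complex_eq_iff)
  have lin: "((\<lambda>x. Complex (1 + x) u) \<longlongrightarrow> Complex 1 u) (at_right 0)" for u
    by (rule tendsto_eq_intros | simp)+
  have ne: "eventually (\<lambda>x. Complex (1 + x) t \<noteq> Complex 1 t) (at_right (0::real))"
    unfolding eventually_at_right_field by (auto intro!: exI[of _ 1])
  have "((\<lambda>z. (zeta z - zeta (Complex 1 t)) / (z - Complex 1 t)) \<longlongrightarrow> deriv zeta (Complex 1 t)) (at (Complex 1 t))"
    using der[OF t] by (simp add: has_field_derivative_iff)
  moreover have "filterlim (\<lambda>x. Complex (1 + x) t) (at (Complex 1 t)) (at_right (0::real))"
    using lin ne unfolding filterlim_at by (auto elim: eventually_mono)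
  ultimately have "((\<lambda>x. (zeta (Complex (1 + x) t) - zeta (Complex 1 t)) / (Complex (1 + x) t - Complex 1 t)) \<longlongrightarrow> deriv zeta (Complex 1 t)) (at_right (0::real))"
    by (rule filterlim_compose)
  moreover have "Complex (1 + x) t - Complex 1 t = of_real x" for x by (simp add: complex_eq_iff)
  ultimately have q: "((\<lambda>x. norm (zeta (Complex (1 + x) t) / of_real x)) \<longlongrightarrow> norm (deriv zeta (Complex 1 t))) (at_right 0)"
    using 0 by (intro tendsto_norm) simp
  have "isCont zeta (Complex 1 (2 * t))" using DERIV_isCont[OF der[of "2 * t"]] t by simp
  hence z2: "((\<lambda>x. norm (zeta (Complex (1 + x) (2 * t)))) \<longlongrightarrow> norm (zeta (Complex 1 (2 * t)))) (at_right 0)"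
    by (intro tendsto_norm isCont_tendsto_compose[OF _ lin])
  \<comment> \<open>This expression is (2 / x)^3 times the last two factors of the 3-4-1 product, an
    upper bound for the product once zeta(1 + x) \<le> 2 / x.\<close>
  have "((\<lambda>x. 8 * x * norm (zeta (Complex (1 + x) t) / of_real x) ^ 4 * norm (zeta (Complex (1 + x) (2 * t)))) \<longlongrightarrow>
     8 * 0 * norm (deriv zeta (Complex 1 t)) ^ 4 * norm (zeta (Complex 1 (2 * t)))) (at_right 0)"
    by (intro tendsto_intros q z2)
  hence lim: "((\<lambda>x. 8 * x * norm (zeta (Complex (1 + x) t) / of_real x) ^ 4 * norm (zeta (Complex (1 + x) (2 * t)))) \<longlongrightarrow> 0) (at_right 0)"
    by simp
  have "eventually (\<lambda>x. x \<in> {0<..<1}) (at_right (0::real))" by (rule eventually_at_right_real) simp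
  hence "eventually (\<lambda>x. 1 \<le> 8 * x * norm (zeta (Complex (1 + x) t) / of_real x) ^ 4 * norm (zeta (Complex (1 + x) (2 * t)))) (at_right 0)"
  proof eventually_elim
    case (elim x)
    have x: "0 < x" "x < 1" using elim by auto
    define Z where "Z = norm (zeta (Complex (1 + x) t)) ^ 4 * norm (zeta (Complex (1 + x) (2 * t)))"
    define q where "q = 81 / 10000 * (1 + x) * (1 + x + 1)"
    have "q \<le> 81 / 10000 * 2 * 3" unfolding q_def using x by (intro mult_mono) auto
    have "zr (1 + x) \<le> 1 / (1 + x - 1) + 1 / 2 + (1 + x) / 12 + q"
      unfolding q_def by (rule zr_bounds(1)) (use x in simp)
    hence "zr (1 + x) \<le> 1 / x + 1 / 2 + (1 + x) / 12 + q" by simp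
    moreover have "q \<le> 243 / 5000" using \<open>q \<le> 81 / 10000 * 2 * 3\<close> by simp
    moreover have "z \<le> y + 1" if "z \<le> y + 1 / 2 + (1 + x) / 12 + q" "q \<le> 243 / 5000" for y z
      using that x by argo
    ultimately have "zr (1 + x) \<le> 1 / x + 1" by blast
    also have "\<dots> \<le> 2 / x" using x by (simp add: field_simps)
    finally have "zr (1 + x) ^ 3 \<le> (2 / x) ^ 3" using zr_pos[of "1 + x"] x by (intro power_mono) auto
    hence "zr (1 + x) ^ 3 * Z \<le> (2 / x) ^ 3 * Z" by (intro mult_right_mono) (auto simp: Z_def)
    moreover have "1 \<le> zr (1 + x) ^ 3 * Z" using zeta_341[of "1 + x" t] x by (simp add: Z_def mult.assoc)
    moreover have "(2 / x) ^ 3 * Z = 8 * x * norm (zeta (Complex (1 + x) t) / of_real x) ^ 4 * norm (zeta (Complex (1 + x) (2 * t)))"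
      using x by (simp add: Z_def norm_divide power_divide field_simps power3_eq_cube power4_eq_xxxx)
    ultimately show ?case by linarith
  qed
  from tendsto_lowerbound[OF lim this] show False by simp
qed

section \<open>The constant c4\<close>

lemma has_integral_half_pi_reflect:
  fixes f :: "real \<Rightarrow> real"
  assumes "(f has_integral I) {a..b}"
  shows "((\<lambda>x. f (c - x)) has_integral I) {c - b..c - a}"
proof -
  have "((\<lambda>x. f (1 *\<^sub>R x + c)) has_integral (I /\<^sub>R 1 ^ DIM(real))) (cbox ((a - c) /\<^sub>R 1) ((b - c) /\<^sub>R 1))"
    by (rule has_integral_affinity') (use assms in auto)
  hence "((\<lambda>x. f (x + c)) has_integral I) {a - c..b - c}" by simp
  hence "((\<lambda>x. f (- x + c)) has_integral I) {- (b - c)..- (a - c)}"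
    by (subst has_integral_reflect_real[of "\<lambda>x. f (x + c)"])
  thus ?thesis by (simp add: add.commute)
qed

lemma x_ln_x_tendsto_0: "((\<lambda>x::real. x * ln x) \<longlongrightarrow> 0) (at_right 0)"
  by real_asymp

lemma x_ln_x_continuous: "continuous_on {0..} (\<lambda>x::real. x * ln x)"
proof -
  have "((\<lambda>x::real. x * ln x) \<longlongrightarrow> 0 * ln 0) (at 0 within {0..})"
    using x_ln_x_tendsto_0 by (simp add: at_within_Ici_at_right)
  moreover have "((\<lambda>x::real. x * ln x) \<longlongrightarrow> y * ln y) (at y within {0..})" if "y > 0" for y
    by (intro tendsto_intros) (use that in auto)
  ultimately show ?thesis unfolding continuous_on_def
    by (metis atLeast_iff less_eq_real_def)
qed

lemma ln_integrable:
  assumes "b \<ge> 0"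
  shows "(ln :: real \<Rightarrow> real) integrable_on {0..b}"
proof -
  have "(ln has_integral ((b * ln b - b) - (0 * ln 0 - 0))) {0..b}"
  proof (rule fundamental_theorem_of_calculus_interior)
    show "continuous_on {0..b} (\<lambda>x. x * ln x - x)"
      by (intro continuous_intros continuous_on_subset[OF x_ln_x_continuous]) auto
    fix x assume "x \<in> {0<..<b}"
    thus "((\<lambda>x. x * ln x - x) has_vector_derivative ln x) (at x)"
      unfolding has_real_derivative_iff_has_vector_derivative[symmetric]
      by (auto intro!: derivative_eq_intros)
  qed fact
  thus ?thesis by blast
qed

text \<open>ln sin x = ln x + ln (sin x / x), where the second summand extends continuously to
  0.\<close>

lemma ln_sin_integrable: "(\<lambda>x. ln (sin x)) integrable_on {0..pi / 2}"
proof -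
  define h where "h = (\<lambda>x::real. if x = 0 then 1 else sin x / x)"
  have hpos: "h x > 0" if "x \<in> {0..pi / 2}" for x
    using that sin_gt_zero[of x] pi_gt_zero by (auto simp: h_def intro!: divide_pos_pos)
  have "(h \<longlongrightarrow> h y) (at y)" for y
  proof (cases "y = 0")
    case True
    have "((\<lambda>x. (sin x - sin 0) / (x - 0)) \<longlongrightarrow> cos 0) (at (0::real))"
      using DERIV_sin[of 0] by (simp only: has_field_derivative_iff)
    hence "((\<lambda>x. sin x / x) \<longlongrightarrow> 1) (at (0::real))" by simp
    moreover have "eventually (\<lambda>x. sin x / x = h x) (at 0)"
      unfolding eventually_at_filter h_def by simp
    ultimately show ?thesis using True by (simp add: h_def tendsto_cong)
  next
    case False
    have "((\<lambda>x. sin x / x) \<longlongrightarrow> sin y / y) (at y)" using False by (intro tendsto_intros)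
    moreover have "eventually (\<lambda>x. x \<noteq> 0) (at y)" using False by (intro eventually_neq_at_within)
    hence "eventually (\<lambda>x. sin x / x = h x) (at y)" by eventually_elim (simp add: h_def)
    ultimately show ?thesis using False by (auto simp: h_def tendsto_cong)
  qed
  hence "continuous_on {0..pi / 2} h"
    by (intro continuous_at_imp_continuous_on ballI) (simp add: isCont_def)
  hence "continuous_on {0..pi / 2} (\<lambda>x. ln (h x))"
    using hpos by (intro continuous_intros) force+
  hence "(\<lambda>x. ln (h x)) integrable_on {0..pi / 2}" by (rule integrable_continuous_real)
  hence "(\<lambda>x. ln x + ln (h x)) integrable_on {0..pi / 2}"
    by (intro integrable_add ln_integrable) auto
  thus ?thesis
  proof (rule integrable_spike_finite[of "{0}", rotated 2])
    fix x assume "x \<in> {0..pi / 2} - {0}"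
    thus "ln (sin x) = ln x + ln (h x)"
      using sin_gt_zero[of x] pi_gt_zero by (auto simp: h_def ln_div)
  qed auto
qed

text \<open>Euler's argument: ln sin and ln cos have the same integral I, and sin 2x = 2 sin x cos x
  gives I = (\<pi>/2) ln 2 + 2 I.\<close>

lemma ln_cos_has_integral: "((\<lambda>x. ln (cos x)) has_integral (- (pi / 2) * ln 2)) {0..pi / 2}"
proof -
  define I where "I = integral {0..pi / 2} (\<lambda>x. ln (sin x))"
  have S: "((\<lambda>x. ln (sin x)) has_integral I) {0..pi / 2}"
    unfolding I_def using ln_sin_integrable by (rule integrable_integral)
  from has_integral_half_pi_reflect[OF S, of "pi / 2"]
  have C: "((\<lambda>x. ln (cos x)) has_integral I) {0..pi / 2}" by (simp add: sin_cos_eq[symmetric] cos_sin_eq)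
  from has_integral_half_pi_reflect[OF S, of pi]
  have "((\<lambda>x. ln (sin x)) has_integral I) {pi / 2..pi}" by simp
  from has_integral_combine[OF _ _ S this] have "((\<lambda>x. ln (sin x)) has_integral (I + I)) {0..pi}" by simp
  from has_integral_affinity'[of "\<lambda>x. ln (sin x)" "I + I" 0 pi 2 0] this
  have D: "((\<lambda>x. ln (sin (2 * x))) has_integral I) {0..pi / 2}" by (simp add: field_simps)
  have "((\<lambda>x. ln 2 + ln (sin x) + ln (cos x)) has_integral (pi / 2 * ln 2 + I + I)) {0..pi / 2}"
    using has_integral_const_real[of "ln (2::real)" 0 "pi / 2"] by (intro has_integral_add S C) simp
  hence "((\<lambda>x. ln (sin (2 * x))) has_integral (pi / 2 * ln 2 + I + I)) {0..pi / 2}"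
  proof (rule has_integral_spike_finite[of "{0, pi / 2}", rotated 2])
    fix x assume "x \<in> {0..pi / 2} - {0, pi / 2}"
    hence "sin x > 0" "cos x > 0" using sin_gt_zero[of x] cos_gt_zero[of x] by auto
    thus "ln (sin (2 * x)) = ln 2 + ln (sin x) + ln (cos x)"
      by (simp add: sin_double ln_mult)
  qed auto
  hence "I = pi / 2 * ln 2 + I + I" using D has_integral_unique by blast
  hence "I = - (pi / 2) * ln 2" by simp
  thus ?thesis using C by simp
qed

lemma zr_DERIV:
  assumes "\<sigma> > 1"
  shows "(zr has_real_derivative Re (deriv zeta (of_real \<sigma>))) (at \<sigma>)"
proof -
  have "(zeta has_field_derivative deriv zeta (of_real \<sigma>)) (at (of_real \<sigma>))"
    by (rule holomorphic_derivI[OF zeta_holomorphic]) (use assms in auto)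
  moreover have "((\<lambda>x. of_real x :: complex) has_vector_derivative of_real 1) (at \<sigma>)"
    by (rule has_vector_derivative_of_real) (rule DERIV_ident)
  ultimately have "(zeta \<circ> of_real has_vector_derivative of_real 1 * deriv zeta (of_real \<sigma>)) (at \<sigma>)"
    by (intro field_vector_diff_chain_at)
  from bounded_linear.has_vector_derivative[OF bounded_linear_Re this] show ?thesis
    unfolding zr_def[abs_def] has_real_derivative_iff_has_vector_derivative by (simp add: o_def)
qed

lemma zr_deriv_quotient:
  assumes "\<sigma> > 1"
  shows "Re (deriv zeta (of_real \<sigma>) / zeta (of_real \<sigma>)) = Re (deriv zeta (of_real \<sigma>)) / zr \<sigma>"
  using zeta_of_real[OF assms] by (simp add: Re_divide_of_real)

text \<open>(\<sigma> - 1) zeta(\<sigma>) is increasing and tends to 1 at the pole.\<close>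

lemma zr_ge: "\<sigma> > 1 \<Longrightarrow> zr \<sigma> \<ge> 1 / (\<sigma> - 1)"
proof -
  assume \<sigma>: "\<sigma> > 1"
  have "(\<lambda>x::real. 1 + x / 2 + (1 + x) * x / 12 - 81 / 10000 * (1 + x) * (1 + x + 1) * x) \<midarrow>0\<rightarrow>
      1 + 0 / 2 + (1 + 0) * 0 / 12 - 81 / 10000 * (1 + 0) * (1 + 0 + 1) * 0"
    by (intro tendsto_intros) auto
  hence "((\<lambda>x::real. 1 + x / 2 + (1 + x) * x / 12 - 81 / 10000 * (1 + x) * (1 + x + 1) * x) \<longlongrightarrow> 1) (at_right 0)"
    by (simp add: filterlim_at_split)
  moreover have "eventually (\<lambda>x. x \<in> {0<..<\<sigma> - 1}) (at_right (0::real))"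
    by (rule eventually_at_right_real) (use \<sigma> in simp)
  hence "eventually (\<lambda>x. 1 + x / 2 + (1 + x) * x / 12 - 81 / 10000 * (1 + x) * (1 + x + 1) * x \<le> (\<sigma> - 1) * zr \<sigma>) (at_right 0)"
  proof eventually_elim
    case (elim x)
    have "x * (1 / (1 + x - 1) + 1 / 2 + (1 + x) / 12 - 81 / 10000 * (1 + x) * (1 + x + 1)) \<le> x * zr (1 + x)"
      using elim by (intro mult_left_mono zr_bounds(2)) auto
    also have "x * zr (1 + x) < (\<sigma> - 1) * zr \<sigma>"
      using zr_scaled_strict_mono[of "1 + x" \<sigma>] elim by simp
    finally show ?case using elim by (simp add: algebra_simps)
  qed
  ultimately have "1 \<le> (\<sigma> - 1) * zr \<sigma>" by (intro tendsto_upperbound) auto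
  thus ?thesis using \<sigma> by (simp add: field_simps)
qed

text \<open>The continuous extension of \<open>ln (x \<zeta>(1 + x))\<close> to \<open>x = 0\<close>.\<close>

definition lnxz :: "real \<Rightarrow> real" where
  "lnxz x = (if x = 0 then 0 else ln (x * zr (1 + x)))"

lemma zr_Suc_eq: "x > 0 \<Longrightarrow> ln (zr (1 + x)) = lnxz x - ln x"
  using zr_pos[of "1 + x"] by (simp add: lnxz_def ln_mult)

lemma lnxz_nonneg: "x \<ge> 0 \<Longrightarrow> lnxz x \<ge> 0"
  using zr_ge[of "1 + x"] by (auto simp: lnxz_def field_simps intro!: ln_ge_zero)

lemma lnxz_strict_mono:
  assumes "0 \<le> x" "x < y"
  shows "lnxz x < lnxz y"
proof -
  have less: "lnxz u < lnxz v" if "0 < u" "u < v" for u v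
    using zr_scaled_strict_mono[of "1 + u" "1 + v"] that zr_pos[of "1 + u"] zr_pos[of "1 + v"]
    by (simp add: lnxz_def)
  show ?thesis
  proof (cases "x = 0")
    case True
    have "lnxz (y / 2) < lnxz y" using assms by (intro less) auto
    moreover have "lnxz (y / 2) \<ge> 0" using assms by (intro lnxz_nonneg) auto
    ultimately show ?thesis using True by (simp add: lnxz_def)
  qed (use less assms in auto)
qed

lemma lnxz_continuous: "continuous_on {0..} lnxz"
proof -
  have "(lnxz \<longlongrightarrow> lnxz y) (at y within {0..})" if "y \<ge> 0" for y
  proof (cases "y = 0")
    case True
    have "(lnxz \<longlongrightarrow> 0) (at_right 0)"
    proof (rule tendsto_sandwich)
      have ev: "eventually (\<lambda>x. x \<in> {0<..<1}) (at_right (0::real))" by (rule eventually_at_right_real) simp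
      show "eventually (\<lambda>x. 0 \<le> lnxz x) (at_right 0)"
        using ev by eventually_elim (auto intro: lnxz_nonneg)
      show "eventually (\<lambda>x. lnxz x \<le> x) (at_right 0)"
        using ev
      proof eventually_elim
        case (elim x)
        have x: "0 < x" "x < 1" using elim by auto
        define q where "q = 81 / 10000 * (1 + x) * (1 + x + 1)"
        have "q \<le> 81 / 10000 * 2 * 3" unfolding q_def using x by (intro mult_mono) auto
        hence q: "q \<le> 243 / 5000" by simp
        have "zr (1 + x) \<le> 1 / (1 + x - 1) + 1 / 2 + (1 + x) / 12 + q"
          unfolding q_def by (rule zr_bounds(1)) (use x in simp)
        hence "zr (1 + x) \<le> 1 / x + 1 / 2 + (1 + x) / 12 + q" by simp
        moreover have "z \<le> y + 1" if "z \<le> y + 1 / 2 + (1 + x) / 12 + q" for y z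
          using that q x by argo
        ultimately have "zr (1 + x) \<le> 1 / x + 1" by blast
        hence "x * zr (1 + x) \<le> x * (1 / x + 1)" using x by (intro mult_left_mono) auto
        hence "x * zr (1 + x) \<le> 1 + x" using x by (simp add: algebra_simps)
        hence "ln (x * zr (1 + x)) \<le> ln (1 + x)" using x zr_pos[of "1 + x"] by simp
        also have "\<dots> \<le> x" using x by (intro ln_add_one_self_le_self) auto
        finally show ?case using x by (simp add: lnxz_def)
      qed
    qed (auto intro!: tendsto_intros)
    thus ?thesis using True by (simp add: at_within_Ici_at_right lnxz_def)
  next
    case False
    hence y: "y > 0" using that by simp
    have "isCont zr (1 + y)" using zr_DERIV[of "1 + y"] y by (intro DERIV_isCont) auto
    hence "isCont (\<lambda>x. zr (1 + x)) y" by (intro isCont_o2[of y "\<lambda>x. 1 + x" zr]) (auto intro!: continuous_intros)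
    hence "isCont (\<lambda>x. ln (x * zr (1 + x))) y"
      using y zr_pos[of "1 + y"] by (intro continuous_intros) auto
    hence "((\<lambda>x. ln (x * zr (1 + x))) \<longlongrightarrow> ln (y * zr (1 + y))) (at y within {0..})"
      unfolding isCont_def by (rule tendsto_within_subset) simp
    moreover have "eventually (\<lambda>x. x \<noteq> 0) (at y within {0..})" using y by (intro eventually_neq_at_within)
    hence "eventually (\<lambda>x. ln (x * zr (1 + x)) = lnxz x) (at y within {0..})"
      by eventually_elim (simp add: lnxz_def)
    ultimately have "(lnxz \<longlongrightarrow> ln (y * zr (1 + y))) (at y within {0..})"
      by (rule Lim_transform_eventually)
    moreover have "lnxz y = ln (y * zr (1 + y))" using y by (simp add: lnxz_def)
    ultimately show ?thesis by metis
  qed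
  thus ?thesis by (simp add: continuous_on_def)
qed

section \<open>The mean of ln zeta(1 + r cos \<theta>) and bounds for \<open>c4\<close>\<close>

lemma lnxz_cos_continuous:
  assumes "r > 0"
  shows "continuous_on {0..pi / 2} (\<lambda>\<theta>. lnxz (r * cos \<theta>))"
  by (rule continuous_on_compose2[OF lnxz_continuous])
     (use assms cos_ge_zero in \<open>auto intro!: continuous_intros\<close>)

text \<open>The logarithmic singularity at \<pi>/2 is split off as -ln r - ln cos \<theta>, whose
  integral is explicit. What remains is continuous.\<close>

lemma ln_zr_cos_has_integral:
  assumes r: "r > 0"
  shows "((\<lambda>\<theta>. ln (zr (1 + r * cos \<theta>))) has_integral
           (integral {0..pi / 2} (\<lambda>\<theta>. lnxz (r * cos \<theta>)) + pi / 2 * ln (2 / r))) {0..pi / 2}"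
proof -
  have "((\<lambda>\<theta>. lnxz (r * cos \<theta>) - (ln r + ln (cos \<theta>))) has_integral
     (integral {0..pi / 2} (\<lambda>\<theta>. lnxz (r * cos \<theta>)) - (pi / 2 * ln r + (- (pi / 2) * ln 2)))) {0..pi / 2}"
    using has_integral_const_real[of "ln r" 0 "pi / 2"]
    by (intro has_integral_diff has_integral_add ln_cos_has_integral integrable_integral
          integrable_continuous_real lnxz_cos_continuous r) simp
  moreover have "integral {0..pi / 2} (\<lambda>\<theta>. lnxz (r * cos \<theta>)) - (pi / 2 * ln r + (- (pi / 2) * ln 2))
     = integral {0..pi / 2} (\<lambda>\<theta>. lnxz (r * cos \<theta>)) + pi / 2 * ln (2 / r)"
    using r by (simp add: ln_div algebra_simps)
  ultimately have "((\<lambda>\<theta>. lnxz (r * cos \<theta>) - (ln r + ln (cos \<theta>))) has_integral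
     (integral {0..pi / 2} (\<lambda>\<theta>. lnxz (r * cos \<theta>)) + pi / 2 * ln (2 / r))) {0..pi / 2}" by metis
  thus ?thesis
  proof (rule has_integral_spike_finite[of "{pi / 2}", rotated 2])
    fix \<theta> assume "\<theta> \<in> {0..pi / 2} - {pi / 2}"
    hence "cos \<theta> > 0" using cos_gt_zero_pi[of \<theta>] by auto
    thus "ln (zr (1 + r * cos \<theta>)) = lnxz (r * cos \<theta>) - (ln r + ln (cos \<theta>))"
      using r zr_Suc_eq[of "r * cos \<theta>"] by (simp add: ln_mult)
  qed auto
qed

text \<open>Under u = cos \<theta> the measure becomes du / sqrt (1 - u^2). Integrating this weight
  to arcsin u and differentiating ln zeta(1 + r u) yields the formula that defines
  \<open>c4\<close>.\<close>

lemma c4_has_integral: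
  assumes r: "r > 0"
  shows "((\<lambda>\<theta>. ln (zr (1 + r * cos \<theta>))) has_integral (pi * c4 r)) {0..pi / 2}"
proof -
  define g where "g = (\<lambda>\<theta>. ln (zr (1 + r * cos \<theta>)))"
  define I where "I = (\<lambda>\<theta>. integral {0..\<theta>} g)"
  have gi: "g integrable_on {0..pi / 2}" unfolding g_def using ln_zr_cos_has_integral[OF r] by blast
  have Ic: "continuous_on {0..pi / 2} I" unfolding I_def by (rule indefinite_integral_continuous_1[OF gi])
  \<comment> \<open>A primitive of \<open>r * k u\<close>, equal to ln zeta(1 + r u) arcsin u + I
    (arccos u). The logarithm is split so that continuity at u = 0 reduces to ln u arcsin u tending
    to 0; in the derivative the two square root terms cancel.\<close>
  define H where "H = (\<lambda>u. (lnxz (r * u) - ln r) * arcsin u - ln u * arcsin u + I (arccos u))"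
  define k where "k = (\<lambda>u. Re (deriv zeta (of_real (1 + r * u)) / zeta (of_real (1 + r * u))) * arcsin u)"
  have lnarc: "continuous_on {0..1} (\<lambda>u. ln u * arcsin u)"
  proof -
    have "((\<lambda>u. ln u * arcsin u) \<longlongrightarrow> ln y * arcsin y) (at y within {0..1})" if y: "y \<in> {0..1}" for y
    proof (cases "y = 0")
      case True
      have "((\<lambda>x. (arcsin x - arcsin 0) / (x - 0)) \<longlongrightarrow> inverse (sqrt (1 - 0\<^sup>2))) (at (0::real))"
        using DERIV_arcsin[of 0] by (simp only: has_field_derivative_iff)
      hence "((\<lambda>x. arcsin x / x) \<longlongrightarrow> 1) (at (0::real))" by simp
      hence "((\<lambda>x. arcsin x / x) \<longlongrightarrow> 1) (at_right (0::real))" by (simp add: filterlim_at_split)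
      hence "((\<lambda>x. (x * ln x) * (arcsin x / x)) \<longlongrightarrow> 0 * 1) (at_right 0)"
        by (intro tendsto_mult x_ln_x_tendsto_0)
      moreover have "eventually (\<lambda>x::real. x \<noteq> 0) (at_right 0)" by (rule eventually_neq_at_within)
      hence "eventually (\<lambda>x. (x * ln x) * (arcsin x / x) = ln x * arcsin x) (at_right 0)"
        by eventually_elim simp
      ultimately have "((\<lambda>x. ln x * arcsin x) \<longlongrightarrow> 0) (at_right 0)" by (simp add: tendsto_cong)
      thus ?thesis using True by (simp add: at_within_Icc_at_right)
    next
      case False
      hence "y > 0" using y by simp
      moreover have "continuous_on {-1..1} arcsin" by (rule continuous_on_arcsin')
      hence "(arcsin \<longlongrightarrow> arcsin y) (at y within {-1..1})" using y by (auto simp: continuous_on_def)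
      hence "(arcsin \<longlongrightarrow> arcsin y) (at y within {0..1})" by (rule tendsto_within_subset) auto
      ultimately show ?thesis by (intro tendsto_intros) auto
    qed
    thus ?thesis by (simp add: continuous_on_def)
  qed
  have "continuous_on {0..1} H"
    unfolding H_def
  proof (intro continuous_on_add continuous_on_diff lnarc)
    have "continuous_on {0..1} (\<lambda>u. lnxz (r * u))"
      by (rule continuous_on_compose2[OF lnxz_continuous]) (use r in \<open>auto intro!: continuous_intros\<close>)
    moreover have "continuous_on {0..1} arcsin" by (rule continuous_on_subset[OF continuous_on_arcsin']) auto
    ultimately show "continuous_on {0..1} (\<lambda>u. (lnxz (r * u) - ln r) * arcsin u)"
      by (intro continuous_on_mult continuous_on_diff continuous_on_const)
    have "continuous_on {0..1} arccos" by (rule continuous_on_subset[OF continuous_on_arccos']) auto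
    moreover have "arccos u \<in> {0..pi / 2}" if "u \<in> {0..1}" for u
      using that arccos_lbound[of u] arccos_le_pi2[of u] by simp
    hence "arccos ` {0..1} \<subseteq> {0..pi / 2}" by blast
    ultimately show "continuous_on {0..1} (\<lambda>u. I (arccos u))"
      by (intro continuous_on_compose2[OF Ic])
  qed
  moreover have "(H has_vector_derivative r * k u) (at u)" if u: "u \<in> {0<..<1}" for u
  proof -
    have eq: "eventually (\<lambda>v. H v = ln (zr (1 + r * v)) * arcsin v + I (arccos v)) (nhds u)"
    proof -
      have "eventually (\<lambda>v. v \<in> {0<..<1}) (nhds u)" using u by (intro eventually_nhds_in_open) auto
      thus ?thesis
      proof eventually_elim
        case (elim v)
        hence e: "lnxz (r * v) = ln (zr (1 + r * v)) + ln r + ln v"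
          using r zr_Suc_eq[of "r * v"] by (simp add: ln_mult)
        show ?case unfolding H_def e by (simp add: algebra_simps)
      qed
    qed
    have ru: "1 + r * u > 1" using r u by simp
    define D where "D = Re (deriv zeta (of_real (1 + r * u)))"
    have Dz: "((\<lambda>v. zr (1 + r * v)) has_real_derivative D * r) (at u)"
      by (rule DERIV_chain2[of zr D "\<lambda>v. 1 + r * v" u r]) (use zr_DERIV[OF ru] in \<open>auto intro!: derivative_eq_intros simp: D_def\<close>)
    have D1: "((\<lambda>v. ln (zr (1 + r * v))) has_real_derivative (D * r / zr (1 + r * u))) (at u)"
      using DERIV_ln_divide[OF zr_pos[OF ru]] DERIV_chain2[OF _ Dz, of ln "1 / zr (1 + r * u)"] by simp
    have D2: "(arcsin has_real_derivative inverse (sqrt (1 - u\<^sup>2))) (at u)"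
      using u by (intro DERIV_arcsin) auto
    have acs: "arccos u \<in> {0<..<pi / 2}"
    proof -
      have c: "cos (arccos u) = u" using u by (intro cos_arccos) auto
      have "arccos u \<noteq> 0"
      proof
        assume "arccos u = 0"
        with c have "u = 1" by simp
        with u show False by simp
      qed
      moreover have "arccos u \<noteq> pi / 2"
      proof
        assume "arccos u = pi / 2"
        with c have "u = 0" by (simp only: cos_pi_half)
        with u show False by simp
      qed
      ultimately show ?thesis using u arccos_lbound[of u] arccos_le_pi2[of u] by auto
    qed
    have gc: "isCont g (arccos u)"
    proof -
      have c: "cos (arccos u) = u" using u by simp
      have "isCont zr (1 + r * cos (arccos u))" unfolding c using zr_DERIV[OF ru] by (rule DERIV_isCont)
      hence "isCont (\<lambda>\<theta>. zr (1 + r * cos \<theta>)) (arccos u)"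
        by (intro isCont_o2[of "arccos u" "\<lambda>\<theta>. 1 + r * cos \<theta>" zr]) (auto intro!: continuous_intros)
      thus ?thesis unfolding g_def using zr_pos[OF ru] c by (intro continuous_intros) auto
    qed
    have "(I has_vector_derivative g (arccos u)) (at (arccos u) within {0..pi / 2} - {})"
      unfolding I_def using acs gc by (intro integral_has_vector_derivative_continuous_at[OF gi]) (auto intro: continuous_at_imp_continuous_at_within)
    hence "(I has_real_derivative g (arccos u)) (at (arccos u) within {0..pi / 2})"
      by (simp add: has_real_derivative_iff_has_vector_derivative)
    hence "(I has_real_derivative g (arccos u)) (at (arccos u))"
      using acs at_within_interior[of "arccos u" "{0..pi / 2}"] by (simp add: interior_atLeastAtMost_real)
    moreover have "(arccos has_real_derivative inverse (- sqrt (1 - u\<^sup>2))) (at u)"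
      using u by (intro DERIV_arccos) auto
    ultimately have D3: "((\<lambda>v. I (arccos v)) has_real_derivative (g (arccos u) * inverse (- sqrt (1 - u\<^sup>2)))) (at u)"
      by (rule DERIV_chain2)
    have "((\<lambda>v. ln (zr (1 + r * v)) * arcsin v + I (arccos v)) has_real_derivative
       (D * r / zr (1 + r * u) * arcsin u + inverse (sqrt (1 - u\<^sup>2)) * ln (zr (1 + r * u)) + g (arccos u) * inverse (- sqrt (1 - u\<^sup>2)))) (at u)"
      by (intro DERIV_add DERIV_mult D1 D2 D3)
    moreover have "D * r / zr (1 + r * u) * arcsin u + inverse (sqrt (1 - u\<^sup>2)) * ln (zr (1 + r * u)) + g (arccos u) * inverse (- sqrt (1 - u\<^sup>2)) = r * k u"
      using u zr_deriv_quotient[OF ru] by (simp add: g_def k_def D_def)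
    ultimately have "((\<lambda>v. ln (zr (1 + r * v)) * arcsin v + I (arccos v)) has_real_derivative r * k u) (at u)" by simp
    hence "(H has_real_derivative r * k u) (at u)"
      using DERIV_cong_ev[OF refl eq refl] by simp
    thus ?thesis by (simp add: has_real_derivative_iff_has_vector_derivative)
  qed
  ultimately have "((\<lambda>u. r * k u) has_integral (H 1 - H 0)) {0..1}"
    by (intro fundamental_theorem_of_calculus_interior) auto
  hence "integral {0..1} (\<lambda>u. r * k u) = H 1 - H 0" by (rule integral_unique)
  hence "r * integral {0..1} k = H 1 - H 0" by simp
  moreover have "H 0 = I (pi / 2)" by (simp add: H_def)
  moreover have "H 1 = ln (zr (1 + r)) * (pi / 2)" using r zr_Suc_eq[of r] by (simp add: H_def I_def)
  moreover have "pi * c4 r = pi / 2 * ln (zr (1 + r)) - r * integral {0..1} k"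
    by (simp add: c4_def zr_def k_def[abs_def] right_diff_distrib)
  ultimately have "pi * c4 r = integral {0..pi / 2} g" by (simp add: I_def)
  thus ?thesis using integrable_integral[OF gi] by (simp add: g_def)
qed

corollary c4_eq:
  assumes "r > 0"
  shows "pi * c4 r = integral {0..pi / 2} (\<lambda>\<theta>. lnxz (r * cos \<theta>)) + pi / 2 * ln (2 / r)"
  using has_integral_unique[OF c4_has_integral[OF assms] ln_zr_cos_has_integral[OF assms]] .

text \<open>\<open>lnxz (r * cos \<theta>)\<close> is strictly largest at \<theta> = 0, so its
  integral is strictly below that of the constant \<open>lnxz r\<close>.\<close>

lemma c4_less:
  assumes r: "r > 0"
  shows "c4 r < 1 / 2 * ln (zr (1 + r)) + 1 / 2 * ln 2"
proof -
  have "integral {0..pi / 2} (\<lambda>\<theta>. lnxz (r * cos \<theta>)) < integral {0..pi / 2} (\<lambda>\<theta>. lnxz r)"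
  proof (rule integral_less_real)
    show "{0<..<pi / 2} \<noteq> {}"
      using pi_half_gt_zero by (metis greaterThanLessThan_empty_iff not_le)
    fix \<theta> assume \<theta>: "\<theta> \<in> {0<..<pi / 2}"
    have "cos \<theta> < cos 0" using \<theta> pi_gt_zero by (intro cos_monotone_0_pi) auto
    moreover have "cos \<theta> > 0" using \<theta> by (intro cos_gt_zero) auto
    ultimately show "lnxz (r * cos \<theta>) < lnxz r" using r by (intro lnxz_strict_mono) auto
  qed (auto intro!: lnxz_cos_continuous r)
  also have "\<dots> = pi / 2 * lnxz r" by simp
  finally have "pi * c4 r < pi / 2 * lnxz r + pi / 2 * ln (2 / r)" using c4_eq[OF r] by simp
  also have "lnxz r = ln (zr (1 + r)) + ln r" using zr_Suc_eq[OF r] by simp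
  also have "pi / 2 * (ln (zr (1 + r)) + ln r) + pi / 2 * ln (2 / r) = pi * (1 / 2 * ln (zr (1 + r)) + 1 / 2 * ln 2)"
    using r by (simp add: ln_div algebra_simps)
  finally show ?thesis by simp
qed

lemma c4_ge:
  assumes r: "r > 0"
  shows "c4 r \<ge> 1 / 2 * ln (2 / r)"
proof -
  have "integral {0..pi / 2} (\<lambda>\<theta>. lnxz (r * cos \<theta>)) \<ge> 0"
    using r cos_ge_zero by (intro integral_nonneg integrable_continuous_real lnxz_cos_continuous lnxz_nonneg) auto
  hence "pi * c4 r \<ge> pi * (1 / 2 * ln (2 / r))" using c4_eq[OF r] by simp
  thus ?thesis by simp
qed

text \<open>Apart from the summand -1/2 ln r, \<open>c4 r\<close> is monotone in r. The price 1/2 ln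
  (r / s) for that summand vanishes as s tends to r, which is how \<open>zero_mass_bound\<close>
  uses it.\<close>

lemma c4_mono_bound:
  assumes "0 < s" "s < r"
  shows "c4 s \<le> c4 r + 1 / 2 * ln (r / s)"
proof -
  have "integral {0..pi / 2} (\<lambda>\<theta>. lnxz (s * cos \<theta>)) \<le> integral {0..pi / 2} (\<lambda>\<theta>. lnxz (r * cos \<theta>))"
  proof (rule integral_le)
    fix \<theta> assume "\<theta> \<in> {0..pi / 2}"
    hence c: "cos \<theta> \<ge> 0" by (intro cos_ge_zero) auto
    show "lnxz (s * cos \<theta>) \<le> lnxz (r * cos \<theta>)"
    proof (cases "cos \<theta> = 0")
      case False
      thus ?thesis using c assms by (intro less_imp_le lnxz_strict_mono) auto
    qed simp
  qed (use assms in \<open>auto intro!: integrable_continuous_real lnxz_cos_continuous\<close>)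
  hence "pi * c4 s \<le> pi * c4 r + pi / 2 * (ln (2 / s) - ln (2 / r))"
    using c4_eq[of s] c4_eq[of r] assms by (simp add: algebra_simps)
  also have "ln (2 / s) - ln (2 / r) = ln (r / s)" using assms by (simp add: ln_div)
  finally have "pi * c4 s \<le> pi * (c4 r + 1 / 2 * ln (r / s))" by (simp add: algebra_simps)
  thus ?thesis by simp
qed

section \<open>Poisson--Jensen for zeta on circles around the 1-line\<close>

lemma fold_circle_integral:
  fixes F :: "real \<Rightarrow> real"
  assumes F: "(F has_integral I) {0..2 * pi}"
  shows "((\<lambda>\<theta>. F \<theta> + F (pi - \<theta>) + F (pi + \<theta>) + F (2 * pi - \<theta>)) has_integral I) {0..pi / 2}"
proof -
  have int: "F integrable_on {0..2 * pi}" using F by blast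
  define J where "J = (\<lambda>a b. integral {a..b} F)"
  have J: "(F has_integral J a b) {a..b}" if "0 \<le> a" "b \<le> 2 * pi" for a b
    unfolding J_def by (rule integrable_integral, rule integrable_on_subinterval[OF int]) (use that in auto)
  have 1: "(F has_integral J 0 (pi / 2)) {0..pi / 2}" by (rule J) auto
  have 2: "(F has_integral J (pi / 2) pi) {pi / 2..pi}" by (rule J) auto
  have 3: "(F has_integral J pi (3 * pi / 2)) {pi..3 * pi / 2}" by (rule J) auto
  have 4: "(F has_integral J (3 * pi / 2) (2 * pi)) {3 * pi / 2..2 * pi}" by (rule J) auto
  have "(F has_integral (J 0 (pi / 2) + J (pi / 2) pi + (J pi (3 * pi / 2) + J (3 * pi / 2) (2 * pi)))) {0..2 * pi}"
    by (rule has_integral_combine[OF _ _ has_integral_combine[OF _ _ 1 2] has_integral_combine[OF _ _ 3 4]]) auto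
  hence I: "I = J 0 (pi / 2) + J (pi / 2) pi + (J pi (3 * pi / 2) + J (3 * pi / 2) (2 * pi))"
    using F has_integral_unique by blast
  have r2: "((\<lambda>\<theta>. F (pi - \<theta>)) has_integral J (pi / 2) pi) {0..pi / 2}"
    using has_integral_half_pi_reflect[OF 2, of pi] by simp
  have r4: "((\<lambda>\<theta>. F (2 * pi - \<theta>)) has_integral J (3 * pi / 2) (2 * pi)) {0..pi / 2}"
    using has_integral_half_pi_reflect[OF 4, of "2 * pi"] by simp
  have r3: "((\<lambda>\<theta>. F (pi + \<theta>)) has_integral J pi (3 * pi / 2)) {0..pi / 2}"
    using has_integral_affinity'[of F "J pi (3 * pi / 2)" pi "3 * pi / 2" 1 pi] 3 by (simp add: add.commute)
  have "((\<lambda>\<theta>. F \<theta> + F (pi - \<theta>) + F (pi + \<theta>) + F (2 * pi - \<theta>)) has_integral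
     (J 0 (pi / 2) + J (pi / 2) pi + J pi (3 * pi / 2) + J (3 * pi / 2) (2 * pi))) {0..pi / 2}"
    by (intro has_integral_add 1 r2 r3 r4)
  thus ?thesis by (simp add: I add_ac)
qed

text \<open>The two points of the circle with the same real part lie at heights symmetric about t.
  Kernels in cos \<theta> weight them equally, and the symmetry is what allows concavity to be used
  in \<open>left_pair_le\<close>.\<close>

definition right_pair :: "real \<Rightarrow> real \<Rightarrow> real \<Rightarrow> real" where
  "right_pair t R \<theta> = ln (norm (zeta (Complex (1 + R * cos \<theta>) (t + R * sin \<theta>))))
     + ln (norm (zeta (Complex (1 + R * cos \<theta>) (t - R * sin \<theta>))))"

definition left_pair :: "real \<Rightarrow> real \<Rightarrow> real \<Rightarrow> real" where
  "left_pair t R \<theta> = ln (norm (zeta (Complex (1 - R * cos \<theta>) (t + R * sin \<theta>))))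
     + ln (norm (zeta (Complex (1 - R * cos \<theta>) (t - R * sin \<theta>))))"

definition zeta_zeros :: "real \<Rightarrow> real \<Rightarrow> complex set" where
  "zeta_zeros t R = {\<rho> \<in> ball (Complex 1 t) R. zeta \<rho> = 0}"

text \<open>\<open>R < t\<close> keeps the pole, which has distance t from the centre, outside the
  closed disc.\<close>

definition zero_free_circle :: "real \<Rightarrow> real \<Rightarrow> bool" where
  "zero_free_circle t R \<longleftrightarrow> 0 < R \<and> R < t \<and> (\<forall>z\<in>sphere (Complex 1 t) R. zeta z \<noteq> 0)"

lemma circle_point_mem:
  assumes "R \<ge> 0"
  shows "Complex (1 + R * x) (t + R * y) \<in> sphere (Complex 1 t) R \<longleftrightarrow> R = 0 \<or> x\<^sup>2 + y\<^sup>2 = 1"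
proof -
  have "dist (Complex 1 t) (Complex (1 + R * x) (t + R * y)) = R * sqrt (x\<^sup>2 + y\<^sup>2)"
    using assms by (simp add: dist_complex_def cmod_def power_mult_distrib real_sqrt_mult flip: distrib_left)
  thus ?thesis using assms by auto
qed

lemma circle_points_nonzero:
  assumes "zero_free_circle t R"
  shows "zeta (Complex (1 + R * cos \<theta>) (t + R * sin \<theta>)) \<noteq> 0"
    "zeta (Complex (1 + R * cos \<theta>) (t - R * sin \<theta>)) \<noteq> 0"
    "zeta (Complex (1 - R * cos \<theta>) (t + R * sin \<theta>)) \<noteq> 0"
    "zeta (Complex (1 - R * cos \<theta>) (t - R * sin \<theta>)) \<noteq> 0"
proof -
  have R: "R \<ge> 0" and nz: "\<And>z. z \<in> sphere (Complex 1 t) R \<Longrightarrow> zeta z \<noteq> 0"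
    using assms by (auto simp: zero_free_circle_def)
  have *: "zeta (Complex (1 + R * x) (t + R * y)) \<noteq> 0" if "x\<^sup>2 + y\<^sup>2 = 1" for x y
    using nz circle_point_mem[OF R, of x t y] that by blast
  show "zeta (Complex (1 + R * cos \<theta>) (t + R * sin \<theta>)) \<noteq> 0" using *[of "cos \<theta>" "sin \<theta>"] by simp
  show "zeta (Complex (1 + R * cos \<theta>) (t - R * sin \<theta>)) \<noteq> 0" using *[of "cos \<theta>" "- sin \<theta>"] by simp
  show "zeta (Complex (1 - R * cos \<theta>) (t + R * sin \<theta>)) \<noteq> 0" using *[of "- cos \<theta>" "sin \<theta>"] by simp
  show "zeta (Complex (1 - R * cos \<theta>) (t - R * sin \<theta>)) \<noteq> 0" using *[of "- cos \<theta>" "- sin \<theta>"] by simp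
qed

lemma ln_norm_zeta_continuous:
  assumes "continuous_on A x" "continuous_on A y"
    and "\<And>\<theta>. \<theta> \<in> A \<Longrightarrow> zeta (Complex (x \<theta>) (y \<theta>)) \<noteq> 0"
  shows "continuous_on A (\<lambda>\<theta>. ln (norm (zeta (Complex (x \<theta>) (y \<theta>)))))"
proof -
  have c: "continuous_on A (\<lambda>\<theta>. Complex (x \<theta>) (y \<theta>))"
    using assms(1,2) unfolding continuous_on_def by (auto intro: tendsto_Complex)
  have z: "continuous_on (- {1}) zeta" by (rule holomorphic_on_imp_continuous_on[OF zeta_holomorphic])
  \<comment> \<open>The convention \<open>zeta 1 = 0\<close> makes the nonvanishing assumption
    exclude the pole as well.\<close>
  have "(\<lambda>\<theta>. Complex (x \<theta>) (y \<theta>)) ` A \<subseteq> - {1}"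
  proof clarify
    fix \<theta> assume "\<theta> \<in> A" "Complex (x \<theta>) (y \<theta>) = 1"
    thus False using assms(3)[of \<theta>] zeta_1 by simp
  qed
  hence "continuous_on A (\<lambda>\<theta>. zeta (Complex (x \<theta>) (y \<theta>)))"
    by (rule continuous_on_compose2[OF z c])
  thus ?thesis using assms(3) by (intro continuous_on_ln continuous_on_norm) auto
qed

lemma pair_continuous:
  assumes "zero_free_circle t R"
  shows "continuous_on A (right_pair t R)" "continuous_on A (left_pair t R)"
  unfolding right_pair_def[abs_def] left_pair_def[abs_def]
  by (intro continuous_on_add ln_norm_zeta_continuous continuous_intros circle_points_nonzero[OF assms])+

theorem zeta_poisson_jensen:
  assumes zf: "zero_free_circle t R" and w: "\<bar>w\<bar> < 1" and nz: "zeta (Complex (1 + R * w) t) \<noteq> 0"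
  shows "finite (zeta_zeros t R)"
    and "((\<lambda>\<theta>. poisson w (cos \<theta>) * right_pair t R \<theta> + poisson w (- cos \<theta>) * left_pair t R \<theta>) has_integral
       2 * pi * (ln (norm (zeta (Complex (1 + R * w) t))) +
         (\<Sum>\<rho>\<in>zeta_zeros t R. of_int (zorder zeta \<rho>) * green ((\<rho> - Complex 1 t) / of_real R) w))) {0..pi / 2}"
proof -
  have R: "0 < R" "R < t" and sph: "\<And>z. z \<in> sphere (Complex 1 t) R \<Longrightarrow> zeta z \<noteq> 0"
    using zf by (auto simp: zero_free_circle_def)
  have "1 \<notin> ball (Complex 1 t) t" using R by (simp add: dist_complex_def cmod_def)
  hence hol: "zeta holomorphic_on ball (Complex 1 t) t"
    by (intro holomorphic_on_subset[OF zeta_holomorphic]) auto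
  have "Complex 1 t + of_real (R * w) = Complex (1 + R * w) t" by (simp add: complex_eq_iff)
  hence nz': "zeta (Complex 1 t + of_real (R * w)) \<noteq> 0" using nz by simp
  note PJ = poisson_jensen[OF hol R sph w nz', folded zeta_zeros_def]
  show "finite (zeta_zeros t R)" by (rule PJ(1))
  define u where "u = (\<lambda>x y. ln (norm (zeta (Complex (1 + R * x) (t + R * y)))))"
  have pt: "Complex 1 t + of_real R * cis \<theta> = Complex (1 + R * cos \<theta>) (t + R * sin \<theta>)" for \<theta>
    by (simp add: complex_eq_iff)
  have "((\<lambda>\<theta>. poisson w (cos \<theta>) * u (cos \<theta>) (sin \<theta>)) has_integral
       2 * pi * (ln (norm (zeta (Complex (1 + R * w) t))) +
         (\<Sum>\<rho>\<in>zeta_zeros t R. of_int (zorder zeta \<rho>) * green ((\<rho> - Complex 1 t) / of_real R) w))) {0..2 * pi}"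
    using PJ(2) unfolding pt u_def \<open>Complex 1 t + of_real (R * w) = Complex (1 + R * w) t\<close> .
  from fold_circle_integral[OF this]
  have "((\<lambda>\<theta>. poisson w (cos \<theta>) * u (cos \<theta>) (sin \<theta>) + poisson w (- cos \<theta>) * u (- cos \<theta>) (sin \<theta>)
      + poisson w (- cos \<theta>) * u (- cos \<theta>) (- sin \<theta>) + poisson w (cos \<theta>) * u (cos \<theta>) (- sin \<theta>)) has_integral
       2 * pi * (ln (norm (zeta (Complex (1 + R * w) t))) +
         (\<Sum>\<rho>\<in>zeta_zeros t R. of_int (zorder zeta \<rho>) * green ((\<rho> - Complex 1 t) / of_real R) w))) {0..pi / 2}"
    by simp
  moreover have "poisson w (cos \<theta>) * u (cos \<theta>) (sin \<theta>) + poisson w (- cos \<theta>) * u (- cos \<theta>) (sin \<theta>)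
      + poisson w (- cos \<theta>) * u (- cos \<theta>) (- sin \<theta>) + poisson w (cos \<theta>) * u (cos \<theta>) (- sin \<theta>)
      = poisson w (cos \<theta>) * right_pair t R \<theta> + poisson w (- cos \<theta>) * left_pair t R \<theta>" for \<theta>
    by (simp add: u_def right_pair_def left_pair_def algebra_simps)
  ultimately show "((\<lambda>\<theta>. poisson w (cos \<theta>) * right_pair t R \<theta> + poisson w (- cos \<theta>) * left_pair t R \<theta>) has_integral
       2 * pi * (ln (norm (zeta (Complex (1 + R * w) t))) +
         (\<Sum>\<rho>\<in>zeta_zeros t R. of_int (zorder zeta \<rho>) * green ((\<rho> - Complex 1 t) / of_real R) w))) {0..pi / 2}"
    by simp
qed

text \<open>Two-sided, because the kernels \<open>Kq\<close> and \<open>Ke\<close> change sign on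
  the right half circle.\<close>

lemma right_pair_bound:
  assumes "R > 0" "\<theta> \<in> {0..<pi / 2}"
  shows "\<bar>right_pair t R \<theta>\<bar> \<le> 2 * ln (zr (1 + R * cos \<theta>))"
proof -
  have "cos \<theta> > 0" using assms by (intro cos_gt_zero_pi) auto
  hence \<sigma>: "1 + R * cos \<theta> > 1" using assms by simp
  have *: "\<bar>ln (norm (zeta (Complex (1 + R * cos \<theta>) y)))\<bar> \<le> ln (zr (1 + R * cos \<theta>))" for y
  proof -
    define n where "n = norm (zeta (Complex (1 + R * cos \<theta>) y))"
    have n: "n > 0" using zeta_nonzero[of "Complex (1 + R * cos \<theta>) y"] \<sigma> by (simp add: n_def)
    have "n \<le> zr (1 + R * cos \<theta>)" using norm_zeta_le_zr[of "Complex (1 + R * cos \<theta>) y"] \<sigma> by (simp add: n_def)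
    hence 1: "ln n \<le> ln (zr (1 + R * cos \<theta>))" using n by simp
    have "1 \<le> n * zr (1 + R * cos \<theta>)" using zeta_times_zr_ge_1[OF \<sigma>, of y] by (simp add: n_def)
    hence "0 \<le> ln (n * zr (1 + R * cos \<theta>))" by (rule ln_ge_zero)
    hence "0 \<le> ln n + ln (zr (1 + R * cos \<theta>))" using n zr_pos[OF \<sigma>] by (simp add: ln_mult)
    with 1 show ?thesis by (simp add: n_def)
  qed
  show ?thesis using *[of "t + R * sin \<theta>"] *[of "t - R * sin \<theta>"] unfolding right_pair_def by linarith
qed

section \<open>Moments of sine and cosine on the quarter period\<close>

lemma cos_power_integrals:
  shows "((\<lambda>\<theta>. cos \<theta>) has_integral 1) {0..pi / 2}"
    and "((\<lambda>\<theta>. (cos \<theta>)\<^sup>2) has_integral pi / 4) {0..pi / 2}"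
    and "((\<lambda>\<theta>. (sin \<theta>)\<^sup>2) has_integral pi / 4) {0..pi / 2}"
    and "((\<lambda>\<theta>. cos \<theta> * (sin \<theta>)\<^sup>2) has_integral 1 / 3) {0..pi / 2}"
proof -
  note [simp] = has_real_derivative_iff_has_vector_derivative[symmetric]
  have "((\<lambda>\<theta>. cos \<theta>) has_integral (sin (pi / 2) - sin 0)) {0..pi / 2}"
    by (rule fundamental_theorem_of_calculus) (auto intro!: derivative_eq_intros)
  thus "((\<lambda>\<theta>. cos \<theta>) has_integral 1) {0..pi / 2}" by simp
  have "((\<lambda>\<theta>. (cos \<theta>)\<^sup>2) has_integral ((pi / 2 / 2 + sin (pi / 2) * cos (pi / 2) / 2) - (0 / 2 + sin 0 * cos 0 / 2))) {0..pi / 2}"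
    by (rule fundamental_theorem_of_calculus)
       (auto intro!: derivative_eq_intros simp: sin_squared_eq power2_eq_square[symmetric] field_simps)
  thus "((\<lambda>\<theta>. (cos \<theta>)\<^sup>2) has_integral pi / 4) {0..pi / 2}" by simp
  have "((\<lambda>\<theta>. (sin \<theta>)\<^sup>2) has_integral ((pi / 2 / 2 - sin (pi / 2) * cos (pi / 2) / 2) - (0 / 2 - sin 0 * cos 0 / 2))) {0..pi / 2}"
    by (rule fundamental_theorem_of_calculus)
       (auto intro!: derivative_eq_intros simp: cos_squared_eq power2_eq_square[symmetric] field_simps)
  thus "((\<lambda>\<theta>. (sin \<theta>)\<^sup>2) has_integral pi / 4) {0..pi / 2}" by simp
  have "((\<lambda>\<theta>. cos \<theta> * (sin \<theta>)\<^sup>2) has_integral (sin (pi / 2) ^ 3 / 3 - sin 0 ^ 3 / 3)) {0..pi / 2}"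
    by (rule fundamental_theorem_of_calculus) (auto intro!: derivative_eq_intros)
  thus "((\<lambda>\<theta>. cos \<theta> * (sin \<theta>)\<^sup>2) has_integral 1 / 3) {0..pi / 2}" by simp
qed

lemma cos_powr_continuous: "a > 0 \<Longrightarrow> continuous_on {0..pi / 2} (\<lambda>\<theta>. cos \<theta> powr a)"
  by (intro continuous_on_powr' continuous_intros) (auto intro: cos_ge_zero)

lemma E_half_has_integral: "((\<lambda>\<theta>. cos \<theta> powr (3 / 2)) has_integral E_half) {0..pi / 2}"
  unfolding E_half_def by (intro integrable_integral integrable_continuous_real cos_powr_continuous) auto

lemma E_half_pos: "E_half > 0"
proof -
  have "integral {0..pi / 2} (\<lambda>\<theta>. 0 :: real) < integral {0..pi / 2} (\<lambda>\<theta>. cos \<theta> powr (3 / 2))"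
  proof (rule integral_less_real)
    show "{0<..<pi / 2} \<noteq> {}" using pi_half_gt_zero by (metis greaterThanLessThan_empty_iff not_le)
    fix \<theta> assume "\<theta> \<in> {0<..<pi / 2}"
    hence "cos \<theta> > 0" by (intro cos_gt_zero) auto
    thus "0 < cos \<theta> powr (3 / 2)" by simp
  qed (auto intro!: cos_powr_continuous)
  thus ?thesis by (simp add: E_half_def)
qed

text \<open>The function sin \<theta> cos^(5/2) \<theta> vanishes at both ends and has derivative
  cos^(3/2) \<theta> (1 - 7/2 sin^2 \<theta>). These moments serve the case of negative B.\<close>

lemma cos_powr_reduction:
  shows "((\<lambda>\<theta>. cos \<theta> powr (3 / 2) * (cos \<theta>)\<^sup>2) has_integral 5 / 7 * E_half) {0..pi / 2}"
    and "((\<lambda>\<theta>. cos \<theta> powr (3 / 2) * (sin \<theta>)\<^sup>2) has_integral 2 / 7 * E_half) {0..pi / 2}"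
proof -
  have "((\<lambda>\<theta>. cos \<theta> powr (3 / 2) - 7 / 2 * (cos \<theta> powr (3 / 2) * (sin \<theta>)\<^sup>2)) has_integral
      (sin (pi / 2) * cos (pi / 2) powr (5 / 2) - sin 0 * cos 0 powr (5 / 2))) {0..pi / 2}"
  proof (rule fundamental_theorem_of_calculus_interior)
    show "continuous_on {0..pi / 2} (\<lambda>\<theta>. sin \<theta> * cos \<theta> powr (5 / 2))"
      by (intro continuous_on_mult cos_powr_continuous continuous_intros) auto
    fix \<theta> assume "\<theta> \<in> {0<..<pi / 2}"
    hence c: "cos \<theta> > 0" by (intro cos_gt_zero) auto
    have "((\<lambda>\<theta>. cos \<theta> powr (5 / 2)) has_real_derivative 5 / 2 * cos \<theta> powr (5 / 2 - of_nat 1) * (- sin \<theta>)) (at \<theta>)"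
      by (rule DERIV_fun_powr) (use c in \<open>auto intro!: derivative_eq_intros\<close>)
    hence "((\<lambda>\<theta>. cos \<theta> powr (5 / 2)) has_real_derivative 5 / 2 * cos \<theta> powr (3 / 2) * (- sin \<theta>)) (at \<theta>)" by simp
    from DERIV_mult[OF DERIV_sin this]
    have D: "((\<lambda>\<theta>. sin \<theta> * cos \<theta> powr (5 / 2)) has_real_derivative
        cos \<theta> * cos \<theta> powr (5 / 2) + 5 / 2 * cos \<theta> powr (3 / 2) * (- sin \<theta>) * sin \<theta>) (at \<theta>)" .
    have e: "cos \<theta> * cos \<theta> powr (5 / 2) = cos \<theta> powr (3 / 2) * (cos \<theta>)\<^sup>2"
    proof -
      have "cos \<theta> * cos \<theta> powr (5 / 2) = cos \<theta> powr 1 * cos \<theta> powr (5 / 2)" using c by simp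
      also have "\<dots> = cos \<theta> powr (3 / 2 + 2)" by (subst powr_add[symmetric]) simp
      also have "\<dots> = cos \<theta> powr (3 / 2) * cos \<theta> powr 2" by (rule powr_add)
      also have "cos \<theta> powr 2 = (cos \<theta>)\<^sup>2" using c by simp
      finally show ?thesis .
    qed
    have "cos \<theta> * cos \<theta> powr (5 / 2) + 5 / 2 * cos \<theta> powr (3 / 2) * (- sin \<theta>) * sin \<theta>
      = cos \<theta> powr (3 / 2) - 7 / 2 * (cos \<theta> powr (3 / 2) * (sin \<theta>)\<^sup>2)"
      unfolding e cos_squared_eq by (simp add: power2_eq_square algebra_simps)
    with D have "((\<lambda>\<theta>. sin \<theta> * cos \<theta> powr (5 / 2)) has_real_derivative
        cos \<theta> powr (3 / 2) - 7 / 2 * (cos \<theta> powr (3 / 2) * (sin \<theta>)\<^sup>2)) (at \<theta>)"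
      by (simp only:)
    thus "((\<lambda>\<theta>. sin \<theta> * cos \<theta> powr (5 / 2)) has_vector_derivative
        cos \<theta> powr (3 / 2) - 7 / 2 * (cos \<theta> powr (3 / 2) * (sin \<theta>)\<^sup>2)) (at \<theta>)"
      by (simp add: has_real_derivative_iff_has_vector_derivative)
  qed auto
  hence "((\<lambda>\<theta>. cos \<theta> powr (3 / 2) - 7 / 2 * (cos \<theta> powr (3 / 2) * (sin \<theta>)\<^sup>2)) has_integral 0) {0..pi / 2}" by simp
  from has_integral_mult_right[OF has_integral_diff[OF E_half_has_integral this], of "2 / 7"]
  show S: "((\<lambda>\<theta>. cos \<theta> powr (3 / 2) * (sin \<theta>)\<^sup>2) has_integral 2 / 7 * E_half) {0..pi / 2}"
    by (simp add: mult_ac)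
  from has_integral_diff[OF E_half_has_integral S]
  have "((\<lambda>\<theta>. cos \<theta> powr (3 / 2) * (cos \<theta>)\<^sup>2) has_integral (E_half - 2 / 7 * E_half)) {0..pi / 2}"
    by (simp add: cos_squared_eq right_diff_distrib)
  thus "((\<lambda>\<theta>. cos \<theta> powr (3 / 2) * (cos \<theta>)\<^sup>2) has_integral 5 / 7 * E_half) {0..pi / 2}" by simp
qed

section \<open>Kernels and Green functions\<close>

text \<open>The last summand is the kernel at base point 0. To first order in \<open>e\<close> the
  combination is -4 e c.\<close>

definition Kq :: "real \<Rightarrow> real \<Rightarrow> real" where
  "Kq e c = 2 * poisson e c - poisson (4 * e) c - 1"

text \<open>To first order -6 e c. Comparing only the two outer points, this kernel serves to count
  zeros very close to the centre.\<close>

definition Ke :: "real \<Rightarrow> real \<Rightarrow> real" where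
  "Ke e c = poisson e c - poisson (4 * e) c"

text \<open>37/500 covers all values of \<open>e\<close> that occur, by \<open>e_bounds\<close>. The
  argument -c stands for the left half circle.\<close>

lemma Kq_Ke_eq:
  fixes e c :: real
  assumes "0 < e" "e \<le> 37 / 500" "\<bar>c\<bar> \<le> 1"
  defines "D1 \<equiv> 1 + 2 * e * c + e\<^sup>2" and "D4 \<equiv> 1 + 8 * e * c + 16 * e\<^sup>2"
  shows "Kq e (- c) = 4 * e * (7 * e + c - 4 * e * c\<^sup>2 - 6 * e\<^sup>2 * c - 8 * e ^ 3) / (D1 * D4)"
    and "Ke e (- c) = 6 * e * (5 * e + c + 4 * e\<^sup>2 * c) / (D1 * D4)"
    and "D1 > 0" "D4 > 0"
proof -
  show D: "D1 > 0" "D4 > 0"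
    using poisson_denom_pos[of e "- c"] poisson_denom_pos[of "4 * e" "- c"] assms
    by (auto simp: power2_eq_square)
  have p: "poisson e (- c) = (1 - e\<^sup>2) / D1" "poisson (4 * e) (- c) = (1 - 16 * e\<^sup>2) / D4"
    by (simp_all add: poisson_def D1_def D4_def power2_eq_square)
  have "2 * (1 - e\<^sup>2) * D4 - (1 - 16 * e\<^sup>2) * D1 - D1 * D4 =
      4 * e * (7 * e + c - 4 * e * c\<^sup>2 - 6 * e\<^sup>2 * c - 8 * e ^ 3)"
    unfolding D1_def D4_def by (simp add: power2_eq_square power3_eq_cube algebra_simps)
  thus "Kq e (- c) = 4 * e * (7 * e + c - 4 * e * c\<^sup>2 - 6 * e\<^sup>2 * c - 8 * e ^ 3) / (D1 * D4)"
    unfolding Kq_def p using D by (simp add: field_simps)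
  have "(1 - e\<^sup>2) * D4 - (1 - 16 * e\<^sup>2) * D1 = 6 * e * (5 * e + c + 4 * e\<^sup>2 * c)"
    unfolding D1_def D4_def by (simp add: power2_eq_square algebra_simps)
  thus "Ke e (- c) = 6 * e * (5 * e + c + 4 * e\<^sup>2 * c) / (D1 * D4)"
    unfolding Ke_def p using D by (simp add: field_simps)
qed

text \<open>Nonnegativity lets upper bounds for ln |zeta| suffice on the left. The shape p c + q (1
  - c^2) of the majorants is chosen so that, with c = cos \<theta>, the integrals in
  \<open>cos_power_integrals\<close> apply.\<close>

lemma kernels_left:
  fixes e c :: real
  assumes e: "0 < e" "e \<le> 37 / 500" and c: "0 \<le> c" "c \<le> 1"
  shows "0 \<le> Kq e (- c)" "Kq e (- c) \<le> 4 * e * c + 28 * e\<^sup>2 * (1 - c\<^sup>2)"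
    and "0 \<le> Ke e (- c)" "Ke e (- c) \<le> 6 * e * c + 30 * e\<^sup>2 * (1 - c\<^sup>2)"
proof -
  define D1 where "D1 = 1 + 2 * e * c + e\<^sup>2"
  define D4 where "D4 = 1 + 8 * e * c + 16 * e\<^sup>2"
  have c': "\<bar>c\<bar> \<le> 1" using c by simp
  note eq = Kq_Ke_eq[OF e c', folded D1_def D4_def]
  have cc: "c\<^sup>2 \<le> 1" "0 \<le> c\<^sup>2" using c by (auto simp: power_le_one)
  have DD: "D1 * D4 = 1 + 10 * e * c + 17 * e\<^sup>2 + 16 * (e * c)\<^sup>2 + 40 * e ^ 3 * c + 16 * e ^ 4"
    unfolding D1_def D4_def by (simp add: power2_eq_square power3_eq_cube power4_eq_xxxx algebra_simps)
  have DD1: "D1 * D4 \<ge> 1 + 10 * e * c + 17 * e\<^sup>2" unfolding DD using e c by simp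
  have DD0: "D1 * D4 \<ge> 1 + 10 * e * c"
    using DD1 zero_le_power2[of e] by argo
  have pos: "D1 * D4 > 0" using eq(3,4) by simp
  have e2: "e\<^sup>2 \<le> e * (37 / 500)" unfolding power2_eq_square using e by (intro mult_left_mono) auto
  have ec2: "e * c\<^sup>2 \<le> e" using cc e by simp
  have e2c: "e\<^sup>2 * c \<le> e\<^sup>2" using c by (simp add: mult_left_le)
  have e3: "e ^ 3 \<le> e\<^sup>2" using e by (intro power_decreasing) auto
  have num: "0 \<le> 7 * e + c - 4 * e * c\<^sup>2 - 6 * e\<^sup>2 * c - 8 * e ^ 3"
    using ec2 e2c e3 e2 e c by argo
  show "0 \<le> Kq e (- c)" unfolding eq(1) using num pos e by (intro divide_nonneg_pos mult_nonneg_nonneg) auto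
  show "0 \<le> Ke e (- c)" unfolding eq(2) using pos e c by (intro divide_nonneg_pos mult_nonneg_nonneg) auto
  have "7 * e + c - 4 * e * c\<^sup>2 - 6 * e\<^sup>2 * c - 8 * e ^ 3 \<le> 7 * e + c"
  proof -
    have "0 \<le> 4 * e * c\<^sup>2" "0 \<le> 6 * e\<^sup>2 * c" "0 \<le> 8 * e ^ 3" using e c by auto
    thus ?thesis by linarith
  qed
  \<comment> \<open>Keeping only 10 e c from the denominator is enough: it produces 10 e c^2, which
    outweighs the 7 e c^2 removed on the left factor.\<close>
  also have "\<dots> \<le> (c + 7 * e * (1 - c\<^sup>2)) * (1 + 10 * e * c)"
  proof -
    have "(c + 7 * e * (1 - c\<^sup>2)) * (1 + 10 * e * c) = 7 * e + c + 3 * e * c\<^sup>2 + 70 * e\<^sup>2 * c * (1 - c\<^sup>2)"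
      by (simp add: power2_eq_square algebra_simps)
    moreover have "0 \<le> 3 * e * c\<^sup>2 + 70 * e\<^sup>2 * c * (1 - c\<^sup>2)" using e c cc by simp
    ultimately show ?thesis by linarith
  qed
  also have "\<dots> \<le> (c + 7 * e * (1 - c\<^sup>2)) * (D1 * D4)"
    using DD0 e c cc by (intro mult_left_mono add_nonneg_nonneg) auto
  finally have "4 * e * (7 * e + c - 4 * e * c\<^sup>2 - 6 * e\<^sup>2 * c - 8 * e ^ 3) \<le> 4 * e * ((c + 7 * e * (1 - c\<^sup>2)) * (D1 * D4))"
    using e by (intro mult_left_mono) auto
  hence "Kq e (- c) \<le> 4 * e * (c + 7 * e * (1 - c\<^sup>2))"
    unfolding eq(1) using pos by (simp add: divide_le_eq mult_ac)
  also have "\<dots> = 4 * e * c + 28 * e\<^sup>2 * (1 - c\<^sup>2)" by (simp add: power2_eq_square algebra_simps)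
  finally show "Kq e (- c) \<le> 4 * e * c + 28 * e\<^sup>2 * (1 - c\<^sup>2)" .
  have "5 * e + c + 4 * e\<^sup>2 * c \<le> (c + 5 * e * (1 - c\<^sup>2)) * (1 + 10 * e * c + 17 * e\<^sup>2)"
  proof -
    have "(c + 5 * e * (1 - c\<^sup>2)) * (1 + 10 * e * c + 17 * e\<^sup>2) = 5 * e + c + 4 * e\<^sup>2 * c
       + (5 * e * c\<^sup>2 + 13 * e\<^sup>2 * c + 50 * e\<^sup>2 * c * (1 - c\<^sup>2) + 85 * e ^ 3 * (1 - c\<^sup>2))"
      by (simp add: power2_eq_square power3_eq_cube algebra_simps)
    moreover have "0 \<le> 5 * e * c\<^sup>2 + 13 * e\<^sup>2 * c + 50 * e\<^sup>2 * c * (1 - c\<^sup>2) + 85 * e ^ 3 * (1 - c\<^sup>2)"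
      using e c cc by simp
    ultimately show ?thesis by linarith
  qed
  also have "\<dots> \<le> (c + 5 * e * (1 - c\<^sup>2)) * (D1 * D4)"
    using DD1 e c cc by (intro mult_left_mono add_nonneg_nonneg) auto
  finally have "6 * e * (5 * e + c + 4 * e\<^sup>2 * c) \<le> 6 * e * ((c + 5 * e * (1 - c\<^sup>2)) * (D1 * D4))"
    using e by (intro mult_left_mono) auto
  hence "Ke e (- c) \<le> 6 * e * (c + 5 * e * (1 - c\<^sup>2))"
    unfolding eq(2) using pos by (simp add: divide_le_eq mult_ac)
  also have "\<dots> = 6 * e * c + 30 * e\<^sup>2 * (1 - c\<^sup>2)" by (simp add: power2_eq_square algebra_simps)
  finally show "Ke e (- c) \<le> 6 * e * c + 30 * e\<^sup>2 * (1 - c\<^sup>2)" .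
qed

text \<open>The denominators are smallest at c = 1, where their product is \<open>p * p\<close>. One
  factor \<open>p\<close> is recovered from the numerator.\<close>

lemma kernels_right:
  fixes e c :: real
  assumes e: "0 < e" "e \<le> 37 / 500" and c: "0 \<le> c" "c \<le> 1"
  shows "\<bar>Kq e c\<bar> \<le> 36 / 5 * e" "\<bar>Ke e c\<bar> \<le> 93 / 10 * e"
proof -
  define D1 where "D1 = 1 + 2 * e * (- c) + e\<^sup>2"
  define D4 where "D4 = 1 + 8 * e * (- c) + 16 * e\<^sup>2"
  have c': "\<bar>- c\<bar> \<le> 1" using c by simp
  note eq = Kq_Ke_eq[OF e c', folded D1_def D4_def, simplified]
  have ec: "e * c \<le> e" using e c by (simp add: mult_left_le)
  define p where "p = (1 - e) * (1 - 4 * e)"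
  have e2: "e\<^sup>2 \<le> e * (37 / 500)" "0 \<le> e\<^sup>2" unfolding power2_eq_square using e by (auto intro!: mult_left_mono)
  have p: "p = 1 - 5 * e + 4 * e\<^sup>2" by (simp add: p_def power2_eq_square algebra_simps)
  \<comment> \<open>The tangent of e^2 at 37/500, which makes lower bounds for \<open>p\<close>
    linear in e.\<close>
  have tan: "e\<^sup>2 \<ge> 37 / 250 * e - (37 / 500)\<^sup>2"
    using zero_le_power2[of "e - 37 / 500"] by (simp add: power2_eq_square algebra_simps)
  have plb: "p \<ge> 13 / 20" unfolding p using tan e by (simp add: power2_eq_square)
  have "(1 - e)\<^sup>2 \<le> D1" "(1 - 4 * e)\<^sup>2 \<le> D4"
    using ec by (auto simp: D1_def D4_def power2_eq_square algebra_simps)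
  moreover have "(1 - e)\<^sup>2 > 0" "(1 - 4 * e)\<^sup>2 > 0" using e by auto
  ultimately have "(1 - e)\<^sup>2 * (1 - 4 * e)\<^sup>2 \<le> D1 * D4"
    using eq(3,4) by (intro mult_mono) auto
  hence DD: "p * p \<le> D1 * D4" by (simp add: p_def power2_eq_square mult_ac)
  have pos: "D1 * D4 > 0" using eq(3,4) by simp
  have p0: "p > 0" using plb by simp
  have div: "\<bar>x / (D1 * D4)\<bar> \<le> y / (p * p)" if "\<bar>x\<bar> \<le> y" for x y
    unfolding abs_divide using that DD pos p0 by (intro frac_le) auto
  have "\<bar>Ke e c\<bar> \<le> 6 * e * p / (p * p)"
  proof -
    have "\<bar>5 * e - c - 4 * e\<^sup>2 * c\<bar> \<le> p"
    proof -
      have k: "4 * e\<^sup>2 * c \<le> 4 * e\<^sup>2" "0 \<le> 4 * e\<^sup>2 * c" using c e2(2) by (auto simp: mult_left_le)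
      have "5 * e - c - 4 * e\<^sup>2 * c \<le> p" unfolding p using k c e e2 by argo
      moreover have "- (5 * e - c - 4 * e\<^sup>2 * c) \<le> p" unfolding p using k c e e2 by argo
      ultimately show ?thesis by (rule abs_leI)
    qed
    hence "\<bar>6 * e * (5 * e - c - 4 * e\<^sup>2 * c)\<bar> \<le> 6 * e * p"
      unfolding abs_mult using e by simp
    from div[OF this] show ?thesis unfolding eq(2) by (simp add: algebra_simps)
  qed
  also have "6 * e * p / (p * p) = 6 * e / p" using p0 by simp
  also have "\<dots> \<le> 6 * e / (13 / 20)" using plb e by (intro divide_left_mono) auto
  also have "\<dots> \<le> 93 / 10 * e" using e by simp
  finally show "\<bar>Ke e c\<bar> \<le> 93 / 10 * e" .
  have "\<bar>7 * e - c - 4 * e * c\<^sup>2 + 6 * e\<^sup>2 * c - 8 * e ^ 3\<bar> \<le> (1 + 2 * e) * p"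
  proof -
    have pe: "(1 + 2 * e) * p = 1 - 3 * e - 6 * e\<^sup>2 + 8 * e ^ 3"
      by (simp add: p power2_eq_square power3_eq_cube algebra_simps)
    have "0 \<le> (1 - c) * (1 + 4 * e * (1 + c) - 6 * e\<^sup>2)"
    proof (rule mult_nonneg_nonneg)
      have "0 \<le> e * (1 + c)" using e c by simp
      moreover have "6 * e\<^sup>2 \<le> 1" using e2 e by argo
      ultimately show "0 \<le> 1 + 4 * e * (1 + c) - 6 * e\<^sup>2" by (simp add: mult.assoc)
    qed (use c in simp)
    hence 1: "- (7 * e - c - 4 * e * c\<^sup>2 + 6 * e\<^sup>2 * c - 8 * e ^ 3) \<le> (1 + 2 * e) * p"
      unfolding pe by (simp add: power2_eq_square algebra_simps)
    have "4 * e * c\<^sup>2 \<ge> 0" "e ^ 3 \<ge> 0" using e by auto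
    moreover have "6 * e\<^sup>2 * c \<le> c"
      using mult_right_mono[of "6 * e\<^sup>2" 1 c] e2 e c by simp
    ultimately have "7 * e - c - 4 * e * c\<^sup>2 + 6 * e\<^sup>2 * c - 8 * e ^ 3 \<le> 7 * e" by linarith
    also have "\<dots> \<le> 1 * (13 / 20)" using e by simp
    also have "\<dots> \<le> (1 + 2 * e) * p" using plb e by (intro mult_mono) auto
    finally show ?thesis using 1 by (simp only: abs_le_iff)
  qed
  hence "\<bar>4 * e * (7 * e - c - 4 * e * c\<^sup>2 + 6 * e\<^sup>2 * c - 8 * e ^ 3)\<bar> \<le> 4 * e * ((1 + 2 * e) * p)"
    unfolding abs_mult[of "4 * e"] using e by simp
  from div[OF this] have "\<bar>Kq e c\<bar> \<le> 4 * e * ((1 + 2 * e) * p) / (p * p)"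
    unfolding eq(1) by (simp add: algebra_simps)
  also have "\<dots> = 4 * e * ((1 + 2 * e) / p)" using p0 by simp
  also have "(1 + 2 * e) / p \<le> 9 / 5"
  proof -
    have "1 + 2 * e \<le> 9 / 5 * p" unfolding p using tan e by (simp add: power2_eq_square)
    thus ?thesis using p0 by (simp add: divide_le_eq)
  qed
  finally show "\<bar>Kq e c\<bar> \<le> 36 / 5 * e" using e by simp
qed

text \<open>
  With \<open>z = e / d\<close> and \<open>y = e d\<close>, where \<open>d\<close> is the distance of the zero from the centre of the
  unit disc, the inequality for the Green functions is symmetric up to the factor \<open>z - y\<close>.
\<close>

lemma green_polynomial:
  fixes c y z :: real
  assumes c: "0 \<le> c" "c \<le> 1" and y: "0 \<le> y" "y \<le> z" "y \<le> 37 / 500" and z: "z \<le> 9 / 5"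
    and p: "z * y \<le> 55 / 10000"
  defines "X \<equiv> (\<lambda>u. 1 + 2 * u * c + u\<^sup>2)"
  shows "(4 * X y - 3 + 12 * y\<^sup>2) * X z ^ 2 \<le> (4 * X z - 3 + 12 * z\<^sup>2) * X y ^ 2"
proof -
  \<comment> \<open>The cofactor of z - y in the difference of the two sides.\<close>
  define G where "G = (2 * c + z + y) * (3 * (X z + X y) - 4 * X z * X y) + 12 * (1 - z * y) * (z * X y + y * X z)"
  have z0: "z \<ge> 0" using y by simp
  have zy0: "z * y \<ge> 0" using z0 y by simp
  have Xy: "X y \<ge> 1" and Xz: "X z \<ge> 1" using c y z0 by (auto simp: X_def)
  have second: "12 * (1 - z * y) * (z * X y + y * X z) \<ge> 1193 / 100 * z"
  proof -
    have "z * 1 \<le> z * X y" by (rule mult_left_mono[OF Xy z0])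
    moreover have "0 \<le> y * X z" using Xz y by (intro mult_nonneg_nonneg) auto
    ultimately have "z * X y \<ge> z * 1" "y * X z \<ge> 0" by auto
    hence "z * X y + y * X z \<ge> z" by simp
    hence "12 * (1 - z * y) * (z * X y + y * X z) \<ge> 12 * (1 - z * y) * z"
      using p by (intro mult_left_mono) auto
    moreover have "12 * (1 - z * y) * z \<ge> 1193 / 100 * z" using p z0 by (intro mult_right_mono) auto
    ultimately show ?thesis by linarith
  qed
  have G: "G \<ge> 0"
  \<comment> \<open>For z < 1 the possibly negative first summand is at most of order z. For z \<ge>
    1 the bound on z y forces y to be tiny.\<close>
  proof (cases "z < 1")
    case True
    have "z * c \<le> z" "z\<^sup>2 \<le> z" using c z0 True by (auto simp: mult_left_le power2_eq_square)
    hence Xz3: "X z - 1 \<le> 3 * z" "X z \<le> 4" using True by (auto simp: X_def)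
    have "y * c \<le> y" "y\<^sup>2 \<le> y * (37 / 500)"
      using c y mult_left_mono[OF y(3) y(1)] by (auto simp: mult_left_le power2_eq_square)
    hence Xy2: "X y - 1 \<le> 2074 / 1000 * y" by (simp add: X_def)
    have "(4 * X z - 3) * (X y - 1) \<le> 13 * (2074 / 1000 * y)"
      using Xz3 Xz Xy Xy2 by (intro mult_mono) auto
    also have "\<dots> \<le> 2" using y by simp
    finally have "3 * (X z + X y) - 4 * X z * X y \<ge> - (3 * z)"
      using Xz3 by (simp add: algebra_simps)
    hence "(2 * c + z + y) * (3 * (X z + X y) - 4 * X z * X y) \<ge> (2 * c + z + y) * (- (3 * z))"
      using c z0 y by (intro mult_left_mono) auto
    moreover have "(2 * c + z + y) * (3 * z) \<le> (31 / 10) * (3 * z)"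
      using c z0 y True by (intro mult_right_mono) auto
    ultimately show ?thesis unfolding G_def using second z0 by argo
  next
    case False
    hence z1: "z \<ge> 1" by simp
    have y1: "y \<le> 55 / 10000"
      using p mult_right_mono[OF z1, of y] y by simp
    have "z * c \<le> 9 / 5" using mult_mono[of z "9 / 5" c 1] z z0 c by simp
    moreover have zsq: "z\<^sup>2 \<le> 81 / 25" using power_mono[OF z z0, of 2] by (simp add: power2_eq_square)
    ultimately have Xz9: "X z \<le> 841 / 100" by (simp add: X_def)
    have "y * c \<le> y" "y\<^sup>2 \<le> y * 1" using c y by (auto simp: mult_left_le power2_eq_square intro!: mult_left_mono)
    hence "X y - 1 \<le> 3 * (55 / 10000)" using y1 by (simp add: X_def)
    hence "(4 * X z - 3) * (X y - 1) \<le> 31 * (3 * (55 / 10000))"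
      using Xz9 Xz Xy by (intro mult_mono) auto
    hence br: "3 * (X z + X y) - 4 * X z * X y \<ge> 3 - X z - 52 / 100" by (simp add: algebra_simps)
    have "(2 * c + z + y) * (3 * (X z + X y) - 4 * X z * X y) \<ge> (2 * c + z + y) * (3 - X z - 52 / 100)"
      using c z0 y by (intro mult_left_mono br) auto
    moreover have "(2 * c + z + y) * (3 - X z - 52 / 100) + 1193 / 100 * z \<ge> 0"
    proof -
      have yb: "y * (3 - X z - 52 / 100) \<ge> - (6 / 100)"
      proof -
        have "y * (X z - 248 / 100) \<le> y * (841 / 100)"
          using y Xz9 by (intro mult_left_mono) auto
        also have "\<dots> \<le> 55 / 10000 * (841 / 100)"
          using y1 by (intro mult_right_mono) auto
        finally have "y * (X z - 248 / 100) \<le> 6 / 100" by simp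
        moreover have "y * (3 - X z - 52 / 100) = - (y * (X z - 248 / 100))" by (simp add: right_diff_distrib)
        ultimately show ?thesis by linarith
      qed
      \<comment> \<open>The value for y = 0, up to rounding. It is concave in c with leading
        coefficient -4 z, so the end points c = 0 and c = 1 decide.\<close>
      define f where "f = (\<lambda>c. (2 * c + z) * (148 / 100 - 2 * z * c - z\<^sup>2) + 1193 / 100 * z)"
      have fc: "f c \<ge> c * f 1 + (1 - c) * f 0"
      proof -
        have "f c - (c * f 1 + (1 - c) * f 0) = 4 * z * (c * (1 - c))"
          unfolding f_def power2_eq_square by (simp add: field_simps)
        moreover have "4 * z * (c * (1 - c)) \<ge> 0" using z0 c by simp
        ultimately show ?thesis by linarith
      qed
      have z2: "z\<^sup>2 \<le> 9 / 5 * z" "z ^ 3 \<le> 81 / 25 * z"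
        using mult_right_mono[OF z z0] mult_right_mono[OF zsq z0]
        by (auto simp: power2_eq_square power3_eq_cube)
      have f1: "f 1 \<ge> 6 / 100"
      proof -
        have "f 1 = 296 / 100 + 941 / 100 * z - 4 * z\<^sup>2 - z ^ 3"
          by (simp add: f_def power2_eq_square power3_eq_cube field_simps)
        thus ?thesis using z2 z by argo
      qed
      have f0: "f 0 \<ge> 6 / 100"
      proof -
        have "f 0 = 1341 / 100 * z - z ^ 3" by (simp add: f_def power2_eq_square power3_eq_cube field_simps)
        thus ?thesis using z2 z1 by argo
      qed
      have "c * f 1 + (1 - c) * f 0 \<ge> c * (6 / 100) + (1 - c) * (6 / 100)"
        using f1 f0 c by (intro add_mono mult_left_mono) auto
      hence "f c \<ge> 6 / 100" using fc by argo
      moreover have "(2 * c + z + y) * (3 - X z - 52 / 100) + 1193 / 100 * z = f c + y * (3 - X z - 52 / 100)"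
        by (simp add: f_def X_def power2_eq_square field_simps)
      ultimately show ?thesis using yb by linarith
    qed
    ultimately show ?thesis unfolding G_def using second by linarith
  qed
  have "(4 * X z - 3 + 12 * z\<^sup>2) * X y ^ 2 - (4 * X y - 3 + 12 * y\<^sup>2) * X z ^ 2 = (z - y) * G"
    unfolding G_def X_def by (simp add: power2_eq_square algebra_simps)
  moreover have "(z - y) * G \<ge> 0" using y G by simp
  ultimately show ?thesis by linarith
qed

section \<open>Green functions of a single zero\<close>

definition gnum :: "complex \<Rightarrow> real \<Rightarrow> real" where
  "gnum \<xi> w = 1 - 2 * w * Re \<xi> + w\<^sup>2 * (norm \<xi>)\<^sup>2"

definition gden :: "complex \<Rightarrow> real \<Rightarrow> real" where
  "gden \<xi> w = (norm \<xi>)\<^sup>2 - 2 * w * Re \<xi> + w\<^sup>2"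

lemma gnum_gden:
  "(norm (1 - of_real w * \<xi>))\<^sup>2 = gnum \<xi> w" "(norm (of_real w - \<xi>))\<^sup>2 = gden \<xi> w"
  unfolding gnum_def gden_def cmod_power2 by (simp_all add: power2_eq_square algebra_simps)

lemma gnum_gden_pos:
  assumes "Re \<xi> \<le> 0" "w \<ge> 0"
  shows "gnum \<xi> w \<ge> 1" "w > 0 \<Longrightarrow> gden \<xi> w > 0"
proof -
  have "w * Re \<xi> \<le> 0" using assms by (simp add: mult_nonneg_nonpos)
  moreover have "0 \<le> w\<^sup>2 * (norm \<xi>)\<^sup>2" by simp
  ultimately show "gnum \<xi> w \<ge> 1" unfolding gnum_def by argo
  assume "w > 0"
  hence "w\<^sup>2 > 0" by simp
  moreover have "0 \<le> (norm \<xi>)\<^sup>2" by simp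
  ultimately show "gden \<xi> w > 0" unfolding gden_def using \<open>w * Re \<xi> \<le> 0\<close> by argo
qed

lemma green_eq:
  assumes "Re \<xi> \<le> 0" "w > 0"
  shows "green \<xi> w = (ln (gnum \<xi> w) - ln (gden \<xi> w)) / 2"
proof -
  have "(norm (1 - of_real w * \<xi>))\<^sup>2 > 0" "(norm (of_real w - \<xi>))\<^sup>2 > 0"
    unfolding gnum_gden using gnum_gden_pos[OF assms(1), of w] assms(2) by linarith+
  hence n: "norm (1 - of_real w * \<xi>) > 0" and d: "norm (of_real w - \<xi>) > 0"
    by auto
  have "ln (gnum \<xi> w) = 2 * ln (norm (1 - of_real w * \<xi>))"
    unfolding gnum_gden(1)[symmetric] using n by (subst ln_realpow) auto
  moreover have "ln (gden \<xi> w) = 2 * ln (norm (of_real w - \<xi>))"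
    unfolding gnum_gden(2)[symmetric] using d by (subst ln_realpow) auto
  ultimately have "green \<xi> w = (ln (gnum \<xi> w) - ln (gden \<xi> w)) / 2"
    using n d by (simp add: green_def ln_div)
  thus ?thesis .
qed

lemma green_0: "\<xi> \<noteq> 0 \<Longrightarrow> green \<xi> 0 = - ln (norm \<xi>)"
  by (simp add: green_def ln_div)

lemma green_ratio:
  assumes "Re \<xi> \<le> 0" "norm \<xi> \<le> 1" "0 < e"
  shows "gden \<xi> e * gnum \<xi> (4 * e) \<le> gden \<xi> (4 * e) * gnum \<xi> e"
proof -
  define a where "a = - Re \<xi>"
  define q where "q = (norm \<xi>)\<^sup>2"
  have a: "a \<ge> 0" using assms by (simp add: a_def)
  have q: "0 \<le> q" "q \<le> 1" using assms(2) by (auto simp: q_def power_le_one)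
  have A: "gden \<xi> w = q + 2 * w * a + w\<^sup>2" and D: "gnum \<xi> w = 1 + 2 * w * a + w\<^sup>2 * q" for w
    by (simp_all add: gden_def gnum_def a_def q_def)
  have "gden \<xi> (4 * e) * gnum \<xi> e - gden \<xi> e * gnum \<xi> (4 * e)
     = (1 - q) * (6 * e * a + 15 * e\<^sup>2 * (1 + q) + 24 * e ^ 3 * a)"
    unfolding A D by (simp add: power2_eq_square power3_eq_cube algebra_simps)
  moreover have "(1 - q) * (6 * e * a + 15 * e\<^sup>2 * (1 + q) + 24 * e ^ 3 * a) \<ge> 0"
    using a q assms(3) by simp
  ultimately show ?thesis by linarith
qed

lemma green_decreasing:
  assumes "Re \<xi> \<le> 0" "norm \<xi> \<le> 1" "0 < e"
  shows "green \<xi> (4 * e) \<le> green \<xi> e"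
proof -
  have "gden \<xi> e > 0" "gden \<xi> (4 * e) > 0" "gnum \<xi> e > 0" "gnum \<xi> (4 * e) > 0"
    using gnum_gden_pos[OF assms(1), of e] gnum_gden_pos[OF assms(1), of "4 * e"] assms by auto
  moreover from this have "ln (gden \<xi> e * gnum \<xi> (4 * e)) \<le> ln (gden \<xi> (4 * e) * gnum \<xi> e)"
    using green_ratio[OF assms] by (intro ln_mono) auto
  ultimately have "ln (gden \<xi> e) + ln (gnum \<xi> (4 * e)) \<le> ln (gden \<xi> (4 * e)) + ln (gnum \<xi> e)"
    by (simp add: ln_mult)
  thus ?thesis using green_eq[OF assms(1), of e] green_eq[OF assms(1), of "4 * e"] assms by simp
qed

text \<open>The inequality 2 g(e) - g(4e) - g(0) \<ge> 0 for the Green function, exponentiated and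
  cleared of denominators. The factor 9/5 is the range of z in
  \<open>green_polynomial\<close>.\<close>

lemma green_zero_far:
  assumes \<xi>: "Re \<xi> \<le> 0" "norm \<xi> \<le> 1" and e: "0 < e" "e \<le> 37 / 500" and far: "e \<le> 9 / 5 * norm \<xi>"
  shows "(gden \<xi> e)\<^sup>2 * gnum \<xi> (4 * e) \<le> (norm \<xi>)\<^sup>2 * gden \<xi> (4 * e) * (gnum \<xi> e)\<^sup>2"
proof -
  define d where "d = norm \<xi>"
  have d: "d > 0" "d \<le> 1" unfolding d_def using far e \<xi> by argo+
  define c where "c = - Re \<xi> / d"
  have "- Re \<xi> \<le> d" using abs_Re_le_cmod[of \<xi>] by (simp add: d_def)
  hence c: "0 \<le> c" "c \<le> 1" using \<xi> d by (auto simp: c_def field_simps)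
  define z where "z = e / d"
  define y where "y = e * d"
  have zy: "z * y = e\<^sup>2" using d by (simp add: z_def y_def power2_eq_square)
  have "e\<^sup>2 \<le> (37 / 500)\<^sup>2" using e by (intro power_mono) auto
  hence zy': "z * y \<le> 55 / 10000" unfolding zy by (simp add: power2_eq_square)
  have ye: "y \<le> e" using d e by (simp add: y_def mult_left_le)
  have "e * d \<le> e * (1 / d)" using d e by (intro mult_left_mono) (auto simp: field_simps mult_le_one)
  hence yz: "y \<le> z" by (simp add: y_def z_def)
  have z: "z \<le> 9 / 5" using far d by (simp add: z_def d_def[symmetric] field_simps)
  define X where "X = (\<lambda>u::real. 1 + 2 * u * c + u\<^sup>2)"
  have P: "(4 * X y - 3 + 12 * y\<^sup>2) * X z ^ 2 \<le> (4 * X z - 3 + 12 * z\<^sup>2) * X y ^ 2"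
  proof -
    have "0 \<le> y" using e d by (simp add: y_def)
    have "y \<le> 37 / 500" using ye e(2) by linarith
    from green_polynomial[OF c \<open>0 \<le> y\<close> yz this z zy'] show ?thesis unfolding X_def .
  qed
  have dc: "d * c = - Re \<xi>" using d by (simp add: c_def)
  have 1: "gnum \<xi> e = X y"
    by (simp add: gnum_def X_def y_def d_def[symmetric] power_mult_distrib dc mult.assoc)
  have 2: "gnum \<xi> (4 * e) = 4 * X y - 3 + 12 * y\<^sup>2"
    by (simp add: gnum_def X_def y_def d_def[symmetric] power_mult_distrib dc mult.assoc)
  have 3: "gden \<xi> e = d\<^sup>2 * X z"
  proof -
    have "d\<^sup>2 * X z = d\<^sup>2 + 2 * (d * z) * (d * c) + (d * z)\<^sup>2" by (simp add: X_def power2_eq_square algebra_simps)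
    also have "d * z = e" using d by (simp add: z_def)
    finally show ?thesis by (simp add: gden_def d_def[symmetric] dc)
  qed
  have 4: "gden \<xi> (4 * e) = d\<^sup>2 * (4 * X z - 3 + 12 * z\<^sup>2)"
  proof -
    have "d\<^sup>2 * (4 * X z - 3 + 12 * z\<^sup>2) = d\<^sup>2 + 8 * (d * z) * (d * c) + 16 * (d * z)\<^sup>2" by (simp add: X_def power2_eq_square algebra_simps)
    also have "d * z = e" using d by (simp add: z_def)
    finally show ?thesis by (simp add: gden_def d_def[symmetric] dc power2_eq_square)
  qed
  have "(gden \<xi> e)\<^sup>2 * gnum \<xi> (4 * e) = d ^ 4 * ((4 * X y - 3 + 12 * y\<^sup>2) * X z ^ 2)"
    unfolding 2 3 by (simp add: power2_eq_square power4_eq_xxxx mult_ac)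
  also have "\<dots> \<le> d ^ 4 * ((4 * X z - 3 + 12 * z\<^sup>2) * X y ^ 2)"
    using P d by (intro mult_left_mono) auto
  also have "\<dots> = (norm \<xi>)\<^sup>2 * gden \<xi> (4 * e) * (gnum \<xi> e)\<^sup>2"
    unfolding 1 4 d_def[symmetric] by (simp add: power2_eq_square power4_eq_xxxx mult_ac)
  finally show ?thesis .
qed

text \<open>For zeros inside the disc of radius s the Green function at 0 is replaced by its
  boundary value -ln s. This is the form for zeros within \<alpha> of the centre, whose surplus in
  Jensen's formula supplies the difference.\<close>

lemma green_zero_inner:
  assumes \<xi>: "Re \<xi> \<le> 0" "norm \<xi> \<le> s" and s: "s \<le> 1" and e: "0 < e" "e \<le> 37 / 500" and far: "e \<le> 9 / 5 * s"
  shows "(gden \<xi> e)\<^sup>2 * gnum \<xi> (4 * e) \<le> s\<^sup>2 * gden \<xi> (4 * e) * (gnum \<xi> e)\<^sup>2"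
proof -
  have s0: "s > 0" using far e by argo
  define a where "a = - Re \<xi>"
  define q where "q = (norm \<xi>)\<^sup>2"
  define Q where "Q = s\<^sup>2"
  have a: "0 \<le> a" "a \<le> s" using \<xi> abs_Re_le_cmod[of \<xi>] by (auto simp: a_def)
  have q: "0 \<le> q" "q \<le> Q" "Q \<le> 1"
    using \<xi> s s0 by (auto simp: q_def Q_def power_le_one intro!: power_mono)
  \<comment> \<open>The zero is moved vertically onto the circle of radius s, where
    \<open>green_zero_far\<close> applies. By \<open>m1\<close>, \<open>m2\<close> and
    \<open>m3\<close> the quotient (gden e)^2 gnum (4e) / (gden (4e) (gnum e)^2) grows with
    |\<xi>|^2 when the real part is fixed.\<close>
  define \<eta> where "\<eta> = Complex (- a) (sqrt (Q - a\<^sup>2))"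
  have "a\<^sup>2 \<le> Q" unfolding Q_def using a by (intro power_mono) auto
  hence "(norm \<eta>)\<^sup>2 = s\<^sup>2" by (simp add: \<eta>_def cmod_power2 Q_def)
  hence n\<eta>: "norm \<eta> = s" using s0 by (simp add: power2_eq_iff_nonneg)
  have R: "Re \<eta> = - a" by (simp add: \<eta>_def)
  have F: "(gden \<eta> e)\<^sup>2 * gnum \<eta> (4 * e) \<le> Q * gden \<eta> (4 * e) * (gnum \<eta> e)\<^sup>2"
    using green_zero_far[of \<eta> e] a n\<eta> R s e far by (simp add: Q_def)
  define A where "A = (\<lambda>x w. x + 2 * w * a + w\<^sup>2)"
  define D where "D = (\<lambda>x w. 1 + 2 * w * a + w\<^sup>2 * x)"
  have gq: "gden \<xi> w = A q w" "gnum \<xi> w = D q w" "gden \<eta> w = A Q w" "gnum \<eta> w = D Q w" for w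
    by (simp_all add: gden_def gnum_def A_def D_def q_def Q_def n\<eta> R) (simp_all add: a_def)
  have pos: "A x e > 0" "A x (4 * e) > 0" "D x e > 0" "D x (4 * e) > 0" if "x \<ge> 0" for x
    using that a e by (auto simp: A_def D_def add_nonneg_pos add_pos_nonneg)
  have Q0: "Q \<ge> 0" using q by simp
  note pq = pos[OF q(1)] and pQ = pos[OF Q0]
  have m1: "A q e * A Q (4 * e) \<le> A Q e * A q (4 * e)"
  proof -
    have "A Q e * A q (4 * e) - A q e * A Q (4 * e) = (Q - q) * (6 * e * a + 15 * e\<^sup>2)"
      by (simp add: A_def power2_eq_square algebra_simps)
    moreover have "\<dots> \<ge> 0" using q a e by simp
    ultimately show ?thesis by linarith
  qed
  have m2: "A q e \<le> A Q e" using q by (simp add: A_def)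
  have m3: "D q (4 * e) * (D Q e)\<^sup>2 \<le> D Q (4 * e) * (D q e)\<^sup>2"
  proof -
    define b where "b = 1 + 2 * e * a"
    have b: "b \<ge> 1" using a e by (simp add: b_def)
    have e2: "e\<^sup>2 \<le> 1" using e by (simp add: power_le_one)
    have "D Q (4 * e) * (D q e)\<^sup>2 - D q (4 * e) * (D Q e)\<^sup>2 =
       (Q - q) * e\<^sup>2 * (16 * b\<^sup>2 - 2 * b * (4 * b - 3) - e\<^sup>2 * (4 * b - 3) * (Q + q) - 16 * (e\<^sup>2)\<^sup>2 * Q * q)"
      by (simp add: D_def b_def power2_eq_square algebra_simps)
    moreover have "16 * b\<^sup>2 - 2 * b * (4 * b - 3) - e\<^sup>2 * (4 * b - 3) * (Q + q) - 16 * (e\<^sup>2)\<^sup>2 * Q * q \<ge> 0"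
    proof -
      have "e\<^sup>2 \<le> (1 / 10)\<^sup>2" using e by (intro power_mono) auto
      hence e2: "e\<^sup>2 \<le> 1 / 100" by (simp add: power2_eq_square)
      have "e\<^sup>2 * (4 * b - 3) * (Q + q) \<le> 1 / 100 * (4 * b) * 2"
        using e2 b q by (intro mult_mono) auto
      moreover have "16 * (e\<^sup>2)\<^sup>2 * Q * q \<le> 16 * 1\<^sup>2 * 1 * 1 / 1000"
      proof -
        have "(e\<^sup>2)\<^sup>2 \<le> (1 / 100)\<^sup>2" using e2 by (intro power_mono) auto
        moreover have "Q * q \<le> 1" using q by (simp add: mult_le_one)
        ultimately have "(e\<^sup>2)\<^sup>2 * (Q * q) \<le> (1 / 100)\<^sup>2 * 1" using q by (intro mult_mono) auto
        also have "(1 / 100)\<^sup>2 * 1 = (1 / 10000 :: real)" by (simp add: power2_eq_square)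
        finally have "16 * ((e\<^sup>2)\<^sup>2 * (Q * q)) \<le> 16 * 1\<^sup>2 * 1 * 1 / 1000" unfolding one_power2 by argo
        thus ?thesis by (simp only: mult.assoc)
      qed
      moreover have "b\<^sup>2 \<ge> b" using b by (simp add: power2_eq_square)
      moreover have "16 * b\<^sup>2 - 2 * b * (4 * b - 3) = 8 * b\<^sup>2 + 6 * b" by (simp add: power2_eq_square algebra_simps)
      ultimately show ?thesis using b unfolding one_power2 by linarith
    qed
    hence "(Q - q) * e\<^sup>2 * (16 * b\<^sup>2 - 2 * b * (4 * b - 3) - e\<^sup>2 * (4 * b - 3) * (Q + q) - 16 * (e\<^sup>2)\<^sup>2 * Q * q) \<ge> 0"
      using q by (intro mult_nonneg_nonneg) auto
    ultimately show ?thesis by linarith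
  qed
  have "((A q e)\<^sup>2 * D q (4 * e)) * (A Q (4 * e) * (D Q e)\<^sup>2) = (A q e * A Q (4 * e)) * A q e * (D q (4 * e) * (D Q e)\<^sup>2)"
    by (simp add: power2_eq_square mult_ac)
  also have "\<dots> \<le> (A Q e * A q (4 * e)) * A Q e * (D Q (4 * e) * (D q e)\<^sup>2)"
    by (rule mult_mono[OF mult_mono[OF m1 m2] m3]) (use pq pQ in \<open>auto intro: mult_nonneg_nonneg less_imp_le\<close>)
  also have "\<dots> = (A q (4 * e) * (D q e)\<^sup>2) * ((A Q e)\<^sup>2 * D Q (4 * e))"
    by (simp add: power2_eq_square mult_ac)
  also have "\<dots> \<le> (A q (4 * e) * (D q e)\<^sup>2) * (Q * A Q (4 * e) * (D Q e)\<^sup>2)"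
    using F[unfolded gq] pq by (intro mult_left_mono) auto
  finally have "((A q e)\<^sup>2 * D q (4 * e)) * (A Q (4 * e) * (D Q e)\<^sup>2) \<le> (Q * A q (4 * e) * (D q e)\<^sup>2) * (A Q (4 * e) * (D Q e)\<^sup>2)"
    by (simp add: mult_ac)
  moreover have "A Q (4 * e) * (D Q e)\<^sup>2 > 0" using pQ by simp
  ultimately have "(A q e)\<^sup>2 * D q (4 * e) \<le> Q * A q (4 * e) * (D q e)\<^sup>2" by (simp only: mult_le_cancel_right_pos)
  thus ?thesis unfolding gq Q_def .
qed

lemma green_combination_far:
  assumes \<xi>: "Re \<xi> \<le> 0" "norm \<xi> \<le> 1" and e: "0 < e" "e \<le> 37 / 500" and far: "e \<le> 9 / 5 * norm \<xi>"
  shows "2 * green \<xi> e - green \<xi> (4 * e) - green \<xi> 0 \<ge> 0"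
proof -
  have n0: "norm \<xi> > 0" using far e by argo
  have pos: "gden \<xi> e > 0" "gden \<xi> (4 * e) > 0" "gnum \<xi> e > 0" "gnum \<xi> (4 * e) > 0"
    using gnum_gden_pos[OF \<xi>(1), of e] gnum_gden_pos[OF \<xi>(1), of "4 * e"] e by auto
  have "ln ((gden \<xi> e)\<^sup>2 * gnum \<xi> (4 * e)) \<le> ln ((norm \<xi>)\<^sup>2 * gden \<xi> (4 * e) * (gnum \<xi> e)\<^sup>2)"
    using green_zero_far[OF assms] pos by (intro ln_mono) auto
  hence "2 * ln (gden \<xi> e) + ln (gnum \<xi> (4 * e)) \<le> 2 * ln (norm \<xi>) + ln (gden \<xi> (4 * e)) + 2 * ln (gnum \<xi> e)"
    using pos n0 by (simp add: ln_mult ln_realpow)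
  thus ?thesis using green_eq[OF \<xi>(1), of e] green_eq[OF \<xi>(1), of "4 * e"] green_0[of \<xi>] n0 e by simp
qed

lemma green_combination_inner:
  assumes \<xi>: "Re \<xi> \<le> 0" "norm \<xi> \<le> s" and s: "s \<le> 1" and e: "0 < e" "e \<le> 37 / 500" and far: "e \<le> 9 / 5 * s"
  shows "2 * green \<xi> e - green \<xi> (4 * e) + ln s \<ge> 0"
proof -
  have n0: "s > 0" using far e by argo
  have pos: "gden \<xi> e > 0" "gden \<xi> (4 * e) > 0" "gnum \<xi> e > 0" "gnum \<xi> (4 * e) > 0"
    using gnum_gden_pos[OF \<xi>(1), of e] gnum_gden_pos[OF \<xi>(1), of "4 * e"] e by auto
  have "ln ((gden \<xi> e)\<^sup>2 * gnum \<xi> (4 * e)) \<le> ln (s\<^sup>2 * gden \<xi> (4 * e) * (gnum \<xi> e)\<^sup>2)"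
    using green_zero_inner[OF assms] pos by (intro ln_mono) auto
  hence "2 * ln (gden \<xi> e) + ln (gnum \<xi> (4 * e)) \<le> 2 * ln s + ln (gden \<xi> (4 * e)) + 2 * ln (gnum \<xi> e)"
    using pos n0 by (simp add: ln_mult ln_realpow)
  thus ?thesis using green_eq[OF \<xi>(1), of e] green_eq[OF \<xi>(1), of "4 * e"] e by simp
qed

text \<open>The extreme case is a negative real \<xi> with |\<xi>| = 5 e / 9. There gden at e is
  (14/9)^2 e^2, about 2.42 e^2, and gden at 4e is (41/9)^2 e^2, more than 8.57 times as
  large.\<close>

lemma gnum_gden_near:
  assumes \<xi>: "Re \<xi> \<le> 0" and e: "0 < e" "e \<le> 37 / 500" and near: "9 / 5 * norm \<xi> \<le> e"
  shows "857 / 100 * gden \<xi> e \<le> gden \<xi> (4 * e)" "gnum \<xi> (4 * e) \<le> 102 / 100 * gnum \<xi> e"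
    and "gden \<xi> e \<le> 242 / 100 * e\<^sup>2"
proof -
  define a where "a = - Re \<xi>"
  define q where "q = (norm \<xi>)\<^sup>2"
  have n: "norm \<xi> \<le> 5 / 9 * e" using near by simp
  have a: "0 \<le> a" "a \<le> 5 / 9 * e" using \<xi> abs_Re_le_cmod[of \<xi>] n by (auto simp: a_def)
  have "q \<le> (5 / 9 * e)\<^sup>2" unfolding q_def using n by (intro power_mono) auto
  hence q: "0 \<le> q" "q \<le> 25 / 81 * e\<^sup>2" by (auto simp: q_def power_mult_distrib power2_eq_square)
  have ea: "e * a \<le> 5 / 9 * e\<^sup>2" "0 \<le> e * a"
    using mult_left_mono[OF a(2), of e] a e by (auto simp: power2_eq_square)
  have e2: "e\<^sup>2 \<le> 55 / 10000" "0 \<le> e\<^sup>2"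
    using power_mono[OF e(2), of 2] e by (auto simp: power2_eq_square)
  have A: "gden \<xi> w = q + 2 * w * a + w\<^sup>2" and D: "gnum \<xi> w = 1 + 2 * w * a + w\<^sup>2 * q" for w
    by (simp_all add: gden_def gnum_def a_def q_def)
  have A1: "gden \<xi> e = q + 2 * (e * a) + e\<^sup>2" and A4: "gden \<xi> (4 * e) = q + 8 * (e * a) + 16 * e\<^sup>2"
    by (simp_all add: A power2_eq_square)
  show "857 / 100 * gden \<xi> e \<le> gden \<xi> (4 * e)" unfolding A1 A4 using ea q by argo
  show "gden \<xi> e \<le> 242 / 100 * e\<^sup>2" unfolding A1 using ea q by argo
  have "e\<^sup>2 * q \<le> 55 / 10000 * (25 / 81 * (55 / 10000))" using e2 q by (intro mult_mono) auto
  moreover have "0 \<le> e\<^sup>2 * q" using q by simp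
  moreover have D1: "gnum \<xi> e = 1 + 2 * (e * a) + e\<^sup>2 * q" and D4: "gnum \<xi> (4 * e) = 1 + 8 * (e * a) + 16 * (e\<^sup>2 * q)"
    by (simp_all add: D power2_eq_square)
  ultimately show "gnum \<xi> (4 * e) \<le> 102 / 100 * gnum \<xi> e" unfolding D1 D4 using ea e2 by argo
qed

text \<open>The constant comes from 8.57 / 1.02 > 8.4.\<close>

lemma green_difference_near:
  assumes \<xi>: "Re \<xi> \<le> 0" and e: "0 < e" "e \<le> 37 / 500" and near: "9 / 5 * norm \<xi> \<le> e"
  shows "2 * (green \<xi> e - green \<xi> (4 * e)) \<ge> ln (84 / 10)"
proof -
  have pos: "gden \<xi> e > 0" "gden \<xi> (4 * e) > 0" "gnum \<xi> e > 0" "gnum \<xi> (4 * e) > 0"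
    using gnum_gden_pos[OF \<xi>, of e] gnum_gden_pos[OF \<xi>, of "4 * e"] e by auto
  note nb = gnum_gden_near[OF assms]
  have "84 / 10 * (gden \<xi> e * gnum \<xi> (4 * e)) \<le> 84 / 10 * (gden \<xi> e * (102 / 100 * gnum \<xi> e))"
    using nb pos by (intro mult_left_mono) auto
  also have "\<dots> \<le> (857 / 100 * gden \<xi> e) * gnum \<xi> e" using pos by simp
  also have "\<dots> \<le> gden \<xi> (4 * e) * gnum \<xi> e" using nb pos by (intro mult_right_mono) auto
  finally have "ln (84 / 10 * (gden \<xi> e * gnum \<xi> (4 * e))) \<le> ln (gden \<xi> (4 * e) * gnum \<xi> e)"
    using pos by (intro ln_mono) auto
  hence "ln (84 / 10) + ln (gden \<xi> e) + ln (gnum \<xi> (4 * e)) \<le> ln (gden \<xi> (4 * e)) + ln (gnum \<xi> e)"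
    using pos by (simp only: ln_mult mult_pos_pos) (simp add: add.assoc ln_mult)
  thus ?thesis using green_eq[OF \<xi>, of e] green_eq[OF \<xi>, of "4 * e"] e by simp
qed

text \<open>A zero this close makes the Green function at 0 large, so its logarithm stays explicit
  instead of being bounded. The constant comes from 8.57 / (2.42 * 1.02) > 3.47.\<close>

lemma green_combination_near:
  assumes \<xi>: "Re \<xi> \<le> 0" "\<xi> \<noteq> 0" and e: "0 < e" "e \<le> 37 / 500" and near: "9 / 5 * norm \<xi> \<le> e"
  shows "2 * green \<xi> e - green \<xi> (4 * e) - green \<xi> 0 \<ge> ln (347 / 100) / 2 + ln (norm \<xi>) - ln e"
proof -
  have pos: "gden \<xi> e > 0" "gden \<xi> (4 * e) > 0" "gnum \<xi> e \<ge> 1" "gnum \<xi> (4 * e) > 0"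
    using gnum_gden_pos[OF \<xi>(1), of e] gnum_gden_pos[OF \<xi>(1), of "4 * e"] e by auto
  have n0: "norm \<xi> > 0" using \<xi> by simp
  note nb = gnum_gden_near[OF \<xi>(1) e near]
  have "347 / 100 * ((gden \<xi> e)\<^sup>2 * gnum \<xi> (4 * e)) \<le> 347 / 100 * ((gden \<xi> e * (242 / 100 * e\<^sup>2)) * (102 / 100 * gnum \<xi> e))"
    unfolding power2_eq_square[of "gden \<xi> e"] using nb pos by (intro mult_left_mono mult_mono) auto
  also have "\<dots> \<le> (857 / 100 * gden \<xi> e) * e\<^sup>2 * gnum \<xi> e" using pos e by (simp add: mult_ac)
  also have "\<dots> \<le> gden \<xi> (4 * e) * e\<^sup>2 * (gnum \<xi> e)\<^sup>2"
    using nb pos e by (intro mult_mono) (auto simp: power2_eq_square)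
  finally have "ln (347 / 100 * ((gden \<xi> e)\<^sup>2 * gnum \<xi> (4 * e))) \<le> ln (gden \<xi> (4 * e) * e\<^sup>2 * (gnum \<xi> e)\<^sup>2)"
    using pos by (intro ln_mono) auto
  hence "ln (347 / 100) + 2 * ln (gden \<xi> e) + ln (gnum \<xi> (4 * e)) \<le> ln (gden \<xi> (4 * e)) + 2 * ln e + 2 * ln (gnum \<xi> e)"
    using pos e ln_mult[of "347 / 100" "(gden \<xi> e)\<^sup>2 * gnum \<xi> (4 * e)"] by (simp add: ln_mult ln_realpow)
  thus ?thesis using green_eq[OF \<xi>(1), of e] green_eq[OF \<xi>(1), of "4 * e"] green_0[OF \<xi>(2)] e by simp
qed

section \<open>Numerical bounds from Euler--Maclaurin summation\<close>

lemma ln_numeric_bounds: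
  shows "ln 2 \<ge> (693 / 1000 :: real)" "ln 2 \<le> (6945 / 10000 :: real)"
    and "ln (8 / 3) \<ge> (98 / 100 :: real)" "ln (39 / 20) \<ge> (2 / 3 :: real)"
    and "ln (273 / 100) \<le> (102 / 100 :: real)"
proof -
  show l2: "ln 2 \<ge> (693 / 1000 :: real)" "ln 2 \<le> (6945 / 10000 :: real)"
    using ln_approx_bounds[of 2 3, simplified, simplified eval_nat_numeral, simplified] ln2_le_25_over_36
    by auto
  have "ln (4 / 3) \<ge> (287 / 1000 :: real)"
    using ln_approx_bounds[of "4 / 3" 2, simplified, simplified eval_nat_numeral, simplified] by auto
  moreover have "ln (8 / 3) = ln 2 + ln (4 / 3 :: real)" using ln_mult[of 2 "4 / 3 :: real"] by simp
  ultimately show "ln (8 / 3) \<ge> (98 / 100 :: real)" using l2 by simp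
  show "ln (39 / 20) \<ge> (2 / 3 :: real)"
    using ln_approx_bounds[of "39 / 20" 3, simplified, simplified eval_nat_numeral, simplified] by auto
  show "ln (273 / 100) \<le> (102 / 100 :: real)"
    using ln_approx_bounds[of "273 / 100" 3, simplified, simplified eval_nat_numeral, simplified]
    by (simp add: power_divide)
qed

lemma exp_two_thirds_le: "exp (2 / 3) \<le> (39 / 20 :: real)"
  using ln_numeric_bounds(4) by (subst ln_ge_iff[symmetric]) auto

lemma ln_8_ge: "ln 8 \<ge> (2079 / 1000 :: real)"
proof -
  have "ln (8::real) = 3 * ln 2" using ln_realpow[of 2 3] by simp
  thus ?thesis using ln_numeric_bounds(1) by argo
qed

lemma ln_4_bounds: "ln 4 \<ge> (1386 / 1000 :: real)" "ln 4 \<le> (1389 / 1000 :: real)"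
proof -
  have "ln (4::real) = 2 * ln 2" using ln_realpow[of 2 2] by simp
  thus "ln 4 \<ge> (1386 / 1000 :: real)" "ln 4 \<le> (1389 / 1000 :: real)" using ln_numeric_bounds(1,2) by argo+
qed

lemma cmod_Complex_le: "0 \<le> c \<Longrightarrow> a\<^sup>2 + b\<^sup>2 \<le> c\<^sup>2 \<Longrightarrow> cmod (Complex a b) \<le> c"
  by (simp add: complex_norm real_le_lsqrt)

lemma norm_of_nat_powr: "k \<ge> 1 \<Longrightarrow> norm (of_nat k powr z :: complex) = real k powr Re z"
  by (subst norm_powr_real_powr) auto

lemma harm_le_ln: "n \<ge> 1 \<Longrightarrow> harm n \<le> 1 + ln (real n)"
  using euler_mascheroni_sequence_decreasing[of 1 n] by (simp add: harm_expand)

text \<open>Euler-Maclaurin summation with N about t / 4. Each term is at most a constant times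
  \<open>M\<close>, except for the Dirichlet polynomial, which is compared with a harmonic sum and
  yields the logarithm.\<close>

lemma zeta_strip_bound:
  fixes t \<tau> \<sigma> :: real
  assumes t: "8 \<le> t" "\<bar>\<tau> - t\<bar> \<le> 2" and \<sigma>: "-1 \<le> \<sigma>" "\<sigma> \<le> 2"
  shows "norm (zeta (Complex \<sigma> \<tau>)) \<le> (ln t + 27 / 20) * (3 * t / 8) powr max (1 - \<sigma>) 0"
proof -
  define s where "s = Complex \<sigma> \<tau>"
  define m where "m = max (1 - \<sigma>) 0"
  \<comment> \<open>With this cut N < t/4 + 1, which is at most 3t/8 from t = 8 on.\<close>
  define N where "N = nat \<lceil>t / 4\<rceil>"
  have N: "t / 4 \<le> real N" "real N < t / 4 + 1" using t by (auto simp: N_def) linarith+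
  have N2: "real N \<ge> 2" and N38: "real N \<le> 3 * t / 8" using N t by argo+
  have N2': "N \<ge> 2" using N2 by simp
  define M where "M = real N powr m"
  have m: "m \<ge> 0" "1 - \<sigma> \<le> m" by (auto simp: m_def)
  have M: "M > 0" using N2 by (simp add: M_def)
  have bd: "real k powr (1 - \<sigma> - j) \<le> M / real k powr j" if "1 \<le> k" "k \<le> N" for k :: nat and j :: real
  proof -
    have "real k powr (1 - \<sigma> - j) = real k powr (1 - \<sigma>) / real k powr j" by (simp add: powr_diff)
    moreover have "real k powr (1 - \<sigma>) \<le> real k powr m" using that m by (intro powr_mono) auto
    moreover have "\<dots> \<le> M" unfolding M_def using that m by (intro powr_mono2) auto
    ultimately show ?thesis by (auto intro!: divide_right_mono)
  qed
  have \<tau>: "\<bar>\<tau>\<bar> \<ge> 6" "\<bar>\<tau>\<bar> \<le> 5 / 4 * t" using t by auto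
  have "\<bar>\<tau>\<bar>\<^sup>2 \<le> (5 / 4 * t)\<^sup>2" using \<tau> by (intro power_mono) auto
  hence \<tau>2: "\<tau>\<^sup>2 \<le> 25 / 16 * t\<^sup>2" by (simp add: power_mult_distrib power2_eq_square)
  have t2: "t\<^sup>2 \<ge> 64" using power_mono[of 8 t 2] t by simp
  have s0: "norm s \<le> 1275 / 1000 * t"
  proof -
    have "\<bar>\<sigma>\<bar>\<^sup>2 \<le> 2\<^sup>2" using \<sigma> by (intro power_mono) auto
    hence "\<sigma>\<^sup>2 + \<tau>\<^sup>2 \<le> (1275 / 1000 * t)\<^sup>2" using \<tau>2 t2 by (simp add: power_mult_distrib power2_eq_square)
    thus ?thesis unfolding s_def using t by (intro cmod_Complex_le) auto
  qed
  have s1: "norm (s + 1) \<le> 1306 / 1000 * t"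
  proof -
    have "\<bar>\<sigma> + 1\<bar>\<^sup>2 \<le> 3\<^sup>2" using \<sigma> by (intro power_mono) auto
    hence a: "(\<sigma> + 1)\<^sup>2 \<le> 9" by simp
    have "(1306 / 1000 * t)\<^sup>2 = 1705636 / 1000000 * t\<^sup>2" by (simp add: power_mult_distrib power2_eq_square)
    hence "(\<sigma> + 1)\<^sup>2 + \<tau>\<^sup>2 \<le> (1306 / 1000 * t)\<^sup>2" using a \<tau>2 t2 by argo
    moreover have e: "s + 1 = Complex (\<sigma> + 1) \<tau>" by (simp add: s_def complex_eq_iff)
    ultimately show ?thesis unfolding e using t by (intro cmod_Complex_le) auto
  qed
  \<comment> \<open>The factor \<sigma> + 2 is kept so that it cancels the denominator in
    \<open>zeta_error_bound\<close>.\<close>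
  have s2: "norm (s + 2) \<le> 1257 / 1000 * t * (\<sigma> + 2)"
  proof -
    have p: "(\<sigma> + 2)\<^sup>2 \<ge> 1" using power_mono[of 1 "\<sigma> + 2" 2] \<sigma> by simp
    define W where "W = (\<sigma> + 2)\<^sup>2 * t\<^sup>2"
    have "(\<sigma> + 2)\<^sup>2 * 64 \<le> W" unfolding W_def using t2 by (intro mult_left_mono) auto
    moreover have "1 * t\<^sup>2 \<le> W" unfolding W_def using p by (intro mult_right_mono) auto
    moreover have "0 \<le> W" by (simp add: W_def)
    ultimately have "(\<sigma> + 2)\<^sup>2 + \<tau>\<^sup>2 \<le> 1580049 / 1000000 * W" using \<tau>2 by linarith
    also have "\<dots> = (1257 / 1000 * t * (\<sigma> + 2))\<^sup>2"
      by (simp only: W_def power_mult_distrib) (simp add: power2_eq_square)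
    finally have "(\<sigma> + 2)\<^sup>2 + \<tau>\<^sup>2 \<le> (1257 / 1000 * t * (\<sigma> + 2))\<^sup>2" .
    moreover have e: "s + 2 = Complex (\<sigma> + 2) \<tau>" by (simp add: s_def complex_eq_iff)
    ultimately show ?thesis unfolding e using t \<sigma> by (intro cmod_Complex_le) auto
  qed
  have sne: "s \<noteq> 1" using \<tau> by (auto simp: s_def complex_eq_iff)
  have EM: "zeta s = (\<Sum>k\<in>{1..<N}. of_nat k powr (- s)) + of_nat N powr (1 - s) / (s - 1) +
     of_nat N powr (- s) / 2 + s * of_nat N powr (- s - 1) / 12
     - s * (s + 1) * (s + 2) * psum bern3 N (s + 3)"
    using N2' \<sigma> sne by (intro zeta_euler_maclaurin) (auto simp: s_def)
  have A1: "norm (\<Sum>k\<in>{1..<N}. of_nat k powr (- s)) \<le> M * (1 + ln (t / 4))"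
  proof -
    have "norm (\<Sum>k\<in>{1..<N}. of_nat k powr (- s)) \<le> (\<Sum>k\<in>{1..<N}. M / real k)"
    proof (rule sum_norm_le)
      fix k assume k: "k \<in> {1..<N}"
      have "norm (of_nat k powr (- s) :: complex) = real k powr (1 - \<sigma> - 1)"
        using k by (subst norm_of_nat_powr) (auto simp: s_def)
      also have "\<dots> \<le> M / real k powr 1" using k by (intro bd) auto
      finally show "norm (of_nat k powr (- s) :: complex) \<le> M / real k" using k by simp
    qed
    also have "\<dots> = M * harm (N - 1)"
    proof -
      have "{1..<N} = {1..N - 1}" using N2' by auto
      thus ?thesis by (simp add: harm_def sum_distrib_left divide_inverse)
    qed
    also have "\<dots> \<le> M * (1 + ln (t / 4))"
    proof (intro mult_left_mono)
      have "harm (N - 1) \<le> 1 + ln (real (N - 1))" using N2' by (intro harm_le_ln) auto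
      also have "ln (real (N - 1)) \<le> ln (t / 4)"
        using N2' N by (intro ln_mono) (auto simp: of_nat_diff)
      finally show "harm (N - 1) \<le> 1 + ln (t / 4)" by simp
    qed (use M in auto)
    finally show ?thesis .
  qed
  have A2: "norm (of_nat N powr (1 - s) / (s - 1)) \<le> M * (1 / 6)"
  proof -
    have "norm (s - 1) \<ge> 6" using abs_Im_le_cmod[of "s - 1"] \<tau> by (simp add: s_def)
    moreover have "norm (of_nat N powr (1 - s) :: complex) \<le> M"
      using bd[of N 0] N2' by (subst norm_of_nat_powr) (auto simp: s_def)
    ultimately have "norm (of_nat N powr (1 - s) :: complex) / norm (s - 1) \<le> M / 6"
      using M by (intro frac_le) auto
    thus ?thesis by (simp add: norm_divide)
  qed
  have A3: "norm (of_nat N powr (- s) / 2 :: complex) \<le> M * (1 / 4)"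
  proof -
    have "norm (of_nat N powr (- s) :: complex) \<le> M / real N"
      using bd[of N 1] N2' by (subst norm_of_nat_powr) (auto simp: s_def)
    also have "\<dots> \<le> M / 2" using M N2 by (intro divide_left_mono) auto
    finally show ?thesis by (simp add: norm_divide)
  qed
  have A4: "norm (s * of_nat N powr (- s - 1) / 12 :: complex) \<le> M * (2125 / 10000)"
  proof -
    have e: "1 - \<sigma> - 2 = Re (- s - 1)" by (simp add: s_def)
    have "norm (of_nat N powr (- s - 1) :: complex) \<le> M / real N powr 2"
      using bd[of N 2, unfolded e] N2' by (subst norm_of_nat_powr) auto
    also have "\<dots> \<le> M / ((t / 4) * 2)"
    proof (intro divide_left_mono)
      have "(t / 4) * 2 \<le> real N * real N" using N N2 by (intro mult_mono) auto
      also have "\<dots> = real N powr 2" using N2' powr_numeral[of "real N" num.One] by (simp add: power2_eq_square)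
      finally show "(t / 4) * 2 \<le> real N powr 2" .
      show "0 \<le> M" using M by simp
      have "0 < real N powr 2" using N2' by simp
      thus "0 < real N powr 2 * (t / 4 * 2)" using t by (intro mult_pos_pos) auto
    qed
    finally have "norm s * norm (of_nat N powr (- s - 1) :: complex) \<le> (1275 / 1000 * t) * (M / ((t / 4) * 2))"
      using s0 t by (intro mult_mono) auto
    also have "\<dots> = M * (255 / 100)" using t by simp
    finally show ?thesis by (simp add: norm_divide norm_mult)
  qed
  have A5: "norm (s * (s + 1) * (s + 2) * psum bern3 N (s + 3)) \<le> M * (1086 / 1000)"
  proof -
    have N3: "real N powr 3 \<ge> (t / 4) ^ 3"
      using power_mono[OF N(1), of 3] N2 t by (simp add: powr_numeral)
    have "norm (psum bern3 N (s + 3)) \<le> 81 / 10000 * (real N powr (- 2 - Re s) / (Re s + 2))"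
      using N2' \<sigma> by (intro zeta_error_bound) (auto simp: s_def)
    also have "\<dots> \<le> 81 / 10000 * ((M / (t / 4) ^ 3) / (\<sigma> + 2))"
    proof -
      have "real N powr (- 2 - Re s) \<le> M / real N powr 3" using bd[of N 3] N2' by (simp add: s_def)
      also have "\<dots> \<le> M / (t / 4) ^ 3" using N3 M t by (intro divide_left_mono) auto
      finally have "real N powr (- 2 - Re s) / (Re s + 2) \<le> M / (t / 4) ^ 3 / (\<sigma> + 2)"
        using \<sigma> by (simp only: s_def complex.sel) (intro divide_right_mono, auto)
      thus ?thesis by (intro mult_left_mono) auto
    qed
    finally have "norm s * norm (s + 1) * norm (s + 2) * norm (psum bern3 N (s + 3))
        \<le> (1275 / 1000 * t) * (1306 / 1000 * t) * (1257 / 1000 * t * (\<sigma> + 2)) * (81 / 10000 * ((M / (t / 4) ^ 3) / (\<sigma> + 2)))"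
      using s0 s1 s2 t \<sigma> by (intro mult_mono mult_nonneg_nonneg) auto
    also have "\<dots> = M * (1275 / 1000 * (1306 / 1000) * (1257 / 1000) * (81 / 10000) * 64)"
    proof -
      have eq: "(a * t) * (b * t) * (c * t * p) * (d * ((M / (t / 4) ^ 3) / p)) = M * (a * b * c * d * 64)"
        if "p \<noteq> 0" for a b c d p :: real
        using t that by (simp add: power3_eq_cube field_simps)
      show ?thesis by (rule eq) (use \<sigma> in simp)
    qed
    also have "\<dots> \<le> M * (1086 / 1000)" using M by (intro mult_left_mono) auto
    finally show ?thesis by (simp add: norm_mult)
  qed
  have "norm (zeta s) \<le> M * (1 + ln (t / 4)) + M * (1 / 6) + M * (1 / 4) + M * (2125 / 10000) + M * (1086 / 1000)"
    unfolding EM by (intro norm_triangle_le norm_triangle_le_diff add_mono A1 A2 A3 A4 A5)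
  also have "\<dots> = M * (1 + ln (t / 4) + 1 / 6 + 1 / 4 + 2125 / 10000 + 1086 / 1000)" by (simp add: algebra_simps)
  \<comment> \<open>1 - ln 4 together with the four error constants stays below 27/20.\<close>
  also have "\<dots> \<le> M * (ln t + 27 / 20)"
  proof (intro mult_left_mono)
    have "ln (t / 4) = ln t - ln 4" using t by (simp add: ln_div)
    thus "1 + ln (t / 4) + 1 / 6 + 1 / 4 + 2125 / 10000 + 1086 / 1000 \<le> ln t + 27 / 20"
      using ln_4_bounds(1) by argo
  qed (use M in auto)
  also have "\<dots> \<le> (3 * t / 8) powr m * (ln t + 27 / 20)"
    unfolding M_def using N38 N2 m t by (intro mult_right_mono powr_mono2) auto
  finally show ?thesis by (simp add: s_def m_def mult.commute)
qed

text \<open>With N = 2 zeta is 1 + P times a bracket, up to a small remainder. As |P| = 1/2 and the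
  bracket hardly exceeds 1 in modulus, the summand 1 dominates.\<close>

lemma zeta_line_1_lower_bound:
  assumes t: "2 < t" "t \<le> 8"
  shows "norm (zeta (Complex 1 t)) \<ge> 2 / 5"
proof -
  define s where "s = Complex 1 t"
  define v where "v = t / 24 - 2 / t"
  define P where "P = (2 powr (- s) :: complex)"
  define er where "er = s * (s + 1) * (s + 2) * psum bern3 2 (s + 3)"
  have sne: "s \<noteq> 1" using t by (auto simp: s_def complex_eq_iff)
  have P: "norm P = 1 / 2" using norm_of_nat_powr[of 2 "- s"] by (simp add: P_def s_def powr_minus)
  have p1: "2 powr (1 - s) = 2 * P" "2 powr (- s - 1) = P / 2"
    using powr_add[of 2 1 "- s"] powr_diff[of 2 "- s" 1] by (simp_all add: P_def)
  have "(s - 1) * Complex 0 (- 2 / t) = 2" using t by (simp add: s_def complex_eq_iff)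
  hence inv: "2 / (s - 1) = Complex 0 (- 2 / t)" using sne by (simp add: field_simps)
  have "zeta s = 1 + 2 powr (1 - s) / (s - 1) + 2 powr (- s) / 2 + s * 2 powr (- s - 1) / 12 - er"
  proof -
    have "{1..<2} = {1::nat}" by auto
    thus ?thesis using zeta_euler_maclaurin[of 2 s] sne by (simp add: s_def er_def)
  qed
  also have "\<dots> = 1 + P * (2 / (s - 1) + 1 / 2 + s / 24) - er"
    unfolding p1 P_def[symmetric] by (simp add: field_simps)
  also have "2 / (s - 1) + 1 / 2 + s / 24 = Complex (13 / 24) v"
    unfolding inv by (simp add: s_def v_def complex_eq_iff)
  finally have eq: "1 = zeta s - P * Complex (13 / 24) v + er" by simp
  have tri: "1 \<le> norm (zeta s) + 1 / 2 * norm (Complex (13 / 24) v) + norm er"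
  proof -
    have "norm (1::complex) \<le> norm (zeta s) + norm (P * Complex (13 / 24) v) + norm er"
      by (subst eq) (intro norm_triangle_le norm_triangle_le_diff add_mono order.refl)
    thus ?thesis by (simp add: norm_mult P)
  qed
  have ps: "norm (psum bern3 2 (s + 3)) \<le> 3375 / 10000000"
    using zeta_error_bound[of 2 s] powr_minus_divide[of 2 "3 :: real"] by (simp add: s_def)
  have e0: "norm er = norm (Complex 1 t) * norm (Complex 2 t) * norm (Complex 3 t) * norm (psum bern3 2 (s + 3))"
  proof -
    have "s + 1 = Complex 2 t" "s + 2 = Complex 3 t" by (simp_all add: s_def complex_eq_iff)
    thus ?thesis by (simp add: er_def norm_mult s_def)
  qed
  show ?thesis
  \<comment> \<open>For small t the bracket is larger and the remainder smaller, for large t the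
    other way round.\<close>
  proof (cases "t \<le> 4")
    case True
    have t2: "t\<^sup>2 \<le> 16" using power_mono[OF True, of 2] t by simp
    define q where "q = 2 / t"
    have "q \<le> 1" "q \<ge> 1 / 2" using t True by (auto simp: q_def field_simps)
    hence "\<bar>v\<bar> \<le> 11 / 12" unfolding v_def q_def[symmetric] using t True by linarith
    hence "\<bar>v\<bar>\<^sup>2 \<le> (11 / 12)\<^sup>2" by (intro power_mono) auto
    hence "norm (Complex (13 / 24) v) \<le> 1065 / 1000" by (intro cmod_Complex_le) (auto simp: power2_eq_square)
    moreover have "norm er \<le> (413 / 100) * (448 / 100) * 5 * (3375 / 10000000)"
      unfolding e0 using t2 ps by (intro mult_mono cmod_Complex_le) (auto simp: power2_eq_square)
    ultimately show ?thesis using tri by (simp add: s_def)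
  next
    case False
    have t2: "t\<^sup>2 \<le> 64" using power_mono[OF t(2), of 2] t by simp
    define q where "q = 2 / t"
    have "q \<le> 1 / 2" "q \<ge> 1 / 4" using t False by (auto simp: q_def field_simps)
    hence "\<bar>v\<bar> \<le> 1 / 3" unfolding v_def q_def[symmetric] using t False by linarith
    hence "\<bar>v\<bar>\<^sup>2 \<le> (1 / 3)\<^sup>2" by (intro power_mono) auto
    hence "norm (Complex (13 / 24) v) \<le> 637 / 1000" by (intro cmod_Complex_le) (auto simp: power2_eq_square)
    moreover have "norm er \<le> (807 / 100) * (825 / 100) * (855 / 100) * (3375 / 10000000)"
      unfolding e0 using t2 ps by (intro mult_mono cmod_Complex_le) (auto simp: power2_eq_square)
    ultimately show ?thesis using tri by (simp add: s_def)
  qed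
qed

text \<open>The height 9.95 is 8 + 1.95, the top of the largest circle that occurs for t below 8.
  Only the logarithm of the bound enters later.\<close>

lemma zeta_low_bound:
  assumes \<tau>: "1 \<le> \<tau>" "\<tau> \<le> 995 / 100" and \<sigma>: "-1 \<le> \<sigma>" "\<sigma> \<le> 1"
  shows "norm (zeta (Complex \<sigma> \<tau>)) \<le> 11"
proof -
  define s where "s = Complex \<sigma> \<tau>"
  have \<tau>2: "\<tau>\<^sup>2 \<le> 990025 / 10000" using power_mono[OF \<tau>(2), of 2] \<tau> by (simp add: power2_eq_square)
  have \<sigma>2: "\<sigma>\<^sup>2 \<le> 1" "(\<sigma> + 1)\<^sup>2 \<le> 4"
    using power_mono[of "\<bar>\<sigma>\<bar>" 1 2] power_mono[of "\<sigma> + 1" 2 2] \<sigma> by auto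
  have s0: "norm s \<le> 1001 / 100" unfolding s_def
    using \<tau>2 \<sigma>2 by (intro cmod_Complex_le) (auto simp: power2_eq_square)
  have s1: "norm (s + 1) \<le> 1015 / 100"
  proof -
    have e: "s + 1 = Complex (\<sigma> + 1) \<tau>" by (simp add: s_def complex_eq_iff)
    have "(\<sigma> + 1)\<^sup>2 + \<tau>\<^sup>2 \<le> (1015 / 100)\<^sup>2" using \<tau>2 \<sigma>2 by (simp add: power_divide)
    thus ?thesis unfolding e by (intro cmod_Complex_le) auto
  qed
  have s2: "norm (s + 2) \<le> 1001 / 100 * (\<sigma> + 2)"
  proof -
    have p: "(\<sigma> + 2)\<^sup>2 \<ge> 1" using power_mono[of 1 "\<sigma> + 2" 2] \<sigma> by simp
    have "(1001 / 100 * (\<sigma> + 2))\<^sup>2 = (1002001 / 10000) * (\<sigma> + 2)\<^sup>2" by (simp only: power_mult_distrib) (simp add: power_divide)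
    hence "(\<sigma> + 2)\<^sup>2 + \<tau>\<^sup>2 \<le> (1001 / 100 * (\<sigma> + 2))\<^sup>2" using p \<tau>2 by argo
    moreover have e: "s + 2 = Complex (\<sigma> + 2) \<tau>" by (simp add: s_def complex_eq_iff)
    ultimately show ?thesis unfolding e using \<sigma> by (intro cmod_Complex_le) auto
  qed
  have sne: "s \<noteq> 1" using \<tau> by (auto simp: s_def complex_eq_iff)
  have EM: "zeta s = 1 / (s - 1) + 1 / 2 + s / 12 - s * (s + 1) * (s + 2) * psum bern3 1 (s + 3)"
    using zeta_euler_maclaurin[of 1 s] sne \<sigma> by (simp add: s_def)
  have A1: "norm (1 / (s - 1)) \<le> 1"
    using abs_Im_le_cmod[of "s - 1"] \<tau> by (simp add: s_def norm_divide divide_le_eq)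
  have A2: "norm (1 / 2 :: complex) \<le> 1 / 2" by simp
  have A3: "norm (s / 12) \<le> 1001 / 1200" using s0 by (simp add: norm_divide)
  have A4: "norm (s * (s + 1) * (s + 2) * psum bern3 1 (s + 3)) \<le> 83 / 10"
  proof -
    have "norm (psum bern3 1 (s + 3)) \<le> 81 / 10000 * (1 / (\<sigma> + 2))"
      using zeta_error_bound[of 1 s] \<sigma> by (simp add: s_def)
    hence "norm s * norm (s + 1) * norm (s + 2) * norm (psum bern3 1 (s + 3))
        \<le> (1001 / 100) * (1015 / 100) * (1001 / 100 * (\<sigma> + 2)) * (81 / 10000 * (1 / (\<sigma> + 2)))"
      using s0 s1 s2 \<sigma> by (intro mult_mono) auto
    also have "\<dots> = 1001 / 100 * (1015 / 100) * (1001 / 100) * (81 / 10000)" using \<sigma> by (simp add: field_simps)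
    also have "\<dots> \<le> 83 / 10" by simp
    finally show ?thesis by (simp add: norm_mult)
  qed
  have "norm (zeta s) \<le> 1 + 1 / 2 + 1001 / 1200 + 83 / 10"
    unfolding EM by (intro norm_triangle_le norm_triangle_le_diff add_mono A1 A2 A3 A4)
  thus ?thesis by (simp add: s_def)
qed

lemma c4_le:
  assumes "195 / 100 \<le> R" "R \<le> 2"
  shows "c4 R \<le> 51 / 100"
proof -
  have "zr (1 + R) \<le> 1 / R + 1 / 2 + (1 + R) / 12 + 81 / 10000 * (1 + R) * (1 + R + 1)"
    using zr_bounds(1)[of "1 + R"] assms by simp
  also have "\<dots> \<le> 100 / 195 + 1 / 2 + 3 / 12 + 81 / 10000 * 3 * 4"
    using assms by (intro add_mono mult_mono) (auto simp: field_simps)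
  also have "\<dots> \<le> 273 / 200" by simp
  finally have "ln (2 * zr (1 + R)) \<le> ln (273 / 100)"
    using zr_pos[of "1 + R"] assms by (intro ln_mono) auto
  moreover have "ln (2 * zr (1 + R)) = ln 2 + ln (zr (1 + R))"
    using zr_pos[of "1 + R"] assms by (simp add: ln_mult)
  ultimately show ?thesis using c4_less[of R] assms ln_numeric_bounds(5) by simp
qed

section \<open>Lower bounds at the centre of the circle\<close>

lemma zeta_zeros_properties:
  assumes zf: "zero_free_circle t R" and \<rho>: "\<rho> \<in> zeta_zeros t R"
  shows "Re \<rho> < 1" "\<rho> \<noteq> Complex 1 t" "zorder zeta \<rho> \<ge> 1" "norm (\<rho> - Complex 1 t) < R" "zeta \<rho> = 0"
proof -
  have R: "0 < R" "R < t" using zf by (auto simp: zero_free_circle_def)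
  show d: "norm (\<rho> - Complex 1 t) < R" and z: "zeta \<rho> = 0"
    using \<rho> by (auto simp: zeta_zeros_def dist_norm norm_minus_commute)
  have im: "Im \<rho> > 0" using abs_Im_le_cmod[of "\<rho> - Complex 1 t"] d R by auto
  show "Re \<rho> < 1"
  proof (rule ccontr)
    assume "\<not> Re \<rho> < 1"
    hence "Re \<rho> > 1 \<or> \<rho> = Complex 1 (Im \<rho>)" by (auto simp: complex_eq_iff)
    moreover have "zeta (Complex 1 (Im \<rho>)) \<noteq> 0" using im by (intro zeta_line_1_nonzero) auto
    ultimately show False using zeta_nonzero[of \<rho>] z by auto
  qed
  thus "\<rho> \<noteq> Complex 1 t" by auto
  have "\<rho> \<noteq> 1" using im by auto
  hence "eventually (\<lambda>w. zeta w \<noteq> 0 \<and> w \<in> - {1}) (at \<rho>)"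
    by (intro non_zero_neighbour_alt[OF zeta_holomorphic, of _ 2] connected_punctured_universe zeta_nonzero) auto
  hence "eventually (\<lambda>w. zeta w \<noteq> 0) (at \<rho>)" by eventually_elim auto
  hence "frequently (\<lambda>w. zeta w \<noteq> 0) (at \<rho>)" by (intro eventually_frequently) auto
  hence "zorder zeta \<rho> > 0"
    using zorder_pos_iff[OF zeta_holomorphic, of \<rho>] z \<open>\<rho> \<noteq> 1\<close> by auto
  thus "zorder zeta \<rho> \<ge> 1" by simp
qed

text \<open>The exemption is made for \<theta> = \<pi>/2, where the majorant
  \<open>zr (1 + R * cos \<theta>)\<close> is evaluated at the pole.\<close>

lemma has_integral_le_except_right:
  fixes f g :: "real \<Rightarrow> real"
  assumes f: "(f has_integral i) {a..b}" and g: "(g has_integral j) {a..b}"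
    and le: "\<And>x. x \<in> {a..<b} \<Longrightarrow> f x \<le> g x"
  shows "i \<le> j"
proof -
  have "((\<lambda>x. if x = b then f x else g x) has_integral j) {a..b}"
    by (rule has_integral_spike_finite[OF _ _ g, of "{b}"]) auto
  thus ?thesis by (rule has_integral_le[OF f]) (use le in auto)
qed

text \<open>On the right |ln |zeta|| is controlled, so only the size \<open>k\<close> of the kernel
  matters. On the left the kernel is nonnegative and upper bounds for ln |zeta| are enough.\<close>

lemma kernel_integral_bound:
  fixes K :: "real \<Rightarrow> real"
  assumes int: "((\<lambda>\<theta>. K (cos \<theta>) * right_pair t R \<theta> + K (- cos \<theta>) * left_pair t R \<theta>) has_integral I) {0..pi / 2}"
    and R: "R > 0"
    and right: "\<And>c. 0 \<le> c \<Longrightarrow> c \<le> 1 \<Longrightarrow> \<bar>K c\<bar> \<le> k"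
    and left: "\<And>c. 0 \<le> c \<Longrightarrow> c \<le> 1 \<Longrightarrow> 0 \<le> K (- c)"
       "\<And>c. 0 \<le> c \<Longrightarrow> c \<le> 1 \<Longrightarrow> K (- c) \<le> p * c + q * (1 - c\<^sup>2)"
    and ab: "a \<ge> 0" "b \<ge> 0" "\<And>\<theta>. \<theta> \<in> {0..pi / 2} \<Longrightarrow> left_pair t R \<theta> \<le> 2 * (a + b * cos \<theta>)"
  shows "I \<le> 2 * (k * (pi * c4 R) + (a * p * 1 + a * q * (pi / 4) + b * p * (pi / 4) + b * q * (1 / 3)))"
proof (rule has_integral_le_except_right[OF int])
  show "((\<lambda>\<theta>. 2 * (k * ln (zr (1 + R * cos \<theta>)) + (a * p * cos \<theta> + a * q * (sin \<theta>)\<^sup>2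
       + b * p * (cos \<theta>)\<^sup>2 + b * q * (cos \<theta> * (sin \<theta>)\<^sup>2)))) has_integral
     2 * (k * (pi * c4 R) + (a * p * 1 + a * q * (pi / 4) + b * p * (pi / 4) + b * q * (1 / 3)))) {0..pi / 2}"
    by (intro has_integral_mult_right has_integral_add c4_has_integral cos_power_integrals R)
next
  fix \<theta> assume \<theta>: "\<theta> \<in> {0..<pi / 2}"
  define c where "c = cos \<theta>"
  have c: "0 \<le> c" "c \<le> 1" using \<theta> by (auto simp: c_def intro: cos_ge_zero)
  have s: "(sin \<theta>)\<^sup>2 = 1 - c\<^sup>2" by (simp add: c_def sin_squared_eq)
  have "K c * right_pair t R \<theta> \<le> \<bar>K c\<bar> * \<bar>right_pair t R \<theta>\<bar>"
    using abs_ge_self[of "K c * right_pair t R \<theta>"] by (simp add: abs_mult)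
  also have "\<dots> \<le> k * (2 * ln (zr (1 + R * c)))"
    using right[OF c] right_pair_bound[OF R \<theta>] by (intro mult_mono) (auto simp: c_def)
  finally have 1: "K c * right_pair t R \<theta> \<le> k * (2 * ln (zr (1 + R * c)))" .
  have "K (- c) * left_pair t R \<theta> \<le> K (- c) * (2 * (a + b * c))"
    using left(1)[OF c] ab(3)[of \<theta>] \<theta> by (intro mult_left_mono) (auto simp: c_def)
  also have "\<dots> \<le> (p * c + q * (1 - c\<^sup>2)) * (2 * (a + b * c))"
    using left(2)[OF c] ab c by (intro mult_right_mono) auto
  finally have "K c * right_pair t R \<theta> + K (- c) * left_pair t R \<theta>
     \<le> k * (2 * ln (zr (1 + R * c))) + (p * c + q * (1 - c\<^sup>2)) * (2 * (a + b * c))" using 1 by linarith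
  thus "K (cos \<theta>) * right_pair t R \<theta> + K (- cos \<theta>) * left_pair t R \<theta> \<le>
     2 * (k * ln (zr (1 + R * cos \<theta>)) + (a * p * cos \<theta> + a * q * (sin \<theta>)\<^sup>2
       + b * p * (cos \<theta>)\<^sup>2 + b * q * (cos \<theta> * (sin \<theta>)\<^sup>2)))"
    unfolding s c_def[symmetric] by (simp add: power2_eq_square algebra_simps)
qed

text \<open>This comes from \<open>zeta_strip_bound\<close> and is therefore free of A and B. The
  98/100 is a lower bound for ln (8/3).\<close>

lemma left_pair_high:
  assumes t: "8 \<le> t" and zf: "zero_free_circle t r" and r: "r \<le> 2" and \<theta>: "\<theta> \<in> {0..pi / 2}"
  shows "left_pair t r \<theta> \<le> 2 * (ln (ln t + 27 / 20) + (ln t - 98 / 100) * r * cos \<theta>)"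
proof -
  have r0: "r > 0" using zf by (auto simp: zero_free_circle_def)
  have c: "0 \<le> cos \<theta>" "cos \<theta> \<le> 1" using \<theta> by (auto intro: cos_ge_zero)
  have s: "\<bar>r * sin \<theta>\<bar> \<le> 2" unfolding abs_mult using r r0 mult_mono[of r 2 "\<bar>sin \<theta>\<bar>" 1] by simp
  have rc: "0 \<le> r * cos \<theta>" "r * cos \<theta> \<le> 2" using r r0 c mult_mono[of r 2 "cos \<theta>" 1] by auto
  have L: "ln t > 0" using t by (intro ln_gt_zero) auto
  have l38: "ln (3 * t / 8) \<le> ln t - 98 / 100"
  proof -
    have "ln (3 * t / 8) = ln (t / (8 / 3))" by (simp add: mult.commute)
    also have "\<dots> = ln t - ln (8 / 3)" using t by (subst ln_div) auto
    finally show ?thesis using ln_numeric_bounds(3) by simp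
  qed
  have key: "ln (norm (zeta (Complex (1 - r * cos \<theta>) \<tau>))) \<le> ln (ln t + 27 / 20) + (ln t - 98 / 100) * r * cos \<theta>"
    if \<tau>: "\<bar>\<tau> - t\<bar> \<le> 2" and nz: "zeta (Complex (1 - r * cos \<theta>) \<tau>) \<noteq> 0" for \<tau>
  proof -
    have "norm (zeta (Complex (1 - r * cos \<theta>) \<tau>)) \<le> (ln t + 27 / 20) * (3 * t / 8) powr (r * cos \<theta>)"
      using zeta_strip_bound[OF t \<tau>, of "1 - r * cos \<theta>"] rc by simp
    hence "ln (norm (zeta (Complex (1 - r * cos \<theta>) \<tau>))) \<le> ln ((ln t + 27 / 20) * (3 * t / 8) powr (r * cos \<theta>))"
      using nz by (intro ln_mono) auto
    also have "\<dots> = ln (ln t + 27 / 20) + r * cos \<theta> * ln (3 * t / 8)"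
    proof -
      have "ln t + 27 / 20 \<noteq> 0" using L by linarith
      thus ?thesis using t by (subst ln_mult) (auto simp: ln_powr)
    qed
    also have "r * cos \<theta> * ln (3 * t / 8) \<le> r * cos \<theta> * (ln t - 98 / 100)"
      using l38 rc by (intro mult_left_mono) auto
    finally show ?thesis by (simp add: mult_ac)
  qed
  show ?thesis unfolding left_pair_def
    using key[of "t + r * sin \<theta>"] key[of "t - r * sin \<theta>"] s circle_points_nonzero(3,4)[OF zf, of \<theta>] by simp
qed

lemma left_pair_low:
  assumes t: "t \<le> 8" and zf: "zero_free_circle t r" and r: "r \<le> 195 / 100" "1 \<le> t - r" and \<theta>: "\<theta> \<in> {0..pi / 2}"
  shows "left_pair t r \<theta> \<le> 2 * (5 / 2)"
proof -
  have r0: "r > 0" using zf by (auto simp: zero_free_circle_def)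
  have c: "0 \<le> cos \<theta>" "cos \<theta> \<le> 1" using \<theta> by (auto intro: cos_ge_zero)
  have s: "\<bar>r * sin \<theta>\<bar> \<le> r" unfolding abs_mult using r0 by (simp add: mult_left_le)
  have rc: "0 \<le> r * cos \<theta>" "r * cos \<theta> \<le> 2" using r r0 c mult_mono[of r 2 "cos \<theta>" 1] by auto
  have key: "ln (norm (zeta (Complex (1 - r * cos \<theta>) \<tau>))) \<le> 5 / 2"
    if \<tau>: "\<bar>\<tau> - t\<bar> \<le> r" and nz: "zeta (Complex (1 - r * cos \<theta>) \<tau>) \<noteq> 0" for \<tau>
  proof -
    have "norm (zeta (Complex (1 - r * cos \<theta>) \<tau>)) \<le> 11"
      by (intro zeta_low_bound) (use \<tau> r t rc in auto)
    hence "ln (norm (zeta (Complex (1 - r * cos \<theta>) \<tau>))) \<le> ln 11" using nz by (intro ln_mono) auto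
    also have "ln 11 = ln (8 :: real) + ln (11 / 8)" using ln_mult[of 8 "11 / 8 :: real"] by simp
    also have "\<dots> \<le> 5 / 2"
    proof -
      have "ln (11 / 8 :: real) \<le> 11 / 8 - 1" by (rule ln_le_minus_one) auto
      moreover have "ln (8 :: real) = 3 * ln 2" using ln_realpow[of 2 3] by simp
      ultimately show ?thesis using ln_numeric_bounds(2) by argo
    qed
    finally show ?thesis .
  qed
  show ?thesis unfolding left_pair_def
    using key[of "t + r * sin \<theta>"] key[of "t - r * sin \<theta>"] s circle_points_nonzero(3,4)[OF zf, of \<theta>] by simp
qed

lemma zero_free_circle_exists:
  assumes "0 < a" "a < b" "b \<le> t"
  obtains R where "a < R" "R < b" "zero_free_circle t R"
proof -
  have fin: "finite {z \<in> cball (Complex 1 t) b. zeta z = 0}" if "b < t" for b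
  proof (rule finite_zeros_cball)
    show "zeta holomorphic_on ball (Complex 1 t) t"
      by (rule holomorphic_on_subset[OF zeta_holomorphic]) (use assms in \<open>auto simp: dist_norm cmod_def\<close>)
    have "Complex 1 t \<in> ball (Complex 1 t) t" using assms by simp
    moreover have "zeta (Complex 1 t) \<noteq> 0" using assms by (intro zeta_line_1_nonzero) auto
    ultimately show "\<exists>z\<in>ball (Complex 1 t) t. zeta z \<noteq> 0" by blast
  qed (use that in auto)
  \<comment> \<open>The midpoint lies below \<open>t\<close> even if \<open>b = t\<close>, so only
    finitely many zeros, and hence radii, have to be avoided.\<close>
  define b' where "b' = (a + b) / 2"
  have b': "a < b'" "b' < b" using assms by (auto simp: b'_def)
  define Z where "Z = {z \<in> cball (Complex 1 t) b'. zeta z = 0}"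
  have "finite ((\<lambda>z. dist (Complex 1 t) z) ` Z)" using fin[of b'] b' assms by (auto simp: Z_def)
  moreover have "infinite {a<..<b'}" using b' by simp
  ultimately have "\<not> {a<..<b'} \<subseteq> (\<lambda>z. dist (Complex 1 t) z) ` Z" using finite_subset by blast
  then obtain R where "R \<in> {a<..<b'}" and R3: "R \<notin> (\<lambda>z. dist (Complex 1 t) z) ` Z" by blast
  hence R: "a < R" "R < b'" by auto
  have "zero_free_circle t R" using R R3 b' assms by (auto simp: zero_free_circle_def Z_def image_iff)
  thus ?thesis using that R b' by auto
qed

section \<open>Comparison of three Poisson-Jensen formulas for t at least 8\<close>

text \<open>The radius is nearly the largest one that \<open>zeta_strip_bound\<close> allows, since
  a large R makes \<open>e = \<delta> / R\<close> small. The interval for R leaves room to avoid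
  zeros on the circle.\<close>

locale high_ordinate =
  fixes t R :: real
  assumes t: "8 \<le> t" and R: "195 / 100 \<le> R" "R < 2" and zf: "zero_free_circle t R"
begin

definition "L = ln t"
definition "\<delta> = 7 / (25 * L)"
definition "e = \<delta> / R"
definition "x = 1 / L"
definition "\<xi> \<rho> = (\<rho> - Complex 1 t) / of_real R"
definition "u w = ln (norm (zeta (Complex (1 + R * w) t)))"
definition "S w = (\<Sum>\<rho>\<in>zeta_zeros t R. of_int (zorder zeta \<rho>) * green (\<xi> \<rho>) w)"
definition "a0 = ln (L + 27 / 20)"
definition "b0 = L - 98 / 100"

lemma R_pos: "R > 0" using R by simp

lemma L_ge: "L \<ge> 2079 / 1000"
proof -
  have "ln 8 \<le> ln t" using t by (intro ln_mono) auto
  thus ?thesis using ln_8_ge by (simp add: L_def)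
qed

lemma x_bounds: "0 < x" "x \<le> 4811 / 10000"
  using L_ge by (auto simp: x_def field_simps)

lemma L_times_x: "L * x = 1" using L_ge by (simp add: x_def)

lemma \<delta>_eq: "\<delta> = 7 / 25 * x" by (simp add: \<delta>_def x_def)

lemma \<delta>_bounds: "0 < \<delta>" "\<delta> \<le> 135 / 1000"
  using x_bounds by (auto simp: \<delta>_eq)

lemma R_times_e: "R * e = \<delta>" using R_pos by (simp add: e_def)

lemma e_bounds: "0 < e" "e \<le> 37 / 500" "e \<le> 1436 / 10000 * x"
proof -
  show "0 < e" using \<delta>_bounds R_pos by (simp add: e_def)
  have "\<delta> / R \<le> \<delta> / (195 / 100)" using R R_pos \<delta>_bounds by (intro divide_left_mono) auto
  also have "\<dots> \<le> 1436 / 10000 * x" using x_bounds by (simp add: \<delta>_eq)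
  finally show 1: "e \<le> 1436 / 10000 * x" by (simp add: e_def)
  show "e \<le> 37 / 500" using 1 x_bounds by argo
qed

text \<open>The logarithm is bounded by its tangent at 5. Multiplied by x = 1 / L, the bound becomes
  linear in x.\<close>

lemma a0_bounds: "0 \<le> a0" "a0 * x \<le> 909 / 1000 * x + 1 / 5"
proof -
  show "0 \<le> a0" unfolding a0_def using L_ge by (intro ln_ge_zero) auto
  have "5 * ((L + 27 / 20) / 5) = L + 27 / 20" by simp
  hence "a0 = ln (5 * ((L + 27 / 20) / 5))" by (simp only: a0_def)
  also have "\<dots> = ln 5 + ln ((L + 27 / 20) / 5)" using L_ge by (subst ln_mult) auto
  finally have "a0 = ln 5 + ln ((L + 27 / 20) / 5)" .
  moreover have "ln ((L + 27 / 20) / 5) \<le> (L + 27 / 20) / 5 - 1" using L_ge by (intro ln_le_minus_one) auto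
  moreover have "ln 5 = ln 4 + ln (5 / 4 :: real)" using ln_mult[of 4 "5 / 4 :: real"] by simp
  moreover have "ln (5 / 4 :: real) \<le> 5 / 4 - 1" by (rule ln_le_minus_one) auto
  ultimately have "a0 \<le> 909 / 1000 + L / 5" using ln_4_bounds(2) by argo
  hence "a0 * x \<le> (909 / 1000 + L / 5) * x" using x_bounds by (intro mult_right_mono) auto
  also have "\<dots> = 909 / 1000 * x + 1 / 5" using L_times_x by (simp add: algebra_simps)
  finally show "a0 * x \<le> 909 / 1000 * x + 1 / 5" .
qed

lemma b0_nonneg: "0 \<le> b0" using L_ge by (simp add: b0_def)

lemma b0_x: "b0 * x = 1 - 98 / 100 * x" using L_times_x by (simp add: b0_def algebra_simps)

lemma left_bound: "\<theta> \<in> {0..pi / 2} \<Longrightarrow> left_pair t R \<theta> \<le> 2 * (a0 + b0 * R * cos \<theta>)"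
  using left_pair_high[OF t zf] R by (simp add: a0_def b0_def L_def)

lemma \<xi>_props:
  assumes "\<rho> \<in> zeta_zeros t R"
  shows "Re (\<xi> \<rho>) \<le> 0" "norm (\<xi> \<rho>) \<le> 1" "\<xi> \<rho> \<noteq> 0" "norm (\<xi> \<rho>) = norm (\<rho> - Complex 1 t) / R"
    "of_int (zorder zeta \<rho>) \<ge> (1::real)"
proof -
  note z = zeta_zeros_properties[OF zf assms]
  show "Re (\<xi> \<rho>) \<le> 0" "norm (\<xi> \<rho>) = norm (\<rho> - Complex 1 t) / R"
    using z R_pos by (simp_all add: \<xi>_def norm_divide divide_nonpos_pos)
  thus "norm (\<xi> \<rho>) \<le> 1" using z R_pos by simp
  show "\<xi> \<rho> \<noteq> 0" using z R_pos by (simp add: \<xi>_def)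
  show "of_int (zorder zeta \<rho>) \<ge> (1::real)" using z by simp
qed

lemma finite_zeros: "finite (zeta_zeros t R)"
  using zeta_poisson_jensen(1)[OF zf, of 0] zeta_line_1_nonzero[of t] t by simp

lemma jensen:
  assumes "0 \<le> w" "w < 1"
  shows "((\<lambda>\<theta>. poisson w (cos \<theta>) * right_pair t R \<theta> + poisson w (- cos \<theta>) * left_pair t R \<theta>) has_integral
       2 * pi * (u w + S w)) {0..pi / 2}"
  unfolding u_def S_def \<xi>_def
proof (rule zeta_poisson_jensen(2)[OF zf])
  show "zeta (Complex (1 + R * w) t) \<noteq> 0"
    using assms R_pos zeta_line_1_nonzero[of t] t zeta_nonzero[of "Complex (1 + R * w) t"]
    by (cases "w = 0") auto
qed (use assms in auto)

lemma e_range: "4 * e < 1" "0 \<le> 4 * e" "e < 1" "0 \<le> e"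
  using e_bounds by auto

lemma Q_bound: "2 * (u e + S e) - (u (4 * e) + S (4 * e)) - (u 0 + S 0) \<le>
    36 / 5 * e * c4 R + (a0 * (4 * e) + b0 * R * (28 * e\<^sup>2) / 3) / pi + (a0 * (28 * e\<^sup>2) + b0 * R * (4 * e)) / 4"
proof -
  have "((\<lambda>\<theta>. 2 * (poisson e (cos \<theta>) * right_pair t R \<theta> + poisson e (- cos \<theta>) * left_pair t R \<theta>) -
      (poisson (4 * e) (cos \<theta>) * right_pair t R \<theta> + poisson (4 * e) (- cos \<theta>) * left_pair t R \<theta>) -
      (poisson 0 (cos \<theta>) * right_pair t R \<theta> + poisson 0 (- cos \<theta>) * left_pair t R \<theta>)) has_integral
      (2 * (2 * pi * (u e + S e)) - 2 * pi * (u (4 * e) + S (4 * e)) - 2 * pi * (u 0 + S 0))) {0..pi / 2}"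
    by (intro has_integral_diff has_integral_mult_right jensen e_range) auto
  moreover have "(\<lambda>\<theta>. 2 * (poisson e (cos \<theta>) * right_pair t R \<theta> + poisson e (- cos \<theta>) * left_pair t R \<theta>) -
      (poisson (4 * e) (cos \<theta>) * right_pair t R \<theta> + poisson (4 * e) (- cos \<theta>) * left_pair t R \<theta>) -
      (poisson 0 (cos \<theta>) * right_pair t R \<theta> + poisson 0 (- cos \<theta>) * left_pair t R \<theta>)) =
      (\<lambda>\<theta>. Kq e (cos \<theta>) * right_pair t R \<theta> + Kq e (- cos \<theta>) * left_pair t R \<theta>)"
    by (rule ext) (simp add: Kq_def poisson_def[of 0] algebra_simps)
  moreover have "2 * (2 * pi * (u e + S e)) - 2 * pi * (u (4 * e) + S (4 * e)) - 2 * pi * (u 0 + S 0) =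
      2 * (pi * (2 * (u e + S e) - (u (4 * e) + S (4 * e)) - (u 0 + S 0)))" by (simp add: algebra_simps)
  ultimately have int: "((\<lambda>\<theta>. Kq e (cos \<theta>) * right_pair t R \<theta> + Kq e (- cos \<theta>) * left_pair t R \<theta>) has_integral
      2 * (pi * (2 * (u e + S e) - (u (4 * e) + S (4 * e)) - (u 0 + S 0)))) {0..pi / 2}" by simp
  have "2 * (pi * (2 * (u e + S e) - (u (4 * e) + S (4 * e)) - (u 0 + S 0))) \<le>
     2 * (36 / 5 * e * (pi * c4 R) + (a0 * (4 * e) * 1 + a0 * (28 * e\<^sup>2) * (pi / 4) + b0 * R * (4 * e) * (pi / 4) + b0 * R * (28 * e\<^sup>2) * (1 / 3)))"
    using b0_nonneg R_pos
    by (intro kernel_integral_bound[OF int R_pos] kernels_left kernels_right e_bounds a0_bounds left_bound) auto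
  also have "\<dots> = 2 * (pi * (36 / 5 * e * c4 R + (a0 * (4 * e) + b0 * R * (28 * e\<^sup>2) / 3) / pi + (a0 * (28 * e\<^sup>2) + b0 * R * (4 * e)) / 4))"
    by (simp add: field_simps)
  finally show ?thesis by simp
qed

lemma E_bound: "(u e + S e) - (u (4 * e) + S (4 * e)) \<le>
    93 / 10 * e * c4 R + (a0 * (6 * e) + b0 * R * (30 * e\<^sup>2) / 3) / pi + (a0 * (30 * e\<^sup>2) + b0 * R * (6 * e)) / 4"
proof -
  have "((\<lambda>\<theta>. (poisson e (cos \<theta>) * right_pair t R \<theta> + poisson e (- cos \<theta>) * left_pair t R \<theta>) -
      (poisson (4 * e) (cos \<theta>) * right_pair t R \<theta> + poisson (4 * e) (- cos \<theta>) * left_pair t R \<theta>)) has_integral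
      (2 * pi * (u e + S e) - 2 * pi * (u (4 * e) + S (4 * e)))) {0..pi / 2}"
    by (intro has_integral_diff jensen e_range)
  moreover have "(\<lambda>\<theta>. (poisson e (cos \<theta>) * right_pair t R \<theta> + poisson e (- cos \<theta>) * left_pair t R \<theta>) -
      (poisson (4 * e) (cos \<theta>) * right_pair t R \<theta> + poisson (4 * e) (- cos \<theta>) * left_pair t R \<theta>)) =
      (\<lambda>\<theta>. Ke e (cos \<theta>) * right_pair t R \<theta> + Ke e (- cos \<theta>) * left_pair t R \<theta>)"
    by (rule ext) (simp add: Ke_def algebra_simps)
  moreover have "2 * pi * (u e + S e) - 2 * pi * (u (4 * e) + S (4 * e)) =
      2 * (pi * ((u e + S e) - (u (4 * e) + S (4 * e))))" by (simp add: algebra_simps)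
  ultimately have int: "((\<lambda>\<theta>. Ke e (cos \<theta>) * right_pair t R \<theta> + Ke e (- cos \<theta>) * left_pair t R \<theta>) has_integral
      2 * (pi * ((u e + S e) - (u (4 * e) + S (4 * e))))) {0..pi / 2}" by simp
  have "2 * (pi * ((u e + S e) - (u (4 * e) + S (4 * e)))) \<le>
     2 * (93 / 10 * e * (pi * c4 R) + (a0 * (6 * e) * 1 + a0 * (30 * e\<^sup>2) * (pi / 4) + b0 * R * (6 * e) * (pi / 4) + b0 * R * (30 * e\<^sup>2) * (1 / 3)))"
    using b0_nonneg R_pos
    by (intro kernel_integral_bound[OF int R_pos] kernels_left kernels_right e_bounds a0_bounds left_bound) auto
  also have "\<dots> = 2 * (pi * (93 / 10 * e * c4 R + (a0 * (6 * e) + b0 * R * (30 * e\<^sup>2) / 3) / pi + (a0 * (30 * e\<^sup>2) + b0 * R * (6 * e)) / 4))"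
    by (simp add: field_simps)
  finally show ?thesis by simp
qed

text \<open>Both error terms are polynomials in \<open>x = 1 / ln t\<close>, up to \<open>a0 * x\<close>.\<close>

lemma error_term_bound:
  fixes k p q :: real
  assumes "k \<ge> 0" "p \<ge> 0" "q \<ge> 0"
  shows "k * e * c4 R + (a0 * (p * e) + b0 * R * (q * e\<^sup>2) / 3) / pi + (a0 * (q * e\<^sup>2) + b0 * R * (p * e)) / 4 \<le>
    k * (1436 / 10000 * (51 / 100)) * x + (909 / 1000 * x + 1 / 5) * (p * (1436 / 30000) + q / 4 * (20621 / 1000000) * x)
     + (1 - 98 / 100 * x) * (7 / 25) * (p / 4 + q / 9 * (1436 / 10000) * x)"
proof -
  have e: "0 \<le> e" "e \<le> 1436 / 10000 * x" and x: "0 \<le> x" using e_bounds x_bounds by auto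
  have c: "c4 R \<le> 51 / 100" using R by (intro c4_le) auto
  have pi3: "pi \<ge> 3" using pi_gt3 by simp
  have "k * e * c4 R \<le> k * e * (51 / 100)" using c assms e by (intro mult_left_mono) auto
  also have "\<dots> \<le> k * (1436 / 10000 * x) * (51 / 100)" using assms e by (intro mult_right_mono mult_left_mono) auto
  finally have 1: "k * e * c4 R \<le> k * (1436 / 10000 * (51 / 100)) * x" by (simp add: mult_ac)
  have e2: "e\<^sup>2 \<le> 20621 / 1000000 * x * x"
  proof -
    have "e\<^sup>2 \<le> (1436 / 10000 * x)\<^sup>2" using e by (intro power_mono) auto
    also have "\<dots> = 2062096 / 100000000 * (x * x)" by (simp add: power2_eq_square)
    also have "\<dots> \<le> 20621 / 1000000 * (x * x)" using x by (intro mult_right_mono) auto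
    finally show ?thesis by (simp only: mult.assoc)
  qed
  have P: "0 \<le> a0 * (p * e) + b0 * R * (q * e\<^sup>2) / 3"
    using a0_bounds b0_nonneg R_pos assms e by simp
  have "(a0 * (p * e) + b0 * R * (q * e\<^sup>2) / 3) / pi \<le> (a0 * (p * e) + b0 * R * (q * e\<^sup>2) / 3) / 3"
    using P pi3 by (intro divide_left_mono) auto
  also have "\<dots> + (a0 * (q * e\<^sup>2) + b0 * R * (p * e)) / 4
     = a0 * (p * e / 3 + q / 4 * e\<^sup>2) + b0 * (R * e) * (p / 4 + q / 9 * e)"
    by (simp add: power2_eq_square field_simps)
  finally have 2: "(a0 * (p * e) + b0 * R * (q * e\<^sup>2) / 3) / pi + (a0 * (q * e\<^sup>2) + b0 * R * (p * e)) / 4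
     \<le> a0 * (p * e / 3 + q / 4 * e\<^sup>2) + b0 * (R * e) * (p / 4 + q / 9 * e)" by simp
  have "p * e / 3 + q / 4 * e\<^sup>2 \<le> p * (1436 / 10000 * x) / 3 + q / 4 * (20621 / 1000000 * x * x)"
    using assms e e2 by (intro add_mono mult_left_mono divide_right_mono) auto
  also have "\<dots> = x * (p * (1436 / 30000) + q / 4 * (20621 / 1000000) * x)" by (simp add: algebra_simps)
  finally have "a0 * (p * e / 3 + q / 4 * e\<^sup>2) \<le> a0 * (x * (p * (1436 / 30000) + q / 4 * (20621 / 1000000) * x))"
    using a0_bounds by (intro mult_left_mono) auto
  also have "\<dots> = (a0 * x) * (p * (1436 / 30000) + q / 4 * (20621 / 1000000) * x)" by (simp only: mult.assoc)
  also have "\<dots> \<le> (909 / 1000 * x + 1 / 5) * (p * (1436 / 30000) + q / 4 * (20621 / 1000000) * x)"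
    using a0_bounds assms x by (intro mult_right_mono) auto
  finally have 3: "a0 * (p * e / 3 + q / 4 * e\<^sup>2) \<le>
    (909 / 1000 * x + 1 / 5) * (p * (1436 / 30000) + q / 4 * (20621 / 1000000) * x)" .
  \<comment> \<open>Here R drops out: R e = \<delta> is a fixed multiple of x, and b0 x is close to
    1. This is the leading part of the error.\<close>
  have "b0 * (R * e) * (p / 4 + q / 9 * e) = (b0 * x) * (7 / 25) * (p / 4 + q / 9 * e)"
    by (simp add: R_times_e \<delta>_eq)
  also have "\<dots> \<le> (b0 * x) * (7 / 25) * (p / 4 + q / 9 * (1436 / 10000 * x))"
    using e assms b0_nonneg x by (intro mult_left_mono add_left_mono) auto
  also have "\<dots> = (1 - 98 / 100 * x) * (7 / 25) * (p / 4 + q / 9 * (1436 / 10000) * x)"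
    by (simp add: b0_x)
  finally show ?thesis using 1 2 3 by linarith
qed

lemma zr_delta_bounds:
  shows "zr (1 + \<delta>) \<le> 1 / \<delta> + 62 / 100" "zr (1 + 4 * \<delta>) \<ge> 1 / (4 * \<delta>) + 1 / 2"
proof -
  have d: "0 < \<delta>" "\<delta> \<le> 135 / 1000" by (rule \<delta>_bounds)+
  have dd: "\<delta>\<^sup>2 \<le> 135 / 1000 * \<delta>" using mult_right_mono[OF d(2), of \<delta>] d by (simp add: power2_eq_square)
  have "zr (1 + \<delta>) \<le> 1 / \<delta> + (1 / 2 + (1 + \<delta>) / 12 + 81 / 10000 * (1 + \<delta>) * (1 + \<delta> + 1))"
    using zr_bounds(1)[of "1 + \<delta>"] d by simp
  also have "1 / 2 + (1 + \<delta>) / 12 + 81 / 10000 * (1 + \<delta>) * (1 + \<delta> + 1) =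
     1 / 2 + 1 / 12 + 162 / 10000 + (1 / 12 + 243 / 10000) * \<delta> + 81 / 10000 * \<delta>\<^sup>2"
    by (simp add: power2_eq_square field_simps)
  also have "\<dots> \<le> 62 / 100" using d dd by argo
  finally show "zr (1 + \<delta>) \<le> 1 / \<delta> + 62 / 100" by simp
  define y where "y = 4 * \<delta>"
  have y: "0 < y" "y \<le> 1" using d by (auto simp: y_def)
  have yy: "y\<^sup>2 \<le> 1 * y" using mult_right_mono[OF y(2), of y] y by (simp add: power2_eq_square)
  have "zr (1 + y) \<ge> 1 / y + (1 / 2 + (1 + y) / 12 - 81 / 10000 * (1 + y) * (1 + y + 1))"
    using zr_bounds(2)[of "1 + y"] y by simp
  moreover have "1 / 2 + (1 + y) / 12 - 81 / 10000 * (1 + y) * (1 + y + 1) =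
     1 / 2 + 1 / 12 - 162 / 10000 + (1 / 12 - 243 / 10000) * y - 81 / 10000 * y\<^sup>2"
    by (simp add: power2_eq_square field_simps)
  moreover have "\<dots> \<ge> 1 / 2" using y yy by argo
  ultimately show "zr (1 + 4 * \<delta>) \<ge> 1 / (4 * \<delta>) + 1 / 2" by (simp add: y_def)
qed

text \<open>The two points are compared through \<open>zeta_times_zr_antimono\<close>, and
  \<open>u e\<close> is bounded below by \<open>zeta_times_zr_ge_1\<close>. With \<delta> = 0.28 x
  the gains 1.05 \<delta> and \<delta>/2 are 0.294 x and 0.14 x. They are kept because they cancel
  the terms in x of \<open>E_numeric\<close> and \<open>Q_numeric\<close>.\<close>

lemma u_bounds:
  shows "u (4 * e) - u e \<le> ln 4 - 294 / 1000 * x"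
    and "2 * u e - u (4 * e) \<ge> - ln (4 / \<delta>) + 14 / 100 * x"
proof -
  define z1 where "z1 = zr (1 + \<delta>)"
  define z4 where "z4 = zr (1 + 4 * \<delta>)"
  have d: "0 < \<delta>" "\<delta> \<le> 135 / 1000" by (rule \<delta>_bounds)+
  have z: "0 < z1" "0 < z4" unfolding z1_def z4_def using d by (auto intro!: zr_pos)
  have up: "u e = ln (norm (zeta (Complex (1 + \<delta>) t)))" "u (4 * e) = ln (norm (zeta (Complex (1 + 4 * \<delta>) t)))"
    by (simp_all add: u_def R_times_e mult.left_commute[of R])
  have nz: "norm (zeta (Complex (1 + \<delta>) t)) > 0" "norm (zeta (Complex (1 + 4 * \<delta>) t)) > 0"
    using d zeta_nonzero[of "Complex (1 + \<delta>) t"] zeta_nonzero[of "Complex (1 + 4 * \<delta>) t"] by auto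
  have "ln (norm (zeta (Complex (1 + 4 * \<delta>) t)) * z4) \<le> ln (norm (zeta (Complex (1 + \<delta>) t)) * z1)"
    unfolding z1_def z4_def using d nz zr_pos[of "1 + 4 * \<delta>"]
    by (intro ln_mono zeta_times_zr_antimono mult_pos_pos) auto
  hence A: "u (4 * e) + ln z4 \<le> u e + ln z1" using nz z by (simp add: up ln_mult)
  have "ln 1 \<le> ln (norm (zeta (Complex (1 + \<delta>) t)) * z1)"
    unfolding z1_def using d by (intro ln_mono zeta_times_zr_ge_1) auto
  hence B: "u e + ln z1 \<ge> 0" using nz z by (simp add: up ln_mult)
  have dd: "\<delta>\<^sup>2 \<le> 135 / 1000 * \<delta>" using mult_right_mono[OF d(2), of \<delta>] d by (simp add: power2_eq_square)
  define y1 where "y1 = 1 + 62 / 100 * \<delta>"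
  define y4 where "y4 = 1 + 2 * \<delta>"
  have "z1 \<le> y1 / \<delta>" using zr_delta_bounds(1) d by (simp add: y1_def z1_def field_simps)
  hence "ln z1 \<le> ln (y1 / \<delta>)" using z by (intro ln_mono) auto
  also have "\<dots> = ln y1 - ln \<delta>" using d by (subst ln_div) (auto simp: y1_def)
  finally have l1: "ln z1 \<le> ln y1 - ln \<delta>" .
  have "z4 \<ge> y4 / (4 * \<delta>)" using zr_delta_bounds(2) d by (simp add: y4_def z4_def field_simps)
  hence "ln z4 \<ge> ln (y4 / (4 * \<delta>))" using d by (intro ln_mono) (auto simp: y4_def)
  moreover have "ln (y4 / (4 * \<delta>)) = ln y4 - (ln 4 + ln \<delta>)"
    using d by (subst ln_div) (auto simp: y4_def ln_mult)
  ultimately have l4: "ln z4 \<ge> ln y4 - ln 4 - ln \<delta>" by simp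
  have r1: "ln y1 - ln y4 \<le> - 105 / 100 * \<delta>"
  proof -
    have "(1 - 105 / 100 * \<delta>) * y4 = 1 + 95 / 100 * \<delta> - 21 / 10 * \<delta>\<^sup>2"
      unfolding y4_def by (simp add: power2_eq_square field_simps)
    hence "y1 \<le> (1 - 105 / 100 * \<delta>) * y4" unfolding y1_def using d dd by argo
    hence "ln y1 \<le> ln ((1 - 105 / 100 * \<delta>) * y4)" using d by (intro ln_mono) (auto simp: y1_def)
    also have "\<dots> = ln (1 - 105 / 100 * \<delta>) + ln y4" using d by (subst ln_mult) (auto simp: y4_def)
    also have "ln (1 - 105 / 100 * \<delta>) \<le> 1 - 105 / 100 * \<delta> - 1" using d by (intro ln_le_minus_one) auto
    finally show ?thesis by simp
  qed
  have r2: "2 * ln y1 - ln y4 \<le> - 1 / 2 * \<delta>"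
  proof -
    have "(1 - 1 / 2 * \<delta>) * y4 = 1 + 3 / 2 * \<delta> - \<delta>\<^sup>2"
      unfolding y4_def by (simp add: power2_eq_square field_simps)
    moreover have "y1\<^sup>2 = 1 + 124 / 100 * \<delta> + 3844 / 10000 * \<delta>\<^sup>2"
      unfolding y1_def by (simp add: power2_eq_square field_simps)
    ultimately have "y1\<^sup>2 \<le> (1 - 1 / 2 * \<delta>) * y4" using d dd by argo
    hence "ln (y1\<^sup>2) \<le> ln ((1 - 1 / 2 * \<delta>) * y4)" using d by (intro ln_mono) (auto simp: y1_def)
    also have "\<dots> = ln (1 - 1 / 2 * \<delta>) + ln y4" using d by (subst ln_mult) (auto simp: y4_def)
    also have "ln (1 - 1 / 2 * \<delta>) \<le> 1 - 1 / 2 * \<delta> - 1" using d by (intro ln_le_minus_one) auto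
    also have "ln (y1\<^sup>2) = 2 * ln y1" using d by (simp add: ln_realpow y1_def)
    finally show ?thesis by simp
  qed
  show "u (4 * e) - u e \<le> ln 4 - 294 / 1000 * x" using A l1 l4 r1 unfolding \<delta>_eq by argo
  have "ln (4 / \<delta>) = ln 4 - ln \<delta>" using d by (subst ln_div) auto
  thus "2 * u e - u (4 * e) \<ge> - ln (4 / \<delta>) + 14 / 100 * x" using A B l1 l4 r2 unfolding \<delta>_eq by argo
qed

end

section \<open>Logarithms of the numerical constants\<close>

lemma ln_29388_bounds:
  shows "ln 29.388 \<ge> ln (100 / 7) + (7205 / 10000 :: real)" "ln 29.388 \<ge> (3375 / 1000 :: real)"
proof -
  have ge: "ln y \<ge> 1 - 1 / y" if "y > 0" for y :: real
    using ln_le_minus_one[of "1 / y"] that by (simp add: ln_div)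
  have "ln (29.388 :: real) = ln (100 / 7 * (2 * (205716 / 200000)))" by simp
  also have "\<dots> = ln (100 / 7) + (ln 2 + ln (205716 / 200000))" by (subst ln_mult | simp)+
  finally show "ln 29.388 \<ge> ln (100 / 7) + (7205 / 10000 :: real)"
    using ge[of "205716 / 200000"] ln_numeric_bounds(1) by simp
  have "ln (29.388 :: real) = ln (32 * (29388 / 32000))" by simp
  also have "\<dots> = 5 * ln 2 + ln (29388 / 32000)" using ln_realpow[of 2 5] by (subst ln_mult) auto
  finally show "ln 29.388 \<ge> (3375 / 1000 :: real)"
    using ge[of "29388 / 32000"] ln_numeric_bounds(1) by simp
qed

lemma ln_37_bounds: "ln (37 / 10) \<ge> (1304 / 1000 :: real)" "ln (37 / 10) \<le> (1314 / 1000 :: real)"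
proof -
  have "ln (37 / 10) = ln (4 :: real) + ln (37 / 40)" using ln_mult[of 4 "37 / 40 :: real"] by simp
  moreover have "ln (37 / 40) \<le> (37 / 40 :: real) - 1" by (rule ln_le_minus_one) auto
  moreover have "- ln (37 / 40) \<le> (40 / 37 :: real) - 1"
    using ln_le_minus_one[of "40 / 37 :: real"] ln_div[of 37 "40 :: real"] ln_div[of 40 "37 :: real"] by simp
  ultimately show "ln (37 / 10) \<ge> (1304 / 1000 :: real)" "ln (37 / 10) \<le> (1314 / 1000 :: real)"
    using ln_4_bounds by argo+
qed

lemma ln_constants:
  shows "ln (84 / 10) \<ge> (212 / 100 :: real)" "ln (347 / 100) \<ge> (12 / 10 :: real)"
proof -
  have "ln (84 / 10) = ln (8 :: real) + ln (105 / 100)" using ln_mult[of 8 "105 / 100 :: real"] by simp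
  moreover have "- ln (105 / 100) \<le> (100 / 105 :: real) - 1"
    using ln_le_minus_one[of "100 / 105 :: real"] ln_div[of 100 "105 :: real"] ln_div[of 105 "100 :: real"] by simp
  ultimately show "ln (84 / 10) \<ge> (212 / 100 :: real)" using ln_8_ge by argo
  have "ln (347 / 100) = ln (4 :: real) + ln (347 / 400)" using ln_mult[of 4 "347 / 400 :: real"] by simp
  moreover have "- ln (347 / 400) \<le> (400 / 347 :: real) - 1"
    using ln_le_minus_one[of "400 / 347 :: real"] ln_div[of 347 "400 :: real"] ln_div[of 400 "347 :: real"] by simp
  ultimately show "ln (347 / 100) \<ge> (12 / 10 :: real)" using ln_4_bounds by argo
qed

section \<open>Zeros close to the centre and the value at 1 + it\<close>

context high_ordinate
begin

lemma x_square_bounds: "0 \<le> x * x" "x * x \<le> 4811 / 10000 * x"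
  using x_bounds mult_right_mono[OF x_bounds(2), of x] by auto

lemma Q_numeric: "2 * (u e + S e) - (u (4 * e) + S (4 * e)) - (u 0 + S 0) \<le> 562 / 1000 + 14 / 100 * x"
proof -
  have "2 * (u e + S e) - (u (4 * e) + S (4 * e)) - (u 0 + S 0) \<le>
    36 / 5 * (1436 / 10000 * (51 / 100)) * x + (909 / 1000 * x + 1 / 5) * (4 * (1436 / 30000) + 28 / 4 * (20621 / 1000000) * x)
     + (1 - 98 / 100 * x) * (7 / 25) * (4 / 4 + 28 / 9 * (1436 / 10000) * x)"
    by (rule order.trans[OF Q_bound error_term_bound]) auto
  also have "\<dots> = (2984 / 9375) + (26140651 / 45000000) * x + (77595287 / 9000000000) * (x * x)"
    by (simp add: field_simps)
  also have "\<dots> \<le> 562 / 1000 + 14 / 100 * x" using x_square_bounds x_bounds by argo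
  finally show ?thesis .
qed

lemma E_numeric: "(u e + S e) - (u (4 * e) + S (4 * e)) \<le> 675 / 1000 + 294 / 1000 * x"
proof -
  have "(u e + S e) - (u (4 * e) + S (4 * e)) \<le>
    93 / 10 * (1436 / 10000 * (51 / 100)) * x + (909 / 1000 * x + 1 / 5) * (6 * (1436 / 30000) + 30 / 4 * (20621 / 1000000) * x)
     + (1 - 98 / 100 * x) * (7 / 25) * (6 / 4 + 30 / 9 * (1436 / 10000) * x)"
    by (rule order.trans[OF E_bound error_term_bound]) auto
  also have "\<dots> = (1492 / 3125) + (20865533 / 30000000) * x + (11085041 / 1200000000) * (x * x)"
    by (simp add: field_simps)
  also have "\<dots> \<le> 675 / 1000 + 294 / 1000 * x" using x_square_bounds x_bounds by argo
  finally show ?thesis .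
qed

lemma near_iff:
  assumes "\<rho> \<in> zeta_zeros t R"
  shows "9 / 5 * norm (\<xi> \<rho>) < e \<longleftrightarrow> 9 / 5 * norm (\<rho> - Complex 1 t) < \<delta>"
proof -
  have "9 / 5 * norm (\<xi> \<rho>) = (9 / 5 * norm (\<rho> - Complex 1 t)) / R" using \<xi>_props(4)[OF assms] by simp
  thus ?thesis unfolding e_def using R_pos by (simp only: divide_less_cancel) simp
qed

text \<open>Each near zero adds at least ln (8.4) / 2 to S(e) - S(4e), and no zero subtracts
  anything. Total multiplicity 2 would require 2.12, but \<open>E_numeric\<close> and
  \<open>u_bounds\<close> allow only 0.675 + ln 4 < 2.07, the terms in x having cancelled.\<close>

lemma near_zeros_simple:
  shows "(\<Sum>\<rho>\<in>{\<rho>\<in>zeta_zeros t R. 9 / 5 * norm (\<rho> - Complex 1 t) < \<delta>}. zorder zeta \<rho>) \<le> 1"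
proof (rule ccontr)
  define A where "A = {\<rho>\<in>zeta_zeros t R. 9 / 5 * norm (\<rho> - Complex 1 t) < \<delta>}"
  assume "\<not> (\<Sum>\<rho>\<in>{\<rho>\<in>zeta_zeros t R. 9 / 5 * norm (\<rho> - Complex 1 t) < \<delta>}. zorder zeta \<rho>) \<le> 1"
  hence "(\<Sum>\<rho>\<in>A. zorder zeta \<rho>) \<ge> 2" by (simp add: A_def)
  hence two: "of_int (\<Sum>\<rho>\<in>A. zorder zeta \<rho>) \<ge> (2 :: real)" by linarith
  have S: "S e - S (4 * e) = (\<Sum>\<rho>\<in>zeta_zeros t R. of_int (zorder zeta \<rho>) * (green (\<xi> \<rho>) e - green (\<xi> \<rho>) (4 * e)))"
    by (simp add: S_def right_diff_distrib sum_subtractf)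
  have "212 / 100 \<le> ln (84 / 10 :: real)" using ln_constants by simp
  also have "\<dots> = 2 * (ln (84 / 10) / 2)" by simp
  also have "\<dots> \<le> of_int (\<Sum>\<rho>\<in>A. zorder zeta \<rho>) * (ln (84 / 10) / 2)"
    using two ln_constants by (intro mult_right_mono) auto
  also have "\<dots> = (\<Sum>\<rho>\<in>A. of_int (zorder zeta \<rho>) * (ln (84 / 10) / 2))" by (simp add: sum_distrib_right)
  also have "\<dots> \<le> (\<Sum>\<rho>\<in>A. of_int (zorder zeta \<rho>) * (green (\<xi> \<rho>) e - green (\<xi> \<rho>) (4 * e)))"
  proof (rule sum_mono)
    fix \<rho> assume "\<rho> \<in> A"
    hence \<rho>: "\<rho> \<in> zeta_zeros t R" and "9 / 5 * norm (\<xi> \<rho>) \<le> e" using near_iff[of \<rho>] by (auto simp: A_def)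
    with green_difference_near[of "\<xi> \<rho>" e] \<xi>_props[OF \<rho>] e_bounds
    have "ln (84 / 10) / 2 \<le> green (\<xi> \<rho>) e - green (\<xi> \<rho>) (4 * e)" by simp
    thus "of_int (zorder zeta \<rho>) * (ln (84 / 10) / 2) \<le> of_int (zorder zeta \<rho>) * (green (\<xi> \<rho>) e - green (\<xi> \<rho>) (4 * e))"
      using \<xi>_props(5)[OF \<rho>] by (intro mult_left_mono) auto
  qed
  also have "\<dots> \<le> S e - S (4 * e)" unfolding S
  proof (rule sum_mono2[OF finite_zeros])
    fix \<rho> assume "\<rho> \<in> zeta_zeros t R - A"
    hence \<rho>: "\<rho> \<in> zeta_zeros t R" by auto
    show "0 \<le> of_int (zorder zeta \<rho>) * (green (\<xi> \<rho>) e - green (\<xi> \<rho>) (4 * e))"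
      using \<xi>_props[OF \<rho>] green_decreasing[of "\<xi> \<rho>" e] e_bounds by (intro mult_nonneg_nonneg) auto
  qed (auto simp: A_def)
  finally show False using E_numeric u_bounds(1) ln_4_bounds(2) by argo
qed

definition "G \<rho> = 2 * green (\<xi> \<rho>) e - green (\<xi> \<rho>) (4 * e) - green (\<xi> \<rho>) 0"

text \<open>Solving the combined Poisson-Jensen formula for the value at the centre; the terms 0.14
  x of \<open>Q_numeric\<close> and \<open>u_bounds\<close> cancel.\<close>

lemma u0_ge: "u 0 \<ge> - ln (4 / \<delta>) + (\<Sum>\<rho>\<in>zeta_zeros t R. of_int (zorder zeta \<rho>) * G \<rho>) - 562 / 1000"
proof -
  have "2 * S e - S (4 * e) - S 0 = (\<Sum>\<rho>\<in>zeta_zeros t R. of_int (zorder zeta \<rho>) * G \<rho>)"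
    by (simp add: S_def G_def sum_distrib_left right_diff_distrib sum_subtractf mult.left_commute)
  thus ?thesis using Q_numeric u_bounds(2) by argo
qed

lemma G_far:
  assumes \<rho>: "\<rho> \<in> zeta_zeros t R" and far: "\<delta> \<le> 9 / 5 * norm (\<rho> - Complex 1 t)"
  shows "G \<rho> \<ge> 0"
proof -
  have "e \<le> 9 / 5 * norm (\<xi> \<rho>)" using near_iff[OF \<rho>] far by auto
  thus ?thesis unfolding G_def
    using \<xi>_props[OF \<rho>] e_bounds by (intro green_combination_far) auto
qed

text \<open>For a zero within \<alpha> the contribution \<open>G\<close> may be negative, but by no
  more than the logarithm that the added sum restores. The 15/100 is what the kernel error leaves of
  ln 29.388 - ln (100/7).\<close>

lemma u0_regular:
  assumes \<alpha>: "0 < \<alpha>" "\<alpha> \<le> 1"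
    and far: "\<And>\<rho>. \<rho> \<in> zeta_zeros t R \<Longrightarrow> \<delta> \<le> 9 / 5 * max (norm (\<rho> - Complex 1 t)) \<alpha>"
  shows "u 0 + (\<Sum>\<rho>\<in>{\<rho>\<in>zeta_zeros t R. norm (\<rho> - Complex 1 t) \<le> \<alpha>}. of_int (zorder zeta \<rho>) * ln (\<alpha> / norm (\<rho> - Complex 1 t)))
     \<ge> - ln (29.388 * ln t) + 15 / 100"
proof -
  define d where "d \<rho> = norm (\<rho> - Complex 1 t)" for \<rho>
  define m where "m \<rho> = real_of_int (zorder zeta \<rho>)" for \<rho>
  have "(\<Sum>\<rho>\<in>zeta_zeros t R. if d \<rho> \<le> \<alpha> then - (m \<rho> * ln (\<alpha> / d \<rho>)) else 0) \<le> (\<Sum>\<rho>\<in>zeta_zeros t R. m \<rho> * G \<rho>)"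
  proof (rule sum_mono)
    fix \<rho> assume \<rho>: "\<rho> \<in> zeta_zeros t R"
    note p = \<xi>_props[OF \<rho>]
    have d0: "d \<rho> > 0" using zeta_zeros_properties(2)[OF zf \<rho>] by (simp add: d_def)
    have m1: "m \<rho> \<ge> 1" using p by (simp add: m_def)
    show "(if d \<rho> \<le> \<alpha> then - (m \<rho> * ln (\<alpha> / d \<rho>)) else 0) \<le> m \<rho> * G \<rho>"
    proof (cases "d \<rho> \<le> \<alpha>")
      case True
      have "\<delta> / R \<le> 9 / 5 * \<alpha> / R" using far[OF \<rho>] True R_pos by (intro divide_right_mono) (auto simp: d_def)
      hence "2 * green (\<xi> \<rho>) e - green (\<xi> \<rho>) (4 * e) + ln (\<alpha> / R) \<ge> 0"
        using p True \<alpha> R R_pos e_bounds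
        by (intro green_combination_inner) (auto simp: d_def e_def intro!: divide_right_mono)
      moreover have "green (\<xi> \<rho>) 0 = - ln (d \<rho> / R)" using green_0[OF p(3)] p(4) by (simp add: d_def)
      moreover have "ln (\<alpha> / R) - ln (d \<rho> / R) = ln (\<alpha> / d \<rho>)" using \<alpha> R_pos d0 by (simp add: ln_div)
      ultimately have "G \<rho> \<ge> - ln (\<alpha> / d \<rho>)" by (simp add: G_def)
      hence "m \<rho> * G \<rho> \<ge> m \<rho> * (- ln (\<alpha> / d \<rho>))" using m1 by (intro mult_left_mono) auto
      thus ?thesis using True by simp
    next
      case False
      hence "G \<rho> \<ge> 0" using far[OF \<rho>] by (intro G_far[OF \<rho>]) (auto simp: d_def max_def split: if_splits)
      thus ?thesis using False m1 by simp
    qed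
  qed
  moreover have "(\<Sum>\<rho>\<in>zeta_zeros t R. if d \<rho> \<le> \<alpha> then - (m \<rho> * ln (\<alpha> / d \<rho>)) else 0)
      = - (\<Sum>\<rho>\<in>{\<rho>\<in>zeta_zeros t R. d \<rho> \<le> \<alpha>}. m \<rho> * ln (\<alpha> / d \<rho>))"
    using finite_zeros by (auto simp: sum_negf[symmetric] sum.inter_filter intro!: sum.cong)
  moreover have "ln (29.388 * ln t) = ln 29.388 + ln L" using L_ge by (subst ln_mult) (auto simp: L_def)
  moreover have "ln (4 / \<delta>) = ln (100 / 7) + ln L"
  proof -
    have "4 / \<delta> = 100 / 7 * L" using L_ge by (simp add: \<delta>_def)
    thus ?thesis using L_ge by (simp only:) (subst ln_mult, auto)
  qed
  ultimately show ?thesis using u0_ge ln_29388_bounds(1) by (simp add: d_def m_def)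
qed

text \<open>The near zero contributes -ln \<delta>, which cancels the ln \<delta> of -ln (4 /
  \<delta>): the bound depends on the distance of the zero and no longer on ln t. All other zeros
  are far by \<open>near_zeros_simple\<close>.\<close>

lemma u0_exceptional:
  assumes \<rho>: "\<rho>1 \<in> zeta_zeros t R" and near: "9 / 5 * norm (\<rho>1 - Complex 1 t) < \<delta>"
  shows "u 0 \<ge> ln (norm (\<rho>1 - Complex 1 t)) - 7 / 5"
    and "zorder zeta \<rho>1 = 1"
    and "\<And>\<rho>. \<rho> \<in> zeta_zeros t R \<Longrightarrow> \<rho> \<noteq> \<rho>1 \<Longrightarrow> \<delta> \<le> 9 / 5 * norm (\<rho> - Complex 1 t)"
proof -
  define A where "A = {\<rho>\<in>zeta_zeros t R. 9 / 5 * norm (\<rho> - Complex 1 t) < \<delta>}"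
  have A: "\<rho>1 \<in> A" "finite A" using \<rho> near finite_zeros by (auto simp: A_def)
  have pos: "zorder zeta \<rho> \<ge> 1" if "\<rho> \<in> A" for \<rho>
    using zeta_zeros_properties(3)[OF zf] that by (auto simp: A_def)
  have sum: "zorder zeta \<rho>1 + (\<Sum>\<rho>\<in>A - {\<rho>1}. zorder zeta \<rho>) \<le> 1"
    using near_zeros_simple sum.remove[OF A(2,1), of "zorder zeta"] by (simp add: A_def)
  moreover have "(\<Sum>\<rho>\<in>A - {\<rho>1}. zorder zeta \<rho>) \<ge> 0" using pos by (intro sum_nonneg) force
  ultimately show one: "zorder zeta \<rho>1 = 1" using pos[OF A(1)] by linarith
  show far: "\<delta> \<le> 9 / 5 * norm (\<rho> - Complex 1 t)" if "\<rho> \<in> zeta_zeros t R" "\<rho> \<noteq> \<rho>1" for \<rho>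
  proof (rule ccontr)
    assume "\<not> \<delta> \<le> 9 / 5 * norm (\<rho> - Complex 1 t)"
    hence "\<rho> \<in> A - {\<rho>1}" using that by (auto simp: A_def)
    hence "1 \<le> zorder zeta \<rho>" "zorder zeta \<rho> \<le> (\<Sum>\<rho>\<in>A - {\<rho>1}. zorder zeta \<rho>)"
      using pos A(2) by (auto intro!: member_le_sum) (force dest: pos)
    thus False using sum one by linarith
  qed
  note p = \<xi>_props[OF \<rho>]
  have d0: "norm (\<rho>1 - Complex 1 t) > 0" using zeta_zeros_properties(2)[OF zf \<rho>] by simp
  have "(\<Sum>\<rho>\<in>zeta_zeros t R. of_int (zorder zeta \<rho>) * G \<rho>) = G \<rho>1 + (\<Sum>\<rho>\<in>zeta_zeros t R - {\<rho>1}. of_int (zorder zeta \<rho>) * G \<rho>)"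
    using sum.remove[OF finite_zeros \<rho>, of "\<lambda>\<rho>. of_int (zorder zeta \<rho>) * G \<rho>"] one by simp
  moreover have "(\<Sum>\<rho>\<in>zeta_zeros t R - {\<rho>1}. of_int (zorder zeta \<rho>) * G \<rho>) \<ge> 0"
  proof (rule sum_nonneg)
    fix \<rho> assume "\<rho> \<in> zeta_zeros t R - {\<rho>1}"
    thus "0 \<le> real_of_int (zorder zeta \<rho>) * G \<rho>"
      using far[of \<rho>] G_far[of \<rho>] \<xi>_props(5)[of \<rho>] by (intro mult_nonneg_nonneg) auto
  qed
  moreover have "G \<rho>1 \<ge> ln (347 / 100) / 2 + ln (norm (\<xi> \<rho>1)) - ln e"
    unfolding G_def using p e_bounds near near_iff[OF \<rho>] by (intro green_combination_near) auto
  moreover have "ln (norm (\<xi> \<rho>1)) - ln e = ln (norm (\<rho>1 - Complex 1 t)) - ln \<delta>"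
    unfolding p(4) e_def using d0 R_pos \<delta>_bounds by (simp add: ln_div)
  moreover have "ln (4 / \<delta>) = ln 4 - ln \<delta>" using \<delta>_bounds by (simp add: ln_div)
  ultimately show "u 0 \<ge> ln (norm (\<rho>1 - Complex 1 t)) - 7 / 5"
    using u0_ge ln_constants(2) ln_4_bounds(2) by argo
qed

text \<open>Cauchy's inequality with radius 1 / L. On that disc 1 - \<sigma> is at most 1.3034 / L,
  so the power of t in the strip bound is at most e^1.3034 < 3.7.\<close>

lemma zeta_deriv_bound:
  assumes z: "norm (z - Complex 1 t) \<le> 3034 / (10000 * L)"
  shows "norm (deriv zeta z) \<le> 37 / 10 * L * (L + 27 / 20)"
proof -
  define r where "r = 1 / L"
  define B where "B = 37 / 10 * (L + 27 / 20)"
  have r: "0 < r" "r \<le> 4811 / 10000" using x_bounds by (auto simp: r_def x_def)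
  have zz: "norm (z - Complex 1 t) \<le> 3034 / 10000 * r" using z by (simp add: r_def)
  have Im: "Im w > 0" and bound: "norm (zeta w) \<le> B" if "norm (z - w) \<le> r" for w
  proof -
    define h where "h = 13034 / 10000 * r"
    have h: "h \<le> 64 / 100" using r by (simp add: h_def)
    have "norm (w - Complex 1 t) \<le> norm (z - w) + norm (z - Complex 1 t)"
      using norm_triangle_ineq4[of "z - Complex 1 t" "z - w"] by simp
    hence w: "norm (w - Complex 1 t) \<le> h" using that zz by (simp add: h_def)
    have im: "\<bar>Im w - t\<bar> \<le> h" using abs_Im_le_cmod[of "w - Complex 1 t"] w by simp
    have re: "\<bar>Re w - 1\<bar> \<le> h" using abs_Re_le_cmod[of "w - Complex 1 t"] w by simp
    show "Im w > 0" using im h t by linarith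
    have "norm (zeta (Complex (Re w) (Im w))) \<le> (ln t + 27 / 20) * (3 * t / 8) powr max (1 - Re w) 0"
      using im re h by (intro zeta_strip_bound t) auto
    also have "\<dots> \<le> (ln t + 27 / 20) * (37 / 10)"
    proof (intro mult_left_mono)
      have "(3 * t / 8) powr max (1 - Re w) 0 \<le> t powr max (1 - Re w) 0"
        using t by (intro powr_mono2) auto
      also have "\<dots> \<le> t powr h" using t re r by (intro powr_mono) (auto simp: h_def max_def abs_le_iff)
      also have "\<dots> = exp (13034 / 10000)" using t L_ge by (simp add: powr_def h_def r_def L_def)
      also have "\<dots> \<le> 37 / 10" using ln_37_bounds(1) by (subst ln_ge_iff[symmetric]) auto
      finally show "(3 * t / 8) powr max (1 - Re w) 0 \<le> 37 / 10" .
    qed (use L_ge in \<open>auto simp: L_def\<close>)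
    finally show "norm (zeta w) \<le> B" by (simp add: B_def L_def mult.commute)
  qed
  have sub: "cball z r \<subseteq> - {1}" using Im by (force simp: dist_norm)
  have "norm ((deriv ^^ 1) zeta z) \<le> fact 1 * B / r ^ 1"
  proof (rule Cauchy_inequality)
    show "zeta holomorphic_on ball z r"
      by (rule holomorphic_on_subset[OF zeta_holomorphic]) (use sub ball_subset_cball in blast)
    show "continuous_on (cball z r) zeta"
      by (intro holomorphic_on_imp_continuous_on holomorphic_on_subset[OF zeta_holomorphic] sub)
  qed (use r bound in auto)
  thus ?thesis by (simp add: B_def r_def mult_ac)
qed

lemma zeta_near_zero_bound:
  assumes "norm (z - Complex 1 t) \<le> 3034 / (10000 * L)" "norm (\<rho> - Complex 1 t) \<le> 3034 / (10000 * L)" "zeta \<rho> = 0"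
  shows "norm (zeta z) \<le> 37 / 10 * L * (L + 27 / 20) * norm (z - \<rho>)"
proof -
  have "norm (zeta z - zeta \<rho>) \<le> 37 / 10 * L * (L + 27 / 20) * norm (z - \<rho>)"
  proof (rule field_differentiable_bound[where S = "cball (Complex 1 t) (3034 / (10000 * L))" and f' = "deriv zeta"])
    fix w assume w: "w \<in> cball (Complex 1 t) (3034 / (10000 * L))"
    hence w': "norm (w - Complex 1 t) \<le> 3034 / (10000 * L)" by (simp add: dist_norm norm_minus_commute)
    thus "norm (deriv zeta w) \<le> 37 / 10 * L * (L + 27 / 20)" by (rule zeta_deriv_bound)
    have "3034 / (10000 * L) \<le> 1" using L_ge by simp
    hence "w \<noteq> 1" using abs_Im_le_cmod[of "w - Complex 1 t"] w' t by auto
    hence "(zeta has_field_derivative deriv zeta w) (at w)"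
      by (intro holomorphic_derivI[OF zeta_holomorphic]) auto
    thus "(zeta has_field_derivative deriv zeta w) (at w within cball (Complex 1 t) (3034 / (10000 * L)))"
      by (rule has_field_derivative_at_within)
  qed (use assms in \<open>auto simp: dist_norm norm_minus_commute\<close>)
  thus ?thesis using assms(3) by simp
qed

end

section \<open>Zeros and means over the left half circle\<close>

text \<open>Boundary zeros carry full weight here: Jensen's formula bounds this larger
  count.\<close>

definition zero_mass :: "real \<Rightarrow> real \<Rightarrow> real" where
  "zero_mass t \<alpha> = (\<Sum>\<rho> | zeta \<rho> = 0 \<and> norm (\<rho> - Complex 1 t) \<le> \<alpha>. of_int (zorder zeta \<rho>))"

lemma zeros_le_eq:
  assumes "\<alpha> < r"
  shows "{\<rho>. zeta \<rho> = 0 \<and> norm (\<rho> - Complex 1 t) \<le> \<alpha>} = {\<rho>\<in>zeta_zeros t r. norm (\<rho> - Complex 1 t) \<le> \<alpha>}"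
  using assms by (auto simp: zeta_zeros_def dist_norm norm_minus_commute)

lemma zeta_zeros_finite:
  assumes "zero_free_circle t r"
  shows "finite (zeta_zeros t r)"
  using zeta_poisson_jensen(1)[OF assms, of 0] zeta_line_1_nonzero[of t] assms
  by (auto simp: zero_free_circle_def)

lemma jensen_formula:
  assumes zf: "zero_free_circle t r"
  shows "integral {0..pi / 2} (left_pair t r) + integral {0..pi / 2} (right_pair t r) =
    2 * pi * (ln (norm (zeta (Complex 1 t))) +
      (\<Sum>\<rho>\<in>zeta_zeros t r. of_int (zorder zeta \<rho>) * ln (r / norm (\<rho> - Complex 1 t))))"
proof -
  have r: "0 < r" "r < t" using zf by (auto simp: zero_free_circle_def)
  have 1: "((\<lambda>\<theta>. right_pair t r \<theta> + left_pair t r \<theta>) has_integral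
     2 * pi * (ln (norm (zeta (Complex 1 t))) +
     (\<Sum>\<rho>\<in>zeta_zeros t r. of_int (zorder zeta \<rho>) * green ((\<rho> - Complex 1 t) / of_real r) 0))) {0..pi / 2}"
    using zeta_poisson_jensen(2)[OF zf, of 0] zeta_line_1_nonzero[of t] r by (simp add: poisson_def)
  have 2: "((\<lambda>\<theta>. right_pair t r \<theta> + left_pair t r \<theta>) has_integral
     (integral {0..pi / 2} (right_pair t r) + integral {0..pi / 2} (left_pair t r))) {0..pi / 2}"
    by (intro has_integral_add integrable_integral integrable_continuous_real pair_continuous[OF zf])
  have "integral {0..pi / 2} (right_pair t r) + integral {0..pi / 2} (left_pair t r) =
     2 * pi * (ln (norm (zeta (Complex 1 t))) +
     (\<Sum>\<rho>\<in>zeta_zeros t r. of_int (zorder zeta \<rho>) * green ((\<rho> - Complex 1 t) / of_real r) 0))"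
    by (rule has_integral_unique[OF 2 1])
  moreover have "green ((\<rho> - Complex 1 t) / of_real r) 0 = ln (r / norm (\<rho> - Complex 1 t))" if "\<rho> \<in> zeta_zeros t r" for \<rho>
    using zeta_zeros_properties(2)[OF zf that] r by (subst green_0) (auto simp: norm_divide ln_div)
  ultimately show ?thesis by simp
qed

lemma right_integral_le:
  assumes zf: "zero_free_circle t r"
  shows "integral {0..pi / 2} (right_pair t r) \<le> 2 * pi * c4 r"
proof (rule has_integral_le_except_right)
  have r: "0 < r" using zf by (auto simp: zero_free_circle_def)
  show "(right_pair t r has_integral integral {0..pi / 2} (right_pair t r)) {0..pi / 2}"
    by (intro integrable_integral integrable_continuous_real pair_continuous[OF zf])
  show "((\<lambda>\<theta>. 2 * ln (zr (1 + r * cos \<theta>))) has_integral 2 * pi * c4 r) {0..pi / 2}"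
    using has_integral_mult_right[OF c4_has_integral[OF r], of 2] by (simp add: mult.assoc)
  show "right_pair t r \<theta> \<le> 2 * ln (zr (1 + r * cos \<theta>))" if "\<theta> \<in> {0..<pi / 2}" for \<theta>
    using right_pair_bound[OF r that] by (rule abs_le_D1)
qed

text \<open>With d the distance of a zero, ln (r / d) = ln (r / \<alpha>) + ln (\<alpha> / d). The
  first part counts zeros, the second is the surplus spent in \<open>u0_regular\<close>. Zeros
  between \<alpha> and r only add to the left side.\<close>

lemma zero_sum_split:
  assumes zf: "zero_free_circle t r" and \<alpha>: "0 < \<alpha>" "\<alpha> < r"
  shows "(\<Sum>\<rho>\<in>zeta_zeros t r. of_int (zorder zeta \<rho>) * ln (r / norm (\<rho> - Complex 1 t))) \<ge>
    zero_mass t \<alpha> * ln (r / \<alpha>) +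
     (\<Sum>\<rho> | zeta \<rho> = 0 \<and> norm (\<rho> - Complex 1 t) \<le> \<alpha>. of_int (zorder zeta \<rho>) * ln (\<alpha> / norm (\<rho> - Complex 1 t)))"
    (is "_ \<ge> _ + (\<Sum>\<rho>\<in>?A. _)")
proof -
  have sub: "?A \<subseteq> zeta_zeros t r" unfolding zeros_le_eq[OF \<alpha>(2)] by auto
  have "zero_mass t \<alpha> * ln (r / \<alpha>) + (\<Sum>\<rho>\<in>?A. of_int (zorder zeta \<rho>) * ln (\<alpha> / norm (\<rho> - Complex 1 t)))
     = (\<Sum>\<rho>\<in>?A. of_int (zorder zeta \<rho>) * (ln (r / \<alpha>) + ln (\<alpha> / norm (\<rho> - Complex 1 t))))"
    by (simp add: zero_mass_def sum_distrib_right sum.distrib distrib_left)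
  also have "\<dots> = (\<Sum>\<rho>\<in>?A. of_int (zorder zeta \<rho>) * ln (r / norm (\<rho> - Complex 1 t)))"
  proof (rule sum.cong)
    fix \<rho> assume "\<rho> \<in> ?A"
    hence "norm (\<rho> - Complex 1 t) > 0" using zeta_zeros_properties(2)[OF zf, of \<rho>] sub by auto
    hence "ln (r / \<alpha>) + ln (\<alpha> / norm (\<rho> - Complex 1 t)) = ln (r / norm (\<rho> - Complex 1 t))"
      using \<alpha> by (simp add: ln_div)
    thus "of_int (zorder zeta \<rho>) * (ln (r / \<alpha>) + ln (\<alpha> / norm (\<rho> - Complex 1 t))) =
       of_int (zorder zeta \<rho>) * ln (r / norm (\<rho> - Complex 1 t))" by simp
  qed simp
  also have "\<dots> \<le> (\<Sum>\<rho>\<in>zeta_zeros t r. of_int (zorder zeta \<rho>) * ln (r / norm (\<rho> - Complex 1 t)))"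
  proof (rule sum_mono2[OF zeta_zeros_finite[OF zf] sub])
    fix \<rho> assume "\<rho> \<in> zeta_zeros t r - ?A"
    hence p: "\<rho> \<noteq> Complex 1 t" "zorder zeta \<rho> \<ge> 1" "norm (\<rho> - Complex 1 t) < r"
      using zeta_zeros_properties[OF zf, of \<rho>] by auto
    have "1 \<le> r / norm (\<rho> - Complex 1 t)" using p by simp
    thus "0 \<le> of_int (zorder zeta \<rho>) * ln (r / norm (\<rho> - Complex 1 t))"
      using p by (intro mult_nonneg_nonneg ln_ge_zero) auto
  qed
  finally show ?thesis .
qed

lemma inner_log_sum_nonneg:
  assumes zf: "zero_free_circle t r" and \<alpha>: "0 < \<alpha>" "\<alpha> < r"
  shows "(\<Sum>\<rho> | zeta \<rho> = 0 \<and> norm (\<rho> - Complex 1 t) \<le> \<alpha>. of_int (zorder zeta \<rho>) * ln (\<alpha> / norm (\<rho> - Complex 1 t))) \<ge> 0"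
    and "zero_mass t \<alpha> \<ge> 0"
proof -
  have p: "\<rho> \<noteq> Complex 1 t" "zorder zeta \<rho> \<ge> 1" "norm (\<rho> - Complex 1 t) \<le> \<alpha>"
    if "zeta \<rho> = 0" "norm (\<rho> - Complex 1 t) \<le> \<alpha>" for \<rho>
  proof -
    have "\<rho> \<in> zeta_zeros t r" using zeros_le_eq[OF \<alpha>(2), of t] that by auto
    thus "\<rho> \<noteq> Complex 1 t" "zorder zeta \<rho> \<ge> 1" "norm (\<rho> - Complex 1 t) \<le> \<alpha>"
      using zeta_zeros_properties[OF zf, of \<rho>] that by auto
  qed
  show "zero_mass t \<alpha> \<ge> 0" unfolding zero_mass_def
    using p(2) by (intro sum_nonneg) (auto intro: order.trans[of 0 1])
  show "(\<Sum>\<rho> | zeta \<rho> = 0 \<and> norm (\<rho> - Complex 1 t) \<le> \<alpha>. of_int (zorder zeta \<rho>) * ln (\<alpha> / norm (\<rho> - Complex 1 t))) \<ge> 0"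
  proof (intro sum_nonneg mult_nonneg_nonneg ln_ge_zero)
    fix \<rho> assume \<rho>: "\<rho> \<in> {\<rho>. zeta \<rho> = 0 \<and> norm (\<rho> - Complex 1 t) \<le> \<alpha>}"
    show "0 \<le> real_of_int (zorder zeta \<rho>)" using p(2)[of \<rho>] \<rho> by simp
    have "norm (\<rho> - Complex 1 t) > 0" using p(1)[of \<rho>] \<rho> by simp
    thus "1 \<le> \<alpha> / norm (\<rho> - Complex 1 t)" using \<rho> by simp
  qed
qed

text \<open>For these t the value at the centre has a constant lower bound, so the surplus of the
  inner zeros is simply dropped.\<close>

lemma left_mean_low:
  assumes t: "2 < t" "t \<le> 8" and \<alpha>: "0 < \<alpha>" "\<alpha> < r" and zf: "zero_free_circle t r"
  shows "integral {0..pi / 2} (left_pair t r) / (2 * pi) + c4 r \<ge> zero_mass t \<alpha> * ln (r / \<alpha>) + ln (2 / 5)"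
proof -
  have "ln (2 / 5) \<le> ln (norm (zeta (Complex 1 t)))"
    using zeta_line_1_lower_bound[OF t] by (intro ln_mono) auto
  hence "2 * pi * (zero_mass t \<alpha> * ln (r / \<alpha>) + ln (2 / 5)) \<le> 2 * pi * (ln (norm (zeta (Complex 1 t))) +
      (\<Sum>\<rho>\<in>zeta_zeros t r. of_int (zorder zeta \<rho>) * ln (r / norm (\<rho> - Complex 1 t))))"
    using zero_sum_split[OF zf \<alpha>] inner_log_sum_nonneg(1)[OF zf \<alpha>] by (intro mult_left_mono) auto
  also have "\<dots> \<le> integral {0..pi / 2} (left_pair t r) + 2 * pi * c4 r"
    unfolding jensen_formula[OF zf, symmetric] using right_integral_le[OF zf] by simp
  finally have "2 * pi * (zero_mass t \<alpha> * ln (r / \<alpha>) + ln (2 / 5) - c4 r) \<le> integral {0..pi / 2} (left_pair t r)"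
    by (simp add: algebra_simps)
  hence "zero_mass t \<alpha> * ln (r / \<alpha>) + ln (2 / 5) - c4 r \<le> integral {0..pi / 2} (left_pair t r) / (2 * pi)"
    by (subst pos_le_divide_eq) (simp_all add: mult.commute)
  thus ?thesis by simp
qed

text \<open>
  A zero close to \<open>1 + it\<close> lowers the value of \<open>ln \<bar>\<zeta>\<bar>\<close> at the centre, but then \<open>\<zeta>\<close> is
  also small on the whole right half of the circle.
\<close>

lemma (in high_ordinate) left_mean_exceptional:
  assumes \<alpha>: "0 < \<alpha>" "\<alpha> < r" "9 / 5 * \<alpha> < \<delta>" "ln (r / \<alpha>) \<le> 2 / 3" and r: "r \<le> 195 / 100 * \<alpha>"
    and zf': "zero_free_circle t r"
    and \<rho>: "\<rho> \<in> zeta_zeros t R" and near: "9 / 5 * norm (\<rho> - Complex 1 t) < \<delta>"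
  shows "integral {0..pi / 2} (left_pair t r) / (2 * pi) + c4 r + ln (29.388 * ln t) \<ge>
    zero_mass t \<alpha> * ln (r / \<alpha>) + 15 / 100"
proof -
  define d where "d = norm (\<rho> - Complex 1 t)"
  \<comment> \<open>One quantity for both positions of the zero: if it lies inside the circle of
    radius r, its Jensen term lifts ln d to ln r.\<close>
  define M where "M = max r d"
  define T where "T = 37 / 10 * L * (L + 27 / 20)"
  note ex = u0_exceptional[OF \<rho> near]
  have z\<rho>: "zeta \<rho> = 0" using zeta_zeros_properties(5)[OF zf \<rho>] .
  have d0: "d > 0" using zeta_zeros_properties(2)[OF zf \<rho>] by (simp add: d_def)
  have r0: "r > 0" using \<alpha> by simp
  have M: "M > 0" "r \<le> M" "d \<le> M" using r0 by (auto simp: M_def)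
  have L0: "L > 0" using L_ge by simp
  \<comment> \<open>r is at most 1.95 \<alpha> and \<alpha> is below 5 \<delta> / 9. As 5/9 * 0.28 *
    1.95 < 0.3034, the circle and the zero lie where \<open>zeta_deriv_bound\<close> holds.\<close>
  have h: "5 / 9 * \<delta> * (195 / 100) \<le> 3034 / (10000 * L)" using L0 by (simp add: \<delta>_def field_simps)
  have rh: "r \<le> 3034 / (10000 * L)" using h r \<alpha>(3) by linarith
  have dh: "d \<le> 3034 / (10000 * L)" using h near \<delta>_bounds(1) unfolding d_def by linarith
  have T0: "T > 0" using L0 by (simp add: T_def)
  have right: "ln (norm (zeta z)) \<le> ln (T * (2 * M))" if z: "norm (z - Complex 1 t) = r" "zeta z \<noteq> 0" for z
  proof -
    have "norm (zeta z) \<le> T * norm (z - \<rho>)"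
      unfolding T_def using zeta_near_zero_bound[of z \<rho>] z rh dh z\<rho> by (simp add: d_def)
    also have "norm (z - \<rho>) \<le> norm (z - Complex 1 t) + norm (\<rho> - Complex 1 t)"
      using norm_triangle_ineq4[of "z - Complex 1 t" "\<rho> - Complex 1 t"] by simp
    hence "T * norm (z - \<rho>) \<le> T * (2 * M)" using z M T0 by (intro mult_left_mono) (auto simp: d_def)
    finally show ?thesis using z by (intro ln_mono) auto
  qed
  have pt: "norm (Complex (1 + r * a) y - Complex 1 t) = r" if "a\<^sup>2 + b\<^sup>2 = 1" "y = t + r * b \<or> y = t - r * b" for a b y
  proof -
    have "(r * a)\<^sup>2 + (r * b)\<^sup>2 = r\<^sup>2" using that(1) by (simp add: power_mult_distrib flip: distrib_left)
    thus ?thesis using that(2) r0 by (auto simp: cmod_def)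
  qed
  have "integral {0..pi / 2} (right_pair t r) \<le> integral {0..pi / 2} (\<lambda>\<theta>. 2 * ln (T * (2 * M)))"
  proof (rule integral_le)
    fix \<theta> :: real
    show "right_pair t r \<theta> \<le> 2 * ln (T * (2 * M))" unfolding right_pair_def
      using right[OF pt[of "cos \<theta>" "sin \<theta>" "t + r * sin \<theta>"]] right[OF pt[of "cos \<theta>" "sin \<theta>" "t - r * sin \<theta>"]]
        circle_points_nonzero(1,2)[OF zf', of \<theta>] by simp
  qed (intro integrable_continuous_real pair_continuous[OF zf'] continuous_intros)+
  also have "\<dots> = pi * ln (T * (2 * M))" by simp
  finally have Ir: "integral {0..pi / 2} (right_pair t r) \<le> pi * ln (T * (2 * M))" .
  define \<Sigma> where "\<Sigma> = (\<Sum>\<rho>\<in>zeta_zeros t r. of_int (zorder zeta \<rho>) * ln (r / norm (\<rho> - Complex 1 t)))"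
  have terms: "0 \<le> of_int (zorder zeta \<rho>') * ln (r / norm (\<rho>' - Complex 1 t))" if "\<rho>' \<in> zeta_zeros t r" for \<rho>'
  proof -
    have p: "\<rho>' \<noteq> Complex 1 t" "zorder zeta \<rho>' \<ge> 1" "norm (\<rho>' - Complex 1 t) < r"
      using zeta_zeros_properties[OF zf' that] by auto
    have "1 \<le> r / norm (\<rho>' - Complex 1 t)" using p by simp
    thus ?thesis using p by (intro mult_nonneg_nonneg ln_ge_zero) auto
  qed
  have \<Sigma>: "u 0 + \<Sigma> \<ge> ln M - 7 / 5"
  proof (cases "d < r")
    case True
    hence "\<rho> \<in> zeta_zeros t r" using z\<rho> by (simp add: zeta_zeros_def d_def dist_norm norm_minus_commute)
    hence "of_int (zorder zeta \<rho>) * ln (r / norm (\<rho> - Complex 1 t)) \<le> \<Sigma>"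
      unfolding \<Sigma>_def using terms by (intro member_le_sum zeta_zeros_finite[OF zf']) auto
    hence "ln r - ln d \<le> \<Sigma>" using ex(2) d0 r0 by (simp add: d_def ln_div)
    thus ?thesis using ex(1) True by (simp add: d_def M_def)
  next
    case False
    have "\<Sigma> \<ge> 0" unfolding \<Sigma>_def using terms by (intro sum_nonneg) auto
    thus ?thesis using ex(1) False by (simp add: d_def M_def)
  qed
  \<comment> \<open>No zero but \<rho> can lie within \<alpha>, and \<rho> is simple.\<close>
  have mass: "zero_mass t \<alpha> * ln (r / \<alpha>) \<le> 2 / 3"
  proof -
    have r1: "r \<le> 1"
    proof -
      have "3034 / (10000 * L) \<le> 1" using L_ge by simp
      thus ?thesis using rh by linarith
    qed
    have A: "{\<rho>. zeta \<rho> = 0 \<and> norm (\<rho> - Complex 1 t) \<le> \<alpha>} \<subseteq> {\<rho>}"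
    proof
      fix \<rho>' assume "\<rho>' \<in> {\<rho>. zeta \<rho> = 0 \<and> norm (\<rho> - Complex 1 t) \<le> \<alpha>}"
      hence a: "zeta \<rho>' = 0" "norm (\<rho>' - Complex 1 t) \<le> \<alpha>" by auto
      have "\<rho>' \<in> zeta_zeros t R"
        using a \<alpha> r1 R by (simp add: zeta_zeros_def dist_norm norm_minus_commute)
      thus "\<rho>' \<in> {\<rho>}" using ex(3)[of \<rho>'] a \<alpha> by auto
    qed
    have "zero_mass t \<alpha> \<le> (\<Sum>\<rho>'\<in>{\<rho>}. of_int (zorder zeta \<rho>'))"
      unfolding zero_mass_def using A ex(2) by (intro sum_mono2) auto
    hence "zero_mass t \<alpha> \<le> 1" using ex(2) by simp
    moreover have "ln (r / \<alpha>) \<ge> 0" using \<alpha> by simp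
    ultimately have "zero_mass t \<alpha> * ln (r / \<alpha>) \<le> 1 * (2 / 3)" using \<alpha>(4) by (intro mult_mono) auto
    thus ?thesis by simp
  qed
  have "integral {0..pi / 2} (left_pair t r) + integral {0..pi / 2} (right_pair t r) = 2 * pi * (u 0 + \<Sigma>)"
    using jensen_formula[OF zf'] by (simp add: u_def \<Sigma>_def)
  hence "integral {0..pi / 2} (left_pair t r) \<ge> 2 * pi * (u 0 + \<Sigma>) - pi * ln (T * (2 * M))" using Ir by linarith
  moreover have "2 * pi * (u 0 + \<Sigma>) \<ge> 2 * pi * (ln M - 7 / 5)" using \<Sigma> by (intro mult_left_mono) auto
  ultimately have "integral {0..pi / 2} (left_pair t r) \<ge> (ln M - 7 / 5 - ln (T * (2 * M)) / 2) * (2 * pi)"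
    by (simp add: algebra_simps)
  hence Il: "integral {0..pi / 2} (left_pair t r) / (2 * pi) \<ge> ln M - 7 / 5 - ln (T * (2 * M)) / 2"
    by (subst pos_le_divide_eq) auto
  have lT: "ln (T * (2 * M)) = ln (37 / 10) + ln L + ln (L + 27 / 20) + ln 2 + ln M"
  proof -
    have "ln T = ln (37 / 10) + ln L + ln (L + 27 / 20)"
      unfolding T_def using L0 ln_mult[of "37 / 10 * L" "L + 27 / 20"] ln_mult[of "37 / 10" L] by simp
    thus ?thesis using T0 M ln_mult[of T "2 * M"] ln_mult[of 2 M] by simp
  qed
  \<comment> \<open>Together with \<open>rM\<close> this removes M: ln M - 1/2 ln M - 1/2 ln r is
    nonnegative. Of ln T / 2 there remains ln L and a constant, which ln (29.388 L) covers.\<close>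
  have c4: "c4 r \<ge> (ln 2 - ln r) / 2" using c4_ge[OF r0] r0 by (simp add: ln_div)
  have rM: "ln r \<le> ln M" using r0 M by simp
  have l: "ln (29.388 * ln t) = ln 29.388 + ln L" using L0 by (subst ln_mult) (auto simp: L_def)
  have "ln (L + 27 / 20) - ln L = ln ((L + 27 / 20) / L)" using L0 by (simp add: ln_div)
  also have "\<dots> \<le> (L + 27 / 20) / L - 1" using L0 by (intro ln_le_minus_one) auto
  also have "\<dots> = 27 / 20 * x" using L0 by (simp add: x_def field_simps)
  also have "\<dots> \<le> 65 / 100" using x_bounds(2) by simp
  finally show ?thesis using Il c4 rM mass ln_29388_bounds(2) ln_37_bounds(2) unfolding lT l by argo
qed

lemma left_mean_high:
  assumes t: "8 \<le> t" and \<alpha>: "0 < \<alpha>" "\<alpha> \<le> 1" "\<alpha> < r" "ln (r / \<alpha>) \<le> 2 / 3" and zf': "zero_free_circle t r"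
  shows "integral {0..pi / 2} (left_pair t r) / (2 * pi) + c4 r + ln (29.388 * ln t) \<ge>
    zero_mass t \<alpha> * ln (r / \<alpha>) + 15 / 100"
proof -
  obtain R where R: "195 / 100 < R" "R < 2" "zero_free_circle t R"
    using zero_free_circle_exists[of "195 / 100" 2 t] t by auto
  interpret high_ordinate t R by unfold_locales (use R t in auto)
  have "r / \<alpha> \<le> exp (2 / 3)" using \<alpha> by (subst ln_le_cancel_iff[symmetric]) auto
  hence "r / \<alpha> \<le> 195 / 100" by (rule order.trans) (use exp_two_thirds_le in simp)
  hence r: "r \<le> 195 / 100 * \<alpha>" using \<alpha> by (simp add: divide_le_eq)
  show ?thesis
  \<comment> \<open>Negating the condition yields a zero closer than 5 \<delta> / 9 and at the same
    time \<alpha> < 5 \<delta> / 9, which is the exceptional situation.\<close>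
  proof (cases "\<forall>\<rho>\<in>zeta_zeros t R. \<delta> \<le> 9 / 5 * max (norm (\<rho> - Complex 1 t)) \<alpha>")
    case True
    have A: "{\<rho>\<in>zeta_zeros t R. norm (\<rho> - Complex 1 t) \<le> \<alpha>} = {\<rho>. zeta \<rho> = 0 \<and> norm (\<rho> - Complex 1 t) \<le> \<alpha>}"
      by (rule zeros_le_eq[symmetric]) (use \<alpha> R in auto)
    have "2 * pi * (zero_mass t \<alpha> * ln (r / \<alpha>) - ln (29.388 * ln t) + 15 / 100) \<le>
      2 * pi * (u 0 + (\<Sum>\<rho>\<in>zeta_zeros t r. of_int (zorder zeta \<rho>) * ln (r / norm (\<rho> - Complex 1 t))))"
      using zero_sum_split[OF zf' \<alpha>(1,3)] u0_regular[OF \<alpha>(1,2)] True unfolding A by (intro mult_left_mono) force+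
    also have "\<dots> \<le> integral {0..pi / 2} (left_pair t r) + 2 * pi * c4 r"
      using right_integral_le[OF zf'] jensen_formula[OF zf'] by (simp add: u_def)
    finally have "2 * pi * (zero_mass t \<alpha> * ln (r / \<alpha>) - ln (29.388 * ln t) + 15 / 100 - c4 r) \<le> integral {0..pi / 2} (left_pair t r)"
      by (simp add: algebra_simps)
    hence "zero_mass t \<alpha> * ln (r / \<alpha>) - ln (29.388 * ln t) + 15 / 100 - c4 r \<le> integral {0..pi / 2} (left_pair t r) / (2 * pi)"
      by (subst pos_le_divide_eq) (simp_all add: mult.commute)
    thus ?thesis by simp
  next
    case False
    then obtain \<rho> where "\<rho> \<in> zeta_zeros t R" "9 / 5 * max (norm (\<rho> - Complex 1 t)) \<alpha> < \<delta>" by force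
    thus ?thesis
      using \<alpha> r zf' by (intro left_mean_exceptional[where \<rho> = \<rho>]) auto
  qed
qed

text \<open>The crude growth 1 / r is harmless: where it is used it gets multiplied by a
  \<open>\<kappa>\<close> of order r^2.\<close>

lemma c4_upper:
  assumes "0 < r" "r \<le> 195 / 100"
  shows "c4 r \<le> 1 / r + 35 / 100"
proof -
  have rr: "r\<^sup>2 \<le> 195 / 100 * r" using mult_right_mono[OF assms(2), of r] assms by (simp add: power2_eq_square)
  have "zr (1 + r) \<le> 1 / r + (1 / 2 + (1 + r) / 12 + 81 / 10000 * (1 + r) * (1 + r + 1))"
    using zr_bounds(1)[of "1 + r"] assms by simp
  also have "1 / 2 + (1 + r) / 12 + 81 / 10000 * (1 + r) * (1 + r + 1) =
     1 / 2 + 1 / 12 + 162 / 10000 + (1 / 12 + 243 / 10000) * r + 81 / 10000 * r\<^sup>2"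
    by (simp add: power2_eq_square field_simps)
  also have "\<dots> \<le> 85 / 100" using assms rr by argo
  finally have z: "zr (1 + r) \<le> 1 / r + 85 / 100" by simp
  have "ln 2 + ln (zr (1 + r)) = ln (2 * zr (1 + r))" using zr_pos[of "1 + r"] assms by (simp add: ln_mult)
  also have "\<dots> \<le> 2 * zr (1 + r) - 1" using zr_pos[of "1 + r"] assms by (intro ln_le_minus_one) auto
  finally show ?thesis using c4_less[of r] z assms by simp
qed

section \<open>The left half circle under the hypothesis on zeta\<close>

text \<open>The factor of B stays ln (t^2 - y^2) with y = r sin \<theta>, because enlarging it to 2
  ln t is allowed only for B \<ge> 0. The double logarithms are merged by the inequality of
  arithmetic and geometric means.\<close>

lemma left_pair_le:
  fixes A B t r r0 :: real
  assumes zf: "zero_free_circle t r" and r: "r < r0" "1 < t - r0" and \<theta>: "\<theta> \<in> {0..<pi / 2}"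
    and bound: "\<And>\<tau> \<sigma>. \<tau> \<in> {t - r0..t + r0} \<Longrightarrow> 0 \<le> 1 - \<sigma> \<Longrightarrow> 1 - \<sigma> < r0 \<Longrightarrow>
      zeta (Complex \<sigma> \<tau>) \<noteq> 0 \<Longrightarrow>
      ln (cmod (zeta (Complex \<sigma> \<tau>))) < B * (1 - \<sigma>) powr (3 / 2) * ln \<bar>\<tau>\<bar> + 2 / 3 * ln (ln \<bar>\<tau>\<bar>) + A"
  shows "left_pair t r \<theta> \<le> 2 * A + 4 / 3 * ln (ln t) + B * (r * cos \<theta>) powr (3 / 2) * ln (t\<^sup>2 - (r * sin \<theta>)\<^sup>2)"
proof -
  have r0: "r > 0" "r < t" using zf by (auto simp: zero_free_circle_def)
  have c: "0 \<le> cos \<theta>" "cos \<theta> \<le> 1" using \<theta> by (auto intro: cos_ge_zero)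
  have s: "0 \<le> sin \<theta>" "sin \<theta> \<le> 1" using \<theta> by (auto intro: sin_ge_zero)
  define y where "y = r * sin \<theta>"
  define k where "k = B * (r * cos \<theta>) powr (3 / 2)"
  have y: "0 \<le> y" "y \<le> r" using s r0 by (auto simp: y_def mult_left_le)
  have rc: "0 \<le> r * cos \<theta>" "r * cos \<theta> \<le> r" using c r0 by (auto simp: mult_left_le)
  have tp: "t - y > 1" "t + y > 1" "t > 1" using y r r0 by auto
  define p where "p = ln (t + y)"
  define q where "q = ln (t - y)"
  have pq: "p > 0" "q > 0" unfolding p_def q_def using tp by (auto intro: ln_gt_zero)
  have L: "ln t > 0" using tp by (intro ln_gt_zero)
  have sum: "p + q = ln (t\<^sup>2 - y\<^sup>2)"
    using ln_mult[of "t + y" "t - y"] tp by (simp add: p_def q_def power2_eq_square algebra_simps)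
  have "ln (cmod (zeta (Complex (1 - r * cos \<theta>) (t + y)))) < k * p + 2 / 3 * ln p + A"
    using bound[of "t + y" "1 - r * cos \<theta>"] y r rc tp circle_points_nonzero(3)[OF zf, of \<theta>]
    by (simp add: y_def[symmetric] k_def p_def)
  moreover have "ln (cmod (zeta (Complex (1 - r * cos \<theta>) (t - y)))) < k * q + 2 / 3 * ln q + A"
    using bound[of "t - y" "1 - r * cos \<theta>"] y r rc tp circle_points_nonzero(4)[OF zf, of \<theta>]
    by (simp add: y_def[symmetric] k_def q_def)
  ultimately have "left_pair t r \<theta> \<le> k * (p + q) + 2 / 3 * (ln p + ln q) + 2 * A"
    unfolding left_pair_def y_def[symmetric] distrib_left by linarith
  moreover have "ln p + ln q \<le> 2 * ln (ln t)"
  proof -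
    have "t\<^sup>2 - y\<^sup>2 > 0" using mult_pos_pos[of "t + y" "t - y"] tp by (simp add: power2_eq_square algebra_simps)
    hence "ln (t\<^sup>2 - y\<^sup>2) \<le> ln (t\<^sup>2)" using tp by (intro ln_mono) auto
    also have "\<dots> = 2 * ln t" using tp by (simp add: ln_realpow)
    finally have pq2: "p + q \<le> 2 * ln t" using sum by simp
    have "4 * (p * q) \<le> (p + q)\<^sup>2" using zero_le_power2[of "p - q"] by (simp add: power2_eq_square algebra_simps)
    also have "\<dots> \<le> (2 * ln t)\<^sup>2" using pq2 pq by (intro power_mono) auto
    finally have "p * q \<le> (ln t)\<^sup>2" by (simp add: power_mult_distrib)
    hence "ln (p * q) \<le> ln ((ln t)\<^sup>2)" using pq by (intro ln_mono) auto
    thus ?thesis using pq L by (simp add: ln_mult ln_realpow)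
  qed
  ultimately have "left_pair t r \<theta> \<le> 2 * A + 4 / 3 * ln (ln t) + k * ln (t\<^sup>2 - y\<^sup>2)"
    unfolding sum[symmetric] by argo
  thus ?thesis unfolding k_def y_def .
qed

lemma left_integral_nonneg_coeff:
  fixes A B :: real
  assumes zf: "zero_free_circle t r" and t: "1 < t" and B: "B \<ge> 0"
    and left: "\<And>\<theta>. \<theta> \<in> {0..<pi / 2} \<Longrightarrow>
      left_pair t r \<theta> \<le> 2 * A + 4 / 3 * ln (ln t) + B * (r * cos \<theta>) powr (3 / 2) * ln (t\<^sup>2 - (r * sin \<theta>)\<^sup>2)"
  shows "integral {0..pi / 2} (left_pair t r) / (2 * pi) \<le>
    A / 2 + ln (ln t) / 3 + B * r powr (3 / 2) * ln t * E_half / pi"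
proof -
  have r: "0 < r" "r < t" using zf by (auto simp: zero_free_circle_def)
  have "integral {0..pi / 2} (left_pair t r) \<le>
    (2 * A + 4 / 3 * ln (ln t)) * (pi / 2) + B * r powr (3 / 2) * (2 * ln t) * E_half"
  proof (rule has_integral_le_except_right)
    show "(left_pair t r has_integral integral {0..pi / 2} (left_pair t r)) {0..pi / 2}"
      by (intro integrable_integral integrable_continuous_real pair_continuous[OF zf])
    show "((\<lambda>\<theta>. (2 * A + 4 / 3 * ln (ln t)) + B * r powr (3 / 2) * (2 * ln t) * cos \<theta> powr (3 / 2)) has_integral
       (2 * A + 4 / 3 * ln (ln t)) * (pi / 2) + B * r powr (3 / 2) * (2 * ln t) * E_half) {0..pi / 2}"
      using has_integral_const_real[of "2 * A + 4 / 3 * ln (ln t)" 0 "pi / 2"]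
      by (intro has_integral_add has_integral_mult_right E_half_has_integral) (simp add: mult.commute)
    fix \<theta> assume \<theta>: "\<theta> \<in> {0..<pi / 2}"
    have c: "0 \<le> cos \<theta>" using \<theta> by (auto intro: cos_ge_zero)
    have "\<bar>r * sin \<theta>\<bar> \<le> r" unfolding abs_mult using r by (simp add: mult_left_le)
    hence "(r * sin \<theta>)\<^sup>2 < t\<^sup>2" using power_strict_mono[of "\<bar>r * sin \<theta>\<bar>" t 2] r by simp
    hence "ln (t\<^sup>2 - (r * sin \<theta>)\<^sup>2) \<le> ln (t\<^sup>2)" by (intro ln_mono) auto
    also have "\<dots> = 2 * ln t" using t by (simp add: ln_realpow)
    finally have "B * (r * cos \<theta>) powr (3 / 2) * ln (t\<^sup>2 - (r * sin \<theta>)\<^sup>2) \<le> B * (r * cos \<theta>) powr (3 / 2) * (2 * ln t)"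
      using B by (intro mult_left_mono) auto
    also have "\<dots> = B * r powr (3 / 2) * (2 * ln t) * cos \<theta> powr (3 / 2)"
      using r c by (simp add: powr_mult)
    finally show "left_pair t r \<theta> \<le> (2 * A + 4 / 3 * ln (ln t)) + B * r powr (3 / 2) * (2 * ln t) * cos \<theta> powr (3 / 2)"
      using left[OF \<theta>] by linarith
  qed
  hence "integral {0..pi / 2} (left_pair t r) / (2 * pi) \<le>
    ((2 * A + 4 / 3 * ln (ln t)) * (pi / 2) + B * r powr (3 / 2) * (2 * ln t) * E_half) / (2 * pi)"
    by (intro divide_right_mono) auto
  also have "\<dots> = A / 2 + ln (ln t) / 3 + B * r powr (3 / 2) * ln t * E_half / pi"
    by (simp add: field_simps)
  finally show ?thesis .
qed

text \<open>
  For \<open>B < 0\<close> the factor \<open>ln \<bar>\<tau>\<bar>\<close> is too small near \<open>\<theta> = \<pi> / 2\<close>. Integrating against the weight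
  \<open>1 + \<kappa> (cos\<^sup>2 \<theta> - 1 / 2)\<close> shifts mass to small \<open>\<theta>\<close>; the loss is paid for by the slack in the
  lower bound for the integral.
\<close>

lemma left_integral_neg_coeff:
  fixes A B :: real
  assumes zf: "zero_free_circle t r" and t: "1 < t" and B: "B < 0"
    and left: "\<And>\<theta>. \<theta> \<in> {0..<pi / 2} \<Longrightarrow>
      left_pair t r \<theta> \<le> 2 * A + 4 / 3 * ln (ln t) + B * (r * cos \<theta>) powr (3 / 2) * ln (t\<^sup>2 - (r * sin \<theta>)\<^sup>2)"
    and crude: "\<And>\<theta>. \<theta> \<in> {0..pi / 2} \<Longrightarrow> left_pair t r \<theta> \<le> 2 * (a + b * r * cos \<theta>)"
    and \<eta>: "\<eta> = r\<^sup>2 / (t\<^sup>2 - r\<^sup>2)"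
    and \<kappa>: "0 \<le> \<kappa>" "\<kappa> \<le> 2" "\<eta> * (2 + \<kappa>) \<le> 3 * \<kappa> * ln t"
  shows "(1 + \<kappa> / 2) * (integral {0..pi / 2} (left_pair t r) / (2 * pi)) \<le>
    A / 2 + ln (ln t) / 3 + B * r powr (3 / 2) * ln t * E_half / pi + \<kappa> * ((a * (pi / 4) + b * r / 3) / pi)"
proof -
  define L where "L = ln t"
  define M where "M = 2 * A + 4 / 3 * ln L"
  define D where "D = B * r powr (3 / 2)"
  define I where "I = integral {0..pi / 2} (left_pair t r)"
  have r: "0 < r" "r < t" using zf by (auto simp: zero_free_circle_def)
  have tr: "t\<^sup>2 - r\<^sup>2 > 0" using r power_strict_mono[of r t 2] by simp
  have \<eta>0: "\<eta> \<ge> 0" unfolding \<eta> using tr by simp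
  have D: "D \<le> 0" using B by (simp add: D_def mult_nonpos_nonneg)
  have L: "L > 0" using t by (simp add: L_def)
  have "(1 + \<kappa> / 2) * I - 2 * \<kappa> * (a * (pi / 4) + b * r * (1 / 3)) \<le>
     M * (1 - \<kappa> / 2) * (pi / 2) + M * \<kappa> * (pi / 4) + D * (2 * L * (1 - \<kappa> / 2)) * E_half
       + D * (2 * L * \<kappa>) * (5 / 7 * E_half) - D * (\<eta> * (1 + \<kappa> / 2)) * (2 / 7 * E_half)"
  proof (rule has_integral_le_except_right)
    show "((\<lambda>\<theta>. (1 + \<kappa> / 2) * left_pair t r \<theta> - 2 * \<kappa> * (a * (sin \<theta>)\<^sup>2 + b * r * (cos \<theta> * (sin \<theta>)\<^sup>2))) has_integral
      (1 + \<kappa> / 2) * I - 2 * \<kappa> * (a * (pi / 4) + b * r * (1 / 3))) {0..pi / 2}"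
      unfolding I_def
      by (intro has_integral_diff has_integral_add has_integral_mult_right cos_power_integrals
          integrable_integral integrable_continuous_real pair_continuous[OF zf])
    show "((\<lambda>\<theta>. M * (1 - \<kappa> / 2) + M * \<kappa> * (cos \<theta>)\<^sup>2 + D * (2 * L * (1 - \<kappa> / 2)) * cos \<theta> powr (3 / 2)
       + D * (2 * L * \<kappa>) * (cos \<theta> powr (3 / 2) * (cos \<theta>)\<^sup>2) - D * (\<eta> * (1 + \<kappa> / 2)) * (cos \<theta> powr (3 / 2) * (sin \<theta>)\<^sup>2)) has_integral
       M * (1 - \<kappa> / 2) * (pi / 2) + M * \<kappa> * (pi / 4) + D * (2 * L * (1 - \<kappa> / 2)) * E_half
       + D * (2 * L * \<kappa>) * (5 / 7 * E_half) - D * (\<eta> * (1 + \<kappa> / 2)) * (2 / 7 * E_half)) {0..pi / 2}"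
      using has_integral_const_real[of "M * (1 - \<kappa> / 2)" 0 "pi / 2"]
      by (intro has_integral_diff has_integral_add has_integral_mult_right E_half_has_integral cos_powr_reduction cos_power_integrals)
         (simp add: mult.commute)
    fix \<theta> assume \<theta>: "\<theta> \<in> {0..<pi / 2}"
    define c where "c = cos \<theta>"
    define s2 where "s2 = (sin \<theta>)\<^sup>2"
    define P where "P = c powr (3 / 2)"
    define l where "l = left_pair t r \<theta>"
    \<comment> \<open>The weight 1 + \<kappa> (cos^2 \<theta> - 1/2), written in sin^2
      \<theta>.\<close>
    define k where "k = 1 + \<kappa> / 2 - \<kappa> * s2"
    have c: "0 \<le> c" using \<theta> by (auto simp: c_def intro: cos_ge_zero)
    have cs: "c\<^sup>2 = 1 - s2" by (simp add: c_def s2_def cos_squared_eq)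
    have s2: "0 \<le> s2" "s2 \<le> 1" using zero_le_power2[of c] cs by (auto simp: s2_def)
    have P: "P \<ge> 0" by (simp add: P_def)
    have \<kappa>s: "0 \<le> \<kappa> * s2" "\<kappa> * s2 \<le> \<kappa>" using s2 \<kappa> by (auto simp: mult_left_le)
    have k: "0 \<le> k" "k \<le> 1 + \<kappa> / 2" using \<kappa>s \<kappa> by (auto simp: k_def)
    have ln_ge: "ln (t\<^sup>2 - r\<^sup>2 * s2) \<ge> 2 * L - \<eta> * s2"
    proof -
      have rs: "r\<^sup>2 * s2 \<le> r\<^sup>2" using s2 by (simp add: mult_left_le)
      hence pos: "t\<^sup>2 - r\<^sup>2 * s2 > 0" using tr by linarith
      have "ln (t\<^sup>2) - ln (t\<^sup>2 - r\<^sup>2 * s2) = ln (t\<^sup>2 / (t\<^sup>2 - r\<^sup>2 * s2))" using pos t by (simp add: ln_div)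
      also have "\<dots> \<le> t\<^sup>2 / (t\<^sup>2 - r\<^sup>2 * s2) - 1" using pos t by (intro ln_le_minus_one divide_pos_pos) auto
      also have "\<dots> = r\<^sup>2 * s2 / (t\<^sup>2 - r\<^sup>2 * s2)" using pos by (simp add: field_simps)
      also have "\<dots> \<le> r\<^sup>2 * s2 / (t\<^sup>2 - r\<^sup>2)" using pos tr rs s2 by (intro divide_left_mono mult_pos_pos) auto
      also have "\<dots> = \<eta> * s2" by (simp add: \<eta>)
      finally show ?thesis using t by (simp add: L_def ln_realpow)
    qed
    have "l \<le> M + D * P * ln (t\<^sup>2 - r\<^sup>2 * s2)"
      using left[OF \<theta>] r c
      by (simp add: l_def M_def L_def D_def P_def c_def s2_def powr_mult power_mult_distrib mult_ac)
    also have "\<dots> \<le> M + D * P * (2 * L - \<eta> * s2)"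
      using ln_ge D P by (intro add_left_mono mult_left_mono_neg) (auto simp: mult_nonpos_nonneg)
    finally have "k * l \<le> k * (M + D * P * (2 * L - \<eta> * s2))" using k by (intro mult_left_mono) auto
    also have "\<dots> = k * M + D * P * (2 * L * k - k * (\<eta> * s2))" by (simp add: algebra_simps)
    also have "\<dots> \<le> k * M + D * P * (2 * L * k - (1 + \<kappa> / 2) * (\<eta> * s2))"
    proof -
      have "k * (\<eta> * s2) \<le> (1 + \<kappa> / 2) * (\<eta> * s2)" using k \<eta>0 s2 by (intro mult_right_mono) auto
      thus ?thesis using D P by (intro add_left_mono mult_left_mono_neg) (auto simp: mult_nonpos_nonneg)
    qed
    finally have up: "k * l \<le> k * M + D * P * (2 * L * k - (1 + \<kappa> / 2) * (\<eta> * s2))" .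
    \<comment> \<open>The part \<kappa> sin^2 \<theta> by which the weight falls short of 1 +
      \<kappa>/2 is handled with the crude bound, which does not involve A and B.\<close>
    have "\<kappa> * s2 * l \<le> \<kappa> * s2 * (2 * (a + b * r * c))"
      using crude[of \<theta>] \<theta> \<kappa>s by (intro mult_left_mono) (auto simp: l_def c_def)
    hence "(1 + \<kappa> / 2) * l - 2 * \<kappa> * (a * s2 + b * r * (c * s2)) \<le> k * l"
      by (simp add: k_def algebra_simps)
    also note up
    also have "k * M + D * P * (2 * L * k - (1 + \<kappa> / 2) * (\<eta> * s2)) =
       M * (1 - \<kappa> / 2) + M * \<kappa> * c\<^sup>2 + D * (2 * L * (1 - \<kappa> / 2)) * P
       + D * (2 * L * \<kappa>) * (P * c\<^sup>2) - D * (\<eta> * (1 + \<kappa> / 2)) * (P * s2)"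
      unfolding cs k_def by (simp add: algebra_simps)
    finally show "(1 + \<kappa> / 2) * left_pair t r \<theta> - 2 * \<kappa> * (a * (sin \<theta>)\<^sup>2 + b * r * (cos \<theta> * (sin \<theta>)\<^sup>2)) \<le>
       M * (1 - \<kappa> / 2) + M * \<kappa> * (cos \<theta>)\<^sup>2 + D * (2 * L * (1 - \<kappa> / 2)) * cos \<theta> powr (3 / 2)
       + D * (2 * L * \<kappa>) * (cos \<theta> powr (3 / 2) * (cos \<theta>)\<^sup>2) - D * (\<eta> * (1 + \<kappa> / 2)) * (cos \<theta> powr (3 / 2) * (sin \<theta>)\<^sup>2)"
      by (simp add: c_def s2_def P_def l_def)
  qed
  \<comment> \<open>The moments 5/7 and 2/7 combine to the last bracket. It is nonnegative by the
    third condition on \<kappa> and is multiplied by the nonpositive \<open>D\<close>.\<close>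
  also have "\<dots> = M * (pi / 2) + D * E_half * (2 * L) + D * E_half / 7 * (3 * \<kappa> * L - \<eta> * (2 + \<kappa>))"
    by (simp add: field_simps)
  also have "\<dots> \<le> M * (pi / 2) + D * E_half * (2 * L)"
    using D E_half_pos \<kappa>(3) by (simp add: L_def mult_nonpos_nonneg divide_nonpos_pos)
  finally have "(1 + \<kappa> / 2) * I \<le> M * (pi / 2) + D * E_half * (2 * L) + 2 * \<kappa> * (a * (pi / 4) + b * r * (1 / 3))" by simp
  hence "(1 + \<kappa> / 2) * I / (2 * pi) \<le>
     (M * (pi / 2) + D * E_half * (2 * L) + 2 * \<kappa> * (a * (pi / 4) + b * r * (1 / 3))) / (2 * pi)"
    by (intro divide_right_mono) auto
  also have "\<dots> = A / 2 + ln L / 3 + D * L * E_half / pi + \<kappa> * ((a * (pi / 4) + b * r / 3) / pi)"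
    by (simp add: M_def field_simps)
  finally show ?thesis by (simp add: I_def L_def D_def)
qed

section \<open>The zero count\<close>

text \<open>The circle mean \<open>I\<close> is eliminated between a lower bound with slack
  \<open>\<sigma>\<close> and the weighted upper bound; the slack absorbs what
  \<open>\<kappa>\<close> costs.\<close>

lemma weighted_combination:
  fixes I P c l \<sigma> V W \<kappa> :: real
  assumes lower: "I + c + l \<ge> P + \<sigma>" and upper: "(1 + \<kappa> / 2) * I \<le> V + \<kappa> * W"
    and "P \<ge> 0" "\<kappa> \<ge> 0" and \<sigma>: "\<kappa> * ((c + l - \<sigma>) / 2 + W) \<le> \<sigma>"
  shows "P \<le> V + c + l"
proof -
  have "(1 + \<kappa> / 2) * (P + \<sigma> - c - l) \<le> (1 + \<kappa> / 2) * I" using lower assms(4) by (intro mult_left_mono) auto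
  hence "P + \<kappa> * P / 2 + \<sigma> - c - l \<le> V + \<kappa> * ((c + l - \<sigma>) / 2 + W)" using upper by (simp add: field_simps)
  moreover have "\<kappa> * P / 2 \<ge> 0" using assms by simp
  ultimately show ?thesis using \<sigma> by linarith
qed

text \<open>The 87 is 3 * 29: for t \<ge> 8 and r \<le> 1.95 one has \<eta> \<le> r^2 / 60 and 2 +
  \<kappa> \<le> 2.03, so \<eta> (2 + \<kappa>) is at most r^2 / 29 = 3 \<kappa> L.\<close>

lemma slack_high:
  fixes t r :: real
  assumes t: "8 \<le> t" and r: "0 < r" "r \<le> 195 / 100"
  defines "L \<equiv> ln t" and "\<eta> \<equiv> r\<^sup>2 / (t\<^sup>2 - r\<^sup>2)" and "\<kappa> \<equiv> r\<^sup>2 / (87 * ln t)"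
    and "W \<equiv> (ln (ln t + 27 / 20) * (pi / 4) + (ln t - 98 / 100) * r / 3) / pi"
  shows "0 \<le> \<kappa>" "\<kappa> \<le> 2" "\<eta> * (2 + \<kappa>) \<le> 3 * \<kappa> * L"
    and "\<kappa> * ((c4 r + ln (29.388 * L) - 15 / 100) / 2 + W) \<le> 15 / 100"
proof -
  have "ln 8 \<le> ln t" using t by (intro ln_mono) auto
  hence L: "L \<ge> 2079 / 1000" using ln_8_ge by (simp add: L_def)
  have rr: "0 \<le> r\<^sup>2" "r\<^sup>2 \<le> 38025 / 10000" using power_mono[OF r(2), of 2] r by (simp_all add: power2_eq_square)
  have \<kappa>: "\<kappa> = r\<^sup>2 / (87 * L)" by (simp add: \<kappa>_def L_def)
  show \<kappa>0: "0 \<le> \<kappa>" unfolding \<kappa> using L by simp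
  have "\<kappa> \<le> (38025 / 10000) / (87 * (2079 / 1000))" unfolding \<kappa> using L rr by (intro frac_le) auto
  hence \<kappa>1: "\<kappa> \<le> 3 / 100" by simp
  thus "\<kappa> \<le> 2" by simp
  have "t\<^sup>2 \<ge> 64" using power_mono[of 8 t 2] t by simp
  hence "\<eta> \<le> r\<^sup>2 / 60" unfolding \<eta>_def using rr by (intro divide_left_mono) auto
  hence "\<eta> * (2 + \<kappa>) \<le> r\<^sup>2 / 60 * (203 / 100)" using \<kappa>0 \<kappa>1 by (intro mult_mono) auto
  also have "\<dots> \<le> r\<^sup>2 / 29" using rr by simp
  also have "\<dots> = 3 * \<kappa> * L" unfolding \<kappa> using L by (simp add: field_simps)
  finally show "\<eta> * (2 + \<kappa>) \<le> 3 * \<kappa> * L" .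
  have l: "ln (29.388 * L) \<le> 25 / 10 + L"
  proof -
    have "ln (29.388 * L) = ln 29.388 + ln L" using L by (subst ln_mult) auto
    moreover have "ln (29.388 :: real) \<le> ln 32" by (intro ln_mono) auto
    moreover have "ln (32 :: real) = 5 * ln 2" using ln_realpow[of 2 5] by simp
    moreover have "ln L \<le> L - 1" using L by (intro ln_le_minus_one) auto
    ultimately show ?thesis using ln_numeric_bounds(2) by argo
  qed
  have W: "W \<le> 467 / 1000 * L + 9 / 100"
  proof -
    have "W = ln (L + 27 / 20) / 4 + (L - 98 / 100) * r / 3 / pi" by (simp add: W_def L_def field_simps)
    moreover have "ln (L + 27 / 20) \<le> L + 27 / 20 - 1" using L by (intro ln_le_minus_one) auto
    moreover have "(L - 98 / 100) * r / 3 / pi \<le> L * (195 / 100) / 3 / 3"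
      using L r pi_gt3 by (intro frac_le mult_mono divide_right_mono) auto
    ultimately show ?thesis using L by argo
  qed
  have "(c4 r + ln (29.388 * L) - 15 / 100) / 2 + W \<le> 1 / r / 2 + 166 / 100 * L"
  proof -
    have "(c + l - 15 / 100) / 2 + W \<le> q / 2 + 166 / 100 * L" if "c \<le> q + 35 / 100" "l \<le> 25 / 10 + L" for c l q
      using that W L by argo
    from this[OF c4_upper[OF r] l] show ?thesis .
  qed
  hence "\<kappa> * ((c4 r + ln (29.388 * L) - 15 / 100) / 2 + W) \<le> \<kappa> * (1 / r / 2 + 166 / 100 * L)"
    using \<kappa>0 by (intro mult_left_mono)
  also have "\<dots> = r / (174 * L) + 166 / 8700 * r\<^sup>2" unfolding \<kappa> using L r by (simp add: field_simps power2_eq_square)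
  also have "\<dots> \<le> (195 / 100) / (174 * (2079 / 1000)) + 166 / 8700 * (38025 / 10000)"
    using L r rr by (intro add_mono frac_le mult_left_mono) auto
  also have "\<dots> \<le> 15 / 100" by simp
  finally show "\<kappa> * ((c4 r + ln (29.388 * L) - 15 / 100) / 2 + W) \<le> 15 / 100" .
qed

text \<open>With this \<kappa> one has 3 \<kappa> L = 3.3 \<eta>, which suffices because \<kappa>
  \<le> 1.3. The slack is large, since |zeta(1 + it)| \<ge> 2/5 is far more than the general bound 1
  / (29.388 ln t).\<close>

lemma slack_low:
  fixes t r :: real
  assumes t: "2 < t" and r: "0 < r" "r \<le> 195 / 100" "r + 1 < t"
  defines "L \<equiv> ln t" and "\<eta> \<equiv> r\<^sup>2 / (t\<^sup>2 - r\<^sup>2)" and "\<sigma> \<equiv> ln (29.388 * ln t) + ln (2 / 5)"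
  defines "\<kappa> \<equiv> 11 / 10 * (\<eta> / L)"
  shows "0 \<le> \<kappa>" "\<kappa> \<le> 2" "\<eta> * (2 + \<kappa>) \<le> 3 * \<kappa> * L" "\<sigma> \<ge> 198 / 100"
    and "\<kappa> * ((c4 r + ln (29.388 * L) - \<sigma>) / 2 + (5 / 2 * (pi / 4) + 0 * r / 3) / pi) \<le> \<sigma>"
proof -
  have "ln 2 \<le> ln t" using t by (intro ln_mono) auto
  hence L: "L \<ge> 693 / 1000" using ln_numeric_bounds(1) by (simp add: L_def)
  have tr: "t\<^sup>2 - r\<^sup>2 \<ge> 2 * r + 1"
    using power_mono[of "r + 1" t 2] r by (simp add: power2_eq_square algebra_simps)
  have rr: "r\<^sup>2 \<le> 195 / 100 * r" "0 \<le> r\<^sup>2" using mult_right_mono[OF r(2), of r] r by (simp_all add: power2_eq_square)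
  have \<eta>0: "0 \<le> \<eta>" unfolding \<eta>_def using tr r by simp
  have \<eta>1: "\<eta> \<le> r\<^sup>2 / (2 * r + 1)" unfolding \<eta>_def using tr r by (intro divide_left_mono mult_pos_pos) auto
  have "r\<^sup>2 / (2 * r + 1) \<le> 78 / 100" using rr r by (simp add: divide_le_eq)
  hence \<eta>2: "\<eta> \<le> 78 / 100" using \<eta>1 by linarith
  show \<kappa>0: "0 \<le> \<kappa>" unfolding \<kappa>_def using L \<eta>0 by simp
  have "\<eta> / L \<le> (78 / 100) / (693 / 1000)" using L \<eta>0 \<eta>2 by (intro frac_le) auto
  hence \<kappa>1: "\<kappa> \<le> 13 / 10" unfolding \<kappa>_def by argo
  thus "\<kappa> \<le> 2" by simp
  have "\<eta> * (2 + \<kappa>) \<le> \<eta> * (33 / 10)" using \<eta>0 \<kappa>1 by (intro mult_left_mono) auto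
  also have "\<dots> = 3 * \<kappa> * L" unfolding \<kappa>_def using L by simp
  finally show "\<eta> * (2 + \<kappa>) \<le> 3 * \<kappa> * L" .
  have l25: "ln (2 / 5) \<ge> (- 946 / 1000 :: real)"
  proof -
    have "ln (2 / 5 :: real) = ln 2 - ln 5" by (simp add: ln_div)
    moreover have "ln 5 = ln 4 + ln (5 / 4 :: real)" using ln_mult[of 4 "5 / 4 :: real"] by simp
    moreover have "ln (5 / 4 :: real) \<le> 5 / 4 - 1" by (rule ln_le_minus_one) auto
    ultimately show ?thesis using ln_numeric_bounds(1) ln_4_bounds(2) by argo
  qed
  have "- ln L = ln (1 / L)" using L by (simp add: ln_div)
  also have "\<dots> \<le> 1 / L - 1" using L by (intro ln_le_minus_one) auto
  also have "1 / L \<le> 1 / (693 / 1000)" using L by (intro divide_left_mono) auto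
  finally have "ln L \<ge> - 444 / 1000" by simp
  moreover have "ln (29.388 * ln t) = ln 29.388 + ln L" using L by (subst ln_mult) (auto simp: L_def)
  ultimately show \<sigma>: "\<sigma> \<ge> 198 / 100" unfolding \<sigma>_def using l25 ln_29388_bounds(2) by argo
  have "(c4 r + ln (29.388 * L) - \<sigma>) / 2 + (5 / 2 * (pi / 4) + 0 * r / 3) / pi = (c4 r - ln (2 / 5)) / 2 + 5 / 8"
    by (simp add: \<sigma>_def L_def)
  also have "\<dots> \<le> 1 / r / 2 + 1273 / 1000"
  proof -
    have "(c - l) / 2 + 5 / 8 \<le> q / 2 + 1273 / 1000" if "c \<le> q + 35 / 100" "- 946 / 1000 \<le> l" for c l q :: real
      using that by argo
    from this[OF c4_upper[OF r(1,2)] l25] show ?thesis .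
  qed
  finally have "\<kappa> * ((c4 r + ln (29.388 * L) - \<sigma>) / 2 + (5 / 2 * (pi / 4) + 0 * r / 3) / pi) \<le>
      \<kappa> * (1 / r / 2 + 1273 / 1000)" using \<kappa>0 by (intro mult_left_mono)
  also have "\<dots> = 11 / 10 * (\<eta> * (1 / r / 2 + 1273 / 1000)) / L" by (simp add: \<kappa>_def)
  also have "\<dots> \<le> 11 / 10 * (12 / 10) / (693 / 1000)"
  proof (rule frac_le)
    have "\<eta> * (1 / r / 2 + 1273 / 1000) \<le> r\<^sup>2 / (2 * r + 1) * (1 / r / 2 + 1273 / 1000)"
      using \<eta>1 r by (intro mult_right_mono) auto
    also have "\<dots> = (r\<^sup>2 * (1 / r / 2 + 1273 / 1000)) / (2 * r + 1)" by simp
    also have "r\<^sup>2 * (1 / r / 2 + 1273 / 1000) = r / 2 + 1273 / 1000 * r\<^sup>2"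
      using r by (simp add: field_simps power2_eq_square)
    also have "(r / 2 + 1273 / 1000 * r\<^sup>2) / (2 * r + 1) \<le> 12 / 10"
    proof -
      have "r / 2 + 1273 / 1000 * r\<^sup>2 \<le> 12 / 10 * (2 * r + 1)" using rr r by argo
      thus ?thesis using r by (subst pos_divide_le_eq) auto
    qed
    finally show "11 / 10 * (\<eta> * (1 / r / 2 + 1273 / 1000)) \<le> 11 / 10 * (12 / 10 :: real)"
      by (rule mult_left_mono) simp
  qed (use L in auto)
  also have "\<dots> \<le> \<sigma>" using \<sigma> by simp
  finally show "\<kappa> * ((c4 r + ln (29.388 * L) - \<sigma>) / 2 + (5 / 2 * (pi / 4) + 0 * r / 3) / pi) \<le> \<sigma>" .
qed

lemma zero_mass_circle_bound:
  fixes A B \<alpha> t r r0 :: real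
  assumes \<alpha>: "0 < \<alpha>" "\<alpha> \<le> 1" and t: "t > 2" and r0: "r0 = exp (2 / 3) * \<alpha>" "1 < t - r0"
    and r: "\<alpha> < r" "r < r0" and zf: "zero_free_circle t r"
    and bound: "\<And>\<tau> \<sigma>. \<tau> \<in> {t - r0..t + r0} \<Longrightarrow> 0 \<le> 1 - \<sigma> \<Longrightarrow> 1 - \<sigma> < r0 \<Longrightarrow>
      zeta (Complex \<sigma> \<tau>) \<noteq> 0 \<Longrightarrow>
      ln (cmod (zeta (Complex \<sigma> \<tau>))) < B * (1 - \<sigma>) powr (3 / 2) * ln \<bar>\<tau>\<bar> + 2 / 3 * ln (ln \<bar>\<tau>\<bar>) + A"
  shows "zero_mass t \<alpha> * ln (r / \<alpha>) \<le>
    (A / 2 + ln (ln t) / 3 + B * r powr (3 / 2) * ln t * E_half / pi) + c4 r + ln (29.388 * ln t)"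
proof -
  have "r0 \<le> 195 / 100 * 1" unfolding r0(1) using exp_two_thirds_le \<alpha> by (intro mult_mono) auto
  hence r195: "r \<le> 195 / 100" using r by simp
  have r_pos: "0 < r" using \<alpha> r by simp
  have "r / \<alpha> \<le> exp (2 / 3)" using r r0 \<alpha> by (simp add: divide_le_eq)
  hence lr: "ln (r / \<alpha>) \<le> 2 / 3" using r_pos \<alpha> ln_mono[of "r / \<alpha>" "exp (2 / 3)"] by simp
  have P: "zero_mass t \<alpha> * ln (r / \<alpha>) \<ge> 0" using inner_log_sum_nonneg(2)[OF zf \<alpha>(1) r(1)] \<alpha> r by simp
  have left: "left_pair t r \<theta> \<le> 2 * A + 4 / 3 * ln (ln t) + B * (r * cos \<theta>) powr (3 / 2) * ln (t\<^sup>2 - (r * sin \<theta>)\<^sup>2)"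
    if "\<theta> \<in> {0..<pi / 2}" for \<theta>
    by (rule left_pair_le[OF zf r(2) r0(2) that bound])
  have t1: "1 < t" using t by simp
  \<comment> \<open>Below 8 the slack is the gap between the constant 2/5 and 1 / (29.388 ln t), on
    the logarithmic scale; from 8 on it is the margin in \<open>left_mean_high\<close>.\<close>
  define \<sigma> where "\<sigma> = (if t < 8 then ln (29.388 * ln t) + ln (2 / 5) else 15 / 100)"
  have lower: "integral {0..pi / 2} (left_pair t r) / (2 * pi) + c4 r + ln (29.388 * ln t) \<ge>
      zero_mass t \<alpha> * ln (r / \<alpha>) + \<sigma>"
    using left_mean_low[OF t _ \<alpha>(1) r(1) zf] left_mean_high[OF _ \<alpha> r(1) lr zf] by (auto simp: \<sigma>_def)
  have r1: "r + 1 < t" using r r0 by simp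
  show ?thesis
  proof (cases "B \<ge> 0")
    case True
    have "\<sigma> \<ge> 0" using slack_low(4)[OF t r_pos r195 r1] by (auto simp: \<sigma>_def)
    thus ?thesis using left_integral_nonneg_coeff[OF zf t1 True left] lower by simp
  next
    case False
    hence B: "B < 0" by simp
    show ?thesis
    proof (cases "t < 8")
      case True
      note sl = slack_low[OF t r_pos r195 r1]
      have up: "(1 + (11 / 10 * (r\<^sup>2 / (t\<^sup>2 - r\<^sup>2) / ln t)) / 2) * (integral {0..pi / 2} (left_pair t r) / (2 * pi)) \<le>
        A / 2 + ln (ln t) / 3 + B * r powr (3 / 2) * ln t * E_half / pi
          + (11 / 10 * (r\<^sup>2 / (t\<^sup>2 - r\<^sup>2) / ln t)) * ((5 / 2 * (pi / 4) + 0 * r / 3) / pi)"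
      proof (rule left_integral_neg_coeff[OF zf t1 B left _ refl sl(1-3)])
        fix \<theta> assume "\<theta> \<in> {0..pi / 2}"
        from left_pair_low[OF _ zf r195 _ this] show "left_pair t r \<theta> \<le> 2 * (5 / 2 + 0 * r * cos \<theta>)"
          using True r1 by simp
      qed
      show ?thesis
        by (rule weighted_combination[OF lower up P sl(1)]) (use sl(5) True in \<open>simp add: \<sigma>_def\<close>)
    next
      case False
      hence t8: "8 \<le> t" by simp
      note sl = slack_high[OF t8 r_pos r195]
      have up: "(1 + (r\<^sup>2 / (87 * ln t)) / 2) * (integral {0..pi / 2} (left_pair t r) / (2 * pi)) \<le>
        A / 2 + ln (ln t) / 3 + B * r powr (3 / 2) * ln t * E_half / pi
          + (r\<^sup>2 / (87 * ln t)) * ((ln (ln t + 27 / 20) * (pi / 4) + (ln t - 98 / 100) * r / 3) / pi)"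
        by (rule left_integral_neg_coeff[OF zf t1 B left left_pair_high[OF t8 zf] refl sl(1-3)])
           (use r195 in auto)
      show ?thesis
        by (rule weighted_combination[OF lower up P sl(1)]) (use sl(4) False in \<open>simp add: \<sigma>_def\<close>)
    qed
  qed
qed

text \<open>The circle of radius \<open>r0\<close> may carry zeros and is not fully covered by
  \<open>bound\<close>. Zero-free radii approach it from below, and every term is continuous once c4
  r is traded for c4 r0 + 1/2 ln (r0 / r).\<close>

lemma zero_mass_bound:
  fixes A B \<alpha> t r0 :: real
  assumes \<alpha>: "0 < \<alpha>" "\<alpha> \<le> 1" and t: "t > 2" and r0: "r0 = exp (2 / 3) * \<alpha>" "1 < t - r0"
    and bound: "\<And>\<tau> \<sigma>. \<tau> \<in> {t - r0..t + r0} \<Longrightarrow> 0 \<le> 1 - \<sigma> \<Longrightarrow> 1 - \<sigma> < r0 \<Longrightarrow>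
      zeta (Complex \<sigma> \<tau>) \<noteq> 0 \<Longrightarrow>
      ln (cmod (zeta (Complex \<sigma> \<tau>))) < B * (1 - \<sigma>) powr (3 / 2) * ln \<bar>\<tau>\<bar> + 2 / 3 * ln (ln \<bar>\<tau>\<bar>) + A"
  shows "zero_mass t \<alpha> * (2 / 3) \<le>
    (A / 2 + ln (ln t) / 3 + B * r0 powr (3 / 2) * ln t * E_half / pi) + c4 r0 + ln (29.388 * ln t)"
proof (rule ccontr)
  define F where "F r = (A / 2 + ln (ln t) / 3 + B * r powr (3 / 2) * ln t * E_half / pi) + c4 r0
     + 1 / 2 * ln (r0 / r) + ln (29.388 * ln t) - zero_mass t \<alpha> * ln (r / \<alpha>)" for r
  have r0a: "\<alpha> < r0" unfolding r0(1) using \<alpha> by (simp add: one_less_exp_iff)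
  have r00: "r0 > 0" using r0a \<alpha> by simp
  have lr: "ln (r0 / \<alpha>) = 2 / 3" using \<alpha> by (simp add: r0(1))
  assume "\<not> ?thesis"
  hence neg: "F r0 < 0" unfolding F_def lr using r00 by simp
  have "(F \<longlongrightarrow> F r0) (at_left r0)"
    unfolding F_def using \<alpha> r00 by (intro tendsto_intros) auto
  hence "eventually (\<lambda>r. F r < 0) (at_left r0)" using neg by (rule order_tendstoD)
  then obtain b where b: "b < r0" "\<And>r. b < r \<Longrightarrow> r < r0 \<Longrightarrow> F r < 0"
    using eventually_at_left_field[of "\<lambda>r. F r < 0" r0] by auto
  obtain r where r: "max b \<alpha> < r" "r < r0" "zero_free_circle t r"
    using zero_free_circle_exists[of "max b \<alpha>" r0 t] b(1) r0a r0(2) \<alpha> by (auto simp: less_max_iff_disj)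
  have "zero_mass t \<alpha> * ln (r / \<alpha>) \<le>
    (A / 2 + ln (ln t) / 3 + B * r powr (3 / 2) * ln t * E_half / pi) + c4 r + ln (29.388 * ln t)"
    by (rule zero_mass_circle_bound[OF \<alpha> t r0 _ r(2,3) bound]) (use r in auto)
  moreover have "c4 r \<le> c4 r0 + 1 / 2 * ln (r0 / r)" using r \<alpha> by (intro c4_mono_bound) auto
  ultimately have "F r \<ge> 0" by (simp add: F_def)
  thus False using b(2)[of r] r by auto
qed

lemma zeta_zero_count_le:
  assumes \<alpha>: "0 < \<alpha>" "\<alpha> < t"
  shows "zeta_zero_count (Complex 1 t) \<alpha> \<le> zero_mass t \<alpha>"
proof -
  obtain r where r: "\<alpha> < r" "zero_free_circle t r" using zero_free_circle_exists[of \<alpha> t t] \<alpha> by auto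
  have "norm (1 - Complex 1 t) = \<bar>t\<bar>" by (simp add: cmod_def)
  hence eq: "{\<rho>. \<rho> \<noteq> 1 \<and> zeta \<rho> = 0 \<and> cmod (\<rho> - Complex 1 t) \<le> \<alpha>} = {\<rho>. zeta \<rho> = 0 \<and> norm (\<rho> - Complex 1 t) \<le> \<alpha>}"
    using \<alpha> by auto
  show ?thesis unfolding zeta_zero_count_def zero_mass_def eq
  proof (rule sum_mono)
    fix \<rho> assume "\<rho> \<in> {\<rho>. zeta \<rho> = 0 \<and> norm (\<rho> - Complex 1 t) \<le> \<alpha>}"
    hence "\<rho> \<in> zeta_zeros t r" using zeros_le_eq[OF r(1), of t] by auto
    hence "zorder zeta \<rho> \<ge> 1" by (rule zeta_zeros_properties(3)[OF r(2)])
    thus "(if cmod (\<rho> - Complex 1 t) = \<alpha> then 1 / 2 else 1) * real_of_int (zorder zeta \<rho>) \<le> of_int (zorder zeta \<rho>)"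
      by simp
  qed
qed

text \<open>Points with zeta = 0 are exempt in \<open>zeta_bound\<close> because log 0 stands for
  minus infinity there.\<close>

theorem theorem18:
  fixes \<alpha> t A B :: real
  assumes "0 < \<alpha>" and "\<alpha> \<le> 1" and "t > 2"
    and log_defined: "\<And>\<tau>. \<tau> \<in> {t - exp (2 / 3) * \<alpha> .. t + exp (2 / 3) * \<alpha>} \<Longrightarrow>
      0 < \<bar>\<tau>\<bar> \<and> 0 < ln \<bar>\<tau>\<bar>"
    and zeta_bound: "\<And>\<tau> \<sigma>. \<tau> \<in> {t - exp (2 / 3) * \<alpha> .. t + exp (2 / 3) * \<alpha>} \<Longrightarrow>
      0 \<le> 1 - \<sigma> \<Longrightarrow> 1 - \<sigma> < exp (2 / 3) * \<alpha> \<Longrightarrow>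
      zeta (Complex \<sigma> \<tau>) \<noteq> 0 \<Longrightarrow>
      ln (cmod (zeta (Complex \<sigma> \<tau>))) <
        B * (1 - \<sigma>) powr (3 / 2) * ln \<bar>\<tau>\<bar> + 2 / 3 * ln (ln \<bar>\<tau>\<bar>) + A"
  shows "zeta_zero_count (Complex 1 t) \<alpha> \<le>
           C1_tilde B \<alpha> / pi * ln \<bar>t\<bar> + 2 * ln (ln \<bar>t\<bar>) + C3_tilde A \<alpha> \<and>
         C3_tilde A \<alpha> <
           3 * A / 4 + 3 / 4 * ln (Re (zeta (of_real (1 + exp (2 / 3) * \<alpha>)))) +
           3 * ln 2 / 4 + 3 * ln 29.388 / 2"
proof
  define r where "r = exp (2 / 3) * \<alpha>"
  have r: "r > 0" using \<open>0 < \<alpha>\<close> by (simp add: r_def)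
  \<comment> \<open>Otherwise the range of \<tau> contains 1, where ln |\<tau>| = 0 contradicts
    \<open>log_defined\<close>.\<close>
  have "1 < t - r"
  proof (rule ccontr)
    assume "\<not> 1 < t - r"
    hence "0 < ln \<bar>1 :: real\<bar>" using log_defined[of 1] \<open>t > 2\<close> r by (simp add: r_def)
    thus False by simp
  qed
  hence mass: "zero_mass t \<alpha> * (2 / 3) \<le>
    (A / 2 + ln (ln t) / 3 + B * r powr (3 / 2) * ln t * E_half / pi) + c4 r + ln (29.388 * ln t)"
    using assms(1-3) zeta_bound by (intro zero_mass_bound) (auto simp: r_def)
  \<comment> \<open>The exponents 2/3 and 3/2 cancel, which is the origin of the factor e in
    \<open>C1_tilde\<close>.\<close>
  have "r powr (3 / 2) = exp 1 * \<alpha> powr (3 / 2)"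
    using \<open>0 < \<alpha>\<close> by (simp add: r_def powr_mult exp_powr_real)
  moreover have "ln (29.388 * ln t) = ln 29.388 + ln (ln t)"
    using \<open>t > 2\<close> by (subst ln_mult) auto
  ultimately have "zero_mass t \<alpha> \<le> 3 / 2 * ((A / 2 + ln (ln t) / 3 + B * (exp 1 * \<alpha> powr (3 / 2)) * ln t * E_half / pi)
     + c4 r + (ln 29.388 + ln (ln t)))"
    using mass by simp
  also have "\<dots> = C1_tilde B \<alpha> / pi * ln t + 2 * ln (ln t) + C3_tilde A \<alpha>"
    by (simp add: C1_tilde_def C3_tilde_def r_def field_simps)
  finally show "zeta_zero_count (Complex 1 t) \<alpha> \<le>
           C1_tilde B \<alpha> / pi * ln \<bar>t\<bar> + 2 * ln (ln \<bar>t\<bar>) + C3_tilde A \<alpha>"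
    using zeta_zero_count_le[of \<alpha> t] assms(1-3) by simp
  show "C3_tilde A \<alpha> <
           3 * A / 4 + 3 / 4 * ln (Re (zeta (of_real (1 + exp (2 / 3) * \<alpha>)))) +
           3 * ln 2 / 4 + 3 * ln 29.388 / 2"
    using c4_less[OF r] by (simp add: C3_tilde_def zr_def r_def)
qed

end
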